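(* In the setting described in the context, consider the problem: for every $t\in[0,T]$, find the unique $\mathcal{Y}_t$-measurable random variable $\widehat X(t)\in L^2(\mathbb{P})$ such that $$\mathbb{E}\big[|X(t)-\widehat X(t)|^2\big]=\inf_{Z\in L^2(\mathcal{Y}_t)}\mathbb{E}\big[|X(t)-Z|^2\big],$$ and determine the filtering error $S(t)=\mathbb{E}[(X(t)-\widehat X(t))^2]$. This problem has a unique solution. With $m(t)=\mathbb{E}[X(t)]$, $K_X(t,s)=\operatorname{Cov}(X(t),X(s))$, $\widetilde X(t)=X(t)-\widehat X(t)$ and $H(t,s)=\mathbb{E}[X(t)\widetilde X(s)]$ for $0\le s\le t\le T$, the following hold. (a) $H$ is the unique bounded deterministic solution on the triangular domain $0\le s\le t\le T$ of $$H(t,s)=K_X(t,s)-\int_0^s\frac{G^2(r)}{D^2(r)}H(t,r)H(s,r)\,dr.$$ (b) Define $$A(t,s)=\frac{G^2(s)}{D^2(s)}H(t,s),\qquad B(t,s)=\frac{G(s)}{D^2(s)}H(t,s),$$ the resolvent kernels $$Q_1(t,s)=-A(t,s),\qquad Q_{n+1}(t,s)=-\int_s^tA(t,r)Q_n(r,s)\,dr\ (n\ge1),\qquad Q_H(t,s)=\sum_{n=1}^\infty Q_n(t,s),$$ and $$m_H(t)=m(t)+\int_0^tQ_H(t,s)m(s)\,ds,\qquad L_H(t,u)=B(t,u)+\int_u^tQ_H(t,s)B(s,u)\,ds.$$ Then the unique best estimate is $$\widehat X(t)=\mathbb{E}[X(t)\mid\mathcal{Y}_t]=m_H(t)+\int_0^tL_H(t,u)\,dY(u).$$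 (c) Equivalently, $\widehat X$ is the unique adapted solution of $$\widehat X(t)=m(t)+\int_0^t\frac{G(s)}{D^2(s)}H(t,s)\big[dY(s)-G(s)\widehat X(s)\,ds\big].$$ (d) The minimum mean-square error is $$S(t)=H(t,t)=K_X(t,t)-\int_0^t\frac{G^2(r)}{D^2(r)}H^2(t,r)\,dr.$$ (e) Moreover, $\widehat X(0)=m(0)$, $H(t,0)=K_X(t,0)$ and $S(0)=K_X(0,0)$.
   Context: Setting. Fix $T>0$ and $\alpha\in(\tfrac12,1]$. $F,C,G,D:[0,T]\to\mathbb{R}$ are bounded deterministic Borel functions and $|D(t)|\ge d_0>0$ for all $t$. $B_1$ and $B_2$ are independent one-dimensional Brownian motions on a probability space with probability $\mathbb{P}$ and expectation $\mathbb{E}$. $X_0\in L^2(\mathbb{P})$ is Gaussian and independent of $(B_1,B_2)$. Signal: the time-fractional equation $$D_C^\alpha X(t)=F(t)X(t)+C(t)\overset{\bullet}{B}_1(t),\qquad X(0)=X_0,$$ where $D_C^\alpha$ is the Caputo derivative of order $\alpha$, namely $D_C^\alpha f(t)=\frac{1}{\Gamma(1-\alpha)}\int_0^t(t-s)^{-\alpha}f'(s)\,ds$ for $\frac12<\alpha<1$ and $D_C^1f=f'$, and $\overset{\bullet}{B}_1$ is the time derivative of $B_1$ in the sense of distributions. The equation is understood in its integrated form: for each $t\in[0,T]$, almost surely, $$X(t)=X_0+\frac1{\Gamma(\alpha)}\int_0^t(t-s)^{\alpha-1}F(s)X(s)\,ds+\frac1{\Gamma(\alpha)}\int_0^t(t-s)^{\alpha-1}C(s)\,dB_1(s).$$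 It is assumed that this equation admits a square-integrable (jointly measurable, $\int_0^T\mathbb{E}[X(t)^2]\,dt<\infty$) Gaussian solution $X$ with deterministic mean $m(t)=\mathbb{E}[X(t)]$ and covariance $K_X(t,s)=\operatorname{Cov}(X(t),X(s))$; $X$ denotes this solution. Observation: $$dY(t)=G(t)X(t)\,dt+D(t)\,dB_2(t),\qquad Y(0)=Y_0,$$ with $Y_0$ deterministic. $\mathcal{Y}_t=\sigma\{Y(s):0\le s\le t\}\vee\mathcal{N}$ is the completed observation filtration ($\mathcal N$ the $\mathbb{P}$-null sets), and $L^2(\mathcal{Y}_t)$ is the set of $\mathcal{Y}_t$-measurable random variables in $L^2(\mathbb{P})$. "Adapted" means adapted to $\{\mathcal{Y}_t\}$. Integrals with respect to $dY(s)$ mean integrals with respect to $G(s)X(s)\,ds+D(s)\,dB_2(s)$. Solutions are measurable and such that the integrals make sense; uniqueness of random variables and processes is up to almost sure equality (for each $t$). *)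

theory Defs
  imports "HOL-Probability.Probability"
begin

text \<open>Constants are allowed as (degenerate) Gaussian variables, so that for instance a
  deterministic initial value is included.\<close>

definition gaussian_rv :: "'a measure \<Rightarrow> ('a \<Rightarrow> real) \<Rightarrow> bool" where
  "gaussian_rv M Z \<longleftrightarrow> Z \<in> borel_measurable M \<and>
     (\<exists>\<mu>. (AE \<omega> in M. Z \<omega> = \<mu>) \<or> (\<exists>\<sigma>>0. distributed M lborel Z (normal_density \<mu> \<sigma>)))"

definition gaussian_process :: "'a measure \<Rightarrow> real set \<Rightarrow> (real \<Rightarrow> 'a \<Rightarrow> real) \<Rightarrow> bool" where
  "gaussian_process M I X \<longleftrightarrow>
     (\<forall>J c. finite J \<longrightarrow> J \<subseteq> I \<longrightarrow> gaussian_rv M (\<lambda>\<omega>. \<Sum>t\<in>J. c t * X t \<omega>))"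

definition brownian_motion :: "'a measure \<Rightarrow> real \<Rightarrow> (real \<Rightarrow> 'a \<Rightarrow> real) \<Rightarrow> bool" where
  "brownian_motion M T W \<longleftrightarrow>
     (\<forall>t\<in>{0..T}. W t \<in> borel_measurable M) \<and>
     (AE \<omega> in M. W 0 \<omega> = 0) \<and>
     (AE \<omega> in M. continuous_on {0..T} (\<lambda>t. W t \<omega>)) \<and>
     (\<forall>s t. 0 \<le> s \<and> s < t \<and> t \<le> T \<longrightarrow>
        distributed M lborel (\<lambda>\<omega>. W t \<omega> - W s \<omega>) (normal_density 0 (sqrt (t - s)))) \<and>
     (\<forall>n p. 0 \<le> p 0 \<and> (\<forall>i<n. p i < p (Suc i)) \<and> p n \<le> T \<longrightarrow>
        prob_space.indep_vars M (\<lambda>_. borel) (\<lambda>i \<omega>. W (p (Suc i)) \<omega> - W (p i) \<omega>) {..<n})"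

text \<open>A process on \<open>[0, T]\<close> as one random element of the product space.\<close>

definition sample_path :: "real \<Rightarrow> (real \<Rightarrow> 'a \<Rightarrow> real) \<Rightarrow> 'a \<Rightarrow> real \<Rightarrow> real" where
  "sample_path T W \<omega> = (\<lambda>t\<in>{0..T}. W t \<omega>)"

abbreviation path_space :: "real \<Rightarrow> (real \<Rightarrow> real) measure" where
  "path_space T \<equiv> PiM {0..T} (\<lambda>_. borel)"

definition measurable_process :: "'a measure \<Rightarrow> real \<Rightarrow> (real \<Rightarrow> 'a \<Rightarrow> real) \<Rightarrow> bool" where
  "measurable_process M T Z \<longleftrightarrow>
     (\<lambda>(t, \<omega>). Z t \<omega>) \<in> borel_measurable (restrict_space borel {0..T} \<Otimes>\<^sub>M M)"

text \<open>\<open>J\<close> is a version of the Wiener integral of the deterministic square-integrable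
  function \<open>f\<close> over \<open>[a, b]\<close> with respect to \<open>W\<close>: the limit in mean square of the elementary
  integrals of step functions converging to \<open>f\<close> in \<open>L\<^sup>2(a, b)\<close>. The integral is determined only
  up to null sets, hence a relation.\<close>

definition has_wiener_integral ::
    "'a measure \<Rightarrow> (real \<Rightarrow> 'a \<Rightarrow> real) \<Rightarrow> real \<Rightarrow> real \<Rightarrow> (real \<Rightarrow> real) \<Rightarrow> ('a \<Rightarrow> real) \<Rightarrow> bool" where
  "has_wiener_integral M W a b f J \<longleftrightarrow>
     set_borel_measurable borel {a..b} f \<and> set_integrable lborel {a..b} (\<lambda>s. (f s)\<^sup>2) \<and>
     J \<in> borel_measurable M \<and> integrable M (\<lambda>\<omega>. (J \<omega>)\<^sup>2) \<and>
     (\<exists>(n :: nat \<Rightarrow> nat) (p :: nat \<Rightarrow> nat \<Rightarrow> real) (c :: nat \<Rightarrow> nat \<Rightarrow> real).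
        (\<forall>k. p k 0 = a \<and> p k (n k) = b \<and> (\<forall>i<n k. p k i \<le> p k (Suc i))) \<and>
        (\<lambda>k. LBINT s:{a..b}. (f s - (\<Sum>i<n k. c k i * indicator {p k i<..p k (Suc i)} s))\<^sup>2)
           \<longlonglongrightarrow> 0 \<and>
        (\<lambda>k. \<integral>\<omega>. (J \<omega> - (\<Sum>i<n k. c k i * (W (p k (Suc i)) \<omega> - W (p k i) \<omega>)))\<^sup>2 \<partial>M)
           \<longlonglongrightarrow> 0)"

text \<open>\<open>J\<close> is a version of \<open>\<integral>\<^sub>0\<^sup>t f(s) dY(s)\<close> where \<open>dY(s) = G(s) X(s) ds + D(s) dW(s)\<close>.\<close>

definition has_obs_integral ::
    "'a measure \<Rightarrow> (real \<Rightarrow> real) \<Rightarrow> (real \<Rightarrow> real) \<Rightarrow> (real \<Rightarrow> 'a \<Rightarrow> real) \<Rightarrow> (real \<Rightarrow> 'a \<Rightarrow> real) \<Rightarrow>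
     real \<Rightarrow> (real \<Rightarrow> real) \<Rightarrow> ('a \<Rightarrow> real) \<Rightarrow> bool" where
  "has_obs_integral M G D X W t f J \<longleftrightarrow>
     (AE \<omega> in M. set_integrable lborel {0..t} (\<lambda>s. f s * G s * X s \<omega>)) \<and>
     (\<exists>N. has_wiener_integral M W 0 t (\<lambda>s. f s * D s) N \<and>
        (AE \<omega> in M. J \<omega> = (LBINT s:{0..t}. f s * G s * X s \<omega>) + N \<omega>))"

text \<open>The completed filtration \<open>\<Y>\<^sub>t\<close>; only the underlying \<open>\<sigma>\<close>-algebra of this measure is
  relevant.\<close>

definition obs_filtration :: "'a measure \<Rightarrow> (real \<Rightarrow> 'a \<Rightarrow> real) \<Rightarrow> real \<Rightarrow> 'a measure" where
  "obs_filtration M Y t =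
     sigma (space M) ({Y s -` A \<inter> space M | s A. s \<in> {0..t} \<and> A \<in> sets borel} \<union> null_sets M)"

definition L2_rv :: "'a measure \<Rightarrow> 'a measure \<Rightarrow> ('a \<Rightarrow> real) set" where
  "L2_rv M N = {Z. Z \<in> borel_measurable N \<and> integrable M (\<lambda>\<omega>. (Z \<omega>)\<^sup>2)}"

definition best_estimate ::
    "'a measure \<Rightarrow> 'a measure \<Rightarrow> ('a \<Rightarrow> real) \<Rightarrow> ('a \<Rightarrow> real) \<Rightarrow> bool" where
  "best_estimate M N \<xi> Z \<longleftrightarrow> Z \<in> L2_rv M N \<and>
     (\<integral>\<omega>. (\<xi> \<omega> - Z \<omega>)\<^sup>2 \<partial>M) = (INF V\<in>L2_rv M N. \<integral>\<omega>. (\<xi> \<omega> - V \<omega>)\<^sup>2 \<partial>M)"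

definition process_mean :: "'a measure \<Rightarrow> (real \<Rightarrow> 'a \<Rightarrow> real) \<Rightarrow> real \<Rightarrow> real" where
  "process_mean M X t = (\<integral>\<omega>. X t \<omega> \<partial>M)"

definition process_cov :: "'a measure \<Rightarrow> (real \<Rightarrow> 'a \<Rightarrow> real) \<Rightarrow> real \<Rightarrow> real \<Rightarrow> real" where
  "process_cov M X t s =
     (\<integral>\<omega>. (X t \<omega> - process_mean M X t) * (X s \<omega> - process_mean M X s) \<partial>M)"

definition time_triangle :: "real \<Rightarrow> (real \<times> real) set" where
  "time_triangle T = {(t, s). 0 \<le> s \<and> s \<le> t \<and> t \<le> T}"

definition kernel_eq_solution ::
    "real \<Rightarrow> (real \<Rightarrow> real) \<Rightarrow> (real \<Rightarrow> real) \<Rightarrow> (real \<Rightarrow> real \<Rightarrow> real) \<Rightarrow> (real \<Rightarrow> real \<Rightarrow> real) \<Rightarrow> bool" where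
  "kernel_eq_solution T G D K h \<longleftrightarrow>
     (\<lambda>(t, s). h t s) \<in> borel_measurable (restrict_space borel (time_triangle T)) \<and>
     bounded ((\<lambda>(t, s). h t s) ` time_triangle T) \<and>
     (\<forall>(t, s)\<in>time_triangle T.
        h t s = K t s - (LBINT r:{0..s}. (G r)\<^sup>2 / (D r)\<^sup>2 * h t r * h s r))"

text \<open>\<open>resolvent_iter A n\<close> is the kernel \<open>Q\<^bsub>n+1\<^esub>\<close>, so that \<open>resolvent A\<close> is the sum of
  \<open>Q\<^sub>1, Q\<^sub>2, \<dots>\<close>.\<close>

primrec resolvent_iter :: "(real \<Rightarrow> real \<Rightarrow> real) \<Rightarrow> nat \<Rightarrow> real \<Rightarrow> real \<Rightarrow> real" where
  "resolvent_iter A 0 = (\<lambda>t s. - A t s)"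
| "resolvent_iter A (Suc n) = (\<lambda>t s. - (LBINT r:{s..t}. A t r * resolvent_iter A n r s))"

definition resolvent :: "(real \<Rightarrow> real \<Rightarrow> real) \<Rightarrow> real \<Rightarrow> real \<Rightarrow> real" where
  "resolvent A t s = (\<Sum>n. resolvent_iter A n t s)"

text \<open>Jointly measurable adapted solutions \<open>Z\<close> of
  \<open>Z(t) = m(t) + \<integral>\<^sub>0\<^sup>t (G(s) / D(s)\<^sup>2) H(t, s) [dY(s) - G(s) Z(s) ds]\<close>. The innovation differential
  \<open>dY(s) - G(s) Z(s) ds\<close> makes sense when \<open>G Z\<close> has almost surely integrable paths.\<close>

definition filter_eq_solution ::
    "'a measure \<Rightarrow> real \<Rightarrow> (real \<Rightarrow> real) \<Rightarrow> (real \<Rightarrow> real) \<Rightarrow> (real \<Rightarrow> 'a \<Rightarrow> real) \<Rightarrow>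
     (real \<Rightarrow> 'a \<Rightarrow> real) \<Rightarrow> (real \<Rightarrow> 'a measure) \<Rightarrow> (real \<Rightarrow> real) \<Rightarrow> (real \<Rightarrow> real \<Rightarrow> real) \<Rightarrow>
     (real \<Rightarrow> 'a \<Rightarrow> real) \<Rightarrow> bool" where
  "filter_eq_solution M T G D X W \<F> m H Z \<longleftrightarrow>
     measurable_process M T Z \<and>
     (\<forall>t\<in>{0..T}. Z t \<in> borel_measurable (\<F> t)) \<and>
     (AE \<omega> in M. set_integrable lborel {0..T} (\<lambda>s. G s * Z s \<omega>)) \<and>
     (\<forall>t\<in>{0..T}. \<exists>J. has_obs_integral M G D X W t (\<lambda>s. G s / (D s)\<^sup>2 * H t s) J \<and>
        (AE \<omega> in M. Z t \<omega> =
           m t + (J \<omega> - (LBINT s:{0..t}. G s / (D s)\<^sup>2 * H t s * (G s * Z s \<omega>)))))"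

end

theory Submission
  imports Defs
begin

text \<open>The closed linear span of the centred \<open>X\<^sub>0\<close> and the increments of \<open>B\<^sub>1\<close>, \<open>B\<^sub>2\<close> consists of
  centred Gaussian variables. It contains the centred signal: testing the signal equation with an
  element orthogonal to the span leaves a homogeneous Volterra equation. The same argument shows that
  the signal is orthogonal to \<open>B\<^sub>2\<close>. Among the integrals of deterministic functions against the
  observation on \<open>[0, t]\<close>, the projection of \<open>X(t)\<close> is characterised by a Wiener-Hopf equation, a Fredholm
  equation of the second kind whose kernel is positive semidefinite, so that a relaxed iteration
  converges. By the form of Gaussian characteristic functions, the estimation error, being orthogonal to
  the observation, is independent of it; hence the linear projection is the conditional expectation.

  Comparing the Wiener-Hopf equations for different \<open>t\<close> gives a Volterra equation for their solution, with
  kernel \<open>(G/D)\<^sup>2 H\<close>, and the nonlinear equation for \<open>H\<close>; the defects of these two equations bound each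
  other and therefore vanish. The resolvent of the Volterra kernel produces \<open>m\<^sub>H\<close> and \<open>L\<^sub>H\<close>, and covariances
  turn the Volterra equation into the innovation equation of part (c), whose solutions are
  compared path by path with Gronwall's inequality.\<close>

section \<open>Square-integrable functions\<close>

text \<open>The covariance of the signal is only bounded and measurable, so nothing can be
  differentiated in time: the argument rests on integral equations, energy estimates and Fubini. The
  claims hold at every \<open>t\<close> and every pair \<open>(t, s)\<close>, while solutions of
  integral equations and stochastic integrals are a priori determined up to null sets only. Hence
  the Wiener-Hopf solution is given by a pointwise convergent series, whose measurability in
  \<open>t\<close> can be read off, and Wiener integrals depending on a parameter are chosen jointly
  measurable, so that they can be integrated in time. Functions of time are extended by zero to the
  whole line, which makes most integrability conditions automatic. Integrands are normalised by
  \<open>D\<close>: the observation noise then contributes the identity to the covariance operator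
  of the observation and the signal a positive semidefinite part. The resulting coercivity with
  constant one gives solvability and bounds one defect by the other, without any smallness of
  \<open>T\<close>.\<close>

abbreviation L2 :: "'a measure \<Rightarrow> ('a \<Rightarrow> real) set" where
  "L2 M \<equiv> L2_rv M M"

lemma L2_measurable [measurable_dest]: "f \<in> L2 M \<Longrightarrow> f \<in> borel_measurable M"
  by (simp add: L2_rv_def)

lemma L2_integrable_sq: "f \<in> L2 M \<Longrightarrow> integrable M (\<lambda>x. (f x)\<^sup>2)"
  by (simp add: L2_rv_def)

lemma L2I: "f \<in> borel_measurable M \<Longrightarrow> integrable M (\<lambda>x. (f x)\<^sup>2) \<Longrightarrow> f \<in> L2 M"
  by (simp add: L2_rv_def)

lemma L2_bound:
  assumes "g \<in> L2 M" "f \<in> borel_measurable M" "AE x in M. \<bar>f x\<bar> \<le> \<bar>g x\<bar>"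
  shows "f \<in> L2 M"
proof (rule L2I)
  show "integrable M (\<lambda>x. (f x)\<^sup>2)"
    by (rule Bochner_Integration.integrable_bound[OF L2_integrable_sq[OF assms(1)]])
      (use assms in \<open>auto elim!: eventually_mono simp: abs_le_square_iff\<close>)
qed fact

lemma L2_mult_integrable:
  assumes "f \<in> L2 M" "g \<in> L2 M" shows "integrable M (\<lambda>x. f x * g x)"
proof (rule Bochner_Integration.integrable_bound)
  show "integrable M (\<lambda>x. (f x)\<^sup>2 + (g x)\<^sup>2)"
    using assms by (intro Bochner_Integration.integrable_add L2_integrable_sq)
  have "\<bar>a * b\<bar> \<le> a\<^sup>2 + b\<^sup>2" for a b :: real
  proof -
    have "2 * (\<bar>a\<bar> * \<bar>b\<bar>) \<le> a\<^sup>2 + b\<^sup>2"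
      using sum_squares_bound[of "\<bar>a\<bar>" "\<bar>b\<bar>"] by (simp add: mult.assoc)
    moreover have "0 \<le> \<bar>a\<bar> * \<bar>b\<bar>" by simp
    ultimately show ?thesis unfolding abs_mult by linarith
  qed
  then show "AE x in M. norm (f x * g x) \<le> norm ((f x)\<^sup>2 + (g x)\<^sup>2)"
    by simp
qed (use assms in measurable)

lemma L2_scale: "f \<in> L2 M \<Longrightarrow> (\<lambda>x. c * f x) \<in> L2 M"
  by (auto simp: L2_rv_def power_mult_distrib)

lemma L2_zero: "(\<lambda>_. 0) \<in> L2 M"
  by (simp add: L2_rv_def)

lemma L2_add:
  assumes "f \<in> L2 M" "g \<in> L2 M" shows "(\<lambda>x. f x + g x) \<in> L2 M"
proof (rule L2I)
  have "integrable M (\<lambda>x. (f x)\<^sup>2 + (g x)\<^sup>2 + 2 * (f x * g x))"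
    using assms by (intro Bochner_Integration.integrable_add L2_integrable_sq
        integrable_mult_right L2_mult_integrable)
  then show "integrable M (\<lambda>x. (f x + g x)\<^sup>2)"
    by (simp add: power2_sum mult.assoc)
qed (use assms in measurable)

lemma L2_minus: "f \<in> L2 M \<Longrightarrow> (\<lambda>x. - f x) \<in> L2 M"
  using L2_scale[of f M "- 1"] by simp

lemma L2_diff: "f \<in> L2 M \<Longrightarrow> g \<in> L2 M \<Longrightarrow> (\<lambda>x. f x - g x) \<in> L2 M"
  using L2_add[of f M "\<lambda>x. - g x"] L2_minus[of g M] by simp

lemma L2_sum: "(\<And>i. i \<in> I \<Longrightarrow> f i \<in> L2 M) \<Longrightarrow> (\<lambda>x. \<Sum>i\<in>I. f i x) \<in> L2 M"
  by (induction I rule: infinite_finite_induct) (auto intro: L2_add L2_zero)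

lemma (in finite_measure) L2_const: "(\<lambda>_. c) \<in> L2 M"
  by (simp add: L2_rv_def)

lemma (in finite_measure) L2_integrable: "f \<in> L2 M \<Longrightarrow> integrable M f"
  using L2_mult_integrable[of f M "\<lambda>_. 1"] L2_const[of 1] by simp

lemma L2_cong_AE:
  assumes "f \<in> L2 M" "g \<in> borel_measurable M" "AE x in M. f x = g x" shows "g \<in> L2 M"
  by (rule L2_bound[OF assms(1,2)]) (use assms(3) in \<open>auto elim: eventually_mono\<close>)

lemma integral_sq_add:
  assumes "f \<in> L2 M" "g \<in> L2 M"
  shows "(LINT x|M. (f x + c * g x)\<^sup>2) = (LINT x|M. (f x)\<^sup>2) + 2 * c * (LINT x|M. f x * g x) + c\<^sup>2 * (LINT x|M. (g x)\<^sup>2)"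
proof -
  have "(LINT x|M. (f x + c * g x)\<^sup>2) = (LINT x|M. (f x)\<^sup>2 + 2 * c * (f x * g x) + c\<^sup>2 * (g x)\<^sup>2)"
    by (intro Bochner_Integration.integral_cong refl) (simp add: power2_eq_square algebra_simps)
  also have "\<dots> = (LINT x|M. (f x)\<^sup>2) + 2 * c * (LINT x|M. f x * g x) + c\<^sup>2 * (LINT x|M. (g x)\<^sup>2)"
    using assms by (simp add: L2_integrable_sq L2_mult_integrable)
  finally show ?thesis .
qed

lemma integral_sq_diff:
  assumes "f \<in> L2 M" "g \<in> L2 M"
  shows "(LINT x|M. (f x - g x)\<^sup>2) = (LINT x|M. (f x)\<^sup>2) - 2 * (LINT x|M. f x * g x) + (LINT x|M. (g x)\<^sup>2)"
  using integral_sq_add[OF assms, of "-1"] by simp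

text \<open>The quadratic \<open>a + 2 * l * b\<close> plus \<open>c\<close> times the square of
  \<open>l\<close> is the integral of a square, hence nonnegative for every \<open>l\<close>. Its
  minimiser \<open>- b / c\<close> gives the claim, except when \<open>c = 0\<close>.\<close>

lemma L2_Cauchy_Schwarz:
  assumes "f \<in> L2 M" "g \<in> L2 M"
  shows "(LINT x|M. f x * g x)\<^sup>2 \<le> (LINT x|M. (f x)\<^sup>2) * (LINT x|M. (g x)\<^sup>2)"
proof -
  define a b c where "a = (LINT x|M. (f x)\<^sup>2)" and "b = (LINT x|M. f x * g x)" and "c = (LINT x|M. (g x)\<^sup>2)"
  have nonneg: "0 \<le> a + 2 * l * b + l\<^sup>2 * c" for l
    unfolding a_def b_def c_def integral_sq_add[OF assms, symmetric] by simp
  have "0 \<le> c" by (simp add: c_def)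
  have "b\<^sup>2 \<le> a * c"
  proof (cases "c = 0")
    case True
    have "b = 0"
    proof (rule ccontr)
      assume "b \<noteq> 0"
      \<comment> \<open>With \<open>c = 0\<close> this value of \<open>l\<close> makes the quadratic
        equal to \<open>-1\<close>.\<close>
      then show False using nonneg[of "- (a + 1) / (2 * b)"] True by (simp add: field_simps)
    qed
    then show ?thesis using True by simp
  next
    case False
    then show ?thesis
      using nonneg[of "- b / c"] \<open>0 \<le> c\<close> by (simp add: field_simps power2_eq_square)
  qed
  then show ?thesis by (simp add: a_def b_def c_def)
qed

lemma integral_sq_add_le:
  assumes "f \<in> L2 M" "g \<in> L2 M"
  shows "(LINT x|M. (f x + g x)\<^sup>2) \<le> 2 * (LINT x|M. (f x)\<^sup>2) + 2 * (LINT x|M. (g x)\<^sup>2)"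
proof -
  have "(LINT x|M. (f x + g x)\<^sup>2) \<le> (LINT x|M. 2 * (f x)\<^sup>2 + 2 * (g x)\<^sup>2)"
  proof (intro integral_mono)
    fix x show "(f x + g x)\<^sup>2 \<le> 2 * (f x)\<^sup>2 + 2 * (g x)\<^sup>2"
      using sum_squares_bound[of "f x" "g x"] by (simp add: power2_sum)
  qed (use assms in \<open>auto intro!: L2_integrable_sq L2_add\<close>)
  then show ?thesis using assms by (simp add: L2_integrable_sq)
qed

lemma integral_sq_diff_le:
  assumes "f \<in> L2 M" "g \<in> L2 M" "h \<in> L2 M"
  shows "(LINT x|M. (f x - g x)\<^sup>2) \<le> 2 * (LINT x|M. (f x - h x)\<^sup>2) + 2 * (LINT x|M. (g x - h x)\<^sup>2)"
  using integral_sq_add_le[OF L2_diff[OF assms(1,3)] L2_diff[OF assms(3,2)]]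
  by (simp add: power2_commute)

lemma integral_sq_zero_AE:
  assumes "f \<in> L2 M" "(LINT x|M. (f x)\<^sup>2) = 0" shows "AE x in M. f x = 0"
  using integral_nonneg_eq_0_iff_AE[OF L2_integrable_sq[OF assms(1)]] assms(2)
  by (auto elim: eventually_mono)

lemma tendsto_sqrt_zero: "(\<lambda>n. a n) \<longlonglongrightarrow> (0::real) \<Longrightarrow> (\<lambda>n. sqrt (a n)) \<longlonglongrightarrow> 0"
  using tendsto_real_sqrt[of a 0] by simp

lemma L2_tendsto_integral_mult_right:
  assumes "\<And>n. f n \<in> L2 M" "f' \<in> L2 M" "g \<in> L2 M"
    and "(\<lambda>n. (LINT x|M. (f n x - f' x)\<^sup>2)) \<longlonglongrightarrow> 0"
  shows "(\<lambda>n. (LINT x|M. f n x * g x)) \<longlonglongrightarrow> (LINT x|M. f' x * g x)"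
proof -
  have "(\<lambda>n. (LINT x|M. f n x * g x) - (LINT x|M. f' x * g x)) \<longlonglongrightarrow> 0"
  proof (rule Lim_null_comparison)
    show "(\<lambda>n. sqrt ((LINT x|M. (f n x - f' x)\<^sup>2) * (LINT x|M. (g x)\<^sup>2))) \<longlonglongrightarrow> 0"
      by (intro tendsto_sqrt_zero tendsto_mult_left_zero assms)
    have "norm ((LINT x|M. f n x * g x) - (LINT x|M. f' x * g x))
        \<le> sqrt ((LINT x|M. (f n x - f' x)\<^sup>2) * (LINT x|M. (g x)\<^sup>2))" for n
    proof -
      have "(LINT x|M. f n x * g x) - (LINT x|M. f' x * g x) = (LINT x|M. (f n x - f' x) * g x)"
        using assms by (simp add: left_diff_distrib L2_mult_integrable)
      moreover have "(LINT x|M. (f n x - f' x) * g x)\<^sup>2 \<le> (LINT x|M. (f n x - f' x)\<^sup>2) * (LINT x|M. (g x)\<^sup>2)"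
        by (intro L2_Cauchy_Schwarz L2_diff assms)
      ultimately show ?thesis by (simp add: real_le_rsqrt)
    qed
    then show "\<forall>\<^sub>F n in sequentially. norm ((LINT x|M. f n x * g x) - (LINT x|M. f' x * g x))
        \<le> sqrt ((LINT x|M. (f n x - f' x)\<^sup>2) * (LINT x|M. (g x)\<^sup>2))" by simp
  qed
  then show ?thesis by (simp add: LIM_zero_iff)
qed

lemma L2_tendsto_integral_sq:
  assumes "\<And>n. f n \<in> L2 M" "f' \<in> L2 M"
    and "(\<lambda>n. (LINT x|M. (f n x - f' x)\<^sup>2)) \<longlonglongrightarrow> 0"
  shows "(\<lambda>n. (LINT x|M. (f n x)\<^sup>2)) \<longlonglongrightarrow> (LINT x|M. (f' x)\<^sup>2)"
proof -
  have "(\<lambda>n. (LINT x|M. (f n x - f' x)\<^sup>2) + 2 * (LINT x|M. f n x * f' x) - (LINT x|M. (f' x)\<^sup>2))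
      \<longlonglongrightarrow> 0 + 2 * (LINT x|M. f' x * f' x) - (LINT x|M. (f' x)\<^sup>2)"
    by (intro tendsto_intros L2_tendsto_integral_mult_right assms)
  moreover have "(LINT x|M. (f n x - f' x)\<^sup>2) + 2 * (LINT x|M. f n x * f' x) - (LINT x|M. (f' x)\<^sup>2)
      = (LINT x|M. (f n x)\<^sup>2)" for n
    using integral_sq_diff[OF assms(1)[of n] assms(2)] by simp
  ultimately show ?thesis by (simp add: power2_eq_square)
qed

text \<open>Polarisation: the product is expressed through the squares of \<open>f n\<close>,
  \<open>g n\<close> and their sum \<open>s n\<close>, whose integrals converge.\<close>

lemma L2_tendsto_integral_mult:
  assumes "\<And>n. f n \<in> L2 M" "f' \<in> L2 M" "\<And>n. g n \<in> L2 M" "g' \<in> L2 M"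
    and "(\<lambda>n. (LINT x|M. (f n x - f' x)\<^sup>2)) \<longlonglongrightarrow> 0" "(\<lambda>n. (LINT x|M. (g n x - g' x)\<^sup>2)) \<longlonglongrightarrow> 0"
  shows "(\<lambda>n. (LINT x|M. f n x * g n x)) \<longlonglongrightarrow> (LINT x|M. f' x * g' x)"
proof -
  define s where "s n x = f n x + g n x" for n x
  have s: "s n \<in> L2 M" for n unfolding s_def by (intro L2_add assms)
  have s': "(\<lambda>x. f' x + g' x) \<in> L2 M" by (intro L2_add assms)
  have *: "(\<lambda>n. (LINT x|M. (s n x - (f' x + g' x))\<^sup>2)) \<longlonglongrightarrow> 0"
  proof (rule tendsto_sandwich[OF _ _ tendsto_const])
    show "\<forall>\<^sub>F n in sequentially. (LINT x|M. (s n x - (f' x + g' x))\<^sup>2)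
       \<le> 2 * (LINT x|M. (f n x - f' x)\<^sup>2) + 2 * (LINT x|M. (g n x - g' x)\<^sup>2)"
    proof (intro always_eventually allI)
      fix n
      show "(LINT x|M. (s n x - (f' x + g' x))\<^sup>2)
       \<le> 2 * (LINT x|M. (f n x - f' x)\<^sup>2) + 2 * (LINT x|M. (g n x - g' x)\<^sup>2)"
        using integral_sq_add_le[OF L2_diff[OF assms(1)[of n] assms(2)] L2_diff[OF assms(3)[of n] assms(4)]]
        by (simp add: s_def algebra_simps)
    qed
    show "(\<lambda>n. 2 * (LINT x|M. (f n x - f' x)\<^sup>2) + 2 * (LINT x|M. (g n x - g' x)\<^sup>2)) \<longlonglongrightarrow> 0"
      by (intro tendsto_add_zero tendsto_mult_right_zero assms)
  qed auto
  have "(\<lambda>n. ((LINT x|M. (s n x)\<^sup>2) - (LINT x|M. (f n x)\<^sup>2) - (LINT x|M. (g n x)\<^sup>2)) / 2)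
     \<longlonglongrightarrow> ((LINT x|M. (f' x + g' x)\<^sup>2) - (LINT x|M. (f' x)\<^sup>2) - (LINT x|M. (g' x)\<^sup>2)) / 2"
    by (intro tendsto_intros L2_tendsto_integral_sq assms s s' *) auto
  moreover have "((LINT x|M. (s n x)\<^sup>2) - (LINT x|M. (f n x)\<^sup>2) - (LINT x|M. (g n x)\<^sup>2)) / 2
     = (LINT x|M. f n x * g n x)" for n
    using integral_sq_add[OF assms(1)[of n] assms(3)[of n], of 1] by (simp add: s_def)
  moreover have "((LINT x|M. (f' x + g' x)\<^sup>2) - (LINT x|M. (f' x)\<^sup>2) - (LINT x|M. (g' x)\<^sup>2)) / 2
     = (LINT x|M. f' x * g' x)"
    using integral_sq_add[OF assms(2,4), of 1] by simp
  ultimately show ?thesis by simp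
qed

section \<open>Completeness and orthogonal projection\<close>

lemma (in prob_space) L2_integral_abs_le:
  assumes "f \<in> L2 M" shows "(LINT x|M. \<bar>f x\<bar>) \<le> sqrt (LINT x|M. (f x)\<^sup>2)"
proof -
  have "(\<lambda>x. \<bar>f x\<bar>) \<in> L2 M"
    by (rule L2_bound[OF assms]) (use assms in auto)
  from L2_Cauchy_Schwarz[OF this L2_const[of 1]] show ?thesis
    by (simp add: real_le_rsqrt prob_space)
qed

text \<open>Completeness of \<open>L\<^sup>2\<close>, with a limit that depends measurably on the parameter: the
  subsequence along which convergence is almost sure is itself chosen measurably.\<close>

lemma (in prob_space) L2_complete_param:
  fixes Z :: "nat \<Rightarrow> 's \<Rightarrow> 'a \<Rightarrow> real"
  assumes meas: "\<And>n. (\<lambda>(s, w). Z n s w) \<in> borel_measurable (S \<Otimes>\<^sub>M M)"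
    and L2: "\<And>n s. s \<in> space S \<Longrightarrow> Z n s \<in> L2 M"
    and cauchy: "\<And>s e. s \<in> space S \<Longrightarrow> 0 < e \<Longrightarrow>
      \<exists>N. \<forall>m\<ge>N. \<forall>n\<ge>N. (LINT w|M. (Z m s w - Z n s w)\<^sup>2) < e"
  obtains V where "(\<lambda>(s, w). V s w) \<in> borel_measurable (S \<Otimes>\<^sub>M M)"
    and "\<And>s. s \<in> space S \<Longrightarrow> V s \<in> L2 M"
    and "\<And>s. s \<in> space S \<Longrightarrow> (\<lambda>n. (LINT w|M. (Z n s w - V s w)\<^sup>2)) \<longlonglongrightarrow> 0"
proof -
  define D where "D m n s = (LINT w|M. (Z m s w - Z n s w)\<^sup>2)" for m n s
  have [measurable]: "(\<lambda>x. Z n (fst x) (snd x)) \<in> borel_measurable (S \<Otimes>\<^sub>M M)" for n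
    using meas[of n] by (simp add: case_prod_beta')
  have [measurable]: "D m n \<in> borel_measurable S" for m n
    unfolding D_def by measurable
  \<comment> \<open>The threshold concerns squared distances; its square root \<open>(1/4)^k\<close>
    is summable, as almost sure convergence along the subsequence requires. \<open>P\<close> is a
    countable conjunction of measurable conditions, so the least index \<open>N k\<close> depends
    measurably on the parameter.\<close>
  define P where "P k N s \<longleftrightarrow> (\<forall>m\<ge>N. D N m s \<le> (1/16)^k)" for k N :: nat and s
  have [measurable]: "Measurable.pred S (P k N)" for k N
    unfolding P_def by measurable
  define N where "N k s = (LEAST N. P k N s)" for k s
  have [measurable]: "N k \<in> measurable S (count_space UNIV)" for k
    unfolding N_def by measurable
  define V where "V k s w = Z (N k s) s w" for k s w
  have V_meas: "(\<lambda>x. V k (fst x) (snd x)) \<in> borel_measurable (S \<Otimes>\<^sub>M M)" for k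
    unfolding V_def
    by (rule measurable_compose_countable[where f="\<lambda>i x. Z i (fst x) (snd x)" and g="\<lambda>x. N k (fst x)"])
      measurable
  note [measurable] = V_meas
  define L where "L s w = lim (\<lambda>k. V k s w)" for s w
  have L_meas: "(\<lambda>x. L (fst x) (snd x)) \<in> borel_measurable (S \<Otimes>\<^sub>M M)"
    unfolding L_def by (rule borel_measurable_lim_metric) (rule V_meas)
  have main: "L s \<in> L2 M \<and> (\<lambda>n. D' n) \<longlonglongrightarrow> 0"
    if s: "s \<in> space S" and D': "D' = (\<lambda>n. (LINT w|M. (Z n s w - L s w)\<^sup>2))" for s D'
  proof -
    have V2: "V k s \<in> L2 M" for k using L2[OF s] by (simp add: V_def[abs_def])
    note [measurable] = L2_measurable[OF L2[OF s]] L2_measurable[OF V2]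
    have [measurable]: "L s \<in> borel_measurable M"
      unfolding L_def by (rule borel_measurable_lim_metric) measurable
    have exP: "\<exists>N. P k N s" for k
      using cauchy[OF s, of "(1/16)^k"] unfolding P_def D_def by (auto intro: less_imp_le)
    have P_N: "P k (N k s) s" for k unfolding N_def using exP by (rule LeastI_ex)
    have P_anti: "P (Suc k) n s \<Longrightarrow> P k n s" for k n
    proof -
      have "(1/16)^Suc k \<le> (1/16::real)^k" by simp
      then show "P (Suc k) n s \<Longrightarrow> P k n s" unfolding P_def by (meson order_trans)
    qed
    have N_mono: "N k s \<le> N (Suc k) s" for k
      unfolding N_def[of k] by (rule Least_le) (rule P_anti, rule P_N)
    have diff_le: "(LINT w|M. \<bar>V k s w - V (Suc k) s w\<bar>) \<le> (1/4)^k" for k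
    proof -
      have "D (N k s) (N (Suc k) s) s \<le> (1/16)^k"
        using P_N[of k] N_mono[of k] by (auto simp: P_def)
      then have "sqrt (D (N k s) (N (Suc k) s) s) \<le> sqrt ((1/16)^k)" by (rule real_sqrt_le_mono)
      also have "(1/16::real)^k = ((1/4)^k)\<^sup>2" by (simp add: power_mult[symmetric] power2_eq_square power_mult_distrib[symmetric])
      finally have "sqrt (D (N k s) (N (Suc k) s) s) \<le> (1/4)^k" by simp
      with L2_integral_abs_le[OF L2_diff[OF V2[of k] V2[of "Suc k"]]] show ?thesis
        by (simp add: D_def V_def)
    qed
    have "AE w in M. (\<Sum>k. ennreal \<bar>V k s w - V (Suc k) s w\<bar>) \<noteq> \<infinity>"
    proof (rule nn_integral_PInf_AE)
      have "(\<integral>\<^sup>+ w. (\<Sum>k. ennreal \<bar>V k s w - V (Suc k) s w\<bar>) \<partial>M)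
          = (\<Sum>k. \<integral>\<^sup>+ w. ennreal \<bar>V k s w - V (Suc k) s w\<bar> \<partial>M)"
        by (rule nn_integral_suminf) measurable
      also have "\<dots> = (\<Sum>k. ennreal (LINT w|M. \<bar>V k s w - V (Suc k) s w\<bar>))"
        using L2_integrable[OF L2_diff[OF V2 V2]]
        by (intro suminf_cong nn_integral_eq_integral) auto
      also have "\<dots> \<le> (\<Sum>k. ennreal ((1/4)^k))"
        by (intro suminf_le ennreal_leI diff_le) auto
      also have "\<dots> = ennreal (\<Sum>k. (1/4)^k)"
        by (intro suminf_ennreal2) (auto intro: summable_geometric)
      also have "\<dots> < \<infinity>" by simp
      finally show "(\<integral>\<^sup>+ w. (\<Sum>k. ennreal \<bar>V k s w - V (Suc k) s w\<bar>) \<partial>M) \<noteq> \<infinity>" by simp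
    qed measurable
    then have conv: "AE w in M. (\<lambda>k. V k s w) \<longlonglongrightarrow> L s w"
    proof eventually_elim
      case (elim w)
      have "summable (\<lambda>k. \<bar>V k s w - V (Suc k) s w\<bar>)"
        by (rule summable_suminf_not_top) (use elim in auto)
      then have "summable (\<lambda>k. V (Suc k) s w - V k s w)"
        by (subst (asm) abs_minus_commute) (rule summable_rabs_cancel)
      then have "convergent (\<lambda>n. V 0 s w + (\<Sum>k<n. V (Suc k) s w - V k s w))"
        by (intro convergent_add convergent_const) (simp add: summable_iff_convergent)
      then have "convergent (\<lambda>k. V k s w)" by (simp add: sum_lessThan_telescope[of "\<lambda>k. V k s w"])
      then show ?case by (simp add: L_def convergent_LIMSEQ_iff)
    qed
    \<comment> \<open>Fatou's lemma along the subsequence bounds the distance from every late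
      \<open>Z n\<close> to the limit, so the whole sequence converges. The factor \<open>4\<close>
      arises from passing through an intermediate index \<open>m\<close>, at a cost of
      \<open>2 * e\<close> for each half once \<open>(1/16)^k < e\<close>.\<close>
    have fatou: "(\<integral>\<^sup>+w. ennreal ((Z n s w - L s w)\<^sup>2) \<partial>M) \<le> ennreal (4 * e)"
      if e: "0 < e" and N0: "\<forall>m\<ge>N0. \<forall>n\<ge>N0. D m n s < e" and "N0 \<le> n" for e N0 n
    proof -
      have "(\<integral>\<^sup>+w. ennreal ((Z n s w - L s w)\<^sup>2) \<partial>M)
          = (\<integral>\<^sup>+w. liminf (\<lambda>k. ennreal ((Z n s w - V k s w)\<^sup>2)) \<partial>M)"
      proof (intro nn_integral_cong_AE)
        show "AE w in M. ennreal ((Z n s w - L s w)\<^sup>2) = liminf (\<lambda>k. ennreal ((Z n s w - V k s w)\<^sup>2))"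
          using conv
        proof eventually_elim
          case (elim w)
          then have "(\<lambda>k. ennreal ((Z n s w - V k s w)\<^sup>2)) \<longlonglongrightarrow> ennreal ((Z n s w - L s w)\<^sup>2)"
            by (intro tendsto_intros tendsto_ennrealI) auto
          then show ?case by (intro lim_imp_Liminf[symmetric]) auto
        qed
      qed
      also have "\<dots> \<le> liminf (\<lambda>k. \<integral>\<^sup>+w. ennreal ((Z n s w - V k s w)\<^sup>2) \<partial>M)"
        by (rule nn_integral_liminf) measurable
      also have "\<dots> = liminf (\<lambda>k. ennreal (D n (N k s) s))"
        using L2_integrable_sq[OF L2_diff[OF L2[OF s] V2]]
        by (intro arg_cong[where f=liminf] ext) (auto simp: D_def V_def nn_integral_eq_integral)
      also have "\<dots> \<le> limsup (\<lambda>k. ennreal (D n (N k s) s))" by (rule Liminf_le_Limsup) simp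
      also have "\<dots> \<le> ennreal (4 * e)"
      proof (rule Limsup_bounded)
        have "(\<lambda>k. (1/16::real)^k) \<longlonglongrightarrow> 0" by (rule LIMSEQ_realpow_zero) auto
        from order_tendstoD(2)[OF this e]
        show "\<forall>\<^sub>F k in sequentially. ennreal (D n (N k s) s) \<le> ennreal (4 * e)"
        proof eventually_elim
          case (elim k)
          define m where "m = max N0 (N k s)"
          have "D n (N k s) s \<le> 2 * D n m s + 2 * D (N k s) m s"
            unfolding D_def by (intro integral_sq_diff_le L2 s)
          also have "\<dots> \<le> 2 * e + 2 * (1/16)^k"
            using N0 \<open>N0 \<le> n\<close> P_N[of k] by (intro add_mono mult_left_mono) (auto simp: m_def P_def intro: less_imp_le)
          also have "\<dots> \<le> 4 * e" using elim by simp
          finally show ?case by (rule ennreal_leI)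
        qed
      qed
      finally show ?thesis .
    qed
    have L2d: "(\<lambda>w. Z n s w - L s w) \<in> L2 M \<and> (LINT w|M. (Z n s w - L s w)\<^sup>2) \<le> 4 * e"
      if "0 < e" "\<forall>m\<ge>N0. \<forall>n\<ge>N0. D m n s < e" "N0 \<le> n" for e N0 n
    proof
      have int: "integrable M (\<lambda>w. (Z n s w - L s w)\<^sup>2)"
        using fatou[OF that] by (intro integrableI_nonneg) (auto simp: order_le_less_trans)
      then show "(\<lambda>w. Z n s w - L s w) \<in> L2 M" by (intro L2I) auto
      show "(LINT w|M. (Z n s w - L s w)\<^sup>2) \<le> 4 * e"
        using fatou[OF that] \<open>0 < e\<close> nn_integral_eq_integral[OF int] by simp
    qed
    obtain N0 where N0: "\<forall>m\<ge>N0. \<forall>n\<ge>N0. D m n s < 1" using cauchy[OF s, of 1] unfolding D_def by auto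
    have "L s \<in> L2 M"
      using L2_diff[OF L2[OF s, of N0] conjunct1[OF L2d[OF _ N0 order_refl]]] by simp
    moreover have "D' \<longlonglongrightarrow> 0"
    proof (rule LIMSEQ_I)
      fix r :: real assume "0 < r"
      then obtain N1 where N1: "\<forall>m\<ge>N1. \<forall>n\<ge>N1. D m n s < r / 8"
        using cauchy[OF s, of "r / 8"] unfolding D_def by auto
      have "norm (D' n - 0) < r" if "N1 \<le> n" for n
      proof -
        have "D' n \<le> 4 * (r / 8)" using L2d[OF _ N1 that] \<open>0 < r\<close> by (auto simp: D')
        moreover have "0 \<le> D' n" by (simp add: D')
        ultimately show ?thesis using \<open>0 < r\<close> by simp
      qed
      then show "\<exists>no. \<forall>n\<ge>no. norm (D' n - 0) < r" by blast
    qed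
    ultimately show ?thesis by simp
  qed
  show ?thesis
    by (rule that[of L]) (use L_meas main in \<open>auto simp: case_prod_beta'\<close>)
qed

lemma (in prob_space) L2_complete:
  assumes "\<And>n. Z n \<in> L2 M"
    and "\<And>e. 0 < e \<Longrightarrow> \<exists>N. \<forall>m\<ge>N. \<forall>n\<ge>N. (LINT w|M. (Z m w - Z n w)\<^sup>2) < e"
  obtains V where "V \<in> L2 M" "(\<lambda>n. (LINT w|M. (Z n w - V w)\<^sup>2)) \<longlonglongrightarrow> 0"
proof (rule L2_complete_param[of "\<lambda>n (_ :: unit). Z n" "count_space UNIV"])
  fix n have [measurable]: "Z n \<in> borel_measurable M" using assms by auto
  show "(\<lambda>(s::unit, w). Z n w) \<in> borel_measurable (count_space UNIV \<Otimes>\<^sub>M M)"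
    by measurable
qed (use assms that in auto)

text \<open>Elements are functions, not classes. Closedness under limits of constant sequences makes
  such a set invariant under measurable changes on null sets.\<close>

definition closed_subspace :: "'a measure \<Rightarrow> ('a \<Rightarrow> real) set \<Rightarrow> bool" where
  "closed_subspace M V \<longleftrightarrow> V \<subseteq> L2 M \<and> (\<lambda>_. 0) \<in> V \<and>
     (\<forall>f\<in>V. \<forall>g\<in>V. (\<lambda>x. f x + g x) \<in> V) \<and> (\<forall>f\<in>V. \<forall>c. (\<lambda>x. c * f x) \<in> V) \<and>
     (\<forall>g f. f \<in> L2 M \<longrightarrow> (\<forall>n::nat. g n \<in> V) \<longrightarrow>
        (\<lambda>n. (LINT x|M. (g n x - f x)\<^sup>2)) \<longlonglongrightarrow> 0 \<longrightarrow> f \<in> V)"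

lemma closed_subspace_L2: "closed_subspace M V \<Longrightarrow> f \<in> V \<Longrightarrow> f \<in> L2 M"
  and closed_subspace_zero: "closed_subspace M V \<Longrightarrow> (\<lambda>_. 0) \<in> V"
  and closed_subspace_add: "closed_subspace M V \<Longrightarrow> f \<in> V \<Longrightarrow> g \<in> V \<Longrightarrow> (\<lambda>x. f x + g x) \<in> V"
  and closed_subspace_scale: "closed_subspace M V \<Longrightarrow> f \<in> V \<Longrightarrow> (\<lambda>x. c * f x) \<in> V"
  and closed_subspace_limit: "closed_subspace M V \<Longrightarrow> f \<in> L2 M \<Longrightarrow> (\<And>n. h n \<in> V) \<Longrightarrow>
        (\<lambda>n::nat. (LINT x|M. (h n x - f x)\<^sup>2)) \<longlonglongrightarrow> 0 \<Longrightarrow> f \<in> V"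
  unfolding closed_subspace_def by blast+

lemma closed_subspace_diff:
  "closed_subspace M V \<Longrightarrow> f \<in> V \<Longrightarrow> g \<in> V \<Longrightarrow> (\<lambda>x. f x - g x) \<in> V"
  using closed_subspace_add[of M V f "\<lambda>x. - 1 * g x"] closed_subspace_scale[of M V g "- 1"] by simp

lemma closed_subspace_sum:
  "closed_subspace M V \<Longrightarrow> (\<And>i. i \<in> I \<Longrightarrow> f i \<in> V) \<Longrightarrow> (\<lambda>x. \<Sum>i\<in>I. f i x) \<in> V"
  by (induction I rule: infinite_finite_induct)
    (auto intro: closed_subspace_zero closed_subspace_add)

lemma closed_subspace_cong_AE:
  assumes "closed_subspace M V" "f \<in> V" "g \<in> borel_measurable M" "AE x in M. f x = g x"
  shows "g \<in> V"
proof (rule closed_subspace_limit[OF assms(1), of g "\<lambda>_. f"])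
  have f: "f \<in> L2 M" using assms by (auto intro: closed_subspace_L2)
  then show g: "g \<in> L2 M" using assms(3,4) by (rule L2_cong_AE)
  have "(LINT x|M. (f x - g x)\<^sup>2) = 0"
    by (rule integral_eq_zero_AE) (use assms(4) in \<open>auto elim: eventually_mono\<close>)
  then show "(\<lambda>n. (LINT x|M. (f x - g x)\<^sup>2)) \<longlonglongrightarrow> 0" by simp
qed fact

text \<open>The parallelogram identity, with the midpoint of two members as competitor, makes a
  minimising sequence Cauchy. Orthogonality is the vanishing first variation of the distance in the
  direction \<open>v\<close>.\<close>

lemma (in prob_space) L2_projection:
  assumes V: "closed_subspace M V" and f: "f \<in> L2 M"
  obtains p where "p \<in> V" "\<And>v. v \<in> V \<Longrightarrow> (LINT x|M. (f x - p x) * v x) = 0"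
proof -
  define E where "E v = (LINT x|M. (f x - v x)\<^sup>2)" for v
  define d where "d = (INF v\<in>V. E v)"
  have E0: "0 \<le> E v" for v by (simp add: E_def)
  have bdd: "bdd_below (E ` V)" using E0 by (intro bdd_belowI[of _ 0]) auto
  have ne: "E ` V \<noteq> {}" using closed_subspace_zero[OF V] by auto
  have d_le: "v \<in> V \<Longrightarrow> d \<le> E v" for v unfolding d_def by (rule cINF_lower[OF bdd])
  have "\<exists>v\<in>V. E v < d + 1 / Suc n" for n :: nat
    using cInf_lessD[OF ne, of "d + 1 / Suc n"] by (auto simp: d_def)
  then obtain g where gV: "\<And>n. g n \<in> V" and gE: "\<And>n. E (g n) < d + 1 / Suc n" by metis
  note VL = closed_subspace_L2[OF V]
  have par: "(LINT x|M. (g m x - g n x)\<^sup>2) \<le> 2 / Suc m + 2 / Suc n" for m n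
  proof -
    define u w where "u x = f x - g m x" and "w x = f x - g n x" for x
    have u: "u \<in> L2 M" and w: "w \<in> L2 M" unfolding u_def[abs_def] w_def[abs_def] by (intro L2_diff f VL gV)+
    have mid: "(\<lambda>x. (1/2) * (g m x + g n x)) \<in> V" by (rule closed_subspace_scale[OF V closed_subspace_add[OF V gV gV]])
    have "(LINT x|M. (u x + 1 * w x)\<^sup>2) = 4 * E (\<lambda>x. (1/2) * (g m x + g n x))"
      unfolding E_def
      by (subst integral_mult_right_zero[symmetric]) (rule Bochner_Integration.integral_cong, auto simp: u_def w_def power2_eq_square field_simps)
    then have "4 * d \<le> (LINT x|M. (u x + 1 * w x)\<^sup>2)" using d_le[OF mid] by simp
    moreover have "(LINT x|M. (g m x - g n x)\<^sup>2) = (LINT x|M. (u x + (-1) * w x)\<^sup>2)"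
      by (intro Bochner_Integration.integral_cong refl) (simp add: u_def w_def power2_eq_square algebra_simps)
    moreover have "(LINT x|M. (u x)\<^sup>2) < d + 1 / Suc m" "(LINT x|M. (w x)\<^sup>2) < d + 1 / Suc n"
      using gE by (simp_all add: E_def u_def w_def)
    ultimately show ?thesis unfolding integral_sq_add[OF u w] by simp
  qed
  obtain p where p: "p \<in> L2 M" "(\<lambda>n. (LINT \<omega>|M. (g n \<omega> - p \<omega>)\<^sup>2)) \<longlonglongrightarrow> 0"
  proof (rule L2_complete[of g])
    fix e :: real assume "0 < e"
    then obtain N :: nat where N: "4 / e < real N" using reals_Archimedean2 by blast
    then have "0 < N" using \<open>0 < e\<close> by (intro gr0I) (auto simp: field_simps)
    have "(LINT x|M. (g m x - g n x)\<^sup>2) < e" if "m \<ge> N" "n \<ge> N" for m n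
    proof -
      have "2 / real (Suc k) < e / 2" if "k \<ge> N" for k
      proof -
        have "4 / e < real (Suc k)" using N that by simp
        then show ?thesis using \<open>0 < e\<close> by (simp add: field_simps)
      qed
      from this[OF \<open>m \<ge> N\<close>] this[OF \<open>n \<ge> N\<close>] par[of m n] show ?thesis by simp
    qed
    then show "\<exists>N. \<forall>m\<ge>N. \<forall>n\<ge>N. (LINT x|M. (g m x - g n x)\<^sup>2) < e" by blast
  qed (use VL gV in auto)
  have pV: "p \<in> V" by (rule closed_subspace_limit[OF V p(1) gV p(2)])
  have "E p \<le> d"
  proof (rule LIMSEQ_le)
    have "(\<lambda>n. (LINT x|M. ((f x - g n x) - (f x - p x))\<^sup>2)) \<longlonglongrightarrow> 0"
      using p(2) by (simp add: power2_commute)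
    then show "(\<lambda>n. E (g n)) \<longlonglongrightarrow> E p"
      unfolding E_def by (intro L2_tendsto_integral_sq L2_diff f VL gV pV)
    show "(\<lambda>n. d + 1 / Suc n) \<longlonglongrightarrow> d"
      using tendsto_add[OF tendsto_const[of d] LIMSEQ_Suc[OF lim_inverse_n']] by simp
    show "\<exists>N. \<forall>n\<ge>N. E (g n) \<le> d + 1 / real (Suc n)" using gE by (auto intro: less_imp_le)
  qed
  moreover have "(LINT x|M. (f x - p x) * v x) = 0" if v: "v \<in> V" for v
  proof -
    define b c where "b = (LINT x|M. (f x - p x) * v x)" and "c = (LINT x|M. (v x)\<^sup>2)"
    have fp: "(\<lambda>x. f x - p x) \<in> L2 M" by (intro L2_diff f p)
    have "0 \<le> c" by (simp add: c_def)
    have *: "0 \<le> - 2 * l * b + l\<^sup>2 * c" for l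
    proof -
      have "d \<le> E (\<lambda>x. p x + l * v x)"
        by (rule d_le, rule closed_subspace_add[OF V pV closed_subspace_scale[OF V v]])
      also have "\<dots> = (LINT x|M. ((f x - p x) + (- l) * v x)\<^sup>2)"
        unfolding E_def by (intro Bochner_Integration.integral_cong refl) (simp add: algebra_simps)
      also have "\<dots> = E p - 2 * l * b + l\<^sup>2 * c"
        unfolding integral_sq_add[OF fp VL[OF v]] by (simp add: E_def b_def c_def)
      finally show ?thesis using \<open>E p \<le> d\<close> by simp
    qed
    have "b = 0"
    proof (cases "c = 0")
      case True
      then show ?thesis using *[of "b"] by (simp add: power2_eq_square[symmetric])
    next
      case False
      then have "c > 0" using \<open>0 \<le> c\<close> by simp
      have "- 2 * (b / c) * b + (b / c)\<^sup>2 * c = - (b\<^sup>2 / c)"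
        using \<open>c > 0\<close> by (simp add: field_simps power2_eq_square)
      with *[of "b / c"] have "b\<^sup>2 / c \<le> 0" by simp
      then show ?thesis using \<open>c > 0\<close> by (simp add: divide_le_0_iff)
    qed
    then show ?thesis by (simp add: b_def)
  qed
  ultimately show ?thesis using pV that by blast
qed

section \<open>Positive semidefinite integral equations of the second kind\<close>

definition bounded_supp :: "real \<Rightarrow> (real \<Rightarrow> real) \<Rightarrow> bool" where
  "bounded_supp T f \<longleftrightarrow> f \<in> borel_measurable borel \<and> (\<exists>b. \<forall>x. \<bar>f x\<bar> \<le> b) \<and> (\<forall>x. x \<notin> {0..T} \<longrightarrow> f x = 0)"

lemma bounded_suppI:
  "f \<in> borel_measurable borel \<Longrightarrow> (\<And>x. \<bar>f x\<bar> \<le> b) \<Longrightarrow> (\<And>x. x \<notin> {0..T} \<Longrightarrow> f x = 0) \<Longrightarrow> bounded_supp T f"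
  unfolding bounded_supp_def by blast

lemma bounded_supp_measurable [measurable_dest]: "bounded_supp T f \<Longrightarrow> f \<in> borel_measurable borel"
  by (simp add: bounded_supp_def)

lemma bounded_suppE:
  assumes "bounded_supp T f" obtains b where "0 \<le> b" "\<And>x. \<bar>f x\<bar> \<le> b"
  using assms unfolding bounded_supp_def by (metis abs_ge_zero order_trans)

lemma bounded_supp_zero: "bounded_supp T f \<Longrightarrow> x \<notin> {0..T} \<Longrightarrow> f x = 0"
  unfolding bounded_supp_def by blast

lemma bounded_supp_integrable:
  assumes "bounded_supp T f" shows "integrable lborel f"
proof -
  obtain b where b: "\<And>x. \<bar>f x\<bar> \<le> b" using assms by (metis bounded_suppE)
  show ?thesis
  proof (rule Bochner_Integration.integrable_bound)
    show "integrable lborel (\<lambda>x. b * indicator {0..T} x :: real)"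
      by (intro integrable_mult_right integrable_real_indicator) (auto simp: emeasure_lborel_Icc_eq)
    show "AE x in lborel. norm (f x) \<le> norm (b * indicator {0..T} x)"
      using b order_trans[OF b abs_ge_self] bounded_supp_zero[OF assms]
      by (intro AE_I2) (auto split: split_indicator)
  qed (use assms in measurable)
qed

lemma integral_abs_le_bounded_supp:
  assumes f: "bounded_supp T f" and b: "\<And>x. x \<in> {0..T} \<Longrightarrow> \<bar>f x\<bar> \<le> b" and T: "0 \<le> T"
  shows "\<bar>(LBINT x. f x)\<bar> \<le> b * T"
proof -
  have "\<bar>(LBINT x. f x)\<bar> \<le> (LBINT x. \<bar>f x\<bar>)" by (rule integral_abs_bound)
  also have "\<dots> \<le> (LBINT x. b * indicator {0..T} x)"
  proof (rule integral_mono)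
    show "integrable lborel (\<lambda>x. b * indicator {0..T} x)"
      using T by (intro integrable_mult_right integrable_real_indicator) auto
    show "\<bar>f x\<bar> \<le> b * indicator {0..T} x" for x
      using b[of x] bounded_supp_zero[OF f, of x] by (cases "x \<in> {0..T}") auto
  qed (intro integrable_abs bounded_supp_integrable[OF f])
  also have "\<dots> = b * T" using T by simp
  finally show ?thesis .
qed

lemma bounded_supp_mult:
  assumes "bounded_supp T f" "g \<in> borel_measurable borel" "\<And>x. \<bar>g x\<bar> \<le> b"
  shows "bounded_supp T (\<lambda>x. g x * f x)" "bounded_supp T (\<lambda>x. f x * g x)"
proof -
  obtain b' where b': "0 \<le> b'" "\<And>x. \<bar>f x\<bar> \<le> b'" using assms(1) by (metis bounded_suppE)
  have "0 \<le> b" using assms(3) abs_ge_zero order_trans by blast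
  have "\<bar>g x * f x\<bar> \<le> b * b'" for x
    unfolding abs_mult using b' assms(3) \<open>0 \<le> b\<close> by (intro mult_mono) auto
  then show "bounded_supp T (\<lambda>x. g x * f x)"
    using assms(1,2) bounded_supp_zero[OF assms(1)] by (intro bounded_suppI[of _ "b * b'"]) (auto simp: bounded_supp_def)
  then show "bounded_supp T (\<lambda>x. f x * g x)" by (simp add: mult.commute)
qed

lemma bounded_supp_mult2: "bounded_supp T f \<Longrightarrow> bounded_supp T g \<Longrightarrow> bounded_supp T (\<lambda>x. f x * g x)"
  by (metis bounded_suppE bounded_supp_measurable bounded_supp_mult(2))

lemma bounded_supp_scale: "bounded_supp T f \<Longrightarrow> bounded_supp T (\<lambda>x. c * f x)"
  using bounded_supp_mult(1)[of T f "\<lambda>_. c" "\<bar>c\<bar>"] by simp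

lemma bounded_supp_add:
  assumes "bounded_supp T f" "bounded_supp T g" shows "bounded_supp T (\<lambda>x. f x + g x)"
proof -
  obtain b b' where "\<And>x. \<bar>f x\<bar> \<le> b" "\<And>x. \<bar>g x\<bar> \<le> b'" using assms by (metis bounded_suppE)
  then have "\<bar>f x + g x\<bar> \<le> b + b'" for x using abs_triangle_ineq[of "f x" "g x"] add_mono order_trans by blast
  then show ?thesis using assms by (intro bounded_suppI[of _ "b + b'"]) (auto simp: bounded_supp_def)
qed

lemma bounded_supp_diff: "bounded_supp T f \<Longrightarrow> bounded_supp T g \<Longrightarrow> bounded_supp T (\<lambda>x. f x - g x)"
  using bounded_supp_add[of T f "\<lambda>x. - 1 * g x"] bounded_supp_scale[of T g "- 1"] by simp

lemma bounded_supp_const_zero: "bounded_supp T (\<lambda>x. 0)"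
  by (rule bounded_suppI[of _ 0]) auto

lemma bounded_supp_sum: "(\<And>i. i \<in> I \<Longrightarrow> bounded_supp T (f i)) \<Longrightarrow> bounded_supp T (\<lambda>x. \<Sum>i\<in>I. f i x)"
  by (induction I rule: infinite_finite_induct) (auto intro: bounded_supp_add bounded_supp_const_zero)

lemma bounded_supp_L2: "bounded_supp T f \<Longrightarrow> f \<in> L2 lborel"
  by (auto intro!: L2I bounded_supp_integrable bounded_supp_mult2 simp: power2_eq_square
      intro: bounded_supp_measurable)

definition kop :: "(real \<Rightarrow> real \<Rightarrow> real) \<Rightarrow> (real \<Rightarrow> real) \<Rightarrow> real \<Rightarrow> real" where
  "kop \<kappa> f s = (LBINT r. \<kappa> s r * f r)"

text \<open>The residuals of the Richardson iteration \<open>\<phi> \<mapsto> \<phi> - l (\<phi> + \<kappa>\<phi> - g)\<close> started at \<open>0\<close>, and the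
  limit of the iteration, which is \<open>- l\<close> times the sum of all residuals; it is written in terms of
  \<open>\<kappa>\<close> applied to the residuals because these converge pointwise.\<close>

primrec kresid :: "real \<Rightarrow> (real \<Rightarrow> real \<Rightarrow> real) \<Rightarrow> (real \<Rightarrow> real) \<Rightarrow> nat \<Rightarrow> real \<Rightarrow> real" where
  "kresid l \<kappa> g 0 = (\<lambda>s. - g s)"
| "kresid l \<kappa> g (Suc n) = (\<lambda>s. (1 - l) * kresid l \<kappa> g n s - l * kop \<kappa> (kresid l \<kappa> g n) s)"

definition ksol :: "real \<Rightarrow> (real \<Rightarrow> real \<Rightarrow> real) \<Rightarrow> (real \<Rightarrow> real) \<Rightarrow> real \<Rightarrow> real" where
  "ksol l \<kappa> g s = g s + l * (\<Sum>n. kop \<kappa> (kresid l \<kappa> g n) s)"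

text \<open>A residual arises from the data by finitely many parametrised integrals. The parameter
  \<open>t\<close> is carried along because the kernel and the right-hand side will both be
  truncated at \<open>t\<close>.\<close>

lemma kresid_measurable:
  assumes "(\<lambda>(t, s, r). \<kappa> t s r) \<in> borel_measurable (borel \<Otimes>\<^sub>M borel \<Otimes>\<^sub>M (borel :: real measure))"
    and "(\<lambda>(t, s). g t s) \<in> borel_measurable ((borel :: real measure) \<Otimes>\<^sub>M borel)"
  shows "(\<lambda>x. kresid l (\<kappa> (fst x)) (g (fst x)) n (snd x)) \<in> borel_measurable (borel \<Otimes>\<^sub>M borel)"
proof (induction n)
  case 0
  have [measurable]: "(\<lambda>x. g (fst x) (snd x)) \<in> borel_measurable (borel \<Otimes>\<^sub>M borel)"
    using assms(2) by (simp add: case_prod_beta')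
  show ?case by simp
next
  case (Suc n)
  note [measurable] = Suc
  have [measurable]: "(\<lambda>x. \<kappa> (fst (fst x)) (snd (fst x)) (snd x) * kresid l (\<kappa> (fst (fst x))) (g (fst (fst x))) n (snd x))
      \<in> borel_measurable ((borel \<Otimes>\<^sub>M borel) \<Otimes>\<^sub>M lborel)"
    using measurable_compose[of "\<lambda>x. (fst (fst x), snd (fst x), snd x)" "(borel \<Otimes>\<^sub>M borel) \<Otimes>\<^sub>M lborel" "borel \<Otimes>\<^sub>M borel \<Otimes>\<^sub>M borel", OF _ assms(1)]
      measurable_compose[of "\<lambda>x. (fst (fst x), snd x)" "(borel \<Otimes>\<^sub>M borel) \<Otimes>\<^sub>M lborel" "borel \<Otimes>\<^sub>M borel", OF _ Suc]
    by (intro borel_measurable_times) simp_all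
  have [measurable]: "(\<lambda>x. kop (\<kappa> (fst x)) (kresid l (\<kappa> (fst x)) (g (fst x)) n) (snd x)) \<in> borel_measurable (borel \<Otimes>\<^sub>M borel)"
    unfolding kop_def
    using lborel.borel_measurable_lebesgue_integral[of "\<lambda>x r. \<kappa> (fst x) (snd x) r * kresid l (\<kappa> (fst x)) (g (fst x)) n r" "borel \<Otimes>\<^sub>M borel"]
    by (simp add: case_prod_beta')
  show ?case by simp
qed

lemma ksol_measurable:
  assumes "(\<lambda>(t, s, r). \<kappa> t s r) \<in> borel_measurable (borel \<Otimes>\<^sub>M borel \<Otimes>\<^sub>M (borel :: real measure))"
    and "(\<lambda>(t, s). g t s) \<in> borel_measurable ((borel :: real measure) \<Otimes>\<^sub>M borel)"
  shows "(\<lambda>x. ksol l (\<kappa> (fst x)) (g (fst x)) (snd x)) \<in> borel_measurable (borel \<Otimes>\<^sub>M borel)"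
proof -
  have [measurable]: "(\<lambda>x. g (fst x) (snd x)) \<in> borel_measurable (borel \<Otimes>\<^sub>M borel)"
    using assms(2) by (simp add: case_prod_beta')
  note R = kresid_measurable[OF assms]
  have [measurable]: "(\<lambda>x. \<kappa> (fst (fst x)) (snd (fst x)) (snd x) * kresid l (\<kappa> (fst (fst x))) (g (fst (fst x))) n (snd x))
      \<in> borel_measurable ((borel \<Otimes>\<^sub>M borel) \<Otimes>\<^sub>M lborel)" for n
    using measurable_compose[of "\<lambda>x. (fst (fst x), snd (fst x), snd x)" "(borel \<Otimes>\<^sub>M borel) \<Otimes>\<^sub>M lborel" "borel \<Otimes>\<^sub>M borel \<Otimes>\<^sub>M borel", OF _ assms(1)]
      measurable_compose[of "\<lambda>x. (fst (fst x), snd x)" "(borel \<Otimes>\<^sub>M borel) \<Otimes>\<^sub>M lborel" "borel \<Otimes>\<^sub>M borel", OF _ R[of l n]]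
    by (intro borel_measurable_times) simp_all
  have [measurable]: "(\<lambda>x. kop (\<kappa> (fst x)) (kresid l (\<kappa> (fst x)) (g (fst x)) n) (snd x)) \<in> borel_measurable (borel \<Otimes>\<^sub>M borel)" for n
    unfolding kop_def
    using lborel.borel_measurable_lebesgue_integral[of "\<lambda>x r. \<kappa> (fst x) (snd x) r * kresid l (\<kappa> (fst x)) (g (fst x)) n r" "borel \<Otimes>\<^sub>M borel"]
    by (simp add: case_prod_beta')
  show ?thesis unfolding ksol_def by measurable
qed

locale psd_kernel =
  fixes T c :: real and \<kappa> :: "real \<Rightarrow> real \<Rightarrow> real"
  assumes T_nonneg: "0 \<le> T" and c_nonneg: "0 \<le> c"
    and kernel_measurable: "(\<lambda>(s, r). \<kappa> s r) \<in> borel_measurable (borel \<Otimes>\<^sub>M borel)"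
    and kernel_bound: "\<bar>\<kappa> s r\<bar> \<le> c"
    and kernel_supp: "s \<notin> {0..T} \<or> r \<notin> {0..T} \<Longrightarrow> \<kappa> s r = 0"
    and psd: "bounded_supp T f \<Longrightarrow> 0 \<le> (LBINT s. f s * kop \<kappa> f s)"
begin

lemma section_bounded_supp: "bounded_supp T (\<kappa> s)"
proof (rule bounded_suppI[OF _ kernel_bound])
  show "\<kappa> s \<in> borel_measurable borel"
    using measurable_Pair2[OF kernel_measurable, of s] by simp
qed (use kernel_supp in auto)

lemma kop_bounded_supp:
  assumes f: "bounded_supp T f" shows "bounded_supp T (kop \<kappa> f)"
proof -
  obtain b where b: "0 \<le> b" "\<And>x. \<bar>f x\<bar> \<le> b" using f by (metis bounded_suppE)
  show ?thesis
  proof (rule bounded_suppI)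
    have [measurable]: "f \<in> borel_measurable borel" using f by auto
    show "kop \<kappa> f \<in> borel_measurable borel"
      unfolding kop_def[abs_def]
    proof (rule lborel.borel_measurable_lebesgue_integral)
      have [measurable]: "(\<lambda>x. \<kappa> (fst x) (snd x)) \<in> borel_measurable (borel \<Otimes>\<^sub>M lborel)"
        using kernel_measurable by (simp add: case_prod_beta')
      show "(\<lambda>(s, r). \<kappa> s r * f r) \<in> borel_measurable (borel \<Otimes>\<^sub>M lborel)"
        unfolding case_prod_beta' by measurable
    qed
    show "\<bar>kop \<kappa> f s\<bar> \<le> c * b * T" for s
      unfolding kop_def
      by (rule integral_abs_le_bounded_supp[OF bounded_supp_mult2[OF section_bounded_supp f] _ T_nonneg])
        (auto simp: abs_mult intro!: mult_mono kernel_bound b c_nonneg)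
    show "kop \<kappa> f s = 0" if "s \<notin> {0..T}" for s
      unfolding kop_def using kernel_supp[of s] that by simp
  qed
qed

lemma kop_diff: "bounded_supp T f \<Longrightarrow> bounded_supp T g \<Longrightarrow> kop \<kappa> (\<lambda>x. f x - g x) s = kop \<kappa> f s - kop \<kappa> g s"
  unfolding kop_def right_diff_distrib
  by (intro Bochner_Integration.integral_diff bounded_supp_integrable[of T] bounded_supp_mult2 section_bounded_supp)

lemma kop_scale: "kop \<kappa> (\<lambda>x. d * f x) s = d * kop \<kappa> f s"
  unfolding kop_def by (simp add: mult.left_commute[of _ d])

lemma kop_sum: "(\<And>i. i \<in> I \<Longrightarrow> bounded_supp T (f i)) \<Longrightarrow> finite I \<Longrightarrow>
    kop \<kappa> (\<lambda>x. \<Sum>i\<in>I. f i x) s = (\<Sum>i\<in>I. kop \<kappa> (f i) s)"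
  unfolding kop_def sum_distrib_left
  by (intro Bochner_Integration.integral_sum bounded_supp_integrable[of T] bounded_supp_mult2 section_bounded_supp)

lemma kop_sq_le:
  assumes f: "bounded_supp T f" shows "(kop \<kappa> f s)\<^sup>2 \<le> c\<^sup>2 * T * (LBINT x. (f x)\<^sup>2)"
proof -
  have "(kop \<kappa> f s)\<^sup>2 \<le> (LBINT r. (\<kappa> s r)\<^sup>2) * (LBINT x. (f x)\<^sup>2)"
    unfolding kop_def by (intro L2_Cauchy_Schwarz bounded_supp_L2[of T] section_bounded_supp f)
  also have "\<dots> \<le> (c\<^sup>2 * T) * (LBINT x. (f x)\<^sup>2)"
  proof (rule mult_right_mono)
    have "\<bar>(LBINT r. (\<kappa> s r)\<^sup>2)\<bar> \<le> c\<^sup>2 * T"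
      using bounded_supp_mult2[OF section_bounded_supp[of s] section_bounded_supp[of s]] power_mono[OF kernel_bound abs_ge_zero, of s _ 2]
      by (intro integral_abs_le_bounded_supp[OF _ _ T_nonneg]) (auto simp: power2_eq_square abs_mult)
    then show "(LBINT r. (\<kappa> s r)\<^sup>2) \<le> c\<^sup>2 * T" by simp
  qed simp
  finally show ?thesis .
qed

lemma kop_norm_le:
  assumes f: "bounded_supp T f"
  shows "(LBINT s. (kop \<kappa> f s)\<^sup>2) \<le> (c * T)\<^sup>2 * (LBINT x. (f x)\<^sup>2)"
proof -
  have "\<bar>(LBINT s. (kop \<kappa> f s)\<^sup>2)\<bar> \<le> (c\<^sup>2 * T * (LBINT x. (f x)\<^sup>2)) * T"
    using kop_sq_le[OF f] bounded_supp_mult2[OF kop_bounded_supp[OF f] kop_bounded_supp[OF f]]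
    by (intro integral_abs_le_bounded_supp T_nonneg) (auto simp: power2_eq_square)
  then show ?thesis by (simp add: power2_eq_square ac_simps)
qed

text \<open>The number \<open>c * T\<close> bounds the operator norm of the kernel, hence
  \<open>1 + c * T\<close> that of identity plus kernel. With the inverse square as step size the
  quadratic term in \<open>contraction\<close> is at most \<open>relax\<close> times the squared
  norm of \<open>f\<close>.\<close>

definition relax :: real where "relax = 1 / (1 + c * T)\<^sup>2"

lemma relax_bounds: "0 < relax" "relax \<le> 1"
proof -
  have "0 \<le> c * T" using T_nonneg c_nonneg by simp
  then have "1 \<le> (1 + c * T)\<^sup>2" using one_le_power[of "1 + c * T" 2] by simp
  then show "0 < relax" "relax \<le> 1" unfolding relax_def
    using \<open>0 \<le> c * T\<close> by (auto simp: divide_le_eq_1 zero_less_divide_iff add_nonneg_eq_0_iff)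
qed

text \<open>In the expansion of the square the linear term is \<open>- 2 * relax\<close> times the
  form of identity plus kernel, which by \<open>psd\<close> is at least the squared norm of
  \<open>f\<close>. The quadratic term gives back at most \<open>relax\<close> times that norm,
  which leaves the factor \<open>1 - relax\<close>.\<close>

lemma contraction:
  assumes f: "bounded_supp T f"
  shows "(LBINT s. ((1 - relax) * f s - relax * kop \<kappa> f s)\<^sup>2) \<le> (1 - relax) * (LBINT x. (f x)\<^sup>2)"
proof -
  let ?n = "(LBINT x. (f x)\<^sup>2)" and ?i = "(LBINT s. f s * kop \<kappa> f s)" and ?k = "(LBINT s. (kop \<kappa> f s)\<^sup>2)"
  define L where "L = c * T"
  have L: "0 \<le> L" using T_nonneg c_nonneg by (simp add: L_def)
  have f2: "f \<in> L2 lborel" and kf2: "kop \<kappa> f \<in> L2 lborel" using f kop_bounded_supp bounded_supp_L2 by blast+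
  have g2: "(\<lambda>s. f s + 1 * kop \<kappa> f s) \<in> L2 lborel" using f2 kf2 by (simp add: L2_add)
  have i0: "0 \<le> ?i" using psd[OF f] .
  have n0: "0 \<le> ?n" by simp
  have k: "?k \<le> L\<^sup>2 * ?n" using kop_norm_le[OF f] by (simp add: L_def)
  have "?i\<^sup>2 \<le> (L * ?n)\<^sup>2"
  proof -
    have "?i\<^sup>2 \<le> ?n * ?k" by (intro L2_Cauchy_Schwarz f2 kf2)
    also have "\<dots> \<le> ?n * (L\<^sup>2 * ?n)" using k n0 by (intro mult_left_mono)
    finally show ?thesis by (simp add: power2_eq_square ac_simps)
  qed
  then have i1: "?i \<le> L * ?n" by (rule power2_le_imp_le) (use L in simp)
  have ip: "(LBINT s. f s * (f s + 1 * kop \<kappa> f s)) = ?n + ?i"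
  proof -
    have "(LBINT s. f s * (f s + 1 * kop \<kappa> f s)) = (LBINT s. (f s)\<^sup>2 + f s * kop \<kappa> f s)"
      by (intro Bochner_Integration.integral_cong) (auto simp: power2_eq_square algebra_simps)
    then show ?thesis using f2 kf2 by (simp add: L2_integrable_sq L2_mult_integrable)
  qed
  have "(LBINT s. ((1 - relax) * f s - relax * kop \<kappa> f s)\<^sup>2)
      = (LBINT s. (f s + (- relax) * (f s + 1 * kop \<kappa> f s))\<^sup>2)"
    by (intro Bochner_Integration.integral_cong refl arg_cong[where f="\<lambda>x. x\<^sup>2"]) (simp add: algebra_simps)
  also have "\<dots> = ?n - 2 * relax * (?n + ?i) + relax\<^sup>2 * (?n + 2 * ?i + ?k)"
    unfolding integral_sq_add[OF f2 g2] ip integral_sq_add[OF f2 kf2] by simp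
  also have "\<dots> \<le> ?n - 2 * relax * ?n + relax\<^sup>2 * ((1 + L)\<^sup>2 * ?n)"
  proof (intro add_mono diff_left_mono mult_left_mono)
    show "?n + 2 * ?i + ?k \<le> (1 + L)\<^sup>2 * ?n" using i1 k by (simp add: power2_eq_square algebra_simps)
  qed (use i0 relax_bounds in auto)
  also have "relax\<^sup>2 * ((1 + L)\<^sup>2 * ?n) = relax * ?n"
    using L by (simp add: L_def relax_def power2_eq_square)
  finally show ?thesis by (simp add: algebra_simps)
qed

lemma kresid_bounded_supp: "bounded_supp T g \<Longrightarrow> bounded_supp T (kresid l \<kappa> g n)"
  by (induction n) (auto intro!: bounded_supp_diff bounded_supp_scale kop_bounded_supp
      intro: bounded_supp_scale[of T g "- 1", simplified])

lemma kresid_norm: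
  assumes "bounded_supp T g"
  shows "(LBINT s. (kresid relax \<kappa> g n s)\<^sup>2) \<le> (1 - relax) ^ n * (LBINT s. (g s)\<^sup>2)"
proof (induction n)
  case (Suc n)
  have "(LBINT s. (kresid relax \<kappa> g (Suc n) s)\<^sup>2) \<le> (1 - relax) * (LBINT s. (kresid relax \<kappa> g n s)\<^sup>2)"
    using contraction[OF kresid_bounded_supp[OF assms, of relax n]] by simp
  also have "\<dots> \<le> (1 - relax) * ((1 - relax) ^ n * (LBINT s. (g s)\<^sup>2))"
    using relax_bounds by (intro mult_left_mono Suc) auto
  finally show ?case by simp
qed simp

definition rate :: real where "rate = sqrt (1 - relax)"

lemma rate_bounds: "0 \<le> rate" "rate < 1"
  using relax_bounds unfolding rate_def by auto

lemma suminf_rate: "(\<Sum>n. D * rate ^ n) = D / (1 - rate)"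
  using suminf_mult[OF summable_geometric[of rate], of D] suminf_geometric[of rate] rate_bounds
  by simp

text \<open>The contraction gives decay in mean square only; one application of the bounded kernel
  turns it into a bound at every point, uniform in \<open>s\<close>.\<close>

lemma kop_kresid_bound:
  assumes g: "bounded_supp T g"
  shows "\<bar>kop \<kappa> (kresid relax \<kappa> g n) s\<bar> \<le> sqrt (c\<^sup>2 * T * (LBINT s. (g s)\<^sup>2)) * rate ^ n"
proof -
  have "(kop \<kappa> (kresid relax \<kappa> g n) s)\<^sup>2 \<le> c\<^sup>2 * T * (LBINT x. (kresid relax \<kappa> g n x)\<^sup>2)"
    by (rule kop_sq_le[OF kresid_bounded_supp[OF g]])
  also have "\<dots> \<le> c\<^sup>2 * T * ((1 - relax) ^ n * (LBINT s. (g s)\<^sup>2))"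
    using T_nonneg by (intro mult_left_mono kresid_norm g) auto
  finally have "\<bar>kop \<kappa> (kresid relax \<kappa> g n) s\<bar> \<le> sqrt (c\<^sup>2 * T * ((1 - relax) ^ n * (LBINT s. (g s)\<^sup>2)))"
    using real_sqrt_le_mono by fastforce
  also have "\<dots> = sqrt (c\<^sup>2 * T * (LBINT s. (g s)\<^sup>2)) * rate ^ n"
    by (simp add: rate_def real_sqrt_mult real_sqrt_power)
  finally show ?thesis .
qed

lemma kop_kresid_summable:
  "bounded_supp T g \<Longrightarrow> summable (\<lambda>n. kop \<kappa> (kresid relax \<kappa> g n) s)"
  using rate_bounds
  by (intro summable_comparison_test'[where N=0, OF summable_mult[OF summable_geometric[of rate]]])
    (auto intro: kop_kresid_bound)

lemma ksol_bound:
  assumes g: "bounded_supp T g" and b: "\<And>s. \<bar>g s\<bar> \<le> b"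
  shows "\<bar>ksol relax \<kappa> g s\<bar> \<le> b + sqrt (c\<^sup>2 * T * (LBINT s. (g s)\<^sup>2)) / (1 - rate)"
proof -
  let ?C = "sqrt (c\<^sup>2 * T * (LBINT s. (g s)\<^sup>2))"
  have sm: "summable (\<lambda>n. ?C * rate ^ n)" using rate_bounds by (intro summable_mult summable_geometric) auto
  have "\<bar>\<Sum>n. kop \<kappa> (kresid relax \<kappa> g n) s\<bar> \<le> (\<Sum>n. ?C * rate ^ n)"
    unfolding real_norm_def[symmetric]
    by (rule norm_suminf_le[OF _ sm]) (auto intro: kop_kresid_bound g)
  also have "\<dots> = ?C / (1 - rate)"
    by (rule suminf_rate)
  finally have S: "\<bar>\<Sum>n. kop \<kappa> (kresid relax \<kappa> g n) s\<bar> \<le> ?C / (1 - rate)" .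
  have "\<bar>relax * (\<Sum>n. kop \<kappa> (kresid relax \<kappa> g n) s)\<bar> \<le> 1 * (?C / (1 - rate))"
    unfolding abs_mult using relax_bounds S by (intro mult_mono) auto
  then show ?thesis unfolding ksol_def using b[of s] by linarith
qed

lemma ksol_bounded_supp:
  assumes g: "bounded_supp T g" shows "bounded_supp T (ksol relax \<kappa> g)"
proof -
  obtain b where "\<And>s. \<bar>g s\<bar> \<le> b" using g by (metis bounded_suppE)
  show ?thesis
  proof (rule bounded_suppI[OF _ ksol_bound[OF g \<open>\<And>s. \<bar>g s\<bar> \<le> b\<close>]])
    have [measurable]: "g \<in> borel_measurable borel" "\<And>n. kop \<kappa> (kresid relax \<kappa> g n) \<in> borel_measurable borel"
      using g kresid_bounded_supp kop_bounded_supp bounded_supp_measurable by blast+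
    show "ksol relax \<kappa> g \<in> borel_measurable borel" unfolding ksol_def[abs_def] by measurable
    show "ksol relax \<kappa> g s = 0" if "s \<notin> {0..T}" for s
      using bounded_supp_zero[OF g that] bounded_supp_zero[OF kop_bounded_supp[OF kresid_bounded_supp[OF g]] that]
      by (simp add: ksol_def)
  qed
qed

text \<open>The partial sums \<open>\<phi> N\<close> are the iterates and \<open>?r N\<close> are
  their residuals. The functions \<open>kop \<kappa> (\<phi> N)\<close> converge uniformly to
  \<open>k = g - ksol\<close>. Applying the kernel once more to the identity \<open>res\<close>
  shows that their limit is also \<open>kop \<kappa> (ksol ...)\<close>, and equality of the two
  limits is the equation.\<close>

theorem ksol_solves:
  assumes g: "bounded_supp T g"
  shows "ksol relax \<kappa> g s + kop \<kappa> (ksol relax \<kappa> g) s = g s"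
proof -
  let ?r = "kresid relax \<kappa> g" and ?C = "sqrt (c\<^sup>2 * T * (LBINT s. (g s)\<^sup>2))"
  define k where "k x = g x - ksol relax \<kappa> g x" for x
  define \<phi> where "\<phi> N x = (\<Sum>n<N. - relax * ?r n x)" for N x
  have \<phi>s: "bounded_supp T (\<phi> N)" for N
    unfolding \<phi>_def[abs_def] by (intro bounded_supp_sum bounded_supp_scale kresid_bounded_supp g)
  have ks: "bounded_supp T k" unfolding k_def[abs_def] by (intro bounded_supp_diff g ksol_bounded_supp)
  have op\<phi>: "kop \<kappa> (\<phi> N) x = (\<Sum>n<N. - relax * kop \<kappa> (?r n) x)" for N x
    unfolding \<phi>_def[abs_def]
    by (subst kop_sum) (auto simp only: kop_scale finite_lessThan intro!: bounded_supp_scale kresid_bounded_supp g)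
  have res: "?r N x = \<phi> N x + kop \<kappa> (\<phi> N) x - g x" for N x
    unfolding op\<phi> by (induction N) (auto simp: \<phi>_def algebra_simps)
  have sums: "(\<lambda>n. - relax * kop \<kappa> (?r n) x) sums k x" for x
    using sums_mult[OF summable_sums[OF kop_kresid_summable[OF g, of x]], of "- relax"]
    by (simp add: k_def ksol_def)
  have lim: "(\<lambda>N. kop \<kappa> (\<phi> N) x) \<longlonglongrightarrow> k x" for x
    using sums[of x] unfolding sums_def op\<phi> .
  have tail: "\<bar>kop \<kappa> (\<phi> N) x - k x\<bar> \<le> ?C * rate ^ N / (1 - rate)" for N x
  proof -
    have sm: "summable (\<lambda>n. - relax * kop \<kappa> (?r n) x)" using sums sums_summable by blast
    have sg: "summable (\<lambda>n. ?C * rate ^ N * rate ^ n)"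
      using rate_bounds by (intro summable_mult summable_geometric) auto
    have eq: "k x - kop \<kappa> (\<phi> N) x = (\<Sum>n. - relax * kop \<kappa> (?r (n + N)) x)"
      using suminf_minus_initial_segment[OF sm, of N] sums_unique[OF sums[of x]] by (simp add: op\<phi>)
    have "\<bar>\<Sum>n. - relax * kop \<kappa> (?r (n + N)) x\<bar> \<le> (\<Sum>n. ?C * rate ^ N * rate ^ n)"
      unfolding real_norm_def[symmetric]
    proof (rule norm_suminf_le[OF _ sg])
      fix n
      have "relax * \<bar>kop \<kappa> (?r (n + N)) x\<bar> \<le> 1 * (?C * rate ^ (n + N))"
        using relax_bounds by (intro mult_mono kop_kresid_bound g) auto
      then show "norm (- relax * kop \<kappa> (?r (n + N)) x) \<le> ?C * rate ^ N * rate ^ n"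
        using relax_bounds by (simp add: abs_mult power_add ac_simps)
    qed
    also have "\<dots> = ?C * rate ^ N / (1 - rate)"
      by (rule suminf_rate)
    finally show ?thesis unfolding eq[symmetric] abs_minus_commute[of "k x"] .
  qed
  have rate0: "(\<lambda>N. D * rate ^ N) \<longlonglongrightarrow> 0" for D
    using tendsto_mult_right_zero[OF LIMSEQ_realpow_zero[OF rate_bounds]] .
  have "(\<lambda>N. kop \<kappa> (?r N) s - kop \<kappa> (\<lambda>x. kop \<kappa> (\<phi> N) x - k x) s) \<longlonglongrightarrow> 0 - 0"
  proof (rule tendsto_diff)
    show "(\<lambda>N. kop \<kappa> (?r N) s) \<longlonglongrightarrow> 0"
      by (rule Lim_null_comparison[OF _ rate0[of ?C]]) (auto intro!: always_eventually kop_kresid_bound g)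
    show "(\<lambda>N. kop \<kappa> (\<lambda>x. kop \<kappa> (\<phi> N) x - k x) s) \<longlonglongrightarrow> 0"
    proof (rule Lim_null_comparison[OF _ rate0[of "c * ?C / (1 - rate) * T"]])
      have "\<bar>kop \<kappa> (\<lambda>x. kop \<kappa> (\<phi> N) x - k x) s\<bar> \<le> c * (?C * rate ^ N / (1 - rate)) * T" for N
        unfolding kop_def[of _ "\<lambda>x. kop \<kappa> (\<phi> N) x - k x"]
        by (rule integral_abs_le_bounded_supp[OF bounded_supp_mult2[OF section_bounded_supp bounded_supp_diff[OF kop_bounded_supp[OF \<phi>s] ks]] _ T_nonneg])
          (unfold abs_mult, intro mult_mono kernel_bound tail, auto simp: c_nonneg)
      then show "\<forall>\<^sub>F N in sequentially. norm (kop \<kappa> (\<lambda>x. kop \<kappa> (\<phi> N) x - k x) s) \<le> c * ?C / (1 - rate) * T * rate ^ N"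
        by (simp add: field_simps)
    qed
  qed
  moreover have "kop \<kappa> (?r N) s - kop \<kappa> (\<lambda>x. kop \<kappa> (\<phi> N) x - k x) s = kop \<kappa> (\<phi> N) s - kop \<kappa> (ksol relax \<kappa> g) s" for N
  proof -
    have "kop \<kappa> (?r N) s - kop \<kappa> (\<lambda>x. kop \<kappa> (\<phi> N) x - k x) s = kop \<kappa> (\<lambda>x. ?r N x - (kop \<kappa> (\<phi> N) x - k x)) s"
      by (rule kop_diff[symmetric]) (intro kresid_bounded_supp g bounded_supp_diff kop_bounded_supp \<phi>s ks)+
    also have "(\<lambda>x. ?r N x - (kop \<kappa> (\<phi> N) x - k x)) = (\<lambda>x. \<phi> N x - ksol relax \<kappa> g x)"
      by (auto simp: res k_def)
    also have "kop \<kappa> \<dots> s = kop \<kappa> (\<phi> N) s - kop \<kappa> (ksol relax \<kappa> g) s"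
      by (rule kop_diff) (intro \<phi>s ksol_bounded_supp g)+
    finally show ?thesis .
  qed
  ultimately have "(\<lambda>N. kop \<kappa> (\<phi> N) s) \<longlonglongrightarrow> kop \<kappa> (ksol relax \<kappa> g) s"
    by (simp add: LIM_zero_iff)
  with lim[of s] have "k s = kop \<kappa> (ksol relax \<kappa> g) s" by (rule LIMSEQ_unique)
  then show ?thesis by (simp add: k_def)
qed

end

section \<open>The kernel equation\<close>

lemma set_integral_power_fact:
  fixes a s :: real
  assumes "a \<le> s"
  shows "set_integrable lborel {a..s} (\<lambda>r. (r - a) ^ n / fact n)"
    and "(LBINT r:{a..s}. (r - a) ^ n / fact n) = (s - a) ^ Suc n / fact (Suc n)"
proof -
  have c: "continuous_on {a..s} (\<lambda>r. (r - a) ^ n / fact n)" by (intro continuous_intros) auto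
  then show "set_integrable lborel {a..s} (\<lambda>r. (r - a) ^ n / fact n)"
    by (rule borel_integrable_atLeastAtMost')
  have "(LBINT r:{a..s}. (r - a) ^ n / fact n) = (s - a) ^ Suc n / fact (Suc n) - (a - a) ^ Suc n / fact (Suc n)"
    unfolding set_lebesgue_integral_def
  proof (rule integral_FTC_atLeastAtMost[OF assms _ c])
    fix x
    have "((\<lambda>x. (x - a) ^ Suc n / fact (Suc n)) has_real_derivative (x - a) ^ n / fact n) (at x within {a..s})"
      by (auto intro!: derivative_eq_intros simp: field_simps simp del: of_nat_Suc power_Suc)
    then show "((\<lambda>x. (x - a) ^ Suc n / fact (Suc n)) has_vector_derivative (x - a) ^ n / fact n) (at x within {a..s})"
      by (simp add: has_real_derivative_iff_has_vector_derivative)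
  qed
  then show "(LBINT r:{a..s}. (r - a) ^ n / fact n) = (s - a) ^ Suc n / fact (Suc n)" by simp
qed

text \<open>Iterating the inequality \<open>n\<close> times bounds \<open>w t s\<close> by a term of
  an exponential series in \<open>s - a\<close>. That bound does not depend on the first argument,
  so it applies to \<open>w t r\<close> and \<open>w s r\<close> alike, whence the factor
  \<open>2 * c\<close>. The two-term form fits equations that are quadratic in the unknown kernel;
  for functions of one variable \<open>w\<close> is taken independent of its first argument.\<close>

lemma triangle_gronwall:
  fixes w :: "real \<Rightarrow> real \<Rightarrow> real"
  assumes c: "0 \<le> c"
    and nonneg: "\<And>t s. a \<le> s \<Longrightarrow> s \<le> t \<Longrightarrow> t \<le> b \<Longrightarrow> 0 \<le> w t s"
    and bound: "\<And>t s. a \<le> s \<Longrightarrow> s \<le> t \<Longrightarrow> t \<le> b \<Longrightarrow> w t s \<le> B"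
    and int: "\<And>t s. a \<le> s \<Longrightarrow> s \<le> t \<Longrightarrow> t \<le> b \<Longrightarrow> set_integrable lborel {a..s} (w t)"
    and ineq: "\<And>t s. a \<le> s \<Longrightarrow> s \<le> t \<Longrightarrow> t \<le> b \<Longrightarrow> w t s \<le> c * (LBINT r:{a..s}. w t r + w s r)"
    and st: "a \<le> s" "s \<le> t" "t \<le> b"
  shows "w t s = 0"
proof -
  have *: "w t s \<le> B * (2 * c) ^ n * ((s - a) ^ n / fact n)" if "a \<le> s" "s \<le> t" "t \<le> b" for n t s
    using that
  proof (induction n arbitrary: t s)
    case 0 then show ?case using bound by simp
  next
    case (Suc n)
    let ?g = "\<lambda>r. B * (2 * c) ^ n * ((r - a) ^ n / fact n)"
    have gi: "set_integrable lborel {a..s} (\<lambda>r. 2 * ?g r)"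
      using Suc.prems by (intro set_integrable_mult_right set_integral_power_fact) auto
    have "w t s \<le> c * (LBINT r:{a..s}. w t r + w s r)" using Suc.prems by (rule ineq)
    also have "\<dots> \<le> c * (LBINT r:{a..s}. 2 * ?g r)"
    proof (intro mult_left_mono c set_integral_mono gi set_integral_add)
      fix r assume "r \<in> {a..s}"
      then have "w t r \<le> ?g r" using Suc.prems by (intro Suc.IH) auto
      moreover have "w s r \<le> ?g r" using \<open>r \<in> {a..s}\<close> Suc.prems by (intro Suc.IH) auto
      ultimately show "w t r + w s r \<le> 2 * ?g r" by simp
    qed (use Suc.prems int[of s t] int[of s s] in auto)
    also have "(LBINT r:{a..s}. 2 * ?g r) = 2 * B * (2 * c) ^ n * ((s - a) ^ Suc n / fact (Suc n))"
      unfolding set_integral_mult_right set_integral_power_fact(2)[OF \<open>a \<le> s\<close>] by (simp only: mult.assoc)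
    finally show ?case by (simp add: ac_simps del: fact_Suc)
  qed
  have "(\<lambda>n. B * ((2 * c * (s - a)) ^ n / fact n)) \<longlonglongrightarrow> B * 0"
    using summable_LIMSEQ_zero[OF summable_exp[of "2 * c * (s - a)"]]
    by (intro tendsto_mult_left) (simp add: divide_inverse mult.commute)
  then have "w t s \<le> B * 0"
  proof (rule LIMSEQ_le_const)
    show "\<exists>N. \<forall>n\<ge>N. w t s \<le> B * ((2 * c * (s - a)) ^ n / fact n)"
      using *[OF st] by (auto simp: power_mult_distrib mult.assoc)
  qed
  with nonneg[OF st] show ?thesis by simp
qed

lemma Fubini_bounded_supp:
  fixes F :: "real \<Rightarrow> real \<Rightarrow> real"
  assumes meas: "(\<lambda>x. F (fst x) (snd x)) \<in> borel_measurable (borel \<Otimes>\<^sub>M borel)"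
    and bound: "\<And>x y. \<bar>F x y\<bar> \<le> b"
    and supp: "\<And>x y. x \<notin> {0..T} \<or> y \<notin> {0..T} \<Longrightarrow> F x y = 0"
  shows "(LBINT x. (LBINT y. F x y)) = (LBINT y. (LBINT x. F x y))"
proof -
  have "integrable (lborel \<Otimes>\<^sub>M lborel) (\<lambda>(x, y). F x y)"
  proof (rule Bochner_Integration.integrable_bound)
    have "emeasure (lborel \<Otimes>\<^sub>M lborel) ({0..T} \<times> {0..T}) < \<infinity>"
      by (subst lborel.emeasure_pair_measure_Times) (auto simp: emeasure_lborel_Icc_eq ennreal_mult_less_top)
    then show "integrable (lborel \<Otimes>\<^sub>M lborel) (\<lambda>x. b * indicator ({0..T} \<times> {0..T}) x :: real)"
      by (intro integrable_mult_right integrable_real_indicator) auto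
    show "(\<lambda>(x, y). F x y) \<in> borel_measurable (lborel \<Otimes>\<^sub>M lborel)"
      using meas by (simp add: case_prod_beta' cong: measurable_cong_sets sets_pair_measure_cong)
    show "AE x in lborel \<Otimes>\<^sub>M lborel. norm (case x of (x, y) \<Rightarrow> F x y) \<le> norm (b * indicator ({0..T} \<times> {0..T}) x)"
    proof (intro AE_I2, clarify)
      fix x y
      show "norm (F x y) \<le> norm (b * indicator ({0..T} \<times> {0..T}) (x, y))"
        using supp[of x y] bound[of x y] by (cases "x \<in> {0..T} \<and> y \<in> {0..T}") (auto split: split_indicator)
    qed
  qed
  from lborel_pair.Fubini_integral[OF this] show ?thesis by simp
qed

lemma Fubini_bounded_supp_mult:
  assumes k: "(\<lambda>x. k (fst x) (snd x)) \<in> borel_measurable (borel \<Otimes>\<^sub>M borel)" "\<And>x y. \<bar>k x y\<bar> \<le> b"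
    and w: "bounded_supp T w" and v: "bounded_supp T v"
  shows "(LBINT u. w u * (LBINT s. v s * k s u)) = (LBINT s. v s * (LBINT u. w u * k s u))"
proof -
  obtain bw bv where bw: "0 \<le> bw" "\<And>x. \<bar>w x\<bar> \<le> bw" and bv: "0 \<le> bv" "\<And>x. \<bar>v x\<bar> \<le> bv"
    using w v by (metis bounded_suppE)
  have "(LBINT s. (LBINT u. v s * (w u * k s u))) = (LBINT u. (LBINT s. v s * (w u * k s u)))"
  proof (rule Fubini_bounded_supp)
    have [measurable]: "w \<in> borel_measurable borel" "v \<in> borel_measurable borel" using w v by auto
    note k(1)[measurable]
    show "(\<lambda>x. v (fst x) * (w (snd x) * k (fst x) (snd x))) \<in> borel_measurable (borel \<Otimes>\<^sub>M borel)"
      by measurable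
    show "\<bar>v s * (w u * k s u)\<bar> \<le> bv * (bw * b)" for s u
      unfolding abs_mult by (intro mult_mono bw bv k(2) mult_nonneg_nonneg) auto
    show "v s * (w u * k s u) = 0" if "s \<notin> {0..T} \<or> u \<notin> {0..T}" for s u
      using that bounded_supp_zero[OF w] bounded_supp_zero[OF v] by auto
  qed
  then show ?thesis by (simp only: integral_mult_right_zero[symmetric] mult.left_commute)
qed

text \<open>\<open>a\<close> stands for \<open>G / D\<close> and \<open>K\<close> for the covariance
  of the signal. After division by \<open>D\<close> the noise has unit intensity, and the covariance
  operator of the observation is the identity plus the kernel
  \<open>a s * K s r * a r\<close>.\<close>

locale riccati_kernel =
  fixes T ca cK :: real and a :: "real \<Rightarrow> real" and K :: "real \<Rightarrow> real \<Rightarrow> real"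
  assumes T: "0 \<le> T"
    and a_meas: "a \<in> borel_measurable borel" and a_bound: "\<And>s. \<bar>a s\<bar> \<le> ca"
    and a_supp: "\<And>s. s \<notin> {0..T} \<Longrightarrow> a s = 0"
    and K_meas: "(\<lambda>x. K (fst x) (snd x)) \<in> borel_measurable (borel \<Otimes>\<^sub>M borel)"
    and K_bound: "\<And>t s. \<bar>K t s\<bar> \<le> cK" and K_sym: "\<And>t s. K t s = K s t"
    and K_psd: "\<And>f. bounded_supp T f \<Longrightarrow> 0 \<le> (LBINT s. f s * (LBINT r. K s r * f r))"
begin

lemma ca0: "0 \<le> ca" using a_bound[of 0] by simp
lemma cK0: "0 \<le> cK" using K_bound[of 0 0] by simp

lemma a_bs: "bounded_supp T a" by (rule bounded_suppI[OF a_meas a_bound a_supp])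

lemmas [measurable] = a_meas K_meas

lemma K_sec [measurable]: "K t \<in> borel_measurable borel"
  using measurable_Pair2[of "\<lambda>x. K (fst x) (snd x)" borel borel borel t] K_meas by simp

lemma bounded_supp_K: "bounded_supp T f \<Longrightarrow> bounded_supp T (\<lambda>s. f s * K t s)"
  by (rule bounded_supp_mult(2)[OF _ K_sec K_bound])

definition trunc_kernel :: "real \<Rightarrow> real \<Rightarrow> real \<Rightarrow> real" where
  "trunc_kernel t s r = indicator {0..t} s * indicator {0..t} r * (a s * K s r * a r)"

definition trunc_rhs :: "real \<Rightarrow> real \<Rightarrow> real" where
  "trunc_rhs t s = indicator {0..t} s * (a s * K t s)"

lemma bounded_supp_indicator: "bounded_supp T f \<Longrightarrow> A \<in> sets borel \<Longrightarrow> bounded_supp T (\<lambda>s. indicator A s * f s)"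
  by (intro bounded_supp_mult(1)[of T f _ 1]) (auto split: split_indicator)

text \<open>The truncated kernel is \<open>K\<close> multiplied on both sides by
  \<open>indicator {0..t}\<close> and \<open>a\<close>; its quadratic form at \<open>f\<close> is
  that of \<open>K\<close> at \<open>F\<close>. The truncation expresses that only the observation
  on \<open>{0..t}\<close> is available.\<close>

lemma trunc_psd: "psd_kernel T (ca * cK * ca) (trunc_kernel t)"
proof
  show "0 \<le> T" by (rule T)
  show "0 \<le> ca * cK * ca" using ca0 cK0 by simp
  show "(\<lambda>(s, r). trunc_kernel t s r) \<in> borel_measurable (borel \<Otimes>\<^sub>M borel)"
    unfolding trunc_kernel_def case_prod_beta' by measurable
  have *: "\<bar>a s * K s r * a r\<bar> \<le> ca * cK * ca" for s r
    unfolding abs_mult using ca0 cK0 by (intro mult_mono a_bound K_bound) auto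
  show "\<bar>trunc_kernel t s r\<bar> \<le> ca * cK * ca" for s r
    unfolding trunc_kernel_def using *[of s r] abs_ge_zero[of "a s * K s r * a r"]
    by (auto split: split_indicator)
  show "trunc_kernel t s r = 0" if "s \<notin> {0..T} \<or> r \<notin> {0..T}" for s r
    using that a_supp by (auto simp: trunc_kernel_def)
  show "0 \<le> (LBINT s. f s * kop (trunc_kernel t) f s)" if f: "bounded_supp T f" for f
  proof -
    define F where "F s = indicator {0..t} s * (a s * f s)" for s
    have F: "bounded_supp T F" unfolding F_def[abs_def]
      by (intro bounded_supp_indicator bounded_supp_mult2 a_bs f) auto
    have "kop (trunc_kernel t) f s = indicator {0..t} s * a s * (LBINT r. K s r * F r)" for s
      unfolding kop_def trunc_kernel_def F_def
      by (subst integral_mult_right_zero[symmetric]) (simp add: ac_simps)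
    then have "(LBINT s. f s * kop (trunc_kernel t) f s) = (LBINT s. F s * (LBINT r. K s r * F r))"
      by (simp add: F_def ac_simps)
    also have "0 \<le> \<dots>" by (rule K_psd[OF F])
    finally show ?thesis .
  qed
qed

text \<open>The bound \<open>ca * cK * ca\<close> is the same for all truncation times, so a single
  step size serves the whole family; joint measurability and uniform boundedness of
  \<open>phi\<close> rest on this.\<close>

abbreviation "rlx \<equiv> psd_kernel.relax T (ca * cK * ca)"

lemma trunc_rhs_bs: "bounded_supp T (trunc_rhs t)"
  unfolding trunc_rhs_def[abs_def] by (intro bounded_supp_indicator bounded_supp_K a_bs) auto

lemma trunc_rhs_bound: "\<bar>trunc_rhs t s\<bar> \<le> ca * cK"
proof -
  have "\<bar>a s * K t s\<bar> \<le> ca * cK" unfolding abs_mult using ca0 by (intro mult_mono a_bound K_bound) auto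
  then show ?thesis unfolding trunc_rhs_def using abs_ge_zero[of "a s * K t s"]
    by (auto split: split_indicator)
qed

text \<open>\<open>phi t r\<close> is \<open>D(r)\<close> times the weight of \<open>dY(r)\<close> in the optimal linear estimate of \<open>X(t)\<close>;
  \<open>phi_eq\<close> is the Wiener--Hopf equation.\<close>

definition phi :: "real \<Rightarrow> real \<Rightarrow> real" where
  "phi t = ksol rlx (trunc_kernel t) (trunc_rhs t)"

lemma phi_bs: "bounded_supp T (phi t)"
  unfolding phi_def by (rule psd_kernel.ksol_bounded_supp[OF trunc_psd trunc_rhs_bs])

lemma phi_measurable [measurable]: "(\<lambda>x. phi (fst x) (snd x)) \<in> borel_measurable (borel \<Otimes>\<^sub>M borel)"
  unfolding phi_def
proof (rule ksol_measurable)
  have [measurable]: "Measurable.pred (borel \<Otimes>\<^sub>M borel) (\<lambda>x::real \<times> real. snd x \<in> {0..fst x})"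
    by simp
  have 1: "indicator {0..t} s = (if 0 \<le> s \<and> s \<le> t then 1 else 0 :: real)" for s t :: real by auto
  show "(\<lambda>(t, s, r). trunc_kernel t s r) \<in> borel_measurable (borel \<Otimes>\<^sub>M borel \<Otimes>\<^sub>M borel)"
    unfolding trunc_kernel_def case_prod_beta' 1 by measurable
  show "(\<lambda>(t, s). trunc_rhs t s) \<in> borel_measurable (borel \<Otimes>\<^sub>M borel)"
    unfolding trunc_rhs_def case_prod_beta' 1 by measurable
qed

lemma phi_bounded: "\<exists>b\<ge>0. \<forall>t s. \<bar>phi t s\<bar> \<le> b"
proof -
  interpret psd_kernel T "ca * cK * ca" "trunc_kernel t" for t by (rule trunc_psd)
  let ?b = "ca * cK + sqrt ((ca * cK * ca)\<^sup>2 * T * ((ca * cK)\<^sup>2 * T)) / (1 - rate)"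
  have "\<bar>phi t s\<bar> \<le> ?b" for t s
  proof -
    have "\<bar>(LBINT s. (trunc_rhs t s)\<^sup>2)\<bar> \<le> (ca * cK)\<^sup>2 * T"
      using bounded_supp_mult2[OF trunc_rhs_bs[of t] trunc_rhs_bs[of t]] power_mono[OF trunc_rhs_bound abs_ge_zero, of t _ 2]
      by (intro integral_abs_le_bounded_supp T) (auto simp: power2_eq_square abs_mult)
    then have "sqrt ((ca * cK * ca)\<^sup>2 * T * (LBINT s. (trunc_rhs t s)\<^sup>2)) \<le> sqrt ((ca * cK * ca)\<^sup>2 * T * ((ca * cK)\<^sup>2 * T))"
      using T by (intro real_sqrt_le_mono mult_left_mono) auto
    then have "sqrt ((ca * cK * ca)\<^sup>2 * T * (LBINT s. (trunc_rhs t s)\<^sup>2)) / (1 - rate) \<le> sqrt ((ca * cK * ca)\<^sup>2 * T * ((ca * cK)\<^sup>2 * T)) / (1 - rate)"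
      using rate_bounds by (intro divide_right_mono) auto
    with ksol_bound[OF trunc_rhs_bs trunc_rhs_bound, of t t s] ksol_bound[OF trunc_rhs_bs trunc_rhs_bound, of s t t]
    show ?thesis unfolding phi_def by linarith
  qed
  moreover from this[of 0 0] have "0 \<le> ?b" by (rule order_trans[OF abs_ge_zero])
  ultimately show ?thesis by blast
qed

lemma phi_eq_aux: "phi t s = trunc_rhs t s - indicator {0..t} s * a s * (LBINT r. indicator {0..t} r * (K s r * (a r * phi t r)))"
proof -
  have "kop (trunc_kernel t) (phi t) s = indicator {0..t} s * a s * (LBINT r. indicator {0..t} r * (K s r * (a r * phi t r)))"
    unfolding kop_def trunc_kernel_def
    by (subst integral_mult_right_zero[symmetric]) (simp add: ac_simps)
  then show ?thesis
    using psd_kernel.ksol_solves[OF trunc_psd trunc_rhs_bs, of t t s] by (simp add: phi_def)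
qed

lemma phi_supp: "s \<notin> {0..t} \<Longrightarrow> phi t s = 0"
  by (subst phi_eq_aux) (simp add: trunc_rhs_def)

lemma phi_eq:
  assumes "s \<in> {0..t}"
  shows "phi t s + a s * (LBINT r. K s r * (a r * phi t r)) = a s * K t s"
proof -
  have "(LBINT r. indicator {0..t} r * (K s r * (a r * phi t r))) = (LBINT r. K s r * (a r * phi t r))"
    by (intro Bochner_Integration.integral_cong refl) (auto simp: phi_supp split: split_indicator)
  then show ?thesis using phi_eq_aux[of t s] assms by (simp add: trunc_rhs_def)
qed

text \<open>The covariance of the signal at \<open>t\<close> with the estimation error at
  \<open>s\<close>, written in terms of \<open>K\<close> and \<open>phi\<close> alone;
  \<open>err_Xc\<close> gives this reading. It is defined for all pairs, also for
  \<open>s > t\<close>, which \<open>phi_H\<close> exploits.\<close>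

definition H :: "real \<Rightarrow> real \<Rightarrow> real" where
  "H t s = K t s - (LBINT r. phi s r * (a r * K t r))"

lemma H_measurable [measurable]: "(\<lambda>x. H (fst x) (snd x)) \<in> borel_measurable (borel \<Otimes>\<^sub>M borel)"
proof -
  have "(\<lambda>x. (LBINT r. phi (snd x) r * (a r * K (fst x) r))) \<in> borel_measurable (borel \<Otimes>\<^sub>M borel)"
    by (rule lborel.borel_measurable_lebesgue_integral)
      (use measurable_compose[of "\<lambda>x. (snd (fst x), snd x)" "(borel \<Otimes>\<^sub>M borel) \<Otimes>\<^sub>M lborel" "borel \<Otimes>\<^sub>M borel", OF _ phi_measurable]
        measurable_compose[of "\<lambda>x. (fst (fst x), snd x)" "(borel \<Otimes>\<^sub>M borel) \<Otimes>\<^sub>M lborel" "borel \<Otimes>\<^sub>M borel", OF _ K_meas] in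
       \<open>auto simp: case_prod_beta' intro!: borel_measurable_times\<close>)
  then show ?thesis unfolding H_def by simp
qed

lemma H_sec [measurable]: "H t \<in> borel_measurable borel" "(\<lambda>t. H t s) \<in> borel_measurable borel"
  using measurable_Pair2[of "\<lambda>x. H (fst x) (snd x)" borel borel borel t]
    measurable_Pair1[of "\<lambda>x. H (fst x) (snd x)" borel borel borel s] H_measurable by simp_all

lemma phi_sec [measurable]: "phi t \<in> borel_measurable borel" "(\<lambda>t. phi t s) \<in> borel_measurable borel"
  using measurable_Pair2[of "\<lambda>x. phi (fst x) (snd x)" borel borel borel t]
    measurable_Pair1[of "\<lambda>x. phi (fst x) (snd x)" borel borel borel s] phi_measurable by simp_all

lemma H_bounded: "\<exists>b\<ge>0. \<forall>t s. \<bar>H t s\<bar> \<le> b"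
proof -
  obtain b where b: "0 \<le> b" "\<And>t s. \<bar>phi t s\<bar> \<le> b" using phi_bounded by blast
  have "\<bar>H t s\<bar> \<le> cK + b * (ca * cK) * T" for t s
  proof -
    have "\<bar>(LBINT r. phi s r * (a r * K t r))\<bar> \<le> (b * (ca * cK)) * T"
      by (intro integral_abs_le_bounded_supp T bounded_supp_mult2[OF phi_bs bounded_supp_K[OF a_bs]])
        (unfold abs_mult, intro mult_mono b a_bound K_bound, auto simp: ca0 b)
    then show ?thesis unfolding H_def using K_bound[of t s] by linarith
  qed
  then show ?thesis by (meson order_trans abs_ge_zero)
qed

text \<open>The integral in the Wiener-Hopf equation for \<open>phi s\<close> at \<open>r\<close> is
  \<open>K r s - H r s\<close>. Here the earlier time is the first argument of \<open>H\<close>,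
  whereas the kernel equation and the Volterra equation concern \<open>H\<close> with the later time
  first; relating the two is the content of \<open>chi_eq\<close>.\<close>

lemma phi_H: "phi s r = indicator {0..s} r * (a r * H r s)"
proof (cases "r \<in> {0..s}")
  case True
  have I: "(LBINT u. K r u * (a u * phi s u)) = K r s - H r s"
    unfolding H_def by (simp add: ac_simps)
  show ?thesis using phi_eq[OF True] True K_sym[of r s] unfolding I by (simp add: algebra_simps)
qed (simp add: phi_supp)

lemma bounded_supp_phi_integral:
  assumes v: "bounded_supp T v" shows "bounded_supp T (\<lambda>u. (LBINT s. v s * phi s u))"
proof -
  obtain b where b: "0 \<le> b" "\<And>t s. \<bar>phi t s\<bar> \<le> b" using phi_bounded by blast
  obtain bv where bv: "0 \<le> bv" "\<And>x. \<bar>v x\<bar> \<le> bv" using v by (metis bounded_suppE)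
  have [measurable]: "v \<in> borel_measurable borel" using v by auto
  show ?thesis
  proof (rule bounded_suppI)
    show "(\<lambda>u. (LBINT s. v s * phi s u)) \<in> borel_measurable borel"
    proof (rule lborel.borel_measurable_lebesgue_integral)
      show "(\<lambda>(u, s). v s * phi s u) \<in> borel_measurable (borel \<Otimes>\<^sub>M lborel)"
        using measurable_compose[of "\<lambda>x. (snd x, fst x)" "borel \<Otimes>\<^sub>M lborel" "borel \<Otimes>\<^sub>M borel", OF _ phi_measurable]
        by (auto simp: case_prod_beta' intro!: borel_measurable_times)
    qed
    show "\<bar>(LBINT s. v s * phi s u)\<bar> \<le> (bv * b) * T" for u
      by (intro integral_abs_le_bounded_supp T bounded_supp_mult(2)[OF v _ b(2)] phi_sec)
        (unfold abs_mult, intro mult_mono b bv, auto simp: b bv)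
    show "(LBINT s. v s * phi s u) = 0" if "u \<notin> {0..T}" for u
      using bounded_supp_zero[OF phi_bs that] by simp
  qed
qed

text \<open>After exchanging the integrals, the inner one is \<open>K t s - H t s\<close> by the
  definition of \<open>H\<close>.\<close>

lemma phi_K_swap:
  assumes v: "bounded_supp T v"
  shows "(LBINT u. a u * K t u * (LBINT s. v s * phi s u)) = (LBINT s. v s * K t s) - (LBINT s. v s * H t s)"
proof -
  obtain b where b: "0 \<le> b" "\<And>t s. \<bar>phi t s\<bar> \<le> b" using phi_bounded by blast
  obtain bH where bH: "\<And>t s. \<bar>H t s\<bar> \<le> bH" using H_bounded by blast
  have "(LBINT u. a u * K t u * (LBINT s. v s * phi s u)) = (LBINT s. v s * (LBINT u. a u * K t u * phi s u))"
    by (rule Fubini_bounded_supp_mult[OF phi_measurable b(2) bounded_supp_K[OF a_bs] v])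
  also have "\<dots> = (LBINT s. v s * K t s - v s * H t s)"
    unfolding H_def by (simp add: ac_simps right_diff_distrib)
  also have "\<dots> = (LBINT s. v s * K t s) - (LBINT s. v s * H t s)"
    by (intro Bochner_Integration.integral_diff bounded_supp_integrable[of T] bounded_supp_K v
        bounded_supp_mult(2)[OF v _ bH] H_sec)
  finally show ?thesis .
qed

text \<open>The kernel \<open>A\<close> of the statement, set to zero above the diagonal and outside
  the time interval, so that Volterra integrals become integrals over the line.\<close>

definition wgt :: "real \<Rightarrow> real \<Rightarrow> real" where "wgt t s = indicator {..t} s * ((a s)\<^sup>2 * H t s)"

lemma wgt_bs: "bounded_supp T (wgt t)"
proof -
  obtain bH where bH: "\<And>t s. \<bar>H t s\<bar> \<le> bH" using H_bounded by blast
  show ?thesis unfolding wgt_def[abs_def] power2_eq_square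
    by (intro bounded_supp_indicator bounded_supp_mult(2)[OF _ _ bH] bounded_supp_mult2 a_bs H_sec) auto
qed

lemma bounded_supp_H: "bounded_supp T f \<Longrightarrow> bounded_supp T (\<lambda>s. f s * H t s)"
  using H_bounded by (metis H_sec(1) bounded_supp_mult(2))

text \<open>\<open>chi\<close> is the defect in the Volterra equation for \<open>phi\<close>, \<open>delta\<close> the defect in the kernel
  equation for \<open>H\<close>. Each controls the other, which forces both to vanish.\<close>

definition chi :: "real \<Rightarrow> real \<Rightarrow> real" where
  "chi t r = phi t r - indicator {..t} r * (a r * H t r) + (LBINT s. wgt t s * phi s r)"

definition delta :: "real \<Rightarrow> real \<Rightarrow> real" where
  "delta t r = K t r - H t r - (LBINT s. wgt r s * H t s)"

lemma aH_bs: "bounded_supp T (\<lambda>r. indicator {..t} r * (a r * H t r))"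
  by (intro bounded_supp_indicator bounded_supp_H a_bs) auto

lemma chi_bs: "bounded_supp T (chi t)"
  unfolding chi_def[abs_def]
  by (intro bounded_supp_add bounded_supp_diff phi_bs aH_bs bounded_supp_phi_integral wgt_bs)

lemma aK_chi:
  "(LBINT u. a u * K t u * chi r u) = (LBINT u. a u * K t u * phi r u) - (LBINT s. wgt r s * H t s)"
proof -
  have aK: "bounded_supp T (\<lambda>u. a u * K t u)" by (intro bounded_supp_K a_bs)
  have "(LBINT u. a u * K t u * chi r u) = (LBINT u. a u * K t u * phi r u
      - a u * K t u * (indicator {..r} u * (a u * H r u)) + a u * K t u * (LBINT s. wgt r s * phi s u))"
    by (simp add: chi_def algebra_simps)
  also have "\<dots> = (LBINT u. a u * K t u * phi r u) - (LBINT u. a u * K t u * (indicator {..r} u * (a u * H r u)))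
      + (LBINT u. a u * K t u * (LBINT s. wgt r s * phi s u))"
    using bounded_supp_integrable[OF bounded_supp_mult2[OF aK phi_bs[of r]]]
      bounded_supp_integrable[OF bounded_supp_mult2[OF aK aH_bs[of r]]]
      bounded_supp_integrable[OF bounded_supp_mult2[OF aK bounded_supp_phi_integral[OF wgt_bs[of r]]]]
    by simp
  also have "(LBINT u. a u * K t u * (indicator {..r} u * (a u * H r u))) = (LBINT u. wgt r u * K t u)"
    by (simp add: wgt_def power2_eq_square ac_simps)
  finally show ?thesis unfolding phi_K_swap[OF wgt_bs] by simp
qed

text \<open>Testing the three parts of \<open>chi r\<close> against \<open>a * K t\<close>
  reproduces the three parts of \<open>delta t r\<close>; the contributions of \<open>wgt r\<close>
  against \<open>K t\<close> cancel.\<close>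

lemma delta_eq: "delta t r = (LBINT u. a u * K t u * chi r u)"
  unfolding aK_chi delta_def H_def[of t r] by (simp add: ac_simps)

text \<open>The defect \<open>chi t\<close> solves the Wiener-Hopf equation with right-hand side
  \<open>a * delta t\<close>. The integral of \<open>wgt t\<close> against \<open>H r\<close> is
  split at \<open>r\<close>: above \<open>r\<close> it is, up to the factor \<open>a r\<close>, the
  integral term of \<open>chi t r\<close> by \<open>phi_H\<close>, and below \<open>r\<close> it is
  the integral term of \<open>delta t r\<close>.\<close>

lemma chi_eq:
  assumes r: "r \<in> {0..t}"
  shows "chi t r + a r * (LBINT u. a u * K r u * chi t u) = a r * delta t r"
proof -
  have 1: "phi t r + a r * (LBINT u. a u * K r u * phi t u) = a r * K t r"
    using phi_eq[OF r] by (simp add: ac_simps)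
  have 2: "(LBINT s. wgt t s * phi s r) = a r * (LBINT s. indicator {r..} s * (wgt t s * H r s))"
  proof -
    have "(LBINT s. wgt t s * phi s r) = (LBINT s. a r * (indicator {r..} s * (wgt t s * H r s)))"
      using r by (intro Bochner_Integration.integral_cong) (auto simp: phi_H split: split_indicator)
    then show ?thesis by simp
  qed
  have wH: "bounded_supp T (\<lambda>s. wgt t s * H r s)" by (intro bounded_supp_H wgt_bs)
  have "(LBINT s. wgt t s * H r s)
      = (LBINT s. indicator {r..} s * (wgt t s * H r s) + indicator {..<r} s * (wgt t s * H r s))"
    by (intro Bochner_Integration.integral_cong) (auto split: split_indicator)
  also have "\<dots> = (LBINT s. indicator {r..} s * (wgt t s * H r s)) + (LBINT s. indicator {..<r} s * (wgt t s * H r s))"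
    using wH by (intro Bochner_Integration.integral_add bounded_supp_integrable[of T] bounded_supp_indicator) auto
  \<comment> \<open>For \<open>s < r\<close> the integrand is the square of \<open>a s\<close> times
    \<open>H t s * H r s\<close>, which is symmetric in \<open>t\<close> and \<open>r\<close>. The
    point \<open>s = r\<close> is negligible.\<close>
  also have "(LBINT s. indicator {..<r} s * (wgt t s * H r s)) = (LBINT s. wgt r s * H t s)"
  proof (rule integral_cong_AE)
    show "AE s in lborel. indicator {..<r} s * (wgt t s * H r s) = wgt r s * H t s"
      using AE_lborel_singleton[of r]
      by eventually_elim (use r in \<open>auto simp: wgt_def split: split_indicator\<close>)
    have [measurable]: "wgt t \<in> borel_measurable borel" for t using wgt_bs by auto
    show "(\<lambda>s. indicator {..<r} s * (wgt t s * H r s)) \<in> borel_measurable lborel"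
      "(\<lambda>s. wgt r s * H t s) \<in> borel_measurable lborel" by measurable
  qed
  finally have 3: "(LBINT s. wgt t s * H r s) = (LBINT s. indicator {r..} s * (wgt t s * H r s)) + (LBINT s. wgt r s * H t s)" .
  have "chi t r = phi t r - a r * H t r + a r * (LBINT s. indicator {r..} s * (wgt t s * H r s))"
    using r by (simp add: chi_def 2)
  with 1 show ?thesis unfolding aK_chi 3 delta_def by (simp add: algebra_simps)
qed

lemma chi_supp: "u \<notin> {0..r} \<Longrightarrow> chi r u = 0"
proof -
  assume u: "u \<notin> {0..r}"
  have "wgt r s * phi s u = 0" for s
    using u phi_supp[of u s] by (cases "u \<in> {0..s}") (auto simp: wgt_def)
  then have "(LBINT s. wgt r s * phi s u) = 0" by (simp only: Bochner_Integration.integral_zero)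
  moreover have "indicator {..r} u * (a u * H r u) = 0" using u a_supp[of u] by (cases "u < 0") auto
  ultimately show ?thesis using phi_supp[OF u] by (simp only: chi_def)
qed

lemma delta_sec [measurable]: "delta t \<in> borel_measurable borel"
proof -
  have "(\<lambda>r. (LBINT s. wgt r s * H t s)) \<in> borel_measurable borel"
  proof (rule lborel.borel_measurable_lebesgue_integral)
    have 1: "indicator {..t} s = (if s \<le> t then 1 else 0 :: real)" for s t :: real by auto
    show "(\<lambda>(r, s). wgt r s * H t s) \<in> borel_measurable (borel \<Otimes>\<^sub>M lborel)"
      unfolding wgt_def case_prod_beta' 1 by measurable
  qed
  then show ?thesis unfolding delta_def[abs_def] by measurable
qed

lemma delta_bounded: "\<exists>b\<ge>0. \<forall>t s. \<bar>delta t s\<bar> \<le> b"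
proof -
  obtain b where b: "0 \<le> b" "\<And>t s. \<bar>H t s\<bar> \<le> b" using H_bounded by blast
  have w: "\<bar>wgt r s\<bar> \<le> ca\<^sup>2 * b" for r s
  proof -
    have "\<bar>(a s)\<^sup>2 * H r s\<bar> \<le> ca\<^sup>2 * b"
      unfolding abs_mult power_abs using b by (intro mult_mono power_mono a_bound) (auto simp: a_bound)
    then show ?thesis unfolding wgt_def using b(1) by (auto split: split_indicator)
  qed
  have "\<bar>delta t s\<bar> \<le> cK + b + (ca\<^sup>2 * b) * b * T" for t s
  proof -
    have "\<bar>(LBINT u. wgt s u * H t u)\<bar> \<le> (ca\<^sup>2 * b * b) * T"
      by (intro integral_abs_le_bounded_supp T bounded_supp_H wgt_bs) (unfold abs_mult, intro mult_mono b w, auto simp: b)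
    then show ?thesis unfolding delta_def using K_bound[of t s] b(2)[of t s] by linarith
  qed
  then show ?thesis by (meson order_trans abs_ge_zero)
qed

text \<open>Testing \<open>chi_eq\<close> with \<open>chi r\<close> itself, positivity of
  \<open>K\<close> leaves the squared norm of \<open>chi r\<close> below its inner product with the
  right-hand side; Cauchy-Schwarz and cancellation of one norm follow.\<close>

lemma chi_norm_le: "(LBINT u. (chi r u)\<^sup>2) \<le> (LBINT u. (indicator {0..r} u * (a u * delta r u))\<^sup>2)"
proof -
  let ?N = "(LBINT u. (chi r u)\<^sup>2)" and ?g = "\<lambda>u. indicator {0..r} u * (a u * delta r u)"
  obtain b where b: "0 \<le> b" "\<And>t s. \<bar>delta t s\<bar> \<le> b" using delta_bounded by blast
  have g: "bounded_supp T ?g" by (intro bounded_supp_indicator bounded_supp_mult(2)[OF a_bs _ b(2)] delta_sec) auto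
  have ac: "bounded_supp T (\<lambda>u. a u * chi r u)" by (intro bounded_supp_mult2 a_bs chi_bs)
  obtain bc where bc: "\<And>x. \<bar>a x * chi r x\<bar> \<le> bc" using ac by (metis bounded_suppE)
  have op: "bounded_supp T (\<lambda>s. a s * (LBINT u. K s u * (a u * chi r u)))"
  proof (rule bounded_supp_mult(2)[OF a_bs])
    have [measurable]: "chi r \<in> borel_measurable borel" using chi_bs by auto
    show "(\<lambda>s. (LBINT u. K s u * (a u * chi r u))) \<in> borel_measurable borel"
      by (rule lborel.borel_measurable_lebesgue_integral) (simp add: case_prod_beta', measurable)
    show "\<bar>(LBINT u. K s u * (a u * chi r u))\<bar> \<le> (cK * bc) * T" for s
      by (intro integral_abs_le_bounded_supp T bounded_supp_mult(1)[OF ac K_sec K_bound])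
        (subst abs_mult, intro mult_mono K_bound bc, auto simp: cK0)
  qed
  have "?N + (LBINT s. a s * chi r s * (LBINT u. K s u * (a u * chi r u)))
     = (LBINT s. chi r s * chi r s + chi r s * (a s * (LBINT u. K s u * (a u * chi r u))))"
    using bounded_supp_integrable[OF bounded_supp_mult2[OF chi_bs[of r] chi_bs[of r]]] bounded_supp_integrable[OF bounded_supp_mult2[OF chi_bs[of r] op]]
    by (simp add: power2_eq_square ac_simps)
  also have "\<dots> = (LBINT s. chi r s * ?g s)"
  proof (intro Bochner_Integration.integral_cong refl)
    fix s
    show "chi r s * chi r s + chi r s * (a s * (LBINT u. K s u * (a u * chi r u))) = chi r s * ?g s"
    proof (cases "s \<in> {0..r}")
      case True
      then show ?thesis
        unfolding distrib_left[symmetric] using chi_eq[OF True] by (simp add: ac_simps)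
    qed (simp add: chi_supp)
  qed
  finally have N1: "?N \<le> (LBINT s. chi r s * ?g s)" using K_psd[OF ac] by simp
  have N2: "(LBINT s. chi r s * ?g s)\<^sup>2 \<le> ?N * (LBINT u. (?g u)\<^sup>2)"
    by (intro L2_Cauchy_Schwarz bounded_supp_L2[of T] chi_bs g)
  have N0: "0 \<le> ?N" by simp
  have "?N * ?N \<le> ?N * (LBINT u. (?g u)\<^sup>2)"
    using order_trans[OF power_mono[OF N1 N0, of 2] N2] unfolding power2_eq_square[of ?N] .
  then show ?thesis using N0 by (cases "?N = 0") (auto simp: mult_le_cancel_left)
qed

text \<open>By \<open>delta_eq\<close> and \<open>chi_norm_le\<close> the square of
  \<open>delta t r\<close> is at most a constant times the integral of the square of
  \<open>delta r u\<close> over \<open>u\<close> in \<open>{0..r}\<close>, and Gronwall applies. The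
  nonnegative term with \<open>delta t u\<close> is added to match the form of
  \<open>triangle_gronwall\<close>.\<close>

lemma delta_zero:
  assumes "0 \<le> s" "s \<le> t" "t \<le> T" shows "delta t s = 0"
proof -
  obtain b where b: "0 \<le> b" "\<And>t s. \<bar>delta t s\<bar> \<le> b" using delta_bounded by blast
  \<comment> \<open>The factor \<open>(ca * cK)\<^sup>2 * T\<close> bounds the squared norm of
    \<open>a * K t\<close>; \<open>ca\<^sup>2\<close> comes from the factor \<open>a\<close> in
    \<open>chi_norm_le\<close>.\<close>
  define c where "c = (ca * cK)\<^sup>2 * T * ca\<^sup>2"
  have di: "set_integrable lborel {0..r} (\<lambda>u. (delta t u)\<^sup>2)" if "r \<le> T" for t r
  proof -
    have "bounded_supp T (\<lambda>u. indicator {0..r} u * (delta t u)\<^sup>2)"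
    proof (rule bounded_suppI)
      show "\<bar>indicator {0..r} u * (delta t u)\<^sup>2\<bar> \<le> b\<^sup>2" for u
        using power_mono[OF b(2) abs_ge_zero, of t u 2] by (auto split: split_indicator)
    qed (use that in \<open>auto split: split_indicator\<close>)
    then show ?thesis unfolding set_integrable_def by (simp add: bounded_supp_integrable)
  qed
  have ineq: "(delta t r)\<^sup>2 \<le> c * (LBINT u:{0..r}. (delta t u)\<^sup>2 + (delta r u)\<^sup>2)" if "r \<le> T" for t r
  proof -
    have "(delta t r)\<^sup>2 \<le> (LBINT u. (a u * K t u)\<^sup>2) * (LBINT u. (chi r u)\<^sup>2)"
      unfolding delta_eq by (intro L2_Cauchy_Schwarz bounded_supp_L2[of T] chi_bs bounded_supp_K a_bs)
    also have "\<dots> \<le> ((ca * cK)\<^sup>2 * T) * (ca\<^sup>2 * (LBINT u:{0..r}. (delta r u)\<^sup>2))"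
    proof (rule mult_mono)
      have aKb: "\<bar>a u * K t u\<bar> \<le> ca * cK" for u unfolding abs_mult by (intro mult_mono a_bound K_bound) (auto simp: ca0)
      have "\<bar>(LBINT u. (a u * K t u)\<^sup>2)\<bar> \<le> (ca * cK)\<^sup>2 * T"
        using bounded_supp_mult2[OF bounded_supp_K[OF a_bs, of t] bounded_supp_K[OF a_bs, of t]] power_mono[OF aKb abs_ge_zero, of _ 2]
        by (intro integral_abs_le_bounded_supp T) (auto simp: power2_eq_square abs_mult)
      then show "(LBINT u. (a u * K t u)\<^sup>2) \<le> (ca * cK)\<^sup>2 * T" by simp
      have "(LBINT u. (indicator {0..r} u * (a u * delta r u))\<^sup>2) \<le> (LBINT u:{0..r}. ca\<^sup>2 * (delta r u)\<^sup>2)"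
        unfolding set_lebesgue_integral_def
      proof (intro integral_mono)
        have "bounded_supp T (\<lambda>u. indicator {0..r} u * (a u * delta r u))"
          by (intro bounded_supp_indicator bounded_supp_mult(2)[OF a_bs _ b(2)] delta_sec) auto
        then show "integrable lborel (\<lambda>u. (indicator {0..r} u * (a u * delta r u))\<^sup>2)"
          using bounded_supp_L2 L2_integrable_sq by blast
        have "set_integrable lborel {0..r} (\<lambda>u. ca\<^sup>2 * (delta r u)\<^sup>2)"
          by (intro set_integrable_mult_right di that)
        then show "integrable lborel (\<lambda>u. indicat_real {0..r} u *\<^sub>R (ca\<^sup>2 * (delta r u)\<^sup>2))"
          unfolding set_integrable_def .
        show "(indicator {0..r} u * (a u * delta r u))\<^sup>2 \<le> indicat_real {0..r} u *\<^sub>R (ca\<^sup>2 * (delta r u)\<^sup>2)" for u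
          using power_mono[OF a_bound abs_ge_zero, of u 2]
          by (auto split: split_indicator simp: power_mult_distrib intro!: mult_right_mono)
      qed
      then show "(LBINT u. (chi r u)\<^sup>2) \<le> ca\<^sup>2 * (LBINT u:{0..r}. (delta r u)\<^sup>2)"
        using chi_norm_le[of r] by simp
    qed (use T in auto)
    also have "\<dots> \<le> c * (LBINT u:{0..r}. (delta t u)\<^sup>2 + (delta r u)\<^sup>2)"
      unfolding c_def mult.assoc[symmetric] using T di[OF that]
      by (intro mult_left_mono set_integral_mono set_integral_add) auto
    finally show ?thesis .
  qed
  have "(delta t s)\<^sup>2 = 0"
  proof (rule triangle_gronwall[where w="\<lambda>t s. (delta t s)\<^sup>2" and a=0 and b=T and B="b\<^sup>2" and c=c])
    show "0 \<le> c" using T by (simp add: c_def)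
    show "(delta t s)\<^sup>2 \<le> b\<^sup>2" for t s using power_mono[OF b(2) abs_ge_zero, of t s 2] by simp
  qed (use assms ineq di in auto)
  then show ?thesis by simp
qed

theorem H_kernel_eq:
  assumes "0 \<le> s" "s \<le> t" "t \<le> T"
  shows "H t s = K t s - (LBINT r. indicator {..s} r * ((a r)\<^sup>2 * H t r * H s r))"
  using delta_zero[OF assms] by (simp add: delta_def wgt_def ac_simps)

text \<open>With \<open>delta = 0\<close> the norm of \<open>chi t\<close> vanishes, which gives
  \<open>chi t = 0\<close> almost everywhere only. Inserted into the integral of
  \<open>chi_eq\<close>, this yields the equation at every \<open>r\<close>.\<close>

theorem phi_volterra:
  assumes "0 \<le> r" "r \<le> t" "t \<le> T"
  shows "phi t r = a r * H t r - (LBINT s. wgt t s * phi s r)"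
proof -
  have "(LBINT u. (chi t u)\<^sup>2) \<le> (LBINT u. (indicator {0..t} u * (a u * delta t u))\<^sup>2)"
    by (rule chi_norm_le)
  also have "\<dots> = (\<integral>u. 0 \<partial>(lborel :: real measure))"
    using delta_zero assms by (intro Bochner_Integration.integral_cong) (auto split: split_indicator)
  finally have "(LBINT u. (chi t u)\<^sup>2) = 0" by (simp add: order.antisym)
  then have chi0: "AE u in lborel. chi t u = 0"
    by (intro integral_sq_zero_AE bounded_supp_L2[of T] chi_bs)
  have "(LBINT u. a u * K r u * chi t u) = 0"
    by (rule integral_eq_zero_AE) (use chi0 in \<open>auto elim: eventually_mono\<close>)
  then have "chi t r = 0" using chi_eq[of r t] delta_zero assms by simp
  then show ?thesis using assms by (simp add: chi_def)
qed

end

section \<open>Volterra resolvents\<close>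

lemma set_integrable_bounded:
  fixes f :: "real \<Rightarrow> real"
  assumes "f \<in> borel_measurable borel" "\<And>x. x \<in> {a..b} \<Longrightarrow> \<bar>f x\<bar> \<le> B"
  shows "set_integrable lborel {a..b} f"
  unfolding set_integrable_def
proof (rule Bochner_Integration.integrable_bound)
  show "integrable lborel (\<lambda>x. \<bar>B\<bar> * indicator {a..b} x :: real)"
    by (intro integrable_mult_right integrable_real_indicator) (auto simp: emeasure_lborel_Icc_eq)
  show "AE x in lborel. norm (indicat_real {a..b} x *\<^sub>R f x) \<le> norm (\<bar>B\<bar> * indicator {a..b} x :: real)"
    using assms(2) by (intro AE_I2) (auto split: split_indicator intro: order_trans abs_ge_self)
qed (use assms(1) in measurable)

lemma set_integral_abs_le:
  fixes f :: "real \<Rightarrow> real"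
  shows "\<bar>LBINT x:A. f x\<bar> \<le> (LBINT x:A. \<bar>f x\<bar>)"
proof -
  have "\<bar>LBINT x:A. f x\<bar> \<le> (LBINT x. \<bar>indicator A x *\<^sub>R f x\<bar>)"
    unfolding set_lebesgue_integral_def by (rule integral_abs_bound)
  then show ?thesis by (simp add: set_lebesgue_integral_def abs_mult)
qed

lemma set_integral_abs_le_const:
  fixes f :: "real \<Rightarrow> real"
  assumes "\<And>x. x \<in> {a..b} \<Longrightarrow> \<bar>f x\<bar> \<le> B" "a \<le> b" "0 \<le> B"
  shows "\<bar>LBINT x:{a..b}. f x\<bar> \<le> B * (b - a)"
proof (cases "set_integrable lborel {a..b} f")
  case True
  have "\<bar>LBINT x:{a..b}. f x\<bar> \<le> (LBINT x:{a..b}. \<bar>f x\<bar>)" by (rule set_integral_abs_le)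
  also have "\<dots> \<le> (LBINT x:{a..b}. B)"
    using assms by (intro set_integral_mono set_integrable_abs True set_integrable_bounded[where B=B]) auto
  also have "\<dots> = B * (b - a)" using assms by (simp add: set_lebesgue_integral_def)
  finally show ?thesis .
next
  \<comment> \<open>A function that is not integrable has integral \<open>0\<close> by convention,
    so the bound holds in this case as well.\<close>
  case False
  then have "(LBINT x:{a..b}. f x) = 0"
    unfolding set_lebesgue_integral_def set_integrable_def by (rule not_integrable_integral_eq)
  then show ?thesis using assms by simp
qed

text \<open>The inequality holds only almost everywhere and \<open>u\<close> need not be bounded. It
  is therefore integrated: the primitive \<open>v\<close> is monotone, bounded by
  \<open>v T\<close>, and satisfies a Gronwall inequality at every time.\<close>

lemma gronwall_AE:
  fixes u :: "real \<Rightarrow> real"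
  assumes c: "0 \<le> c" and T: "0 \<le> T"
    and int: "set_integrable lborel {0..T} u"
    and nonneg: "\<And>t. t \<in> {0..T} \<Longrightarrow> 0 \<le> u t"
    and ineq: "AE t in lborel. t \<in> {0..T} \<longrightarrow> u t \<le> c * (LBINT s:{0..t}. u s)"
  shows "(LBINT s:{0..T}. u s) = 0" and "AE t in lborel. t \<in> {0..T} \<longrightarrow> u t = 0"
proof -
  define v where "v t = (LBINT s:{0..t}. u s)" for t
  have int': "set_integrable lborel {0..t} u" if "t \<le> T" for t
    by (rule set_integrable_subset[OF int]) (use that in auto)
  have v_mono: "v s \<le> v t" if "s \<le> t" "t \<le> T" for s t
    unfolding v_def set_lebesgue_integral_def
  proof (rule integral_mono)
    show "integrable lborel (\<lambda>x. indicator {0..s} x *\<^sub>R u x)" "integrable lborel (\<lambda>x. indicator {0..t} x *\<^sub>R u x)"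
      using int'[of s] int'[of t] that by (auto simp: set_integrable_def)
    show "indicat_real {0..s} x *\<^sub>R u x \<le> indicat_real {0..t} x *\<^sub>R u x" for x
      using nonneg[of x] that by (auto split: split_indicator)
  qed
  have v0: "0 \<le> v t" if "t \<le> T" for t
    unfolding v_def set_lebesgue_integral_def
    using nonneg that by (intro Bochner_Integration.integral_nonneg) (auto split: split_indicator)
  define u' where "u' s = indicator {0..T} s * u s" for s
  have [measurable]: "u' \<in> borel_measurable borel"
    using int unfolding set_integrable_def u'_def[abs_def] by (simp add: integrable_iff_bounded)
  have vu': "v t = (LBINT s. (if 0 \<le> s \<and> s \<le> t then 1 else 0) * u' s)" if "t \<le> T" for t
    unfolding v_def u'_def set_lebesgue_integral_def using that
    by (intro Bochner_Integration.integral_cong) (auto split: split_indicator)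
  have v_meas: "(\<lambda>t. if t \<le> T then v t else 0) \<in> borel_measurable borel"
  proof -
    have "(\<lambda>t. (LBINT s. (if 0 \<le> s \<and> s \<le> t then 1 else 0) * u' s)) \<in> borel_measurable borel"
      by (rule lborel.borel_measurable_lebesgue_integral) (simp add: case_prod_beta')
    then have "(\<lambda>t. if t \<le> T then (LBINT s. (if 0 \<le> s \<and> s \<le> t then 1 else 0) * u' s) else 0) \<in> borel_measurable borel"
      by measurable
    then show ?thesis by (simp add: vu' cong: if_cong)
  qed
  have v_int: "set_integrable lborel {0..t} v" if "t \<le> T" for t
  proof -
    have "set_integrable lborel {0..t} (\<lambda>t. if t \<le> T then v t else 0)"
      by (rule set_integrable_bounded[OF v_meas, of _ _ "v T"]) (use that v0 v_mono in auto)
    then show ?thesis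
      by (rule set_integrable_cong[THEN iffD1, rotated -1]) (use that in auto)
  qed
  have vT: "v T = 0"
  proof (rule triangle_gronwall[where w="\<lambda>_. v" and a=0 and b=T and c=c and B="v T" and s=T and t=T])
    show "v s \<le> c * (LBINT r:{0..s}. v r + v r)" if "0 \<le> s" "s \<le> t" "t \<le> T" for s t
    proof -
      have "v s \<le> (LBINT r:{0..s}. c * v r)"
        unfolding v_def[of s] set_lebesgue_integral_def
      proof (rule integral_mono_AE)
        show "integrable lborel (\<lambda>x. indicator {0..s} x *\<^sub>R u x)" "integrable lborel (\<lambda>x. indicator {0..s} x *\<^sub>R (c * v x))"
          using int'[of s] set_integrable_mult_right[OF v_int[of s], of c] that by (auto simp: set_integrable_def)
        show "AE x in lborel. indicat_real {0..s} x *\<^sub>R u x \<le> indicat_real {0..s} x *\<^sub>R (c * v x)"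
          using ineq by eventually_elim (use that in \<open>auto simp: v_def split: split_indicator\<close>)
      qed
      also have "\<dots> \<le> c * (LBINT r:{0..s}. v r + v r)"
        unfolding set_integral_mult_right
        using that v0 by (intro mult_left_mono c set_integral_mono set_integral_add v_int) auto
      finally show ?thesis .
    qed
  qed (use T v0 v_mono v_int c in auto)
  then show "(LBINT s:{0..T}. u s) = 0" by (simp add: v_def)
  then have "AE x in lborel. indicat_real {0..T} x *\<^sub>R u x = 0"
    using int nonneg unfolding set_lebesgue_integral_def set_integrable_def
    by (subst (asm) integral_nonneg_eq_0_iff_AE) (auto split: split_indicator)
  then show "AE t in lborel. t \<in> {0..T} \<longrightarrow> u t = 0"
    by eventually_elim (auto split: split_indicator_asm)
qed

text \<open>For \<open>s \<le> t\<close> the iterated integrals evaluate the kernel only at ordered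
  pairs between \<open>s\<close> and \<open>t\<close>. Hence a kernel known on the triangle may be
  replaced by an extension that is bounded and measurable on the plane.\<close>

lemma resolvent_iter_cong:
  assumes "\<And>t s. a \<le> s \<Longrightarrow> s \<le> t \<Longrightarrow> t \<le> b \<Longrightarrow> A t s = A' t s" "a \<le> s" "s \<le> t" "t \<le> b"
  shows "resolvent_iter A n t s = resolvent_iter A' n t s"
  using assms(2-4)
proof (induction n arbitrary: t s)
  case (Suc n)
  have "(LBINT r:{s..t}. A t r * resolvent_iter A n r s) = (LBINT r:{s..t}. A' t r * resolvent_iter A' n r s)"
    by (intro set_lebesgue_integral_cong) (use Suc assms(1) in auto)
  then show ?case by simp
qed (use assms(1) in auto)

lemma resolvent_cong:
  assumes "\<And>t s. a \<le> s \<Longrightarrow> s \<le> t \<Longrightarrow> t \<le> b \<Longrightarrow> A t s = A' t s" "a \<le> s" "s \<le> t" "t \<le> b"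
  shows "resolvent A t s = resolvent A' t s"
  unfolding resolvent_def using resolvent_iter_cong[OF assms] by simp

section \<open>Iterated kernels, their sum and the solution formula\<close>

locale volterra_kernel =
  fixes T c :: real and A :: "real \<Rightarrow> real \<Rightarrow> real"
  assumes A_meas [measurable]: "(\<lambda>x. A (fst x) (snd x)) \<in> borel_measurable (borel \<Otimes>\<^sub>M borel)"
    and A_bound: "\<And>t s. \<bar>A t s\<bar> \<le> c"
begin

lemma c0: "0 \<le> c" using A_bound[of 0 0] by simp

lemma Icc_if: "indicator {s..t} r = (if s \<le> r \<and> r \<le> t then 1 else 0 :: real)" for s t r :: real
  by auto

lemma iter_measurable [measurable]:
  "(\<lambda>x. resolvent_iter A n (fst x) (snd x)) \<in> borel_measurable (borel \<Otimes>\<^sub>M borel)"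
proof (induction n)
  case (Suc n)
  have "(\<lambda>x. (LBINT r. indicator {snd x..fst x} r *\<^sub>R (A (fst x) r * resolvent_iter A n r (snd x)))) \<in> borel_measurable (borel \<Otimes>\<^sub>M borel)"
  proof (rule lborel.borel_measurable_lebesgue_integral)
    have [measurable]: "(\<lambda>x. resolvent_iter A n (snd x) (snd (fst x))) \<in> borel_measurable ((borel \<Otimes>\<^sub>M borel) \<Otimes>\<^sub>M lborel)"
      "(\<lambda>x. A (fst (fst x)) (snd x)) \<in> borel_measurable ((borel \<Otimes>\<^sub>M borel) \<Otimes>\<^sub>M lborel)"
      using measurable_compose[of "\<lambda>x. (snd x, snd (fst x))" "(borel \<Otimes>\<^sub>M borel) \<Otimes>\<^sub>M lborel" "borel \<Otimes>\<^sub>M borel", OF _ Suc]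
        measurable_compose[of "\<lambda>x. (fst (fst x), snd x)" "(borel \<Otimes>\<^sub>M borel) \<Otimes>\<^sub>M lborel" "borel \<Otimes>\<^sub>M borel", OF _ A_meas]
      by simp_all
    show "(\<lambda>(x, r). indicat_real {snd x..fst x} r *\<^sub>R (A (fst x) r * resolvent_iter A n r (snd x)))
        \<in> borel_measurable ((borel \<Otimes>\<^sub>M borel) \<Otimes>\<^sub>M lborel)"
      unfolding case_prod_beta' Icc_if by measurable
  qed
  then show ?case by (simp add: set_lebesgue_integral_def)
qed simp

lemma A_sec [measurable]: "A t \<in> borel_measurable borel" "(\<lambda>t. A t s) \<in> borel_measurable borel"
  using measurable_Pair2[OF A_meas, of t] measurable_Pair1[OF A_meas, of s] by simp_all

lemma iter_sec [measurable]: "resolvent_iter A n t \<in> borel_measurable borel"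
    "(\<lambda>t. resolvent_iter A n t s) \<in> borel_measurable borel"
  using measurable_Pair2[OF iter_measurable, of t] measurable_Pair1[OF iter_measurable, of s] by simp_all

text \<open>Index \<open>n\<close> stands for the kernel with \<open>n + 1\<close> factors of
  \<open>A\<close> but \<open>n\<close> integrations; hence one power of \<open>c\<close> more than
  of \<open>t - s\<close>, and the factorial of \<open>n\<close>.\<close>

lemma iter_bound:
  assumes "s \<le> t" shows "\<bar>resolvent_iter A n t s\<bar> \<le> c * (c ^ n * ((t - s) ^ n / fact n))"
  using assms
proof (induction n arbitrary: t)
  case 0 then show ?case using A_bound by simp
next
  case (Suc n)
  have "\<bar>resolvent_iter A (Suc n) t s\<bar> \<le> (LBINT r:{s..t}. \<bar>A t r * resolvent_iter A n r s\<bar>)"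
    using set_integral_abs_le by simp
  also have "\<dots> \<le> (LBINT r:{s..t}. c * (c * c ^ n) * ((r - s) ^ n / fact n))"
  proof (rule set_integral_mono)
    have b: "\<bar>A t r * resolvent_iter A n r s\<bar> \<le> c * (c * c ^ n) * ((r - s) ^ n / fact n)" if "r \<in> {s..t}" for r
    proof -
      have "\<bar>A t r * resolvent_iter A n r s\<bar> \<le> c * (c * (c ^ n * ((r - s) ^ n / fact n)))"
        unfolding abs_mult by (intro mult_mono A_bound Suc.IH) (use that c0 in auto)
      then show ?thesis by (simp add: mult.assoc)
    qed
    then show "\<And>r. r \<in> {s..t} \<Longrightarrow> \<bar>A t r * resolvent_iter A n r s\<bar> \<le> c * (c * c ^ n) * ((r - s) ^ n / fact n)" .
    have "\<bar>A t r * resolvent_iter A n r s\<bar> \<le> c * (c * c ^ n) * ((t - s) ^ n / fact n)" if "r \<in> {s..t}" for r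
    proof (rule order_trans[OF b[OF that]], rule mult_left_mono)
      show "(r - s) ^ n / fact n \<le> (t - s) ^ n / fact n"
        using that by (intro divide_right_mono power_mono) auto
    qed (use c0 in auto)
    then show "set_integrable lborel {s..t} (\<lambda>r. \<bar>A t r * resolvent_iter A n r s\<bar>)"
      by (intro set_integrable_bounded) auto
    show "set_integrable lborel {s..t} (\<lambda>r. c * (c * c ^ n) * ((r - s) ^ n / fact n))"
      using Suc.prems by (intro set_integrable_mult_right set_integral_power_fact)
  qed
  also have "\<dots> = c * (c ^ Suc n * ((t - s) ^ Suc n / fact (Suc n)))"
    unfolding set_integral_mult_right set_integral_power_fact(2)[OF Suc.prems] by (simp only: power_Suc mult.assoc)
  finally show ?case .
qed

definition qbound :: "real \<Rightarrow> nat \<Rightarrow> real" where "qbound R n = c * (c ^ n * (R ^ n / fact n))"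

lemma qbound_summable: "summable (qbound R)"
  using summable_mult[OF summable_exp[of "c * R"], of c]
  by (simp add: qbound_def[abs_def] power_mult_distrib divide_inverse ac_simps)

lemma qbound_nonneg: "0 \<le> R \<Longrightarrow> 0 \<le> qbound R n"
  using c0 by (simp add: qbound_def)

lemma iter_qbound: "s \<le> t \<Longrightarrow> t - s \<le> R \<Longrightarrow> \<bar>resolvent_iter A n t s\<bar> \<le> qbound R n"
  unfolding qbound_def using c0
  by (intro order_trans[OF iter_bound] mult_left_mono divide_right_mono power_mono) auto

lemma iter_summable: "s \<le> t \<Longrightarrow> summable (\<lambda>n. resolvent_iter A n t s)"
  by (rule summable_comparison_test'[OF qbound_summable[of "t - s"], of 0]) (auto intro: iter_qbound)

lemma resolvent_measurable [measurable]:
  "(\<lambda>x. resolvent A (fst x) (snd x)) \<in> borel_measurable (borel \<Otimes>\<^sub>M borel)"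
  unfolding resolvent_def by measurable

lemma resolvent_sec [measurable]: "resolvent A t \<in> borel_measurable borel"
    "(\<lambda>t. resolvent A t s) \<in> borel_measurable borel"
  using measurable_Pair2[OF resolvent_measurable, of t] measurable_Pair1[OF resolvent_measurable, of s] by simp_all

definition qmax :: "real \<Rightarrow> real" where "qmax R = (\<Sum>n. qbound R n)"

lemma resolvent_bound: "s \<le> t \<Longrightarrow> t - s \<le> R \<Longrightarrow> \<bar>resolvent A t s\<bar> \<le> qmax R"
  unfolding resolvent_def qmax_def real_norm_def[symmetric]
  by (intro norm_suminf_le qbound_summable) (auto intro: iter_qbound)

lemma qmax_nonneg: "0 \<le> R \<Longrightarrow> 0 \<le> qmax R"
  unfolding qmax_def by (intro suminf_nonneg qbound_summable qbound_nonneg)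

lemma iter_integrable: "set_integrable lborel {s..t} (\<lambda>r. A t r * resolvent_iter A n r s)"
proof (rule set_integrable_bounded)
  show "\<bar>A t r * resolvent_iter A n r s\<bar> \<le> c * qbound (t - s) n" if "r \<in> {s..t}" for r
    unfolding abs_mult using that c0 by (intro mult_mono A_bound iter_qbound) auto
qed measurable

text \<open>The exponential majorant \<open>qbound\<close> allows the sum to be taken out of the
  integral. The recursion then shifts the series by one, so that its first term
  \<open>- A t s\<close> is left over.\<close>

lemma resolvent_eq:
  assumes "s \<le> t"
  shows "resolvent A t s = - A t s - (LBINT r:{s..t}. A t r * resolvent A r s)"
proof -
  have Ab: "\<bar>A t r * resolvent_iter A n r s\<bar> \<le> c * qbound (t - s) n" if "r \<in> {s..t}" for r n
    unfolding abs_mult using that c0 by (intro mult_mono A_bound iter_qbound) auto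
  have qb: "0 \<le> qbound (t - s) n" for n using assms by (intro qbound_nonneg) simp
  have "(LBINT r:{s..t}. A t r * resolvent A r s)
     = (LBINT r. (\<Sum>n. indicator {s..t} r *\<^sub>R (A t r * resolvent_iter A n r s)))"
    unfolding set_lebesgue_integral_def resolvent_def
    by (intro Bochner_Integration.integral_cong refl) (auto split: split_indicator intro!: suminf_mult[symmetric] iter_summable)
  also have "\<dots> = (\<Sum>n. LBINT r:{s..t}. A t r * resolvent_iter A n r s)"
    unfolding set_lebesgue_integral_def
  proof (rule integral_suminf)
    show "integrable lborel (\<lambda>r. indicat_real {s..t} r *\<^sub>R (A t r * resolvent_iter A n r s))" for n
      using iter_integrable[of s t n] by (simp add: set_integrable_def)
    show "AE r in lborel. summable (\<lambda>n. norm (indicat_real {s..t} r *\<^sub>R (A t r * resolvent_iter A n r s)))"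
    proof (intro AE_I2 summable_comparison_test'[OF summable_mult[OF qbound_summable[of "t - s"], of c], of 0])
      fix r n
      show "norm (norm (indicat_real {s..t} r *\<^sub>R (A t r * resolvent_iter A n r s))) \<le> c * qbound (t - s) n"
        using Ab[of r n] qb[of n] c0 by (auto split: split_indicator)
    qed
    show "summable (\<lambda>n. (LBINT r. norm (indicat_real {s..t} r *\<^sub>R (A t r * resolvent_iter A n r s))))"
    proof (rule summable_comparison_test'[OF summable_mult[OF qbound_summable[of "t - s"], of "c * (t - s)"], of 0])
      fix n
      have "\<bar>LBINT r:{s..t}. \<bar>A t r * resolvent_iter A n r s\<bar>\<bar> \<le> (c * qbound (t - s) n) * (t - s)"
        using assms Ab qb c0 by (intro set_integral_abs_le_const) auto
      then show "norm (LBINT r. norm (indicat_real {s..t} r *\<^sub>R (A t r * resolvent_iter A n r s))) \<le> c * (t - s) * qbound (t - s) n"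
        by (simp add: set_lebesgue_integral_def abs_mult ac_simps)
    qed
  qed
  also have "\<dots> = - (\<Sum>n. resolvent_iter A (Suc n) t s)"
  proof -
    have "summable (\<lambda>n. resolvent_iter A (Suc n) t s)"
      using summable_Suc_iff[of "\<lambda>n. resolvent_iter A n t s"] iter_summable[OF assms] by blast
    from suminf_minus[OF this] show ?thesis by simp
  qed
  also have "(\<Sum>n. resolvent_iter A (Suc n) t s) = resolvent A t s + A t s"
    unfolding resolvent_def using suminf_split_head[OF iter_summable[OF assms]] by simp
  finally show ?thesis by simp
qed

text \<open>Inserting \<open>x\<close> produces a double integral over
  \<open>u \<le> r \<le> s \<le> t\<close>, encoded by \<open>F\<close> on the plane. Integrated in
  \<open>s\<close> first, \<open>resolvent_eq\<close> evaluates the inner integral; the terms with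
  \<open>A t r * b r\<close> cancel and the one with the resolvent remains.\<close>

lemma resolvent_solves:
  assumes u: "0 \<le> u" and b_meas: "b \<in> borel_measurable borel" and b_bound: "\<And>s. s \<in> {u..T} \<Longrightarrow> \<bar>b s\<bar> \<le> B"
    and t: "u \<le> t" "t \<le> T"
  defines "x \<equiv> \<lambda>t. b t + (LBINT s:{u..t}. resolvent A t s * b s)"
  shows "x t = b t - (LBINT s:{u..t}. A t s * x s)"
proof -
  note [measurable] = b_meas
  have B0: "0 \<le> B" using b_bound[of t] t by simp
  have T: "0 \<le> T" using u t by simp
  have Qb: "\<bar>resolvent A s r * b r\<bar> \<le> qmax T * B" if "u \<le> r" "r \<le> s" "s \<le> T" for s r
    unfolding abs_mult using that u T by (intro mult_mono resolvent_bound b_bound qmax_nonneg) auto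
  have I1: "set_integrable lborel {u..t} (\<lambda>s. A t s * b s)"
    by (rule set_integrable_bounded[where B="c * B"]) (use t c0 b_bound in \<open>auto simp: abs_mult intro!: mult_mono A_bound\<close>)
  define F where "F s r = indicator {u..t} s * indicator {u..s} r * (A t s * (resolvent A s r * b r))" for s r
  have F_bound: "\<bar>F s r\<bar> \<le> c * (qmax T * B)" for s r
  proof (cases "s \<in> {u..t} \<and> r \<in> {u..s}")
    case True
    then show ?thesis unfolding F_def using t c0
      by (auto simp: abs_mult intro!: mult_mono A_bound Qb[unfolded abs_mult])
  next
    case False
    then have "F s r = 0" by (auto simp: F_def)
    then show ?thesis using c0 qmax_nonneg[OF T] B0 by simp
  qed
  have F_meas: "(\<lambda>x. F (fst x) (snd x)) \<in> borel_measurable (borel \<Otimes>\<^sub>M borel)"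
    unfolding F_def Icc_if by measurable
  have F_supp: "F s r = 0" if "s \<notin> {0..T} \<or> r \<notin> {0..T}" for s r
    using that u t by (auto simp: F_def split: split_indicator)
  have F_swap: "(LBINT s. (LBINT r. F s r)) = (LBINT r. (LBINT s. F s r))"
    by (rule Fubini_bounded_supp[OF F_meas F_bound F_supp])
  have F1: "(LBINT r. F s r) = indicator {u..t} s *\<^sub>R (A t s * (LBINT r:{u..s}. resolvent A s r * b r))" for s
    unfolding F_def set_lebesgue_integral_def
    by (simp add: mult.assoc[symmetric] flip: integral_mult_right_zero) (simp add: ac_simps)
  have I2: "set_integrable lborel {u..t} (\<lambda>s. A t s * (LBINT r:{u..s}. resolvent A s r * b r))"
    unfolding set_integrable_def F1[symmetric]
  proof (rule bounded_supp_integrable[of T], rule bounded_suppI)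
    show "(\<lambda>s. (LBINT r. F s r)) \<in> borel_measurable borel"
      by (rule lborel.borel_measurable_lebesgue_integral) (use F_meas in \<open>simp add: case_prod_beta' cong: measurable_cong_sets sets_pair_measure_cong\<close>)
    have "bounded_supp T (F s)" for s
      by (rule bounded_suppI[OF _ F_bound]) (use F_supp measurable_Pair2[OF F_meas, of s] in auto)
    then show "\<bar>(LBINT r. F s r)\<bar> \<le> (c * (qmax T * B)) * T" for s
      by (rule integral_abs_le_bounded_supp[OF _ F_bound T])
    show "(LBINT r. F s r) = 0" if "s \<notin> {0..T}" for s
      using F_supp that by simp
  qed
  have F2: "(LBINT s. F s r) = indicator {u..t} r *\<^sub>R ((- A t r - resolvent A t r) * b r)" for r
  proof (cases "r \<in> {u..t}")
    case True
    have "(LBINT s. F s r) = (LBINT s:{r..t}. A t s * resolvent A s r) * b r"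
      unfolding set_lebesgue_integral_def integral_mult_left_zero[symmetric]
      by (intro Bochner_Integration.integral_cong) (use True in \<open>auto simp: F_def split: split_indicator\<close>)
    also have "(LBINT s:{r..t}. A t s * resolvent A s r) = - A t r - resolvent A t r"
      using resolvent_eq[of r t] True by simp
    finally show ?thesis using True by simp
  next
    case False
    then have "F s r = 0" for s by (auto simp: F_def split: split_indicator)
    then show ?thesis using False by simp
  qed
  have I3: "set_integrable lborel {u..t} (\<lambda>r. resolvent A t r * b r)"
    by (rule set_integrable_bounded[where B="qmax T * B"]) (use t Qb in auto)
  have "(LBINT s:{u..t}. A t s * x s) = (LBINT s:{u..t}. A t s * b s + A t s * (LBINT r:{u..s}. resolvent A s r * b r))"
    by (simp add: x_def distrib_left)
  also have "\<dots> = (LBINT s:{u..t}. A t s * b s) + (LBINT s:{u..t}. A t s * (LBINT r:{u..s}. resolvent A s r * b r))"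
    by (rule set_integral_add(2)[OF I1 I2])
  also have "(LBINT s:{u..t}. A t s * (LBINT r:{u..s}. resolvent A s r * b r)) = (LBINT r:{u..t}. (- A t r - resolvent A t r) * b r)"
    unfolding set_lebesgue_integral_def[of _ "{u..t}"] F1[symmetric] F2[symmetric] by (rule F_swap)
  also have "\<dots> = (LBINT r:{u..t}. - (A t r * b r) - resolvent A t r * b r)"
    by (simp add: algebra_simps)
  also have "\<dots> = (LBINT r:{u..t}. - (A t r * b r)) - (LBINT r:{u..t}. resolvent A t r * b r)"
    using set_integrable_mult_right[OF I1, of "-1"] by (intro set_integral_diff I3) auto
  also have "(LBINT r:{u..t}. - (A t r * b r)) = - (LBINT r:{u..t}. A t r * b r)"
    by (simp add: set_lebesgue_integral_def)
  finally show ?thesis by (simp add: x_def)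
qed

lemma resolvent_formula_bound:
  assumes u: "0 \<le> u" and b_meas: "b \<in> borel_measurable borel" and b_bound: "\<And>s. s \<in> {u..T} \<Longrightarrow> \<bar>b s\<bar> \<le> B"
    and t: "u \<le> t" "t \<le> T"
  shows "set_integrable lborel {u..t} (\<lambda>s. resolvent A t s * b s)"
    and "\<bar>b t + (LBINT s:{u..t}. resolvent A t s * b s)\<bar> \<le> B + qmax T * B * T"
proof -
  note [measurable] = b_meas
  have B0: "0 \<le> B" using b_bound[of t] t by simp
  have T: "0 \<le> T" using u t by simp
  have Qb: "\<bar>resolvent A t r * b r\<bar> \<le> qmax T * B" if "r \<in> {u..t}" for r
    unfolding abs_mult using that u t T by (intro mult_mono resolvent_bound b_bound qmax_nonneg) auto
  show "set_integrable lborel {u..t} (\<lambda>s. resolvent A t s * b s)"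
    by (rule set_integrable_bounded[OF _ Qb]) auto
  have "\<bar>LBINT s:{u..t}. resolvent A t s * b s\<bar> \<le> qmax T * B * (t - u)"
    using Qb t qmax_nonneg[OF T] B0 by (intro set_integral_abs_le_const) auto
  also have "\<dots> \<le> qmax T * B * T" using t u qmax_nonneg[OF T] B0 by (intro mult_left_mono) auto
  finally show "\<bar>b t + (LBINT s:{u..t}. resolvent A t s * b s)\<bar> \<le> B + qmax T * B * T"
    using b_bound[of t] t by simp
qed

lemma volterra_unique:
  assumes x: "x \<in> borel_measurable borel" "\<And>t. t \<in> {u..T} \<Longrightarrow> \<bar>x t\<bar> \<le> Bx"
    and y: "y \<in> borel_measurable borel" "\<And>t. t \<in> {u..T} \<Longrightarrow> \<bar>y t\<bar> \<le> By"
    and eqx: "\<And>t. t \<in> {u..T} \<Longrightarrow> x t = b t - (LBINT s:{u..t}. A t s * x s)"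
    and eqy: "\<And>t. t \<in> {u..T} \<Longrightarrow> y t = b t - (LBINT s:{u..t}. A t s * y s)"
    and t: "t \<in> {u..T}"
  shows "x t = y t"
proof -
  note [measurable] = x(1) y(1)
  have d: "set_integrable lborel {u..s} (\<lambda>s. \<bar>x s - y s\<bar>)" if "s \<le> T" for s
  proof (rule set_integrable_bounded)
    show "\<bar>\<bar>x r - y r\<bar>\<bar> \<le> Bx + By" if "r \<in> {u..s}" for r
      using x(2)[of r] y(2)[of r] that \<open>s \<le> T\<close> by auto
  qed measurable
  have "\<bar>x t - y t\<bar> = 0"
  proof (rule triangle_gronwall[where w="\<lambda>_ s. \<bar>x s - y s\<bar>" and a=u and b=T and c=c and B="Bx + By"])
    fix t s assume st: "u \<le> s" "s \<le> t" "t \<le> T"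
    show "\<bar>x s - y s\<bar> \<le> Bx + By" using x(2)[of s] y(2)[of s] st by auto
    have Ix: "set_integrable lborel {u..s} (\<lambda>r. A s r * x r)"
      by (rule set_integrable_bounded[where B="c * Bx"]) (use st x c0 in \<open>auto simp: abs_mult intro!: mult_mono A_bound\<close>)
    have Iy: "set_integrable lborel {u..s} (\<lambda>r. A s r * y r)"
      by (rule set_integrable_bounded[where B="c * By"]) (use st y c0 in \<open>auto simp: abs_mult intro!: mult_mono A_bound\<close>)
    have "x s - y s = (LBINT r:{u..s}. A s r * y r - A s r * x r)"
      using eqx[of s] eqy[of s] st set_integral_diff(2)[OF Iy Ix] by simp
    also have "\<bar>\<dots>\<bar> \<le> (LBINT r:{u..s}. \<bar>A s r * y r - A s r * x r\<bar>)" by (rule set_integral_abs_le)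
    also have "\<dots> \<le> (LBINT r:{u..s}. c * \<bar>x r - y r\<bar>)"
    proof (rule set_integral_mono)
      show "\<bar>A s r * y r - A s r * x r\<bar> \<le> c * \<bar>x r - y r\<bar>" for r
        unfolding right_diff_distrib[symmetric] abs_mult abs_minus_commute[of "x r"]
        by (intro mult_right_mono A_bound) auto
    qed (use st in \<open>intro set_integrable_abs set_integral_diff Iy Ix set_integrable_mult_right d; simp\<close>)+
    also have "\<dots> \<le> c * (LBINT r:{u..s}. \<bar>x r - y r\<bar> + \<bar>x r - y r\<bar>)"
      unfolding set_integral_mult_right
      using st by (intro mult_left_mono c0 set_integral_mono set_integral_add d) auto
    finally show "\<bar>x s - y s\<bar> \<le> c * (LBINT r:{u..s}. \<bar>x r - y r\<bar> + \<bar>x r - y r\<bar>)" .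
  qed (use t d c0 in auto)
  then show ?thesis by simp
qed

text \<open>The formula defines a bounded measurable solution, and \<open>volterra_unique\<close>
  leaves only one in this class.\<close>

theorem volterra_resolvent:
  assumes u: "0 \<le> u" and b: "b \<in> borel_measurable borel" "\<And>s. s \<in> {u..T} \<Longrightarrow> \<bar>b s\<bar> \<le> B"
    and y: "y \<in> borel_measurable borel" "\<And>t. t \<in> {u..T} \<Longrightarrow> \<bar>y t\<bar> \<le> By"
    and eq: "\<And>t. t \<in> {u..T} \<Longrightarrow> y t = b t - (LBINT s:{u..t}. A t s * y s)"
    and t: "t \<in> {u..T}"
  shows "y t = b t + (LBINT s:{u..t}. resolvent A t s * b s)"
proof (rule volterra_unique[OF y _ _ eq])
  note [measurable] = b(1)
  have "(\<lambda>t. (LBINT s. indicator {u..t} s *\<^sub>R (resolvent A t s * b s))) \<in> borel_measurable borel"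
    by (rule lborel.borel_measurable_lebesgue_integral) (unfold case_prod_beta' Icc_if, measurable)
  then show "(\<lambda>t. b t + (LBINT s:{u..t}. resolvent A t s * b s)) \<in> borel_measurable borel"
    unfolding set_lebesgue_integral_def by measurable
qed (use resolvent_solves[OF u b] resolvent_formula_bound(2)[OF u b] t in auto)

end

section \<open>Wiener integrals\<close>

lemma cell_mono:
  fixes p :: "nat \<Rightarrow> real"
  assumes "\<And>i. i < m \<Longrightarrow> p i \<le> p (Suc i)" "i \<le> j" "j \<le> m" shows "p i \<le> p j"
  using assms(2,3)
proof (induction j)
  case (Suc j)
  then show ?case using assms(1)[of j] by (cases "i = Suc j") auto
qed simp

lemma sum_indicator_cells:
  fixes p :: "nat \<Rightarrow> real"
  assumes "\<And>i. i < m \<Longrightarrow> p i \<le> p (Suc i)"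
  shows "(\<Sum>i<m. indicator {p i<..p (Suc i)} x :: real) = indicator {p 0<..p m} x"
  using assms
proof (induction m)
  case (Suc m)
  have "p 0 \<le> p m" "p m \<le> p (Suc m)"
    using Suc.prems by (auto intro!: cell_mono[of "Suc m" p 0 m])
  moreover have "(\<Sum>i<m. indicator {p i<..p (Suc i)} x :: real) = indicator {p 0<..p m} x"
    using Suc.prems by (intro Suc.IH) auto
  ultimately show ?case by (auto split: split_indicator)
qed simp

text \<open>Half-open cells of a monotone partition are disjoint, so at most one summand is nonzero;
  \<open>\<phi> 0 = 0\<close> covers points outside all cells.\<close>

lemma apply_sum_indicator_cells:
  fixes p :: "nat \<Rightarrow> real" and c :: "nat \<Rightarrow> real" and \<phi> :: "real \<Rightarrow> real"
  assumes p: "\<And>i. i < m \<Longrightarrow> p i \<le> p (Suc i)" and "\<phi> 0 = 0"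
  shows "\<phi> (\<Sum>i<m. c i * indicator {p i<..p (Suc i)} x) = (\<Sum>i<m. \<phi> (c i) * indicator {p i<..p (Suc i)} x)"
proof (cases "\<exists>i<m. x \<in> {p i<..p (Suc i)}")
  case True
  then obtain i where i: "i < m" "x \<in> {p i<..p (Suc i)}" by blast
  have "x \<notin> {p j<..p (Suc j)}" if "j < m" "j \<noteq> i" for j
  proof (cases "j < i")
    case True
    then have "p (Suc j) \<le> p i" using cell_mono[of m p "Suc j" i, OF p] i by simp
    then show ?thesis using i by auto
  next
    case False
    then have "p (Suc i) \<le> p j" using cell_mono[of m p "Suc i" j, OF p] that by simp
    then show ?thesis using i by auto
  qed
  then have ind: "indicator {p j<..p (Suc j)} x = (if j = i then 1 else 0 :: real)" if "j < m" for j
    using that i by (auto split: split_indicator)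
  have "(\<Sum>j<m. d j * indicator {p j<..p (Suc j)} x) = d i" for d :: "nat \<Rightarrow> real"
    using i by (simp add: ind if_distrib[of "(*) _"] cong: if_cong)
  then show ?thesis by simp
next
  case False
  then show ?thesis using assms(2) by simp
qed

section \<open>Mean-square approximation by averages on uniform grids\<close>

definition ugrid :: "real \<Rightarrow> real \<Rightarrow> nat \<Rightarrow> nat \<Rightarrow> real" where
  "ugrid a b n i = a + (b - a) * real i / real (Suc n)"

lemma ugrid_0 [simp]: "ugrid a b n 0 = a" and ugrid_end [simp]: "ugrid a b n (Suc n) = b"
  by (simp_all add: ugrid_def del: of_nat_Suc)

lemma ugrid_Suc: "ugrid a b n (Suc i) - ugrid a b n i = (b - a) / real (Suc n)"
  unfolding ugrid_def by (simp add: distrib_left add_divide_distrib)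

lemma ugrid_mono: "a \<le> b \<Longrightarrow> i \<le> j \<Longrightarrow> ugrid a b n i \<le> ugrid a b n j"
  by (simp add: ugrid_def divide_right_mono mult_left_mono)

lemma ugrid_bounds: "a \<le> b \<Longrightarrow> i \<le> Suc n \<Longrightarrow> a \<le> ugrid a b n i \<and> ugrid a b n i \<le> b"
  using ugrid_mono[of a b 0 i n] ugrid_mono[of a b i "Suc n" n] by simp

text \<open>The mean of \<open>f\<close> on one cell. Means are used instead of point values because
  they contract in mean square, which extends convergence from continuous to bounded measurable
  functions.\<close>

definition avg_coeff :: "real \<Rightarrow> real \<Rightarrow> nat \<Rightarrow> (real \<Rightarrow> real) \<Rightarrow> nat \<Rightarrow> real" where
  "avg_coeff a b n f i =
     (LBINT x. indicator {ugrid a b n i<..ugrid a b n (Suc i)} x * f x) / ((b - a) / real (Suc n))"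

definition avg_step :: "real \<Rightarrow> real \<Rightarrow> nat \<Rightarrow> (real \<Rightarrow> real) \<Rightarrow> real \<Rightarrow> real" where
  "avg_step a b n f x = (\<Sum>i<Suc n. avg_coeff a b n f i * indicator {ugrid a b n i<..ugrid a b n (Suc i)} x)"

lemma avg_step_measurable [measurable]: "avg_step a b n f \<in> borel_measurable borel"
  unfolding avg_step_def[abs_def] by measurable

lemma L2_indicator:
  fixes f :: "real \<Rightarrow> real"
  assumes "f \<in> borel_measurable borel" "\<And>x. \<bar>f x\<bar> \<le> B" "A \<in> sets borel" "A \<subseteq> {a..b}"
  shows "(\<lambda>x. indicator A x * f x) \<in> L2 lborel"
proof (rule L2I)
  have "\<bar>(f x)\<^sup>2\<bar> \<le> B\<^sup>2" for x using power_mono[OF assms(2) abs_ge_zero, of x 2] by simp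
  then have "set_integrable lborel {a..b} (\<lambda>x. (f x)\<^sup>2)" using assms by (intro set_integrable_bounded) auto
  then have "set_integrable lborel A (\<lambda>x. (f x)\<^sup>2)" by (rule set_integrable_subset) (use assms in auto)
  moreover have "(\<lambda>x. (indicator A x * f x)\<^sup>2) = (\<lambda>x. indicator A x *\<^sub>R (f x)\<^sup>2)"
    by (auto split: split_indicator)
  ultimately show "integrable lborel (\<lambda>x. (indicator A x * f x)\<^sup>2)" by (simp add: set_integrable_def)
qed (use assms in measurable)

lemma indicator_Ioc_L2: "indicator {a<..b::real} \<in> L2 lborel"
proof -
  have "{a<..b} \<subseteq> {a..b}" by auto
  then show ?thesis using L2_indicator[of "\<lambda>_. 1" 1 "{a<..b}" a b] by simp
qed

lemma avg_step_L2: "avg_step a b n f \<in> L2 lborel"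
  unfolding avg_step_def[abs_def] by (intro L2_sum L2_scale indicator_Ioc_L2)

lemma ugrid_cell_sub: "a \<le> b \<Longrightarrow> i < Suc n \<Longrightarrow> {ugrid a b n i<..ugrid a b n (Suc i)} \<subseteq> {a..b}"
  using ugrid_bounds[of a b i n] ugrid_bounds[of a b "Suc i" n] by auto

lemma cell_integrable:
  assumes "a \<le> b" "f \<in> borel_measurable borel" "\<And>x. \<bar>f x\<bar> \<le> B" "i < Suc n"
  shows "integrable lborel (\<lambda>x. indicator {ugrid a b n i<..ugrid a b n (Suc i)} x * f x :: real)"
proof -
  have "set_integrable lborel {a..b} f" using assms by (intro set_integrable_bounded) auto
  then have "set_integrable lborel {ugrid a b n i<..ugrid a b n (Suc i)} f"
    by (rule set_integrable_subset) (use ugrid_cell_sub[OF assms(1,4)] in auto)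
  then show ?thesis by (simp add: set_integrable_def)
qed

lemma avg_step_outside:
  assumes "a \<le> b" "x \<notin> {a..b}" shows "avg_step a b n f x = 0"
  unfolding avg_step_def
proof (intro sum.neutral ballI)
  fix i assume "i \<in> {..<Suc n}"
  then have "x \<notin> {ugrid a b n i<..ugrid a b n (Suc i)}" using ugrid_cell_sub[OF assms(1), of i n] assms(2) by blast
  then show "avg_coeff a b n f i * indicator {ugrid a b n i<..ugrid a b n (Suc i)} x = 0" by simp
qed

text \<open>On each cell, Cauchy-Schwarz against the indicator bounds the squared mean by the mean
  of the square.\<close>

lemma avg_step_contraction:
  assumes ab: "a < b" and f: "f \<in> borel_measurable borel" "\<And>x. \<bar>f x\<bar> \<le> B"
  shows "(LBINT x. (avg_step a b n f x)\<^sup>2) \<le> (LBINT x. (indicator {a..b} x * f x)\<^sup>2)"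
proof -
  define h where "h = (b - a) / real (Suc n)"
  have h: "0 < h" using ab by (simp add: h_def del: of_nat_Suc)
  let ?I = "\<lambda>i. {ugrid a b n i<..ugrid a b n (Suc i)}"
  note [measurable] = f(1)
  have If: "(\<lambda>x. indicator (?I i) x * f x) \<in> L2 lborel" if "i < Suc n" for i
    using f that ab by (intro L2_indicator[OF _ _ _ ugrid_cell_sub]) auto
  have Ih: "(LBINT x. indicator (?I i) x) = h" for i
    using ugrid_mono[of a b i "Suc i" n] ab ugrid_Suc[of a b n i] by (simp add: h_def)
  have "(LBINT x. (avg_step a b n f x)\<^sup>2) = (LBINT x. (\<Sum>i<Suc n. (avg_coeff a b n f i)\<^sup>2 * indicator (?I i) x))"
    unfolding avg_step_def
    using ab ugrid_mono[of a b _ _ n]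
    by (intro Bochner_Integration.integral_cong refl apply_sum_indicator_cells[where \<phi>="\<lambda>x. x\<^sup>2"]) auto
  also have "\<dots> = (\<Sum>i<Suc n. (avg_coeff a b n f i)\<^sup>2 * h)"
    using ab ugrid_mono[of a b _ "Suc _" n]
    by (subst Bochner_Integration.integral_sum) (auto simp: Ih ugrid_Suc h_def intro!: integrable_mult_right integrable_real_indicator simp del: sum.lessThan_Suc of_nat_Suc)
  also have "\<dots> \<le> (\<Sum>i<Suc n. (LBINT x. indicator (?I i) x * (f x)\<^sup>2))"
  proof (rule sum_mono)
    fix i assume i: "i \<in> {..<Suc n}"
    let ?J = "(LBINT x. indicator (?I i) x * f x)"
    have "(LBINT x. indicator (?I i) x * (indicator (?I i) x * f x))\<^sup>2
        \<le> (LBINT x. (indicator (?I i) x)\<^sup>2) * (LBINT x. (indicator (?I i) x * f x)\<^sup>2)"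
      using i by (intro L2_Cauchy_Schwarz indicator_Ioc_L2 If) auto
    moreover have "(\<lambda>x. indicator (?I i) x * (indicator (?I i) x * f x)) = (\<lambda>x. indicator (?I i) x * f x)"
      "(\<lambda>x. (indicator (?I i) x)\<^sup>2) = (indicator (?I i) :: real \<Rightarrow> real)"
      "(\<lambda>x. (indicator (?I i) x * f x)\<^sup>2) = (\<lambda>x. indicator (?I i) x * (f x)\<^sup>2)"
      by (auto split: split_indicator)
    ultimately have "?J\<^sup>2 \<le> h * (LBINT x. indicator (?I i) x * (f x)\<^sup>2)" by (simp only: Ih)
    then have "?J\<^sup>2 / h \<le> (LBINT x. indicator (?I i) x * (f x)\<^sup>2)"
      unfolding pos_divide_le_eq[OF h] by (simp only: mult.commute[of h])
    moreover have "(avg_coeff a b n f i)\<^sup>2 * h = ?J\<^sup>2 / h"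
    proof -
      have "avg_coeff a b n f i = ?J / h" by (simp only: avg_coeff_def h_def)
      moreover have "(z / h)\<^sup>2 * h = z\<^sup>2 / h" for z using h by (simp add: power2_eq_square)
      ultimately show ?thesis by simp
    qed
    ultimately show "(avg_coeff a b n f i)\<^sup>2 * h \<le> (LBINT x. indicator (?I i) x * (f x)\<^sup>2)" by linarith
  qed
  also have "\<dots> = (LBINT x. (\<Sum>i<Suc n. indicator (?I i) x * (f x)\<^sup>2))"
  proof (rule Bochner_Integration.integral_sum[symmetric])
    fix i assume "i \<in> {..<Suc n}"
    then have "integrable lborel (\<lambda>x. (indicator (?I i) x * f x)\<^sup>2)" using If by (auto intro: L2_integrable_sq)
    moreover have "(\<lambda>x. (indicator (?I i) x * f x)\<^sup>2) = (\<lambda>x. indicator (?I i) x * (f x)\<^sup>2)"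
      by (auto split: split_indicator)
    ultimately show "integrable lborel (\<lambda>x. indicator (?I i) x * (f x)\<^sup>2)" by simp
  qed
  also have "\<dots> = (LBINT x. (indicator {a<..b} x * f x)\<^sup>2)"
    unfolding sum_distrib_right[symmetric]
    by (subst sum_indicator_cells) (use ab ugrid_mono[of a b _ _ n] in \<open>auto intro!: Bochner_Integration.integral_cong split: split_indicator\<close>)
  also have "\<dots> \<le> (LBINT x. (indicator {a..b} x * f x)\<^sup>2)"
    by (intro integral_mono L2_integrable_sq L2_indicator[OF f, where a=a and b=b]) (auto split: split_indicator)
  finally show ?thesis .
qed

lemma avg_coeff_diff:
  assumes "a \<le> b" "f \<in> borel_measurable borel" "\<And>x. \<bar>f x\<bar> \<le> B" "g \<in> borel_measurable borel" "\<And>x. \<bar>g x\<bar> \<le> B'" "i < Suc n"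
  shows "avg_coeff a b n (\<lambda>x. f x - g x) i = avg_coeff a b n f i - avg_coeff a b n g i"
proof -
  show ?thesis
    unfolding avg_coeff_def right_diff_distrib
    by (simp add: Bochner_Integration.integral_diff[OF cell_integrable[OF assms(1,2,3,6)] cell_integrable[OF assms(1,4,5,6)]] diff_divide_distrib)
qed

lemma avg_step_diff:
  assumes "a \<le> b" "f \<in> borel_measurable borel" "\<And>x. \<bar>f x\<bar> \<le> B" "g \<in> borel_measurable borel" "\<And>x. \<bar>g x\<bar> \<le> B'"
  shows "avg_step a b n (\<lambda>x. f x - g x) x = avg_step a b n f x - avg_step a b n g x"
proof -
  let ?I = "\<lambda>i. {ugrid a b n i<..ugrid a b n (Suc i)}"
  have "avg_step a b n (\<lambda>x. f x - g x) x = (\<Sum>i<Suc n. (avg_coeff a b n f i - avg_coeff a b n g i) * indicator (?I i) x)"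
    unfolding avg_step_def
  proof (rule sum.cong[OF refl])
    fix i assume "i \<in> {..<Suc n}"
    then show "avg_coeff a b n (\<lambda>x. f x - g x) i * indicator (?I i) x = (avg_coeff a b n f i - avg_coeff a b n g i) * indicator (?I i) x"
      using avg_coeff_diff[OF assms, of i n] by simp
  qed
  then show ?thesis by (simp only: left_diff_distrib sum_subtractf avg_step_def)
qed

lemma avg_step_continuous:
  assumes ab: "a < b" and g: "continuous_on UNIV g" and B: "\<And>x. \<bar>g x\<bar> \<le> B"
  shows "(\<lambda>n. (LBINT x. (indicator {a..b} x * g x - avg_step a b n g x)\<^sup>2)) \<longlonglongrightarrow> 0"
proof (rule LIMSEQ_I)
  fix r :: real assume "0 < r"
  \<comment> \<open>A uniform error of size \<open>e\<close> contributes at most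
    \<open>e\<^sup>2 * (b - a) = r / 2\<close> to the squared norm.\<close>
  define e where "e = sqrt (r / (2 * (b - a)))"
  have e: "0 < e" "e\<^sup>2 * (b - a) < r"
  proof -
    have "e\<^sup>2 = r / (2 * (b - a))" using ab \<open>0 < r\<close> by (simp add: e_def)
    then have "e\<^sup>2 * (b - a) = r / 2" using ab by (simp add: field_simps)
    then show "e\<^sup>2 * (b - a) < r" using \<open>0 < r\<close> by simp
  qed (use ab \<open>0 < r\<close> in \<open>simp add: e_def\<close>)
  have "uniformly_continuous_on {a..b} g"
    by (rule compact_uniformly_continuous) (auto intro: continuous_on_subset[OF g])
  then obtain d where d: "0 < d" "\<And>x y. x \<in> {a..b} \<Longrightarrow> y \<in> {a..b} \<Longrightarrow> \<bar>y - x\<bar> < d \<Longrightarrow> \<bar>g y - g x\<bar> < e"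
    unfolding uniformly_continuous_on_def dist_real_def using e(1) by metis
  obtain N :: nat where N: "(b - a) / d < real N" using reals_Archimedean2 by blast
  have [measurable]: "g \<in> borel_measurable borel" using g by (rule borel_measurable_continuous_onI)
  have "norm ((LBINT x. (indicator {a..b} x * g x - avg_step a b n g x)\<^sup>2) - 0) < r" if n: "N \<le> n" for n
  proof -
    define h where "h = (b - a) / real (Suc n)"
    have h0: "0 < h" using ab by (simp add: h_def del: of_nat_Suc)
    have "(b - a) / d < real (Suc n)" using N n by simp
    then have hd: "h < d" using d(1) by (simp add: h_def field_simps del: of_nat_Suc)
    let ?I = "\<lambda>i. {ugrid a b n i<..ugrid a b n (Suc i)}"
    have Ih: "(LBINT x. indicator (?I i) x) = h" for i
      using ugrid_mono[of a b i "Suc i" n] ab ugrid_Suc[of a b n i] by (simp add: h_def)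
    have pt: "\<bar>g x - avg_step a b n g x\<bar> \<le> e" if x: "x \<in> {a<..b}" for x
    proof -
      have one: "(\<Sum>i<Suc n. indicator (?I i) x :: real) = 1"
        by (subst sum_indicator_cells) (use ab x ugrid_mono[of a b _ _ n] in auto)
      have ci: "\<bar>(g x - avg_coeff a b n g i) * indicator (?I i) x\<bar> \<le> e * indicator (?I i) x" if i: "i < Suc n" for i
      proof (cases "x \<in> ?I i")
        case True
        have sub: "?I i \<subseteq> {a..b}" using ab i by (intro ugrid_cell_sub) auto
        have int1: "integrable lborel (\<lambda>y. indicator (?I i) y * g y)"
          using ab i by (intro cell_integrable[OF _ _ B]) auto
        have int2: "integrable lborel (indicator (?I i) :: real \<Rightarrow> real)"
          using ab ugrid_mono[of a b i "Suc i" n] by (intro integrable_real_indicator) auto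
        have "h * (g x - avg_coeff a b n g i) = (LBINT y. indicator (?I i) y * g x) - (LBINT y. indicator (?I i) y * g y)"
        proof -
          have "avg_coeff a b n g i = (LBINT y. indicator (?I i) y * g y) / h"
            by (simp only: avg_coeff_def h_def)
          moreover have "(LBINT y. indicator (?I i) y * g x) = h * g x"
            by (simp only: integral_mult_left_zero Ih)
          ultimately show ?thesis using h0 by (simp only: right_diff_distrib) simp
        qed
        also have "\<dots> = (LBINT y. indicator (?I i) y * (g x - g y))"
          unfolding right_diff_distrib
          by (rule Bochner_Integration.integral_diff[symmetric]) (use int1 int2 in auto)
        finally have "\<bar>h * (g x - avg_coeff a b n g i)\<bar> \<le> (LBINT y. \<bar>indicator (?I i) y * (g x - g y)\<bar>)"
          by simp
        also have "\<dots> \<le> (LBINT y. e * indicator (?I i) y)"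
        proof (rule integral_mono)
          show "integrable lborel (\<lambda>y. \<bar>indicator (?I i) y * (g x - g y)\<bar>)"
            unfolding right_diff_distrib by (intro integrable_abs Bochner_Integration.integrable_diff) (use int1 int2 in auto)
          show "integrable lborel (\<lambda>y. e * indicator (?I i) y)" using int2 by simp
          show "\<bar>indicator (?I i) y * (g x - g y)\<bar> \<le> e * indicator (?I i) y" for y
          proof (cases "y \<in> ?I i")
            case y: True
            have "\<bar>x - y\<bar> < d" using y True hd ugrid_Suc[of a b n i] by (auto simp: h_def)
            then have "\<bar>g x - g y\<bar> < e" using sub y True by (intro d) auto
            then show ?thesis using y by simp
          qed simp
        qed
        finally have "h * \<bar>g x - avg_coeff a b n g i\<bar> \<le> h * e" using h0 Ih[of i] by (simp add: abs_mult ac_simps)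
        then show ?thesis using h0 True by simp
      qed simp
      have "g x - avg_step a b n g x = (\<Sum>i<Suc n. g x * indicator (?I i) x) - (\<Sum>i<Suc n. avg_coeff a b n g i * indicator (?I i) x)"
        unfolding avg_step_def sum_distrib_left[symmetric] one by simp
      also have "\<dots> = (\<Sum>i<Suc n. (g x - avg_coeff a b n g i) * indicator (?I i) x)"
        by (simp only: sum_subtractf left_diff_distrib)
      also have "\<bar>\<dots>\<bar> \<le> (\<Sum>i<Suc n. e * indicator (?I i) x)"
        by (rule order_trans[OF sum_abs sum_mono]) (use ci in auto)
      also have "\<dots> = e" unfolding sum_distrib_left[symmetric] one by simp
      finally show ?thesis .
    qed
    have "(LBINT x. (indicator {a..b} x * g x - avg_step a b n g x)\<^sup>2) \<le> (LBINT x. e\<^sup>2 * indicator {a..b} x)"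
    proof (rule integral_mono_AE)
      show "integrable lborel (\<lambda>x. (indicator {a..b} x * g x - avg_step a b n g x)\<^sup>2)"
        by (intro L2_integrable_sq L2_diff avg_step_L2 L2_indicator[where a=a and b=b, OF _ B]) auto
      show "integrable lborel (\<lambda>x. e\<^sup>2 * indicator {a..b} x)"
        by (intro integrable_mult_right integrable_real_indicator) (auto simp: emeasure_lborel_Icc_eq)
      have out: "avg_step a b n g x = 0" if "x \<notin> {a..b}" for x
        using ab that by (intro avg_step_outside) auto
      \<comment> \<open>The endpoint \<open>a\<close> lies in none of the half-open cells, so the
        comparison excludes it.\<close>
      show "AE x in lborel. (indicator {a..b} x * g x - avg_step a b n g x)\<^sup>2 \<le> e\<^sup>2 * indicator {a..b} x"
        using AE_lborel_singleton[of a]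
      proof eventually_elim
        case (elim x)
        show ?case
        proof (cases "x \<in> {a<..b}")
          case True
          then show ?thesis using power_mono[OF pt[OF True] abs_ge_zero, of 2] by simp
        next
          case False
          then have "x \<notin> {a..b}" using elim by auto
          then show ?thesis using out by simp
        qed
      qed
    qed
    also have "\<dots> = e\<^sup>2 * (b - a)" using ab by simp
    finally show ?thesis using e(2) by simp
  qed
  then show "\<exists>no. \<forall>n\<ge>no. norm ((LBINT x. (indicator {a..b} x * g x - avg_step a b n g x)\<^sup>2) - 0) < r" by blast
qed

text \<open>Measurability provides continuous functions converging off a negligible set. Clamping
  them to \<open>[-B, B]\<close> leaves the limit unchanged and makes dominated convergence
  applicable.\<close>

lemma continuous_L2_approx:
  fixes f :: "real \<Rightarrow> real"
  assumes f: "f \<in> borel_measurable borel" "\<And>x. \<bar>f x\<bar> \<le> B" and "0 < e"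
  obtains g where "continuous_on UNIV g" "\<And>x. \<bar>g x\<bar> \<le> B" "(LBINT x. (indicator {a..b} x * (f x - g x))\<^sup>2) < e"
proof -
  have B0: "0 \<le> B" using f(2)[of 0] by simp
  have "f measurable_on UNIV"
    using f(1) by (intro lebesgue_measurable_imp_measurable_on) (auto simp: measurable_completion)
  then obtain N g where N: "negligible N" and g: "\<And>n::nat. continuous_on UNIV (g n)"
    and lim: "\<And>x. x \<notin> N \<Longrightarrow> (\<lambda>n. g n x) \<longlonglongrightarrow> f x"
    unfolding measurable_on_def by auto
  define g' where "g' n x = max (- B) (min B (g n x))" for n x
  have g'c: "continuous_on UNIV (g' n)" for n unfolding g'_def[abs_def] by (intro continuous_intros g)
  have g'b: "\<bar>g' n x\<bar> \<le> B" for n x using B0 by (auto simp: g'_def)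
  have [measurable]: "g' n \<in> borel_measurable borel" for n by (rule borel_measurable_continuous_onI[OF g'c])
  note [measurable] = f(1)
  have "AE x in lebesgue. x \<notin> N" using N by (intro AE_not_in) (simp add: negligible_iff_null_sets)
  then have ae: "AE x in lborel. x \<notin> N" by (simp add: AE_completion_iff)
  have "(\<lambda>n. (LBINT x. (indicator {a..b} x * (f x - g' n x))\<^sup>2)) \<longlonglongrightarrow> (\<integral>x. 0 \<partial>(lborel :: real measure))"
  proof (rule integral_dominated_convergence)
    show "integrable lborel (\<lambda>x. (2 * B)\<^sup>2 * indicator {a..b} x :: real)"
      by (intro integrable_mult_right integrable_real_indicator) (auto simp: emeasure_lborel_Icc_eq)
    show "AE x in lborel. (\<lambda>n. (indicator {a..b} x * (f x - g' n x))\<^sup>2) \<longlonglongrightarrow> 0"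
      using ae
    proof eventually_elim
      case (elim x)
      have "(\<lambda>n. g' n x) \<longlonglongrightarrow> max (- B) (min B (f x))"
        unfolding g'_def by (intro tendsto_intros lim elim)
      also have "max (- B) (min B (f x)) = f x" using f(2)[of x] by auto
      finally have "(\<lambda>n. (indicator {a..b} x * (f x - g' n x))\<^sup>2) \<longlonglongrightarrow> (indicator {a..b} x * (f x - f x))\<^sup>2"
        by (intro tendsto_intros)
      then show ?case by simp
    qed
    show "AE x in lborel. norm ((indicator {a..b} x * (f x - g' n x))\<^sup>2) \<le> (2 * B)\<^sup>2 * indicator {a..b} x" for n
    proof (intro AE_I2)
      fix x
      have "\<bar>f x - g' n x\<bar> \<le> 2 * B" using f(2)[of x] g'b[of n x] by linarith
      from power_mono[OF this abs_ge_zero, of 2]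
      show "norm ((indicator {a..b} x * (f x - g' n x))\<^sup>2) \<le> (2 * B)\<^sup>2 * indicator {a..b} x"
        by (auto split: split_indicator)
    qed
  qed measurable
  from order_tendstoD(2)[OF this, of e] \<open>0 < e\<close>
  obtain n where "(LBINT x. (indicator {a..b} x * (f x - g' n x))\<^sup>2) < e"
    by (auto simp: eventually_sequentially)
  then show ?thesis using that g'c g'b by blast
qed

theorem avg_step_converges:
  assumes ab: "a < b" and f: "f \<in> borel_measurable borel" "\<And>x. \<bar>f x\<bar> \<le> B"
  shows "(\<lambda>n. (LBINT x. (indicator {a..b} x * f x - avg_step a b n f x)\<^sup>2)) \<longlonglongrightarrow> 0"
proof (rule LIMSEQ_I)
  fix r :: real assume "0 < r"
  \<comment> \<open>The total error is at most \<open>8 * x + 2 * y\<close>, with \<open>x\<close>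
    the squared distance of \<open>f\<close> and \<open>g\<close> and \<open>y\<close> the grid
    error of \<open>g\<close>; this explains \<open>r / 16\<close> here and \<open>r / 4\<close>
    below.\<close>
  obtain g where g: "continuous_on UNIV g" "\<And>x. \<bar>g x\<bar> \<le> B"
    and fg: "(LBINT x. (indicator {a..b} x * (f x - g x))\<^sup>2) < r / 16"
    using continuous_L2_approx[OF f, of "r / 16" a b] \<open>0 < r\<close> by auto
  have gm [measurable]: "g \<in> borel_measurable borel" by (rule borel_measurable_continuous_onI[OF g(1)])
  note [measurable] = f(1)
  obtain N where N: "\<And>n. N \<le> n \<Longrightarrow> (LBINT x. (indicator {a..b} x * g x - avg_step a b n g x)\<^sup>2) < r / 4"
    using LIMSEQ_D[OF avg_step_continuous[OF ab g], of "r / 4"] \<open>0 < r\<close> by auto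
  have db: "\<bar>f x - g x\<bar> \<le> 2 * B" for x using f(2)[of x] g(2)[of x] by linarith
  have "norm ((LBINT x. (indicator {a..b} x * f x - avg_step a b n f x)\<^sup>2) - 0) < r" if "N \<le> n" for n
  proof -
    let ?d = "\<lambda>x. f x - g x"
    have d2: "(\<lambda>x. indicator {a..b} x * ?d x) \<in> L2 lborel" by (rule L2_indicator[where a=a and b=b, OF _ db]) auto
    have g2: "(\<lambda>x. indicator {a..b} x * g x) \<in> L2 lborel" by (rule L2_indicator[where a=a and b=b, OF _ g(2)]) auto
    have "(LBINT x. (indicator {a..b} x * f x - avg_step a b n f x)\<^sup>2)
        = (LBINT x. ((indicator {a..b} x * ?d x - avg_step a b n ?d x) + (indicator {a..b} x * g x - avg_step a b n g x))\<^sup>2)"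
      using avg_step_diff[OF less_imp_le[OF ab] f gm g(2), of n] by (simp add: algebra_simps)
    also have "\<dots> \<le> 2 * (LBINT x. (indicator {a..b} x * ?d x - avg_step a b n ?d x)\<^sup>2) + 2 * (LBINT x. (indicator {a..b} x * g x - avg_step a b n g x)\<^sup>2)"
      by (intro integral_sq_add_le L2_diff d2 g2 avg_step_L2)
    also have "(LBINT x. (indicator {a..b} x * ?d x - avg_step a b n ?d x)\<^sup>2)
       \<le> 2 * (LBINT x. (indicator {a..b} x * ?d x)\<^sup>2) + 2 * (LBINT x. (avg_step a b n ?d x)\<^sup>2)"
      using integral_sq_diff_le[OF d2 avg_step_L2 L2_zero] by simp
    also have "(LBINT x. (avg_step a b n ?d x)\<^sup>2) \<le> (LBINT x. (indicator {a..b} x * ?d x)\<^sup>2)"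
      by (rule avg_step_contraction[OF ab _ db]) simp
    finally show ?thesis using fg N[OF that] by simp
  qed
  then show "\<exists>no. \<forall>n\<ge>no. norm ((LBINT x. (indicator {a..b} x * f x - avg_step a b n f x)\<^sup>2) - 0) < r" by blast
qed

text \<open>A list of triples \<open>(c, s, t)\<close> stands for the formal sum of the \<open>c\<close>-multiples of the intervals
  \<open>(s, t]\<close>, which is read both as a step function and as an elementary stochastic integral.\<close>

definition step_fun :: "(real \<times> real \<times> real) list \<Rightarrow> real \<Rightarrow> real" where
  "step_fun xs u = (\<Sum>(c, s, t)\<leftarrow>xs. c * indicator {s<..t} u)"

definition step_integral :: "(real \<Rightarrow> 'a \<Rightarrow> real) \<Rightarrow> (real \<times> real \<times> real) list \<Rightarrow> 'a \<Rightarrow> real" where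
  "step_integral W xs w = (\<Sum>(c, s, t)\<leftarrow>xs. c * (W t w - W s w))"

definition steps_in :: "real \<Rightarrow> (real \<times> real \<times> real) list \<Rightarrow> bool" where
  "steps_in T xs \<longleftrightarrow> (\<forall>(c, s, t)\<in>set xs. 0 \<le> s \<and> s \<le> t \<and> t \<le> T)"

lemma step_simps:
  "step_fun [] u = 0" "step_fun ((c, s, t) # xs) u = c * indicator {s<..t} u + step_fun xs u"
  "step_integral W [] w = 0" "step_integral W ((c, s, t) # xs) w = c * (W t w - W s w) + step_integral W xs w"
  "steps_in T []" "steps_in T ((c, s, t) # xs) \<longleftrightarrow> 0 \<le> s \<and> s \<le> t \<and> t \<le> T \<and> steps_in T xs"
  by (auto simp: step_fun_def step_integral_def steps_in_def)

lemma step_append: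
  "step_fun (xs @ ys) u = step_fun xs u + step_fun ys u"
  "step_integral W (xs @ ys) w = step_integral W xs w + step_integral W ys w"
  "steps_in T (xs @ ys) \<longleftrightarrow> steps_in T xs \<and> steps_in T ys"
  by (simp_all add: step_fun_def step_integral_def steps_in_def ball_Un)

definition step_scale :: "real \<Rightarrow> (real \<times> real \<times> real) list \<Rightarrow> (real \<times> real \<times> real) list" where
  "step_scale d xs = map (\<lambda>(c, s, t). (d * c, s, t)) xs"

lemma step_scale:
  "step_fun (step_scale d xs) u = d * step_fun xs u"
  "step_integral W (step_scale d xs) w = d * step_integral W xs w"
  "steps_in T (step_scale d xs) \<longleftrightarrow> steps_in T xs"
  unfolding step_scale_def
  by (induction xs) (auto simp: step_simps algebra_simps)

definition partition_steps :: "nat \<Rightarrow> (nat \<Rightarrow> real) \<Rightarrow> (nat \<Rightarrow> real) \<Rightarrow> (real \<times> real \<times> real) list" where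
  "partition_steps m p c = map (\<lambda>i. (c i, p i, p (Suc i))) [0..<m]"

lemma partition_steps:
  "step_fun (partition_steps m p c) u = (\<Sum>i<m. c i * indicator {p i<..p (Suc i)} u)"
  "step_integral W (partition_steps m p c) w = (\<Sum>i<m. c i * (W (p (Suc i)) w - W (p i) w))"
  "(\<And>i. i < m \<Longrightarrow> p i \<le> p (Suc i)) \<Longrightarrow> 0 \<le> p 0 \<Longrightarrow> p m \<le> T \<Longrightarrow> steps_in T (partition_steps m p c)"
proof -
  show "step_fun (partition_steps m p c) u = (\<Sum>i<m. c i * indicator {p i<..p (Suc i)} u)"
    by (simp add: partition_steps_def step_fun_def comp_def interv_sum_list_conv_sum_set_nat atLeast0LessThan)
  show "step_integral W (partition_steps m p c) w = (\<Sum>i<m. c i * (W (p (Suc i)) w - W (p i) w))"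
    by (simp add: partition_steps_def step_integral_def comp_def interv_sum_list_conv_sum_set_nat atLeast0LessThan)
  assume p: "\<And>i. i < m \<Longrightarrow> p i \<le> p (Suc i)" "0 \<le> p 0" "p m \<le> T"
  have "0 \<le> p i \<and> p (Suc i) \<le> T" if "i < m" for i
    using cell_mono[of m p 0 i, OF p(1)] cell_mono[of m p "Suc i" m, OF p(1)] p that by auto
  then show "steps_in T (partition_steps m p c)"
    using p by (auto simp: partition_steps_def steps_in_def)
qed

lemma step_fun_L2: "step_fun xs \<in> L2 lborel"
proof (induction xs)
  case (Cons x xs)
  obtain c s t where [simp]: "x = (c, s, t)" by (cases x)
  have "(\<lambda>u. c * indicator {s<..t} u + step_fun xs u) \<in> L2 lborel"
    by (intro L2_add L2_scale indicator_Ioc_L2 Cons)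
  then show ?case by (simp add: step_simps(2)[abs_def])
qed (simp add: step_simps(1)[abs_def] L2_zero)

section \<open>The isometry and the closure of the elementary integrals\<close>

locale orthogonal_increments = prob_space M for M :: "'a measure" +
  fixes T :: real and W :: "real \<Rightarrow> 'a \<Rightarrow> real"
  assumes T_ge: "0 \<le> T"
    and W_L2: "\<And>t. t \<in> {0..T} \<Longrightarrow> W t \<in> L2 M"
    and W_var: "\<And>s t. 0 \<le> s \<Longrightarrow> s \<le> t \<Longrightarrow> t \<le> T \<Longrightarrow> (LINT w|M. (W t w - W s w)\<^sup>2) = t - s"
begin

lemma increment_L2: "0 \<le> s \<Longrightarrow> s \<le> t \<Longrightarrow> t \<le> T \<Longrightarrow> (\<lambda>w. W t w - W s w) \<in> L2 M"
  by (intro L2_diff W_L2) auto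

lemma increment_var: "s \<in> {0..T} \<Longrightarrow> t \<in> {0..T} \<Longrightarrow> (LINT w|M. (W t w - W s w)\<^sup>2) = \<bar>t - s\<bar>"
  using W_var[of s t] W_var[of t s] by (cases "s \<le> t") (auto simp: power2_commute)

text \<open>Twice the product of two increments is an alternating sum of four squared increments, so
  the variances alone determine all covariances. The resulting combination of distances is twice the
  length of the overlap of the intervals.\<close>

lemma increment_cov:
  assumes st: "0 \<le> s" "s \<le> t" "t \<le> T" and uv: "0 \<le> u" "u \<le> v" "v \<le> T"
  shows "(LINT w|M. (W t w - W s w) * (W v w - W u w)) = (LBINT x. indicator {s<..t} x * indicator {u<..v} x)"
proof -
  have "(LINT w|M. (W t w - W s w) * (W v w - W u w))
     = (LINT w|M. ((W t w - W u w)\<^sup>2 + (W s w - W v w)\<^sup>2 - (W t w - W v w)\<^sup>2 - (W s w - W u w)\<^sup>2) / 2)"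
    by (intro Bochner_Integration.integral_cong) (auto simp: power2_eq_square algebra_simps)
  also have "\<dots> = ((LINT w|M. (W t w - W u w)\<^sup>2) + (LINT w|M. (W s w - W v w)\<^sup>2)
      - (LINT w|M. (W t w - W v w)\<^sup>2) - (LINT w|M. (W s w - W u w)\<^sup>2)) / 2"
    using st uv by (simp add: L2_integrable_sq L2_diff W_L2)
  also have "\<dots> = (\<bar>t - u\<bar> + \<bar>s - v\<bar> - \<bar>t - v\<bar> - \<bar>s - u\<bar>) / 2"
    using st uv by (simp add: increment_var)
  also have "\<dots> = (LBINT x. indicator {max s u<..min t v} x)"
  proof (cases "max s u \<le> min t v")
    case True
    then show ?thesis using st uv by (simp add: max_def min_def abs_if split: if_splits)
  next
    case False
    then have "{max s u<..min t v} = {}" by auto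
    then have "(LBINT x. indicator {max s u<..min t v} x) = (0::real)" by (simp only:) simp
    then show ?thesis using False st uv by (simp only:) (simp add: max_def min_def abs_if split: if_splits)
  qed
  also have "\<dots> = (LBINT x. indicator {s<..t} x * indicator {u<..v} x)"
    by (intro Bochner_Integration.integral_cong) (auto split: split_indicator)
  finally show ?thesis .
qed

lemma step_integral_L2: "steps_in T xs \<Longrightarrow> step_integral W xs \<in> L2 M"
proof (induction xs)
  case (Cons x xs)
  obtain c s t where [simp]: "x = (c, s, t)" by (cases x)
  have "(\<lambda>w. c * (W t w - W s w) + step_integral W xs w) \<in> L2 M"
    using Cons by (intro L2_add L2_scale increment_L2 Cons) (auto simp: step_simps)
  then show ?case by (simp add: step_simps(4)[abs_def])
qed (simp add: step_simps(3)[abs_def] L2_zero)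

lemma step_isometry:
  assumes "steps_in T xs" "steps_in T ys"
  shows "(LINT w|M. step_integral W xs w * step_integral W ys w) = (LBINT u. step_fun xs u * step_fun ys u)"
  using assms(1)
proof (induction xs)
  case (Cons x xs)
  obtain c s t where [simp]: "x = (c, s, t)" by (cases x)
  have st: "0 \<le> s" "s \<le> t" "t \<le> T" "steps_in T xs" using Cons.prems by (auto simp: step_simps)
  have one: "(LINT w|M. (W t w - W s w) * step_integral W ys w) = (LBINT u. indicator {s<..t} u * step_fun ys u)"
    using assms(2)
  proof (induction ys)
    case (Cons y ys)
    obtain d u v where [simp]: "y = (d, u, v)" by (cases y)
    have uv: "0 \<le> u" "u \<le> v" "v \<le> T" "steps_in T ys" using Cons.prems by (auto simp: step_simps)
    have "(LINT w|M. (W t w - W s w) * step_integral W (y # ys) w)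
       = (LINT w|M. d * ((W t w - W s w) * (W v w - W u w)) + (W t w - W s w) * step_integral W ys w)"
      by (simp add: step_simps algebra_simps)
    also have "\<dots> = d * (LBINT x. indicator {s<..t} x * indicator {u<..v} x) + (LBINT u. indicator {s<..t} u * step_fun ys u)"
      using L2_mult_integrable[OF increment_L2[OF st(1-3)] increment_L2[OF uv(1-3)]]
        L2_mult_integrable[OF increment_L2[OF st(1-3)] step_integral_L2[OF uv(4)]]
      by (simp add: increment_cov[OF st(1-3) uv(1-3)] Cons.IH[OF uv(4)])
    also have "\<dots> = (LBINT x. d * (indicator {s<..t} x * indicator {u<..v} x) + indicator {s<..t} x * step_fun ys x)"
      using L2_mult_integrable[OF indicator_Ioc_L2 indicator_Ioc_L2, of s t u v] L2_mult_integrable[OF indicator_Ioc_L2 step_fun_L2, of s t ys]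
      by simp
    finally show ?case by (simp add: step_simps algebra_simps)
  qed (simp add: step_simps)
  have "(LINT w|M. step_integral W (x # xs) w * step_integral W ys w)
     = (LINT w|M. c * ((W t w - W s w) * step_integral W ys w) + step_integral W xs w * step_integral W ys w)"
    by (simp add: step_simps algebra_simps)
  also have "\<dots> = c * (LBINT u. indicator {s<..t} u * step_fun ys u) + (LBINT u. step_fun xs u * step_fun ys u)"
    using L2_mult_integrable[OF increment_L2[OF st(1-3)] step_integral_L2[OF assms(2)]]
      L2_mult_integrable[OF step_integral_L2[OF st(4)] step_integral_L2[OF assms(2)]]
    by (simp add: one Cons.IH[OF st(4)])
  also have "\<dots> = (LBINT u. c * (indicator {s<..t} u * step_fun ys u) + step_fun xs u * step_fun ys u)"
    using L2_mult_integrable[OF indicator_Ioc_L2 step_fun_L2, of s t ys] L2_mult_integrable[OF step_fun_L2 step_fun_L2, of xs ys]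
    by simp
  finally show ?case by (simp add: step_simps algebra_simps)
qed (simp add: step_simps)

text \<open>The closure of the elementary integrals: \<open>N\<close> is the integral of \<open>f\<close> over the whole line.\<close>

definition wiener_rel :: "(real \<Rightarrow> real) \<Rightarrow> ('a \<Rightarrow> real) \<Rightarrow> bool" where
  "wiener_rel f N \<longleftrightarrow> f \<in> L2 lborel \<and> N \<in> L2 M \<and>
     (\<exists>xs. (\<forall>n. steps_in T (xs n)) \<and> (\<lambda>n::nat. (LBINT u. (step_fun (xs n) u - f u)\<^sup>2)) \<longlonglongrightarrow> 0
        \<and> (\<lambda>n. (LINT w|M. (step_integral W (xs n) w - N w)\<^sup>2)) \<longlonglongrightarrow> 0)"

lemma wiener_rel_L2: "wiener_rel f N \<Longrightarrow> f \<in> L2 lborel" "wiener_rel f N \<Longrightarrow> N \<in> L2 M"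
  by (auto simp: wiener_rel_def)

lemma wiener_relE:
  assumes "wiener_rel f N"
  obtains xs where "\<And>n::nat. steps_in T (xs n)" "(\<lambda>n. (LBINT u. (step_fun (xs n) u - f u)\<^sup>2)) \<longlonglongrightarrow> 0"
    "(\<lambda>n. (LINT w|M. (step_integral W (xs n) w - N w)\<^sup>2)) \<longlonglongrightarrow> 0"
  using assms unfolding wiener_rel_def by blast

lemma wiener_isometry:
  assumes "wiener_rel f N" "wiener_rel g N'"
  shows "(LINT w|M. N w * N' w) = (LBINT u. f u * g u)"
proof -
  obtain xs where xs: "\<And>n::nat. steps_in T (xs n)" "(\<lambda>n. (LBINT u. (step_fun (xs n) u - f u)\<^sup>2)) \<longlonglongrightarrow> 0"
    "(\<lambda>n. (LINT w|M. (step_integral W (xs n) w - N w)\<^sup>2)) \<longlonglongrightarrow> 0" using wiener_relE[OF assms(1)] by blast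
  obtain ys where ys: "\<And>n::nat. steps_in T (ys n)" "(\<lambda>n. (LBINT u. (step_fun (ys n) u - g u)\<^sup>2)) \<longlonglongrightarrow> 0"
    "(\<lambda>n. (LINT w|M. (step_integral W (ys n) w - N' w)\<^sup>2)) \<longlonglongrightarrow> 0" using wiener_relE[OF assms(2)] by blast
  have "(\<lambda>n. (LINT w|M. step_integral W (xs n) w * step_integral W (ys n) w)) \<longlonglongrightarrow> (LINT w|M. N w * N' w)"
    by (intro L2_tendsto_integral_mult step_integral_L2 xs ys wiener_rel_L2(2)[OF assms(1)] wiener_rel_L2(2)[OF assms(2)])
  moreover have "(\<lambda>n. (LBINT u. step_fun (xs n) u * step_fun (ys n) u)) \<longlonglongrightarrow> (LBINT u. f u * g u)"
    by (intro L2_tendsto_integral_mult step_fun_L2 xs ys wiener_rel_L2(1)[OF assms(1)] wiener_rel_L2(1)[OF assms(2)])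
  ultimately show ?thesis
    using step_isometry[OF xs(1) ys(1)] by (simp add: LIMSEQ_unique)
qed

lemma wiener_rel_steps: "steps_in T xs \<Longrightarrow> wiener_rel (step_fun xs) (step_integral W xs)"
  unfolding wiener_rel_def by (auto intro!: step_fun_L2 step_integral_L2 exI[of _ "\<lambda>_. xs"])

lemma sq_sum_tendsto_zero:
  assumes "\<And>n. f n \<in> L2 N" "f' \<in> L2 N" "\<And>n. g n \<in> L2 N" "g' \<in> L2 N"
    and "(\<lambda>n. \<integral>x. (f n x - f' x)\<^sup>2 \<partial>N) \<longlonglongrightarrow> 0" "(\<lambda>n. \<integral>x. (g n x - g' x)\<^sup>2 \<partial>N) \<longlonglongrightarrow> 0"
  shows "(\<lambda>n::nat. \<integral>x. ((f n x + g n x) - (f' x + g' x))\<^sup>2 \<partial>N) \<longlonglongrightarrow> 0"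
proof (rule tendsto_sandwich[OF _ _ tendsto_const])
  show "\<forall>\<^sub>F n in sequentially. (\<integral>x. ((f n x + g n x) - (f' x + g' x))\<^sup>2 \<partial>N)
     \<le> 2 * (\<integral>x. (f n x - f' x)\<^sup>2 \<partial>N) + 2 * (\<integral>x. (g n x - g' x)\<^sup>2 \<partial>N)"
  proof (intro always_eventually allI)
    fix n
    show "(\<integral>x. ((f n x + g n x) - (f' x + g' x))\<^sup>2 \<partial>N)
     \<le> 2 * (\<integral>x. (f n x - f' x)\<^sup>2 \<partial>N) + 2 * (\<integral>x. (g n x - g' x)\<^sup>2 \<partial>N)"
      using integral_sq_add_le[OF L2_diff[OF assms(1)[of n] assms(2)] L2_diff[OF assms(3)[of n] assms(4)]]
      by (simp add: algebra_simps)
  qed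
  show "(\<lambda>n. 2 * (\<integral>x. (f n x - f' x)\<^sup>2 \<partial>N) + 2 * (\<integral>x. (g n x - g' x)\<^sup>2 \<partial>N)) \<longlonglongrightarrow> 0"
    by (intro tendsto_add_zero tendsto_mult_right_zero assms)
qed auto

lemma wiener_rel_add:
  assumes "wiener_rel f N" "wiener_rel g N'"
  shows "wiener_rel (\<lambda>u. f u + g u) (\<lambda>w. N w + N' w)"
proof -
  obtain xs where xs: "\<And>n::nat. steps_in T (xs n)" "(\<lambda>n. (LBINT u. (step_fun (xs n) u - f u)\<^sup>2)) \<longlonglongrightarrow> 0"
    "(\<lambda>n. (LINT w|M. (step_integral W (xs n) w - N w)\<^sup>2)) \<longlonglongrightarrow> 0" using wiener_relE[OF assms(1)] by blast
  obtain ys where ys: "\<And>n::nat. steps_in T (ys n)" "(\<lambda>n. (LBINT u. (step_fun (ys n) u - g u)\<^sup>2)) \<longlonglongrightarrow> 0"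
    "(\<lambda>n. (LINT w|M. (step_integral W (ys n) w - N' w)\<^sup>2)) \<longlonglongrightarrow> 0" using wiener_relE[OF assms(2)] by blast
  note L = wiener_rel_L2[OF assms(1)] wiener_rel_L2[OF assms(2)]
  show ?thesis
    unfolding wiener_rel_def
    using sq_sum_tendsto_zero[OF step_fun_L2 L(1) step_fun_L2 L(3) xs(2) ys(2)]
      sq_sum_tendsto_zero[OF step_integral_L2[OF xs(1)] L(2) step_integral_L2[OF ys(1)] L(4) xs(3) ys(3)]
    by (intro conjI L2_add L exI[of _ "\<lambda>n. xs n @ ys n"]) (auto simp: step_append xs ys)
qed

lemma wiener_rel_scale:
  assumes "wiener_rel f N" shows "wiener_rel (\<lambda>u. c * f u) (\<lambda>w. c * N w)"
proof -
  obtain xs where xs: "\<And>n::nat. steps_in T (xs n)" "(\<lambda>n. (LBINT u. (step_fun (xs n) u - f u)\<^sup>2)) \<longlonglongrightarrow> 0"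
    "(\<lambda>n. (LINT w|M. (step_integral W (xs n) w - N w)\<^sup>2)) \<longlonglongrightarrow> 0" using wiener_relE[OF assms(1)] by blast
  note L = wiener_rel_L2[OF assms(1)]
  show ?thesis
    unfolding wiener_rel_def
    using tendsto_mult_right_zero[OF xs(2), of "c\<^sup>2"] tendsto_mult_right_zero[OF xs(3), of "c\<^sup>2"]
    by (intro conjI L2_scale L exI[of _ "\<lambda>n. step_scale c (xs n)"])
      (auto simp: step_scale xs right_diff_distrib[symmetric] power_mult_distrib)
qed

lemma wiener_rel_diff:
  "wiener_rel f N \<Longrightarrow> wiener_rel g N' \<Longrightarrow> wiener_rel (\<lambda>u. f u - g u) (\<lambda>w. N w - N' w)"
  using wiener_rel_add[of f N "\<lambda>u. - 1 * g u" "\<lambda>w. - 1 * N' w"] wiener_rel_scale[of g N' "- 1"] by simp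

lemma wiener_rel_norm: "wiener_rel f N \<Longrightarrow> (LINT w|M. (N w)\<^sup>2) = (LBINT u. (f u)\<^sup>2)"
  using wiener_isometry[of f N f N] by (simp add: power2_eq_square)

lemma wiener_rel_unique:
  assumes "wiener_rel f N" "wiener_rel g N'" "AE u in lborel. f u = g u"
  shows "AE w in M. N w = N' w"
proof -
  have "(LINT w|M. (N w - N' w)\<^sup>2) = (LBINT u. (f u - g u)\<^sup>2)"
    by (rule wiener_rel_norm[OF wiener_rel_diff[OF assms(1,2)]])
  also have "\<dots> = 0" by (rule integral_eq_zero_AE) (use assms(3) in \<open>auto elim: eventually_mono\<close>)
  finally have "AE w in M. N w - N' w = 0"
    by (intro integral_sq_zero_AE L2_diff wiener_rel_L2(2)[OF assms(1)] wiener_rel_L2(2)[OF assms(2)])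
  then show ?thesis by simp
qed

lemma wiener_rel_orthogonal:
  assumes N: "wiener_rel f N" and \<psi>: "\<psi> \<in> L2 M"
    and orth: "\<And>s t. 0 \<le> s \<Longrightarrow> s \<le> t \<Longrightarrow> t \<le> T \<Longrightarrow> (LINT w|M. (W t w - W s w) * \<psi> w) = 0"
  shows "(LINT w|M. N w * \<psi> w) = 0"
proof -
  obtain xs where xs: "\<And>n::nat. steps_in T (xs n)" "(\<lambda>n. (LBINT u. (step_fun (xs n) u - f u)\<^sup>2)) \<longlonglongrightarrow> 0"
    "(\<lambda>n. (LINT w|M. (step_integral W (xs n) w - N w)\<^sup>2)) \<longlonglongrightarrow> 0" using wiener_relE[OF N] by blast
  have "(LINT w|M. step_integral W ys w * \<psi> w) = 0" if "steps_in T ys" for ys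
    using that
  proof (induction ys)
    case (Cons y ys)
    obtain d u v where [simp]: "y = (d, u, v)" by (cases y)
    have uv: "0 \<le> u" "u \<le> v" "v \<le> T" "steps_in T ys" using Cons.prems by (auto simp: step_simps)
    have "(LINT w|M. step_integral W (y # ys) w * \<psi> w)
       = (LINT w|M. d * ((W v w - W u w) * \<psi> w) + step_integral W ys w * \<psi> w)"
      by (simp add: step_simps algebra_simps)
    also have "\<dots> = 0"
      using L2_mult_integrable[OF increment_L2[OF uv(1-3)] \<psi>] L2_mult_integrable[OF step_integral_L2[OF uv(4)] \<psi>]
      by (simp add: orth[OF uv(1-3)] Cons.IH[OF uv(4)])
    finally show ?case .
  qed (simp add: step_simps)
  then have "(\<lambda>n. (LINT w|M. step_integral W (xs n) w * \<psi> w)) \<longlonglongrightarrow> 0" using xs by simp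
  moreover have "(\<lambda>n. (LINT w|M. step_integral W (xs n) w * \<psi> w)) \<longlonglongrightarrow> (LINT w|M. N w * \<psi> w)"
    by (intro L2_tendsto_integral_mult_right step_integral_L2 xs wiener_rel_L2(2)[OF N] \<psi>)
  ultimately show ?thesis by (metis LIMSEQ_unique)
qed

lemma wiener_rel_in_subspace:
  assumes N: "wiener_rel f N" and V: "closed_subspace M V"
    and inc: "\<And>s t. 0 \<le> s \<Longrightarrow> s \<le> t \<Longrightarrow> t \<le> T \<Longrightarrow> (\<lambda>w. W t w - W s w) \<in> V"
  shows "N \<in> V"
proof -
  obtain xs where xs: "\<And>n::nat. steps_in T (xs n)" "(\<lambda>n. (LBINT u. (step_fun (xs n) u - f u)\<^sup>2)) \<longlonglongrightarrow> 0"
    "(\<lambda>n. (LINT w|M. (step_integral W (xs n) w - N w)\<^sup>2)) \<longlonglongrightarrow> 0" using wiener_relE[OF N] by blast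
  have "step_integral W ys \<in> V" if "steps_in T ys" for ys
    using that
  proof (induction ys)
    case Nil
    then show ?case using closed_subspace_zero[OF V] by (simp add: step_simps(3)[abs_def])
  next
    case (Cons y ys)
    obtain d u v where [simp]: "y = (d, u, v)" by (cases y)
    have "(\<lambda>w. d * (W v w - W u w) + step_integral W ys w) \<in> V"
      using Cons by (intro closed_subspace_add[OF V] closed_subspace_scale[OF V] inc) (auto simp: step_simps)
    then show ?case by (simp add: step_simps(4)[abs_def])
  qed
  then show ?thesis using closed_subspace_limit[OF V wiener_rel_L2(2)[OF N] _ xs(3)] xs(1) by blast
qed

text \<open>The cells of the partitions lie in \<open>{a..b}\<close>, so the step functions vanish
  outside and integrals over \<open>{a..b}\<close> become integrals over the line with
  \<open>f\<close> cut off.\<close>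

lemma has_wiener_integral_imp_rel:
  assumes "has_wiener_integral M W a b f J" and ab: "0 \<le> a" "a \<le> b" "b \<le> T"
  shows "wiener_rel (\<lambda>x. indicator {a..b} x * f x) J"
proof -
  obtain n p c where p: "\<And>k. p k 0 = a \<and> p k (n k) = b \<and> (\<forall>i<n k. p k i \<le> p k (Suc i))"
    and l1: "(\<lambda>k::nat. LBINT s:{a..b}. (f s - (\<Sum>i<n k. c k i * indicator {p k i<..p k (Suc i)} s))\<^sup>2) \<longlonglongrightarrow> 0"
    and l2: "(\<lambda>k. (LINT w|M. (J w - (\<Sum>i<n k. c k i * (W (p k (Suc i)) w - W (p k i) w)))\<^sup>2)) \<longlonglongrightarrow> 0"
    using assms(1) unfolding has_wiener_integral_def by blast
  have pm: "p k i \<le> p k (Suc i)" if "i < n k" for k i using p that by blast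
  have p0: "p k 0 = a" and pn: "p k (n k) = b" for k using p by blast+
  define xs where "xs k = partition_steps (n k) (p k) (c k)" for k
  have "(LBINT s:{a..b}. (f s - (\<Sum>i<n k. c k i * indicator {p k i<..p k (Suc i)} s))\<^sup>2)
      = (LBINT s. (step_fun (xs k) s - indicator {a..b} s * f s)\<^sup>2)" for k
  proof -
    have "step_fun (xs k) s = 0" if "s \<notin> {a..b}" for s
      unfolding xs_def partition_steps
    proof (rule sum.neutral, safe)
      fix i assume i: "i < n k"
      have "p k 0 \<le> p k i" "p k (Suc i) \<le> p k (n k)" 
        using cell_mono[of "n k" "p k" 0 i, OF pm] cell_mono[of "n k" "p k" "Suc i" "n k", OF pm] i by simp_all
      then show "c k i * indicat_real {p k i<..p k (Suc i)} s = 0" using that by (auto simp: p0 pn)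
    qed
    then show ?thesis
      unfolding set_lebesgue_integral_def xs_def[symmetric] partition_steps(1)[symmetric]
      by (intro Bochner_Integration.integral_cong) (auto split: split_indicator simp: power2_commute)
  qed
  with l1 have l1': "(\<lambda>k. (LBINT s. (step_fun (xs k) s - indicator {a..b} s * f s)\<^sup>2)) \<longlonglongrightarrow> 0" by simp
  have l2': "(\<lambda>k. (LINT w|M. (step_integral W (xs k) w - J w)\<^sup>2)) \<longlonglongrightarrow> 0"
    using l2 by (simp add: xs_def partition_steps power2_commute)
  have "(\<lambda>x. indicator {a..b} x * f x) \<in> L2 lborel"
  proof (rule L2I)
    show "(\<lambda>x. indicator {a..b} x * f x) \<in> borel_measurable lborel"
      using assms(1) by (simp add: has_wiener_integral_def set_borel_measurable_def)
    have "(\<lambda>x. (indicator {a..b} x * f x)\<^sup>2) = (\<lambda>x. indicator {a..b} x *\<^sub>R (f x)\<^sup>2)"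
      by (auto split: split_indicator)
    then show "integrable lborel (\<lambda>x. (indicator {a..b} x * f x)\<^sup>2)"
      using assms(1) by (simp add: has_wiener_integral_def set_integrable_def)
  qed
  moreover have "J \<in> L2 M" using assms(1) by (auto simp: has_wiener_integral_def intro: L2I)
  moreover have "steps_in T (xs k)" for k
    unfolding xs_def using ab by (intro partition_steps(3) pm) (auto simp: p0 pn)
  ultimately show ?thesis unfolding wiener_rel_def using l1' l2' by (intro conjI exI[of _ xs]) auto
qed

lemma avg_step_list: "step_fun (partition_steps (Suc n) (ugrid a b n) (avg_coeff a b n f)) = avg_step a b n f"
  by (rule ext) (simp only: partition_steps avg_step_def)

lemma avg_steps_in: "0 \<le> a \<Longrightarrow> a \<le> b \<Longrightarrow> b \<le> T \<Longrightarrow> steps_in T (partition_steps (Suc n) (ugrid a b n) c)"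
  by (intro partition_steps) (auto intro: ugrid_mono)

text \<open>The closure admits arbitrary lists of intervals, whereas
  \<open>has_wiener_integral\<close> asks for partitions of \<open>{a..b}\<close>. The grid averages
  of \<open>f\<close> provide these, and by the isometry their integrals converge to
  \<open>J\<close> as fast as the step functions converge to \<open>f\<close>.\<close>

lemma rel_imp_has_wiener_integral:
  assumes rel: "wiener_rel (\<lambda>x. indicator {a..b} x * f x) J" and ab: "0 \<le> a" "a \<le> b" "b \<le> T"
    and f: "f \<in> borel_measurable borel" "\<And>x. \<bar>f x\<bar> \<le> B"
  shows "has_wiener_integral M W a b f J"
proof -
  note [measurable] = f(1)
  have sbm: "set_borel_measurable borel {a..b} f" unfolding set_borel_measurable_def by measurable
  have sq: "(\<lambda>x. (indicator {a..b} x * f x)\<^sup>2) = (\<lambda>x. indicator {a..b} x *\<^sub>R (f x)\<^sup>2)"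
    by (auto split: split_indicator)
  have si: "set_integrable lborel {a..b} (\<lambda>s. (f s)\<^sup>2)"
    using L2_integrable_sq[OF wiener_rel_L2(1)[OF rel]] unfolding sq by (simp add: set_integrable_def)
  have J: "J \<in> borel_measurable M" "integrable M (\<lambda>w. (J w)\<^sup>2)"
    using wiener_rel_L2(2)[OF rel] by (auto dest: L2_measurable L2_integrable_sq)
  have grid: "\<forall>k. ugrid a b k 0 = a \<and> ugrid a b k (Suc k) = b \<and> (\<forall>i<Suc k. ugrid a b k i \<le> ugrid a b k (Suc i))"
    using ab by (auto intro: ugrid_mono)
  have lim: "(\<lambda>k. (LBINT s. (indicator {a..b} s * f s - avg_step a b k f s)\<^sup>2)) \<longlonglongrightarrow> 0"
  proof (cases "a < b")
    case True then show ?thesis by (rule avg_step_converges[OF _ f])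
  next
    \<comment> \<open>For \<open>a = b\<close> all cells are empty and the integrand is supported at
      one point, so both sides vanish.\<close>
    case False
    then have [simp]: "b = a" using ab by simp
    have "avg_step a b k f s = 0" for k s
      unfolding avg_step_def by (rule sum.neutral) (auto simp: ugrid_def)
    moreover have "(LBINT s. (indicator {a..a} s * f s)\<^sup>2) = 0"
      by (rule integral_eq_zero_AE) (use AE_lborel_singleton[of a] in \<open>auto elim!: eventually_mono\<close>)
    ultimately show ?thesis by simp
  qed
  have out: "avg_step a b k f s = 0" if "s \<notin> {a..b}" for k s
    using ab that by (intro avg_step_outside) auto
  have l1: "(\<lambda>k. LBINT s:{a..b}. (f s - (\<Sum>i<Suc k. avg_coeff a b k f i * indicat_real {ugrid a b k i<..ugrid a b k (Suc i)} s))\<^sup>2) \<longlonglongrightarrow> 0"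
  proof -
    have "(LBINT s:{a..b}. (f s - avg_step a b k f s)\<^sup>2) = (LBINT s. (indicator {a..b} s * f s - avg_step a b k f s)\<^sup>2)" for k
      unfolding set_lebesgue_integral_def
      by (intro Bochner_Integration.integral_cong) (auto simp: out split: split_indicator)
    then show ?thesis using lim unfolding avg_step_def by simp
  qed
  have l2: "(\<lambda>k. (LINT w|M. (J w - (\<Sum>i<Suc k. avg_coeff a b k f i * (W (ugrid a b k (Suc i)) w - W (ugrid a b k i) w)))\<^sup>2)) \<longlonglongrightarrow> 0"
  proof -
    have "(LINT w|M. (J w - step_integral W (partition_steps (Suc k) (ugrid a b k) (avg_coeff a b k f)) w)\<^sup>2)
       = (LBINT s. (indicator {a..b} s * f s - avg_step a b k f s)\<^sup>2)" for k
      unfolding avg_step_list[symmetric] using ab by (intro wiener_rel_norm wiener_rel_diff rel wiener_rel_steps avg_steps_in)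
    then show ?thesis using lim by (simp only: partition_steps)
  qed
  show ?thesis
    unfolding has_wiener_integral_def
    by (intro conjI sbm si J, rule exI[of _ Suc], rule exI[of _ "ugrid a b"],
        rule exI[of _ "\<lambda>k. avg_coeff a b k f"], intro conjI grid l1 l2)
qed

text \<open>The grid averages depend measurably on \<open>s\<close>, and a fixed grid involves
  finitely many values of \<open>W\<close>; thus the elementary integrals are jointly measurable.
  They are Cauchy for each \<open>s\<close> by the isometry, and \<open>L2_complete_param\<close>
  yields a jointly measurable limit.\<close>

theorem measurable_wiener_version:
  fixes l :: "real \<Rightarrow> real \<Rightarrow> real"
  assumes T: "0 < T" and l: "(\<lambda>x. l (fst x) (snd x)) \<in> borel_measurable (borel \<Otimes>\<^sub>M borel)" "\<And>s u. \<bar>l s u\<bar> \<le> B"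
  obtains Z where "(\<lambda>(s, w). Z s w) \<in> borel_measurable (borel \<Otimes>\<^sub>M M)"
    "\<And>s. wiener_rel (\<lambda>u. indicator {0..T} u * l s u) (Z s)"
proof -
  note [measurable] = l(1)
  have ls [measurable]: "l s \<in> borel_measurable borel" for s using measurable_Pair2[OF l(1), of s] by simp
  define xs where "xs n s = partition_steps (Suc n) (ugrid 0 T n) (avg_coeff 0 T n (l s))" for n s
  define Z where "Z n s = step_integral W (xs n s)" for n s
  have xs: "steps_in T (xs n s)" for n s unfolding xs_def using T by (intro avg_steps_in) auto
  have sf: "step_fun (xs n s) = avg_step 0 T n (l s)" for n s unfolding xs_def by (rule avg_step_list)
  have Zm: "(\<lambda>(s, w). Z n s w) \<in> borel_measurable (borel \<Otimes>\<^sub>M M)" for n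
  proof -
    have [measurable]: "(\<lambda>s. avg_coeff 0 T n (l s) i) \<in> borel_measurable borel" for i
    proof -
      have "(\<lambda>s. (LBINT x. indicator {ugrid 0 T n i<..ugrid 0 T n (Suc i)} x * l s x)) \<in> borel_measurable borel"
        by (rule lborel.borel_measurable_lebesgue_integral) (unfold case_prod_beta', measurable)
      then show ?thesis unfolding avg_coeff_def by measurable
    qed
    have Wm: "W (ugrid 0 T n i) \<in> borel_measurable M" if "i \<le> Suc n" for i
      using ugrid_bounds[of 0 T i n] T that by (intro L2_measurable W_L2) auto
    show ?thesis
      unfolding Z_def xs_def partition_steps case_prod_beta'
    proof (rule borel_measurable_sum)
      fix i assume i: "i \<in> {..<Suc n}"
      have [measurable]: "W (ugrid 0 T n i) \<in> borel_measurable M" "W (ugrid 0 T n (Suc i)) \<in> borel_measurable M"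
        using i by (auto intro!: Wm)
      show "(\<lambda>x. avg_coeff 0 T n (l (fst x)) i * (W (ugrid 0 T n (Suc i)) (snd x) - W (ugrid 0 T n i) (snd x))) \<in> borel_measurable (borel \<Otimes>\<^sub>M M)"
        by measurable
    qed
  qed
  have Z2: "Z n s \<in> L2 M" for n s unfolding Z_def by (rule step_integral_L2[OF xs])
  let ?l = "\<lambda>s u. indicator {0..T} u * l s u"
  have l2: "?l s \<in> L2 lborel" for s by (rule L2_indicator[where a=0 and b=T, OF _ l(2)]) auto
  have lim: "(\<lambda>n. (LBINT u. (avg_step 0 T n (l s) u - ?l s u)\<^sup>2)) \<longlonglongrightarrow> 0" for s
    using avg_step_converges[OF T ls l(2)] by (simp add: power2_commute)
  obtain V where V: "(\<lambda>(s, w). V s w) \<in> borel_measurable (borel \<Otimes>\<^sub>M M)" "\<And>s. V s \<in> L2 M"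
    "\<And>s. (\<lambda>n. (LINT w|M. (Z n s w - V s w)\<^sup>2)) \<longlonglongrightarrow> 0"
  proof (rule L2_complete_param[of Z borel])
    fix s e :: real assume "0 < e"
    then obtain N where N: "\<And>n. N \<le> n \<Longrightarrow> (LBINT u. (avg_step 0 T n (l s) u - ?l s u)\<^sup>2) < e / 4"
      using LIMSEQ_D[OF lim, of "e / 4" s] by auto
    have "(LINT w|M. (Z m s w - Z n s w)\<^sup>2) < e" if "N \<le> m" "N \<le> n" for m n
    proof -
      have "(LINT w|M. (Z m s w - Z n s w)\<^sup>2) = (LBINT u. (avg_step 0 T m (l s) u - avg_step 0 T n (l s) u)\<^sup>2)"
        unfolding Z_def sf[symmetric] by (intro wiener_rel_norm wiener_rel_diff wiener_rel_steps xs)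
      also have "\<dots> \<le> 2 * (LBINT u. (avg_step 0 T m (l s) u - ?l s u)\<^sup>2) + 2 * (LBINT u. (avg_step 0 T n (l s) u - ?l s u)\<^sup>2)"
        by (intro integral_sq_diff_le avg_step_L2 l2)
      also have "\<dots> < e" using N[OF that(1)] N[OF that(2)] by simp
      finally show ?thesis .
    qed
    then show "\<exists>N. \<forall>m\<ge>N. \<forall>n\<ge>N. (LINT w|M. (Z m s w - Z n s w)\<^sup>2) < e" by blast
  qed (use Zm Z2 in auto)
  have "wiener_rel (?l s) (V s)" for s
    unfolding wiener_rel_def using V(2,3)[of s] l2[of s] lim[of s]
    by (intro conjI exI[of _ "\<lambda>n. xs n s"]) (auto simp: xs sf Z_def)
  then show ?thesis using that V(1) by blast
qed

end

lemma has_wiener_integral_cong: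
  assumes "\<And>s. s \<in> {a..b} \<Longrightarrow> f s = g s"
  shows "has_wiener_integral M W a b f J \<longleftrightarrow> has_wiener_integral M W a b g J"
proof -
  have "has_wiener_integral M W a b g J" if "\<And>s. s \<in> {a..b} \<Longrightarrow> f s = g s" "has_wiener_integral M W a b f J" for f g
  proof -
    have 1: "set_borel_measurable borel {a..b} f = set_borel_measurable borel {a..b} g"
      unfolding set_borel_measurable_def using that(1) by (intro arg_cong[where f="\<lambda>h. h \<in> _"]) (auto split: split_indicator)
    have 2: "set_integrable lborel {a..b} (\<lambda>s. (f s)\<^sup>2) = set_integrable lborel {a..b} (\<lambda>s. (g s)\<^sup>2)"
      using that(1) by (intro set_integrable_cong) auto
    have 3: "(LBINT s:{a..b}. (f s - h s)\<^sup>2) = (LBINT s:{a..b}. (g s - h s)\<^sup>2)" for h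
      using that(1) by (intro set_lebesgue_integral_cong) auto
    show ?thesis using that(2) unfolding has_wiener_integral_def 1 2 3 .
  qed
  from this[of f g] this[of g f] assms show ?thesis by auto
qed

section \<open>Gaussian spaces and conditional expectation\<close>

text \<open>The positive and negative parts of \<open>Z\<close>, normalised, are probability
  densities. Their image measures under \<open>y\<close> have the same characteristic function by
  hypothesis, hence coincide by Levy's uniqueness theorem.\<close>

lemma (in prob_space) fourier_zero_real:
  fixes Z y :: "'a \<Rightarrow> real"
  assumes Z: "integrable M Z" and y [measurable]: "y \<in> borel_measurable M"
    and F: "\<And>c. (CLINT w|M. complex_of_real (Z w) * iexp (c * y w)) = 0"
    and A: "A \<in> sets borel"
  shows "(LINT w|M. Z w * indicator A (y w)) = 0"
proof -
  note [measurable] = borel_measurable_integrable[OF Z] A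
  define P N where "P w = max 0 (Z w)" and "N w = max 0 (- Z w)" for w
  have ZPN: "Z w = P w - N w" for w by (auto simp: P_def N_def)
  have P0: "0 \<le> P w" and N0: "0 \<le> N w" for w by (auto simp: P_def N_def)
  have [measurable]: "P \<in> borel_measurable M" "N \<in> borel_measurable M" unfolding P_def[abs_def] N_def[abs_def] by measurable
  have Pi: "integrable M P" and Ni: "integrable M N"
    by (rule Bochner_Integration.integrable_bound[OF Z]; auto simp: P_def N_def)+
  have bi: "integrable M (\<lambda>w. f w * g w)" if "integrable M f" "g \<in> borel_measurable M" "\<And>w. \<bar>g w\<bar> \<le> 1" for f g :: "'a \<Rightarrow> real"
    using that(2,3) by (intro Bochner_Integration.integrable_bound[OF that(1)] borel_measurable_times borel_measurable_integrable[OF that(1)])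
      (auto simp: abs_mult mult_left_le)
  have ci: "integrable M (\<lambda>w. complex_of_real (f w) * iexp (c * y w))" if "integrable M f" for f :: "'a \<Rightarrow> real" and c
    using borel_measurable_integrable[OF that]
    by (intro Bochner_Integration.integrable_bound[OF that]) (auto simp: norm_mult)
  have eqF: "(CLINT w|M. complex_of_real (P w) * iexp (c * y w)) = (CLINT w|M. complex_of_real (N w) * iexp (c * y w))" for c
  proof -
    have "(CLINT w|M. complex_of_real (P w) * iexp (c * y w)) - (CLINT w|M. complex_of_real (N w) * iexp (c * y w))
       = (CLINT w|M. complex_of_real (Z w) * iexp (c * y w))"
      unfolding ZPN of_real_diff left_diff_distrib
      by (rule Bochner_Integration.integral_diff[symmetric]) (intro ci Pi Ni)+
    then show ?thesis using F[of c] by simp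
  qed
  define a where "a = (LINT w|M. P w)"
  \<comment> \<open>Frequency \<open>0\<close> shows that both parts have the same total mass. Mass
    zero is treated separately, as it cannot be normalised.\<close>
  have aN: "a = (LINT w|M. N w)"
    using eqF[of 0] by (simp add: a_def integral_complex_of_real)
  show ?thesis
  proof (cases "a = 0")
    case True
    have "AE w in M. P w = 0" "AE w in M. N w = 0"
      using integral_nonneg_eq_0_iff_AE[OF Pi] integral_nonneg_eq_0_iff_AE[OF Ni] P0 N0 True aN by (auto simp: a_def)
    then have "AE w in M. Z w * indicator A (y w) = 0" by eventually_elim (simp add: ZPN)
    then show ?thesis by (rule integral_eq_zero_AE)
  next
    case False
    then have a: "0 < a" using P0 by (simp add: a_def less_le integral_nonneg)
    define \<mu> where "\<mu> f = distr (density M (\<lambda>w. ennreal (f w / a))) borel y" for f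
    have main: "real_distribution (\<mu> f) \<and> char (\<mu> f) c = (CLINT w|M. complex_of_real (f w) * iexp (c * y w)) / a
        \<and> measure (\<mu> f) A = (LINT w|M. f w * indicator A (y w)) / a"
      if f: "integrable M f" "\<And>w. 0 \<le> f w" "(LINT w|M. f w) = a" for f c
    proof -
      note [measurable] = borel_measurable_integrable[OF f(1)]
      let ?D = "density M (\<lambda>w. ennreal (f w / a))"
      have "emeasure ?D (space M) = (\<integral>\<^sup>+w. ennreal (f w / a) \<partial>M)"
        by (simp add: emeasure_density cong: nn_integral_cong)
      also have "\<dots> = ennreal (LINT w|M. f w / a)" using f a by (intro nn_integral_eq_integral) auto
      also have "\<dots> = 1" using f a by simp
      finally have "prob_space ?D" by (intro prob_spaceI) simp
      then interpret D: prob_space ?D .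
      have rd: "real_distribution (\<mu> f)" unfolding \<mu>_def by (rule D.real_distribution_distr) simp
      have "char (\<mu> f) c = (CLINT w|?D. iexp (c * y w))"
        unfolding char_def \<mu>_def by (rule integral_distr) auto
      also have "\<dots> = (CLINT w|M. (f w / a) *\<^sub>R iexp (c * y w))"
        using f a by (intro integral_density) auto
      also have "\<dots> = (CLINT w|M. complex_of_real (f w) * iexp (c * y w) / a)"
        by (intro Bochner_Integration.integral_cong) (auto simp: scaleR_conv_of_real)
      also have "\<dots> = (CLINT w|M. complex_of_real (f w) * iexp (c * y w)) / a" by simp
      finally have ch: "char (\<mu> f) c = (CLINT w|M. complex_of_real (f w) * iexp (c * y w)) / a" .
      have "measure (\<mu> f) A = measure ?D (y -` A \<inter> space M)"
        unfolding \<mu>_def by (subst measure_distr) auto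
      also have "\<dots> = (\<integral>w. indicator (y -` A \<inter> space M) w \<partial>?D)" by simp
      also have "\<dots> = (LINT w|M. (f w / a) *\<^sub>R indicator (y -` A \<inter> space M) w)"
        using f a by (intro integral_density) auto
      also have "\<dots> = (LINT w|M. f w * indicator A (y w) / a)"
        by (intro Bochner_Integration.integral_cong) (auto split: split_indicator)
      also have "\<dots> = (LINT w|M. f w * indicator A (y w)) / a" by simp
      finally show ?thesis using rd ch by simp
    qed
    have "char (\<mu> P) = char (\<mu> N)"
      using main[OF Pi P0 a_def[symmetric]] main[OF Ni N0 aN[symmetric]] eqF by (intro ext) simp
    then have "\<mu> P = \<mu> N"
      using main[OF Pi P0 a_def[symmetric]] main[OF Ni N0 aN[symmetric]] by (intro Levy_uniqueness) auto
    then have "(LINT w|M. P w * indicator A (y w)) = (LINT w|M. N w * indicator A (y w))"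
      using main[OF Pi P0 a_def[symmetric]] main[OF Ni N0 aN[symmetric]] a by simp
    moreover have "(LINT w|M. Z w * indicator A (y w)) = (LINT w|M. P w * indicator A (y w)) - (LINT w|M. N w * indicator A (y w))"
      unfolding ZPN left_diff_distrib
      by (rule Bochner_Integration.integral_diff; rule bi[OF Pi] bi[OF Ni]) (auto split: split_indicator)
    ultimately show ?thesis by simp
  qed
qed

text \<open>Complex weights occur in the induction over several variables, where exponentials are
  absorbed into the weight. Conjugation reverses the frequency, so the hypothesis passes to
  \<open>cnj Z\<close> and thereby to the real and imaginary parts.\<close>

lemma (in prob_space) fourier_zero_complex:
  fixes Z :: "'a \<Rightarrow> complex" and y :: "'a \<Rightarrow> real"
  assumes Z: "integrable M Z" and y [measurable]: "y \<in> borel_measurable M"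
    and F: "\<And>c. (CLINT w|M. Z w * iexp (c * y w)) = 0"
    and A: "A \<in> sets borel"
  shows "(CLINT w|M. Z w * complex_of_real (indicator A (y w))) = 0"
proof -
  note [measurable] = borel_measurable_integrable[OF Z] A
  have ci: "integrable M (\<lambda>w. f w * iexp (c * y w))" if "integrable M f" for f :: "'a \<Rightarrow> complex" and c
    using borel_measurable_integrable[OF that]
    by (intro Bochner_Integration.integrable_bound[OF that]) (auto simp: norm_mult)
  have cZ: "integrable M (\<lambda>w. cnj (Z w))" using Z by simp
  have cF: "(CLINT w|M. cnj (Z w) * iexp (c * y w)) = 0" for c
  proof -
    have "(CLINT w|M. cnj (Z w) * iexp (c * y w)) = (CLINT w|M. cnj (Z w * iexp (- c * y w)))"
      by (intro Bochner_Integration.integral_cong) (auto simp: exp_cnj)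
    also have "\<dots> = cnj (CLINT w|M. Z w * iexp (- c * y w))" by (rule Bochner_Integration.integral_cnj)
    also have "\<dots> = 0" unfolding F by simp
    finally show ?thesis .
  qed
  have ii: "\<i> * (a * (\<i> * b)) = - (a * b)" for a b
  proof -
    have "\<i> * (a * (\<i> * b)) = (\<i> * \<i>) * (a * b)" by (simp only: ac_simps)
    then show ?thesis by simp
  qed
  have R: "(CLINT w|M. complex_of_real (Re (Z w)) * iexp (c * y w)) = 0" for c
  proof -
    have "(CLINT w|M. complex_of_real (Re (Z w)) * iexp (c * y w)) = (CLINT w|M. (Z w * iexp (c * y w) + cnj (Z w) * iexp (c * y w)) / 2)"
      by (intro Bochner_Integration.integral_cong) (auto simp: distrib_right[symmetric] complex_add_cnj)
    also have "\<dots> = ((CLINT w|M. Z w * iexp (c * y w)) + (CLINT w|M. cnj (Z w) * iexp (c * y w))) / 2"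
      using Bochner_Integration.integral_add[OF ci[OF Z, of c] ci[OF cZ, of c]] by (simp only: integral_divide_zero)
    finally show ?thesis by (simp only: F cF) simp
  qed
  have I: "(CLINT w|M. complex_of_real (Im (Z w)) * iexp (c * y w)) = 0" for c
  proof -
    have "(CLINT w|M. complex_of_real (Im (Z w)) * iexp (c * y w)) = (CLINT w|M. (Z w * iexp (c * y w) - cnj (Z w) * iexp (c * y w)) / (2 * \<i>))"
      by (intro Bochner_Integration.integral_cong) (auto simp: left_diff_distrib[symmetric] complex_diff_cnj ii)
    also have "\<dots> = ((CLINT w|M. Z w * iexp (c * y w)) - (CLINT w|M. cnj (Z w) * iexp (c * y w))) / (2 * \<i>)"
      using Bochner_Integration.integral_diff[OF ci[OF Z, of c] ci[OF cZ, of c]] by (simp only: integral_divide_zero)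
    finally show ?thesis by (simp only: F cF) simp
  qed
  have iA: "integrable M (\<lambda>w. Z w * complex_of_real (indicator A (y w)))"
    by (intro Bochner_Integration.integrable_bound[OF Z]) (auto simp: norm_mult split: split_indicator)
  show ?thesis
  proof (rule complex_eqI)
    show "Re (CLINT w|M. Z w * complex_of_real (indicator A (y w))) = Re 0"
      using fourier_zero_real[OF _ y R A] Z by (simp add: integral_Re[OF iA, symmetric])
    show "Im (CLINT w|M. Z w * complex_of_real (indicator A (y w))) = Im 0"
      using fourier_zero_real[OF _ y I A] Z by (simp add: integral_Im[OF iA, symmetric])
  qed
qed

text \<open>The exponentials are exchanged for indicators one variable at a time. While the variable
  \<open>s\<close> is treated, the exponentials of the others belong to the weight; afterwards the
  indicator for \<open>s\<close> joins the weight and the induction hypothesis applies.\<close>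

lemma (in prob_space) fourier_zero_multi:
  fixes Z :: "'a \<Rightarrow> complex" and y :: "'s \<Rightarrow> 'a \<Rightarrow> real"
  assumes "finite J" and "integrable M Z" and "\<And>s. s \<in> J \<Longrightarrow> y s \<in> borel_measurable M"
    and "\<And>c. (CLINT w|M. Z w * iexp (\<Sum>s\<in>J. c s * y s w)) = 0"
    and "\<And>s. s \<in> J \<Longrightarrow> A s \<in> sets borel"
  shows "(CLINT w|M. Z w * complex_of_real (\<Prod>s\<in>J. indicator (A s) (y s w))) = 0"
  using assms
proof (induction J arbitrary: Z)
  case empty
  then show ?case by simp
next
  case (insert s J)
  note [measurable] = borel_measurable_integrable[OF insert.prems(1)]
  have ys [measurable]: "y s \<in> borel_measurable M" and As [measurable]: "A s \<in> sets borel" using insert.prems by auto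
  have yJ: "(\<lambda>w. \<Sum>r\<in>J. c r * y r w) \<in> borel_measurable M" for c
    using insert.prems(2) by (intro borel_measurable_sum borel_measurable_times) auto
  note [measurable] = yJ
  have 1: "(CLINT w|M. Z w * iexp (\<Sum>r\<in>J. c r * y r w) * complex_of_real (indicator (A s) (y s w))) = 0" for c
  proof (rule fourier_zero_complex[OF _ ys _ As])
    have "(\<lambda>w. Z w * iexp (\<Sum>r\<in>J. c r * y r w)) \<in> borel_measurable M" by measurable
    then show "integrable M (\<lambda>w. Z w * iexp (\<Sum>r\<in>J. c r * y r w))"
      by (rule Bochner_Integration.integrable_bound[OF insert.prems(1)]) (simp only: norm_mult norm_exp_i_times, simp)
    fix d
    have "(CLINT w|M. Z w * iexp (\<Sum>r\<in>J. c r * y r w) * iexp (d * y s w))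
       = (CLINT w|M. Z w * iexp (\<Sum>r\<in>insert s J. (c(s := d)) r * y r w))"
    proof (intro Bochner_Integration.integral_cong refl)
      fix w
      have "(\<Sum>r\<in>insert s J. (c(s := d)) r * y r w) = d * y s w + (\<Sum>r\<in>J. c r * y r w)"
        using insert.hyps by (simp add: sum.insert) (intro sum.cong refl, auto)
      then show "Z w * iexp (\<Sum>r\<in>J. c r * y r w) * iexp (d * y s w) = Z w * iexp (\<Sum>r\<in>insert s J. (c(s := d)) r * y r w)"
        by (simp add: exp_add distrib_left ac_simps)
    qed
    then show "(CLINT w|M. Z w * iexp (\<Sum>r\<in>J. c r * y r w) * iexp (d * y s w)) = 0"
      using insert.prems(3) by simp
  qed
  have "(CLINT w|M. (Z w * complex_of_real (indicator (A s) (y s w))) * complex_of_real (\<Prod>r\<in>J. indicator (A r) (y r w))) = 0"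
  proof (rule insert.IH)
    show "integrable M (\<lambda>w. Z w * complex_of_real (indicator (A s) (y s w)))"
      by (intro Bochner_Integration.integrable_bound[OF insert.prems(1)]) (auto simp: norm_mult split: split_indicator)
    show "(CLINT w|M. Z w * complex_of_real (indicator (A s) (y s w)) * iexp (\<Sum>r\<in>J. c r * y r w)) = 0" for c
      using 1[of c] by (simp add: ac_simps)
  qed (use insert.prems in auto)
  then show ?case using insert.hyps by (simp add: mult.assoc)
qed

text \<open>The characteristic function is prescribed at frequency one only; the other frequencies
  follow from multiples, which lie in the same space. Degenerate variables are included.\<close>

definition gaussian_space :: "'a measure \<Rightarrow> ('a \<Rightarrow> real) set \<Rightarrow> bool" where
  "gaussian_space M V \<longleftrightarrow> closed_subspace M V \<and>
     (\<forall>U\<in>V. (CLINT w|M. iexp (U w)) = complex_of_real (exp (- (LINT w|M. (U w)\<^sup>2) / 2)))"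

text \<open>The expectation of \<open>iexp (a * e + w)\<close> depends on \<open>a\<close> only
  through its square, because the cross term vanishes; its derivative at \<open>a = 0\<close>, which
  is \<open>\<i>\<close> times the integral in question, is therefore zero. Quantitatively, the
  increment of the expectation and the error of linearisation are each at most
  \<open>a\<^sup>2 / 2\<close> times the second moment of \<open>e\<close>; dividing by
  \<open>a\<close> and letting \<open>a\<close> tend to zero gives the claim.\<close>

lemma (in prob_space) gaussian_orthogonal:
  assumes V: "gaussian_space M V" and e: "e \<in> V" and w: "w \<in> V"
    and ew: "(LINT \<omega>|M. e \<omega> * w \<omega>) = 0"
  shows "(CLINT \<omega>|M. complex_of_real (e \<omega>) * iexp (w \<omega>)) = 0"
proof -
  have cV: "closed_subspace M V" and ch: "\<And>U. U \<in> V \<Longrightarrow> (CLINT \<omega>|M. iexp (U \<omega>)) = complex_of_real (exp (- (LINT \<omega>|M. (U \<omega>)\<^sup>2) / 2))"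
    using V by (auto simp: gaussian_space_def)
  have e2: "e \<in> L2 M" and w2: "w \<in> L2 M" using cV e w by (auto intro: closed_subspace_L2)
  note [measurable] = L2_measurable[OF e2] L2_measurable[OF w2]
  let ?Q = "CLINT \<omega>|M. complex_of_real (e \<omega>) * iexp (w \<omega>)" and ?s = "(LINT \<omega>|M. (e \<omega>)\<^sup>2)"
  have ie: "integrable M (\<lambda>\<omega>. complex_of_real (e \<omega>) * iexp (w \<omega>))"
    by (intro Bochner_Integration.integrable_bound[OF L2_integrable[OF e2]]) (auto simp: norm_mult)
  have ix: "integrable M (\<lambda>\<omega>. iexp (f \<omega>))" if "f \<in> borel_measurable M" for f :: "'a \<Rightarrow> real"
    using that by (intro Bochner_Integration.integrable_bound[OF integrable_const[of "1::real"]]) auto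
  have bound: "norm ?Q \<le> a * ?s" if a: "0 < a" for a
  proof -
    have u: "(\<lambda>\<omega>. a * e \<omega> + w \<omega>) \<in> V" by (intro closed_subspace_add[OF cV] closed_subspace_scale[OF cV] e w)
    have "(LINT \<omega>|M. (a * e \<omega> + w \<omega>)\<^sup>2) = (LINT \<omega>|M. (w \<omega>)\<^sup>2) + a\<^sup>2 * ?s"
      using integral_sq_add[OF w2 e2, of a] ew by (simp add: ac_simps)
    then have E1: "(CLINT \<omega>|M. iexp (a * e \<omega> + w \<omega>)) = complex_of_real (exp (- (LINT \<omega>|M. (w \<omega>)\<^sup>2) / 2) * exp (- (a\<^sup>2 * ?s / 2)))"
      using ch[OF u] by (simp add: exp_add[symmetric] exp_of_real field_simps)
    have "norm ((CLINT \<omega>|M. iexp (a * e \<omega> + w \<omega>)) - (CLINT \<omega>|M. iexp (w \<omega>))) \<le> a\<^sup>2 * ?s / 2"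
    proof -
      let ?x = "a\<^sup>2 * ?s / 2" and ?p = "exp (- (LINT \<omega>|M. (w \<omega>)\<^sup>2) / 2)"
      have x: "0 \<le> ?x" by simp
      have "(CLINT \<omega>|M. iexp (a * e \<omega> + w \<omega>)) - (CLINT \<omega>|M. iexp (w \<omega>)) = complex_of_real (?p * exp (- ?x) - ?p)"
        unfolding E1 ch[OF w] by (simp only: of_real_diff)
      also have "norm \<dots> = ?p * (1 - exp (- ?x))"
      proof -
        have "0 \<le> ?p * (1 - exp (- ?x))" using x by (intro mult_nonneg_nonneg) auto
        moreover have "?p * exp (- ?x) - ?p = - (?p * (1 - exp (- ?x)))" by (simp only: right_diff_distrib)
        ultimately show ?thesis unfolding norm_of_real by (simp only: abs_minus_cancel abs_of_nonneg)
      qed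
      also have "\<dots> \<le> 1 * ?x"
      proof (intro mult_mono)
        show "1 - exp (- ?x) \<le> ?x" using exp_ge_add_one_self[of "- ?x"] by simp
      qed (use x in auto)
      finally show ?thesis by simp
    qed
    moreover have "norm ((CLINT \<omega>|M. iexp (a * e \<omega> + w \<omega>)) - (CLINT \<omega>|M. iexp (w \<omega>)) - \<i> * a * ?Q) \<le> a\<^sup>2 * ?s / 2"
    proof -
      have i1: "integrable M (\<lambda>\<omega>. iexp (a * e \<omega> + w \<omega>))" and i2: "integrable M (\<lambda>\<omega>. iexp (w \<omega>))"
        by (rule ix, measurable)+
      have i3: "integrable M (\<lambda>\<omega>. \<i> * a * (complex_of_real (e \<omega>) * iexp (w \<omega>)))"
        using ie by (rule integrable_mult_right)
      define h where "h \<omega> = iexp (a * e \<omega> + w \<omega>) - iexp (w \<omega>) - \<i> * a * (complex_of_real (e \<omega>) * iexp (w \<omega>))" for \<omega>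
      have i4: "integrable M h"
        unfolding h_def[abs_def] by (rule Bochner_Integration.integrable_diff[OF Bochner_Integration.integrable_diff[OF i1 i2] i3])
      have hb: "norm (h \<omega>) \<le> a\<^sup>2 * (e \<omega>)\<^sup>2 / 2" for \<omega>
      proof -
        have S: "(\<Sum>k\<le>1. (\<i> * complex_of_real (a * e \<omega>)) ^ k / fact k) = 1 + \<i> * (a * e \<omega>)"
          by simp
        have X: "iexp (a * e \<omega> + w \<omega>) = iexp (a * e \<omega>) * iexp (w \<omega>)"
          by (simp only: of_real_add distrib_left exp_add)
        have "h \<omega> = (iexp (a * e \<omega>) - (1 + \<i> * (a * e \<omega>))) * iexp (w \<omega>)"
          unfolding h_def X by (simp only: left_diff_distrib distrib_right of_real_mult mult.assoc mult_1_left diff_diff_eq)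
        then have "norm (h \<omega>) = norm (iexp (a * e \<omega>) - (\<Sum>k\<le>1. (\<i> * complex_of_real (a * e \<omega>)) ^ k / fact k))"
          unfolding S by (simp only: norm_mult norm_exp_i_times mult_1_right)
        also have "\<dots> \<le> \<bar>a * e \<omega>\<bar> ^ Suc 1 / fact (Suc 1)" by (rule iexp_approx1)
        also have "\<dots> = a\<^sup>2 * (e \<omega>)\<^sup>2 / 2"
          by (simp add: numeral_2_eq_2[symmetric] power_mult_distrib)
        finally show ?thesis .
      qed
      have eq: "(CLINT \<omega>|M. iexp (a * e \<omega> + w \<omega>)) - (CLINT \<omega>|M. iexp (w \<omega>)) - \<i> * a * ?Q = (CLINT \<omega>|M. h \<omega>)"
        unfolding h_def
        by (simp only: Bochner_Integration.integral_diff i1 i2 i3 Bochner_Integration.integrable_diff integral_mult_right_zero)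
      have n1: "norm (CLINT \<omega>|M. h \<omega>) \<le> (LINT \<omega>|M. norm (h \<omega>))"
        by (rule integral_norm_bound)
      have n2: "(LINT \<omega>|M. norm (h \<omega>)) \<le> (LINT \<omega>|M. a\<^sup>2 * (e \<omega>)\<^sup>2 / 2)"
        using L2_integrable_sq[OF e2] by (intro integral_mono integrable_norm[OF i4] hb) auto
      show ?thesis unfolding eq using order_trans[OF n1 n2] by simp
    qed
    ultimately have "norm (\<i> * a * ?Q) \<le> a\<^sup>2 * ?s / 2 + a\<^sup>2 * ?s / 2"
      using norm_triangle_sub[of "\<i> * a * ?Q" "(CLINT \<omega>|M. iexp (a * e \<omega> + w \<omega>)) - (CLINT \<omega>|M. iexp (w \<omega>))"]
      by (simp add: norm_minus_commute)
    then have "a * norm ?Q \<le> a * (a * ?s)" using a by (simp add: norm_mult power2_eq_square ac_simps)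
    then show ?thesis using a by simp
  qed
  have "norm ?Q \<le> 0"
  proof (rule field_le_epsilon)
    fix r :: real assume "0 < r"
    have s: "0 \<le> ?s" by simp
    have cancel: "r / z * z = r" if "0 < z" for z :: real using that by simp
    have s1: "0 < ?s + 1" by (rule add_nonneg_pos[OF s]) simp
    have "norm ?Q \<le> (r / (?s + 1)) * ?s" by (intro bound divide_pos_pos s1 \<open>0 < r\<close>)
    also have "\<dots> \<le> (r / (?s + 1)) * (?s + 1)"
      by (rule mult_left_mono) (use \<open>0 < r\<close> s1 in \<open>auto intro: divide_nonneg_pos\<close>)
    also have "\<dots> = r" by (rule cancel[OF s1])
    finally show "norm ?Q \<le> 0 + r" by simp
  qed
  then show ?thesis by simp
qed

text \<open>For a finite set of times, linear combinations of the observations are, up to constants,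
  elements of the Gaussian space orthogonal to \<open>e\<close>, so
  \<open>fourier_zero_multi\<close> settles cylinder events. A Dynkin argument extends this to the
  generated sigma-algebra.\<close>

lemma (in prob_space) gaussian_independent_of_filtration:
  fixes Y :: "real \<Rightarrow> 'a \<Rightarrow> real"
  assumes V: "gaussian_space M V" and e: "e \<in> V" and v: "\<And>s. s \<in> {0..t} \<Longrightarrow> v s \<in> V"
    and ev: "\<And>s. s \<in> {0..t} \<Longrightarrow> (LINT \<omega>|M. e \<omega> * v s \<omega>) = 0"
    and Y: "\<And>s. s \<in> {0..t} \<Longrightarrow> Y s \<in> borel_measurable M"
    and Yv: "\<And>s. s \<in> {0..t} \<Longrightarrow> AE \<omega> in M. Y s \<omega> = \<mu> s + v s \<omega>"
    and A: "A \<in> sets (obs_filtration M Y t)"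
  shows "(LINT \<omega>:A|M. e \<omega>) = 0"
proof -
  have cV: "closed_subspace M V" using V by (simp add: gaussian_space_def)
  have e2: "e \<in> L2 M" using cV e by (rule closed_subspace_L2)
  note ei = L2_integrable[OF e2]
  note [measurable] = L2_measurable[OF e2]
  define cyl where "cyl J B = {\<omega>\<in>space M. \<forall>s\<in>J. Y s \<omega> \<in> B s}" for J and B :: "real \<Rightarrow> real set"
  \<comment> \<open>Null sets are joined to the cylinder sets; as an intersection with a null set is
    null, the family stays stable under intersection and generates the completed
    sigma-algebra.\<close>
  define P where "P = {cyl J B | J B. finite J \<and> J \<subseteq> {0..t} \<and> (\<forall>s\<in>J. B s \<in> sets borel)} \<union> null_sets M"
  have cyl_sets: "cyl J B \<in> sets M" if "finite J" "J \<subseteq> {0..t}" "\<forall>s\<in>J. B s \<in> sets borel" for J B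
    unfolding cyl_def
  proof (rule sets.sets_Collect_finite_All[OF _ that(1)])
    fix s assume "s \<in> J"
    then have "Y s -` B s \<inter> space M \<in> sets M" using that Y by (intro measurable_sets[of _ _ borel]) auto
    then show "{\<omega> \<in> space M. Y s \<omega> \<in> B s} \<in> sets M" by (simp add: vimage_def Int_def conj_commute)
  qed
  have P_sets: "P \<subseteq> sets M" unfolding P_def using cyl_sets by (auto dest: null_setsD2)
  have P_Pow: "P \<subseteq> Pow (space M)" using P_sets sets.sets_into_space by auto
  have Int: "Int_stable P"
  proof (rule Int_stableI)
    fix a b assume a: "a \<in> P" and b: "b \<in> P"
    show "a \<inter> b \<in> P"
    proof (cases "a \<in> null_sets M \<or> b \<in> null_sets M")
      case True
      then have "a \<inter> b \<in> null_sets M"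
        using a b P_sets null_set_Int1[of b M a] null_set_Int2[of a M b] by auto
      then show ?thesis by (simp add: P_def)
    next
      case False
      then obtain J1 B1 J2 B2 where 1: "a = cyl J1 B1" "finite J1" "J1 \<subseteq> {0..t}" "\<forall>s\<in>J1. B1 s \<in> sets borel"
        and 2: "b = cyl J2 B2" "finite J2" "J2 \<subseteq> {0..t}" "\<forall>s\<in>J2. B2 s \<in> sets borel"
        using a b unfolding P_def by blast
      define B where "B s = (if s \<in> J1 then B1 s else UNIV) \<inter> (if s \<in> J2 then B2 s else UNIV)" for s
      have "a \<inter> b = cyl (J1 \<union> J2) B" unfolding 1 2 cyl_def B_def by auto
      moreover have "\<forall>s\<in>J1 \<union> J2. B s \<in> sets borel" unfolding B_def using 1 2 by auto
      ultimately show ?thesis using 1 2 unfolding P_def by blast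
    qed
  qed
  have sub: "{Y s -` A \<inter> space M | s A. s \<in> {0..t} \<and> A \<in> sets borel} \<union> null_sets M \<subseteq> P"
  proof safe
    fix s and B :: "real set" assume "s \<in> {0..t}" "B \<in> sets borel"
    moreover have "Y s -` B \<inter> space M = cyl {s} (\<lambda>_. B)" by (auto simp: cyl_def)
    ultimately show "Y s -` B \<inter> space M \<in> P" unfolding P_def by blast
  qed (simp add: P_def)
  have "A \<in> sigma_sets (space M) ({Y s -` A \<inter> space M | s A. s \<in> {0..t} \<and> A \<in> sets borel} \<union> null_sets M)"
    using A sub P_Pow unfolding obs_filtration_def by (subst (asm) sets_measure_of) auto
  then have AP: "A \<in> sigma_sets (space M) P" using sigma_sets_mono'[OF sub] by blast
  have basic: "(LINT \<omega>:a|M. e \<omega>) = 0" if aP: "a \<in> P" for a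
  proof (cases "a \<in> null_sets M")
    case True
    have "AE \<omega> in M. indicator a \<omega> *\<^sub>R e \<omega> = 0" using AE_not_in[OF True] by eventually_elim simp
    then show ?thesis unfolding set_lebesgue_integral_def by (rule integral_eq_zero_AE)
  next
    case False
    then obtain J B where J: "a = cyl J B" "finite J" "J \<subseteq> {0..t}" "\<forall>s\<in>J. B s \<in> sets borel"
      using aP unfolding P_def by blast
    have "(CLINT \<omega>|M. complex_of_real (e \<omega>) * complex_of_real (\<Prod>s\<in>J. indicator (B s) (Y s \<omega>))) = 0"
    proof (rule fourier_zero_multi[OF J(2)])
      show "integrable M (\<lambda>\<omega>. complex_of_real (e \<omega>))" using ei by simp
      fix c :: "real \<Rightarrow> real"
      define w where "w \<omega> = (\<Sum>s\<in>J. c s * v s \<omega>)" for \<omega>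
      have w: "w \<in> V" unfolding w_def[abs_def] using J v
        by (intro closed_subspace_sum[OF cV] closed_subspace_scale[OF cV]) auto
      have w2: "w \<in> L2 M" using cV w by (rule closed_subspace_L2)
      have vL: "v s \<in> L2 M" if "s \<in> J" for s using J v that by (intro closed_subspace_L2[OF cV]) auto
      have "(LINT \<omega>|M. e \<omega> * w \<omega>) = (LINT \<omega>|M. (\<Sum>s\<in>J. c s * (e \<omega> * v s \<omega>)))"
        by (simp add: w_def sum_distrib_left ac_simps)
      also have "\<dots> = (\<Sum>s\<in>J. c s * (LINT \<omega>|M. e \<omega> * v s \<omega>))"
        using L2_mult_integrable[OF e2 vL] by (simp add: Bochner_Integration.integral_sum)
      also have "\<dots> = 0" using ev J by (intro sum.neutral) auto
      finally have ew: "(LINT \<omega>|M. e \<omega> * w \<omega>) = 0" .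
      have "AE \<omega> in M. \<forall>s\<in>J. Y s \<omega> = \<mu> s + v s \<omega>"
        using J Yv by (intro AE_finite_allI) auto
      then have ae: "AE \<omega> in M. (\<Sum>s\<in>J. c s * Y s \<omega>) = (\<Sum>s\<in>J. c s * \<mu> s) + w \<omega>"
        by eventually_elim (simp add: w_def distrib_left sum.distrib)
      have [measurable]: "(\<lambda>\<omega>. \<Sum>s\<in>J. c s * Y s \<omega>) \<in> borel_measurable M"
        using J Y by (intro borel_measurable_sum borel_measurable_times) auto
      note [measurable] = L2_measurable[OF w2]
      \<comment> \<open>The deterministic part of the observations contributes only a constant phase
        factor.\<close>
      have "(CLINT \<omega>|M. complex_of_real (e \<omega>) * iexp (\<Sum>s\<in>J. c s * Y s \<omega>))
         = (CLINT \<omega>|M. iexp (\<Sum>s\<in>J. c s * \<mu> s) * (complex_of_real (e \<omega>) * iexp (w \<omega>)))"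
      proof (rule integral_cong_AE)
        show "AE \<omega> in M. complex_of_real (e \<omega>) * iexp (\<Sum>s\<in>J. c s * Y s \<omega>)
          = iexp (\<Sum>s\<in>J. c s * \<mu> s) * (complex_of_real (e \<omega>) * iexp (w \<omega>))"
          using ae
        proof eventually_elim
          case (elim \<omega>)
          show ?case unfolding elim of_real_add distrib_left exp_add by (simp only: ac_simps)
        qed
      qed measurable
      also have "\<dots> = 0" using gaussian_orthogonal[OF V e w ew] by simp
      finally show "(CLINT \<omega>|M. complex_of_real (e \<omega>) * iexp (\<Sum>s\<in>J. c s * Y s \<omega>)) = 0" .
    qed (use J Y in auto)
    then have "(LINT \<omega>|M. e \<omega> * (\<Prod>s\<in>J. indicator (B s) (Y s \<omega>))) = 0"
      unfolding of_real_mult[symmetric] integral_complex_of_real by simp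
    moreover have "(LINT \<omega>:a|M. e \<omega>) = (LINT \<omega>|M. e \<omega> * (\<Prod>s\<in>J. indicator (B s) (Y s \<omega>)))"
      unfolding set_lebesgue_integral_def
    proof (intro Bochner_Integration.integral_cong refl)
      fix \<omega> assume "\<omega> \<in> space M"
      then have "indicator a \<omega> = (\<Prod>s\<in>J. indicator (B s) (Y s \<omega>) :: real)"
      proof (cases "\<forall>s\<in>J. Y s \<omega> \<in> B s")
        case True
        then show ?thesis using \<open>\<omega> \<in> space M\<close> by (simp add: J(1) cyl_def)
      next
        case False
        then obtain s where "s \<in> J" "Y s \<omega> \<notin> B s" by blast
        then have "(\<Prod>s\<in>J. indicator (B s) (Y s \<omega>) :: real) = 0"
          using J(2) by (intro prod_zero bexI[of _ s]) auto
        then show ?thesis using False by (simp add: J(1) cyl_def)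
      qed
      then show "indicator a \<omega> *\<^sub>R e \<omega> = e \<omega> * (\<Prod>s\<in>J. indicator (B s) (Y s \<omega>))" by simp
    qed
    ultimately show ?thesis by simp
  qed
  have AM: "a \<in> sigma_sets (space M) P \<Longrightarrow> a \<in> sets M" for a
    using sets.sigma_sets_subset[OF P_sets] by blast
  have sint: "set_integrable M a e" if "a \<in> sets M" for a
    unfolding set_integrable_def using that ei by (rule integrable_mult_indicator)
  \<comment> \<open>The cylinder over no times at all is the whole space; it provides the zero mean
    of \<open>e\<close> for the complement step of the induction.\<close>
  have "space M = cyl {} (\<lambda>_. UNIV)" by (auto simp: cyl_def)
  then have "space M \<in> P" unfolding P_def by blast
  show ?thesis
    using Int P_Pow AP
  proof (induction rule: sigma_sets_induct_disjoint)
    case (basic a) then show ?case by (rule \<open>\<And>a. a \<in> P \<Longrightarrow> (LINT \<omega>:a|M. e \<omega>) = 0\<close>)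
  next
    case empty then show ?case by (simp add: set_lebesgue_integral_def)
  next
    case (compl a)
    have "(LINT \<omega>:space M|M. e \<omega>) = (LINT \<omega>:(space M - a)|M. e \<omega>) + (LINT \<omega>:a|M. e \<omega>)"
      using set_integral_Un[of "space M - a" a M e] AM[OF compl(1)] sets.sets_into_space[OF AM[OF compl(1)]]
      by (simp add: sint Un_absorb2 Diff_Int_distrib2 Int_commute)
    then show ?case using compl(2) basic[OF \<open>space M \<in> P\<close>] by simp
  next
    case (union F)
    have "(LINT \<omega>:(\<Union>i. F i)|M. e \<omega>) = (\<Sum>i. (LINT \<omega>:(F i)|M. e \<omega>))"
    proof (rule lebesgue_integral_countable_add)
      have FM: "F i \<in> sets M" for i using union(2) AM by blast
      then show "F i \<in> sets M" for i .
      show "F i \<inter> F j = {}" if "i \<noteq> j" for i j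
        using union(1) that by (auto simp: disjoint_family_on_def)
      show "set_integrable M (\<Union>i. F i) e" using FM by (intro sint) auto
    qed
    then show ?case using union by simp
  qed
qed

section \<open>The completed observation filtration and conditional expectation\<close>

lemma obs_filtration_subalgebra:
  assumes "\<And>s. s \<in> {0..t} \<Longrightarrow> Y s \<in> borel_measurable M"
  shows "subalgebra M (obs_filtration M Y t)"
proof -
  have *: "{Y s -` A \<inter> space M | s A. s \<in> {0..t} \<and> A \<in> sets borel} \<union> null_sets M \<subseteq> sets M"
    using assms by (auto intro: measurable_sets dest: null_setsD2)
  then have "{Y s -` A \<inter> space M | s A. s \<in> {0..t} \<and> A \<in> sets borel} \<union> null_sets M \<subseteq> Pow (space M)"
    using sets.sets_into_space by blast
  then show ?thesis
    using sets.sigma_sets_subset[OF *] unfolding subalgebra_def obs_filtration_def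
    by (simp add: sets_measure_of space_measure_of)
qed

lemma obs_filtration_sets:
  assumes "\<And>s. s \<in> {0..t} \<Longrightarrow> Y s \<in> borel_measurable M"
  shows "null_sets M \<subseteq> sets (obs_filtration M Y t)"
    and "s \<in> {0..t} \<Longrightarrow> Y s \<in> borel_measurable (obs_filtration M Y t)"
proof -
  have *: "{Y s -` A \<inter> space M | s A. s \<in> {0..t} \<and> A \<in> sets borel} \<union> null_sets M \<subseteq> Pow (space M)"
    using assms sets.sets_into_space by (auto dest: null_setsD2)
  show "null_sets M \<subseteq> sets (obs_filtration M Y t)"
    unfolding obs_filtration_def using * by (auto simp: sets_measure_of)
  assume s: "s \<in> {0..t}"
  show "Y s \<in> borel_measurable (obs_filtration M Y t)"
  proof (rule measurableI)
    fix A :: "real set" assume "A \<in> sets borel"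
    then show "Y s -` A \<inter> space (obs_filtration M Y t) \<in> sets (obs_filtration M Y t)"
      unfolding obs_filtration_def using * s by (auto simp: sets_measure_of space_measure_of intro!: sigma_sets.Basic)
  qed simp
qed

text \<open>A preimage under \<open>f\<close> differs from the one under \<open>g\<close> by parts
  of a null set, and these are events of the completed sub-sigma-algebra.\<close>

lemma measurable_complete_subalgebra:
  assumes sub: "subalgebra M N" and null: "null_sets M \<subseteq> sets N"
    and g: "g \<in> borel_measurable N" and f: "f \<in> borel_measurable M" and ae: "AE x in M. f x = g x"
  shows "f \<in> borel_measurable N"
proof (rule measurableI)
  fix A :: "'b set" assume A: "A \<in> sets borel"
  have sp: "space N = space M" using sub by (simp add: subalgebra_def)
  have gA: "g -` A \<inter> space M \<in> sets N" using measurable_sets[OF g A] by (simp add: sp)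
  obtain E where E: "E \<in> null_sets M" "{x\<in>space M. f x \<noteq> g x} \<subseteq> E" using ae by (auto elim!: AE_E simp: null_setsI)
  have sM: "sets N \<subseteq> sets M" using sub by (simp add: subalgebra_def)
  have fA: "f -` A \<inter> space M \<in> sets M" using measurable_sets[OF f A] .
  have EN: "E \<in> sets N" using E null by auto
  have "(f -` A \<inter> space M) \<inter> E \<in> null_sets M" using null_set_Int1[OF E(1) fA] by (simp add: Int_commute)
  then have n: "(f -` A \<inter> space M) \<inter> E \<in> sets N" using null by auto
  have "f -` A \<inter> space M = ((g -` A \<inter> space M) - E) \<union> ((f -` A \<inter> space M) \<inter> E)"
    using E(2) by auto
  also have "\<dots> \<in> sets N" using gA EN n by auto
  finally show "f -` A \<inter> space N \<in> sets N" by (simp add: sp)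
qed simp

text \<open>Completeness is applied in the space restricted to \<open>N\<close>, which yields an
  \<open>N\<close>-measurable limit \<open>V\<close>. It agrees almost surely with \<open>f\<close>,
  and since \<open>N\<close> contains the null sets, \<open>f\<close> is itself
  \<open>N\<close>-measurable.\<close>

lemma (in prob_space) L2_rv_closed_subspace:
  assumes sub: "subalgebra M N" and null: "null_sets M \<subseteq> sets N"
  shows "closed_subspace M (L2_rv M N)"
proof -
  have L: "f \<in> L2 M" if "f \<in> L2_rv M N" for f
    using that measurable_from_subalg[OF sub] by (auto simp: L2_rv_def)
  have mN: "f \<in> borel_measurable N" if "f \<in> L2_rv M N" for f using that by (simp add: L2_rv_def)
  have I: "f \<in> L2_rv M N" if "f \<in> L2 M" "f \<in> borel_measurable N" for f using that by (simp add: L2_rv_def)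
  have lim: "f \<in> L2_rv M N" if f: "f \<in> L2 M" and g: "\<And>n::nat. g n \<in> L2_rv M N" and l: "(\<lambda>n. (LINT x|M. (g n x - f x)\<^sup>2)) \<longlonglongrightarrow> 0" for f g
  proof -
    interpret R: prob_space "restr_to_subalg M N" by (rule prob_space_restr_to_subalg[OF sub prob_space_axioms])
    have eqI: "(\<integral>x. h x \<partial>(restr_to_subalg M N)) = (LINT x|M. h x)" if "h \<in> borel_measurable N" for h :: "'a \<Rightarrow> real"
      using integral_subalgebra2[OF sub that] .
    have gR: "g n \<in> L2 (restr_to_subalg M N)" for n
      using g[of n] by (auto simp: L2_rv_def intro: measurable_in_subalg[OF sub] integrable_in_subalg[OF sub])
    obtain V where V: "V \<in> L2 (restr_to_subalg M N)" "(\<lambda>n. \<integral>x. (g n x - V x)\<^sup>2 \<partial>(restr_to_subalg M N)) \<longlonglongrightarrow> 0"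
    proof (rule R.L2_complete[of g])
      fix e :: real assume "0 < e"
      then obtain K where K: "\<And>n. K \<le> n \<Longrightarrow> (LINT x|M. (g n x - f x)\<^sup>2) < e / 4"
        using LIMSEQ_D[OF l, of "e / 4"] by auto
      have "(\<integral>x. (g m x - g n x)\<^sup>2 \<partial>(restr_to_subalg M N)) < e" if "K \<le> m" "K \<le> n" for m n
      proof -
        have "(\<integral>x. (g m x - g n x)\<^sup>2 \<partial>(restr_to_subalg M N)) = (LINT x|M. (g m x - g n x)\<^sup>2)"
          using mN[OF g] by (intro eqI) auto
        also have "\<dots> \<le> 2 * (LINT x|M. (g m x - f x)\<^sup>2) + 2 * (LINT x|M. (g n x - f x)\<^sup>2)"
          by (intro integral_sq_diff_le L g f)
        also have "\<dots> < e" using K[OF that(1)] K[OF that(2)] by simp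
        finally show ?thesis .
      qed
      then show "\<exists>K. \<forall>m\<ge>K. \<forall>n\<ge>K. (\<integral>x. (g m x - g n x)\<^sup>2 \<partial>(restr_to_subalg M N)) < e" by blast
    qed (use gR in auto)
    have VN: "V \<in> borel_measurable N" using V(1) measurable_in_subalg'[OF sub] by (auto simp: L2_rv_def)
    have "integrable M (\<lambda>x. (V x)\<^sup>2)" using V(1) integrable_from_subalg[OF sub] by (auto simp: L2_rv_def)
    then have VL: "V \<in> L2 M" using VN measurable_from_subalg[OF sub] by (auto simp: L2_rv_def)
    have "(\<lambda>n. (LINT x|M. (g n x - V x)\<^sup>2)) \<longlonglongrightarrow> 0"
      using V(2) mN[OF g] VN by (subst (asm) eqI) auto
    then have "(\<lambda>n. 2 * (LINT x|M. (g n x - f x)\<^sup>2) + 2 * (LINT x|M. (g n x - V x)\<^sup>2)) \<longlonglongrightarrow> 0"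
      using l by (intro tendsto_add_zero tendsto_mult_right_zero)
    moreover have "(LINT x|M. (f x - V x)\<^sup>2) \<le> 2 * (LINT x|M. (g n x - f x)\<^sup>2) + 2 * (LINT x|M. (g n x - V x)\<^sup>2)" for n
      using integral_sq_diff_le[OF f VL L[OF g[of n]]] by (simp add: power2_commute)
    ultimately have "(LINT x|M. (f x - V x)\<^sup>2) \<le> 0" by (intro LIMSEQ_le_const) auto
    then have "AE x in M. f x - V x = 0" by (intro integral_sq_zero_AE L2_diff f VL) (simp add: antisym)
    then have "f \<in> borel_measurable N"
      using L2_measurable[OF f] by (intro measurable_complete_subalgebra[OF sub null VN]) auto
    then show ?thesis by (rule I[OF f])
  qed
  show ?thesis
    unfolding closed_subspace_def
  proof (intro conjI ballI allI impI subsetI)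
    show "(\<lambda>_. 0) \<in> L2_rv M N" by (simp add: L2_rv_def)
    show "(\<lambda>x. f x + g x) \<in> L2_rv M N" if "f \<in> L2_rv M N" "g \<in> L2_rv M N" for f g
      using that by (intro I[OF L2_add[OF L L] borel_measurable_add[OF mN mN]])
    show "(\<lambda>x. c * f x) \<in> L2_rv M N" if "f \<in> L2_rv M N" for f c
      using mN[OF that] by (intro I[OF L2_scale[OF L[OF that]]]) auto
  qed (erule L, rule lim, assumption, blast, assumption)
qed

text \<open>The orthogonal projection onto \<open>L2_rv M N\<close>, tested against indicators of
  events, is the conditional expectation and therefore equals \<open>p\<close> almost surely. Thus
  \<open>p\<close> inherits the orthogonality, and Pythagoras identifies all minimisers.\<close>

lemma (in prob_space) best_estimate_charact:
  assumes sub: "subalgebra M N" and null: "null_sets M \<subseteq> sets N" and \<xi>: "\<xi> \<in> L2 M"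
    and p: "p \<in> L2_rv M N" and set: "\<And>A. A \<in> sets N \<Longrightarrow> (LINT x:A|M. \<xi> x) = (LINT x:A|M. p x)"
  shows "best_estimate M N \<xi> Z \<longleftrightarrow> Z \<in> L2_rv M N \<and> (AE x in M. Z x = p x)"
    and "AE x in M. real_cond_exp M N \<xi> x = p x"
    and "v \<in> L2_rv M N \<Longrightarrow> (LINT x|M. (\<xi> x - p x) * v x) = 0"
proof -
  note V = L2_rv_closed_subspace[OF sub null]
  note VL = closed_subspace_L2[OF V]
  interpret sigma_finite_subalgebra M N
    by (rule finite_measure_subalgebra_is_sigma_finite) (use sub finite_measure_axioms in \<open>auto simp: finite_measure_subalgebra_def finite_measure_subalgebra_axioms_def\<close>)
  obtain q where q: "q \<in> L2_rv M N" "\<And>v. v \<in> L2_rv M N \<Longrightarrow> (LINT x|M. (\<xi> x - q x) * v x) = 0"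
    by (rule L2_projection[OF V \<xi>]) blast
  have 1: "AE x in M. real_cond_exp M N \<xi> x = g x" if g: "g \<in> L2_rv M N" "\<And>A. A \<in> sets N \<Longrightarrow> (LINT x:A|M. \<xi> x) = (LINT x:A|M. g x)" for g
    using g L2_integrable[OF \<xi>] L2_integrable[OF VL[OF g(1)]]
    by (intro real_cond_exp_charact) (auto simp: L2_rv_def)
  show cp: "AE x in M. real_cond_exp M N \<xi> x = p x" by (rule 1[OF p set])
  have "AE x in M. real_cond_exp M N \<xi> x = q x"
  proof (rule 1[OF q(1)])
    fix A assume A: "A \<in> sets N"
    then have AM: "A \<in> sets M" using sub by (auto simp: subalgebra_def)
    have "integrable M (indicator A :: 'a \<Rightarrow> real)" using AM by (intro integrable_real_indicator) (auto simp: less_top[symmetric])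
    then have "indicator A \<in> L2_rv M N" using A AM by (auto simp: L2_rv_def power2_eq_square indicator_inter_arith[symmetric])
    from q(2)[OF this] have "(LINT x|M. indicator A x *\<^sub>R \<xi> x - indicator A x *\<^sub>R q x) = 0"
      by (simp add: algebra_simps)
    moreover have "integrable M (\<lambda>x. indicator A x *\<^sub>R \<xi> x)" "integrable M (\<lambda>x. indicator A x *\<^sub>R q x)"
      by (intro integrable_mult_indicator AM L2_integrable \<xi> VL[OF q(1)])+
    ultimately show "(LINT x:A|M. \<xi> x) = (LINT x:A|M. q x)" by (simp add: set_lebesgue_integral_def)
  qed
  with cp have qp: "AE x in M. q x = p x" by eventually_elim simp
  have orth: "(LINT x|M. (\<xi> x - p x) * v x) = 0" if v: "v \<in> L2_rv M N" for v
  proof -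
    have "(LINT x|M. (\<xi> x - p x) * v x) = (LINT x|M. (\<xi> x - q x) * v x)"
      using qp \<xi> VL[OF p] VL[OF q(1)] VL[OF v]
      by (intro integral_cong_AE) (auto intro!: borel_measurable_times borel_measurable_diff dest: L2_measurable elim: eventually_mono)
    then show ?thesis using q(2)[OF v] by simp
  qed
  then show "v \<in> L2_rv M N \<Longrightarrow> (LINT x|M. (\<xi> x - p x) * v x) = 0" .
  let ?E = "\<lambda>Z. (LINT x|M. (\<xi> x - Z x)\<^sup>2)"
  have pyth: "?E Z = ?E p + (LINT x|M. (p x - Z x)\<^sup>2)" if Z: "Z \<in> L2_rv M N" for Z
  proof -
    have pZ: "(\<lambda>x. p x - Z x) \<in> L2_rv M N" by (rule closed_subspace_diff[OF V p Z])
    have "?E Z = (LINT x|M. ((\<xi> x - p x) + 1 * (p x - Z x))\<^sup>2)" by simp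
    also have "\<dots> = ?E p + 2 * 1 * (LINT x|M. (\<xi> x - p x) * (p x - Z x)) + 1\<^sup>2 * (LINT x|M. (p x - Z x)\<^sup>2)"
      by (rule integral_sq_add[OF L2_diff[OF \<xi> VL[OF p]] VL[OF pZ]])
    finally show ?thesis using orth[OF pZ] by simp
  qed
  have inf: "(INF Z\<in>L2_rv M N. ?E Z) = ?E p"
  proof (rule cInf_eq_minimum)
    show "?E p \<in> ?E ` L2_rv M N" using p by blast
    show "?E p \<le> x" if "x \<in> ?E ` L2_rv M N" for x using that pyth by auto
  qed
  show "best_estimate M N \<xi> Z \<longleftrightarrow> Z \<in> L2_rv M N \<and> (AE x in M. Z x = p x)"
  proof (cases "Z \<in> L2_rv M N")
    case True
    have "?E Z = ?E p \<longleftrightarrow> (LINT x|M. (p x - Z x)\<^sup>2) = 0" using pyth[OF True] by simp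
    also have "\<dots> \<longleftrightarrow> (AE x in M. Z x = p x)"
    proof
      assume "(LINT x|M. (p x - Z x)\<^sup>2) = 0"
      then have "AE x in M. p x - Z x = 0" by (intro integral_sq_zero_AE L2_diff VL[OF p] VL[OF True])
      then show "AE x in M. Z x = p x" by eventually_elim simp
    next
      assume "AE x in M. Z x = p x"
      then show "(LINT x|M. (p x - Z x)\<^sup>2) = 0" by (intro integral_eq_zero_AE) (auto elim: eventually_mono)
    qed
    finally show ?thesis using True by (simp add: best_estimate_def inf)
  qed (simp add: best_estimate_def)
qed

section \<open>Gaussian variables generated by Brownian motions\<close>

text \<open>Stated through the value of the characteristic function at one, a condition that passes
  to sums of independent variables and to mean-square limits and includes the zero variable.\<close>

definition centered_gaussian :: "'a measure \<Rightarrow> ('a \<Rightarrow> real) \<Rightarrow> bool" where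
  "centered_gaussian M U \<longleftrightarrow> U \<in> L2 M \<and> (LINT w|M. U w) = 0 \<and>
     (CLINT w|M. iexp (U w)) = complex_of_real (exp (- (LINT w|M. (U w)\<^sup>2) / 2))"

lemma (in prob_space) centered_gaussian_zero: "AE w in M. U w = 0 \<Longrightarrow> U \<in> borel_measurable M \<Longrightarrow> centered_gaussian M U"
proof -
  assume ae: "AE w in M. U w = 0" and [measurable]: "U \<in> borel_measurable M"
  have "U \<in> L2 M" by (rule L2_cong_AE[OF L2_zero]) (use ae in \<open>auto elim: eventually_mono\<close>)
  moreover have "(LINT w|M. U w) = 0" using ae by (rule integral_eq_zero_AE)
  moreover have "(LINT w|M. (U w)\<^sup>2) = 0" by (rule integral_eq_zero_AE) (use ae in \<open>auto elim: eventually_mono\<close>)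
  moreover have "(CLINT w|M. iexp (U w)) = (CLINT w|M. 1)"
    by (rule integral_cong_AE) (use ae in \<open>auto elim: eventually_mono\<close>)
  ultimately show ?thesis by (simp add: centered_gaussian_def prob_space)
qed

lemma (in prob_space) normal_centered_gaussian:
  assumes D: "distributed M lborel X (normal_density 0 \<sigma>)" and \<sigma>: "0 < \<sigma>"
  shows "centered_gaussian M X" and "(LINT w|M. (X w)\<^sup>2) = \<sigma>\<^sup>2"
proof -
  have [measurable]: "X \<in> borel_measurable M" using distributed_measurable[OF D] by simp
  have mean: "(LINT w|M. X w) = 0" by (rule normal_distributed_expectation[OF \<sigma> D])
  show var: "(LINT w|M. (X w)\<^sup>2) = \<sigma>\<^sup>2" using normal_distributed_variance[OF \<sigma> D] mean by simp
  have "integrable lborel (\<lambda>x. normal_density 0 \<sigma> x * x\<^sup>2)" using integrable_normal_moment[OF \<sigma>, of 0 2] by simp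
  then have "integrable M (\<lambda>w. (X w)\<^sup>2)"
    using distributed_integrable[OF D, of "\<lambda>x. x\<^sup>2"] by simp
  then have L2: "X \<in> L2 M" by (intro L2I) auto
  have D': "distributed M lborel (\<lambda>w. X w / \<sigma>) std_normal_density"
    using D normal_standard_normal_convert[OF \<sigma>, of X 0] by simp
  have "(CLINT w|M. iexp (X w)) = (CLINT w|M. iexp (\<sigma> * (X w / \<sigma>)))" using \<sigma> by simp
  also have "\<dots> = (CLINT x|distr M lborel (\<lambda>w. X w / \<sigma>). iexp (\<sigma> * x))"
    by (rule integral_distr[symmetric]) auto
  also have "\<dots> = char std_normal_distribution \<sigma>"
    unfolding char_def distributed_distr_eq_density[OF D'] by simp
  also have "\<dots> = complex_of_real (exp (- (\<sigma>\<^sup>2) / 2))" by (simp add: char_std_normal_distribution)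
  finally show "centered_gaussian M X" unfolding centered_gaussian_def using L2 mean var by simp
qed

lemma (in prob_space) normal_scale_centered_gaussian:
  assumes D: "distributed M lborel X (normal_density 0 \<sigma>)" and \<sigma>: "0 < \<sigma>"
  shows "centered_gaussian M (\<lambda>w. c * X w)"
proof (cases "c = 0")
  case True
  then show ?thesis by (intro centered_gaussian_zero) auto
next
  case False
  then show ?thesis
    using normal_density_affine[OF D \<sigma>, of c 0] \<sigma> normal_centered_gaussian(1)[of "\<lambda>w. c * X w" "\<bar>c\<bar> * \<sigma>"] by simp
qed

lemma (in prob_space) centered_gaussian_add:
  assumes ind: "indep_var borel U borel W" and U: "centered_gaussian M U" and W: "centered_gaussian M W"
  shows "centered_gaussian M (\<lambda>w. U w + W w)"
proof -
  have U2: "U \<in> L2 M" and W2: "W \<in> L2 M" using U W by (auto simp: centered_gaussian_def)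
  note [measurable] = L2_measurable[OF U2] L2_measurable[OF W2]
  have "(LINT w|M. U w * W w) = (LINT w|M. U w) * (LINT w|M. W w)"
    by (rule indep_var_lebesgue_integral[OF ind L2_integrable[OF U2] L2_integrable[OF W2]])
  then have "(LINT w|M. U w * W w) = 0" using U by (simp add: centered_gaussian_def)
  then have sq: "(LINT w|M. (U w + W w)\<^sup>2) = (LINT w|M. (U w)\<^sup>2) + (LINT w|M. (W w)\<^sup>2)"
    using integral_sq_add[OF U2 W2, of 1] by simp
  have ch: "char (distr M borel f) 1 = (CLINT w|M. iexp (f w))" if [measurable]: "f \<in> borel_measurable M" for f
    unfolding char_def by (subst integral_distr) auto
  have "(CLINT w|M. iexp (U w + W w)) = (CLINT w|M. iexp (U w)) * (CLINT w|M. iexp (W w))"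
    using char_distr_add[OF ind, of 1] by (simp only: ch borel_measurable_add L2_measurable[OF U2] L2_measurable[OF W2])
  also have "\<dots> = complex_of_real (exp (- (LINT w|M. (U w)\<^sup>2) / 2) * exp (- (LINT w|M. (W w)\<^sup>2) / 2))"
    using U W by (simp only: centered_gaussian_def of_real_mult)
  also have "exp (- (LINT w|M. (U w)\<^sup>2) / 2) * exp (- (LINT w|M. (W w)\<^sup>2) / 2) = exp (- (LINT w|M. (U w + W w)\<^sup>2) / 2)"
    unfolding exp_add[symmetric] sq by (simp add: field_simps)
  finally show ?thesis
    using U W L2_integrable[OF U2] L2_integrable[OF W2]
    unfolding centered_gaussian_def by (simp add: L2_add)
qed

lemma (in prob_space) centered_gaussian_sum:
  assumes "finite I" and "indep_vars (\<lambda>_. borel) U I" and "\<And>i. i \<in> I \<Longrightarrow> centered_gaussian M (U i)"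
  shows "centered_gaussian M (\<lambda>w. \<Sum>i\<in>I. U i w)"
  using assms
proof (induction I)
  case empty
  then show ?case by (intro centered_gaussian_zero) auto
next
  case (insert i I)
  have "centered_gaussian M (\<lambda>w. U i w + (\<Sum>i\<in>I. U i w))"
  proof (rule centered_gaussian_add)
    show "indep_var borel (U i) borel (\<lambda>w. \<Sum>i\<in>I. U i w)"
      using insert by (intro indep_vars_sum) auto
    show "centered_gaussian M (\<lambda>w. \<Sum>i\<in>I. U i w)"
      using insert by (intro insert.IH indep_vars_subset[OF insert.prems(1)]) auto
  qed (use insert in auto)
  then show ?case using insert by simp
qed

text \<open>Limits of elements of \<open>S 0, S 1, \<dots>\<close>. Asking for approximations from all late \<open>S n\<close> makes this
  a subspace although the \<open>S n\<close> need not be nested.\<close>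

definition approximable :: "'a measure \<Rightarrow> (nat \<Rightarrow> ('a \<Rightarrow> real) set) \<Rightarrow> ('a \<Rightarrow> real) set" where
  "approximable M S = {U \<in> L2 M. \<forall>e>0. \<exists>N. \<forall>n\<ge>N. \<exists>L\<in>S n. (LINT w|M. (L w - U w)\<^sup>2) < e}"

text \<open>Mean and characteristic function survive the limit because \<open>iexp\<close> is
  Lipschitz with constant one, so expectations differ by at most the distance in mean
  square.\<close>

lemma (in prob_space) approximable_gaussian_space:
  assumes zero: "\<And>n. (\<lambda>_. 0) \<in> S n"
    and add: "\<And>n f g. f \<in> S n \<Longrightarrow> g \<in> S n \<Longrightarrow> (\<lambda>w. f w + g w) \<in> S n"
    and scale: "\<And>n f c. f \<in> S n \<Longrightarrow> (\<lambda>w. c * f w) \<in> S n"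
    and gauss: "\<And>n f. f \<in> S n \<Longrightarrow> centered_gaussian M f"
  shows "gaussian_space M (approximable M S)" and "U \<in> approximable M S \<Longrightarrow> (LINT w|M. U w) = 0"
proof -
  have SL: "f \<in> L2 M" if "f \<in> S n" for f n using gauss[OF that] by (simp add: centered_gaussian_def)
  have VL: "f \<in> L2 M" if "f \<in> approximable M S" for f using that by (simp add: approximable_def)
  have ap: "\<exists>N. \<forall>n\<ge>N. \<exists>L\<in>S n. (LINT w|M. (L w - U w)\<^sup>2) < e" if "U \<in> approximable M S" "0 < e" for U e
    using that by (simp add: approximable_def)
  have seq: "\<exists>L. (\<forall>k. \<exists>n. L k \<in> S n) \<and> (\<lambda>k. (LINT w|M. (L k w - U w)\<^sup>2)) \<longlonglongrightarrow> 0" if U: "U \<in> approximable M S" for U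
  proof -
    have "\<exists>L. (\<exists>n. L \<in> S n) \<and> (LINT w|M. (L w - U w)\<^sup>2) < 1 / Suc k" for k :: nat
    proof -
      obtain N where "\<forall>n\<ge>N. \<exists>L\<in>S n. (LINT w|M. (L w - U w)\<^sup>2) < 1 / Suc k"
        using ap[OF U, of "1 / Suc k"] by auto
      then show ?thesis by (meson order_refl)
    qed
    then obtain L where L: "\<And>k. \<exists>n. L k \<in> S n" "\<And>k. (LINT w|M. (L k w - U w)\<^sup>2) < 1 / Suc k" by metis
    have "(\<lambda>k. (LINT w|M. (L k w - U w)\<^sup>2)) \<longlonglongrightarrow> 0"
      by (rule tendsto_sandwich[OF _ _ tendsto_const LIMSEQ_Suc[OF lim_inverse_n']])
        (use L(2) in \<open>auto intro!: always_eventually less_imp_le\<close>)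
    then show ?thesis using L by blast
  qed
  have closed: "closed_subspace M (approximable M S)"
    unfolding closed_subspace_def
  proof (intro conjI ballI allI impI)
    show "approximable M S \<subseteq> L2 M" using VL by blast
    show "(\<lambda>_. 0) \<in> approximable M S" unfolding approximable_def using zero by (auto intro!: L2_zero bexI[of _ "\<lambda>_. 0"])
    show "(\<lambda>x. f x + g x) \<in> approximable M S" if f: "f \<in> approximable M S" and g: "g \<in> approximable M S" for f g
      unfolding approximable_def
    proof (intro CollectI conjI allI impI)
      fix e :: real assume "0 < e"
      then obtain N1 N2 where N1: "\<forall>n\<ge>N1. \<exists>L\<in>S n. (LINT w|M. (L w - f w)\<^sup>2) < e / 4"
        and N2: "\<forall>n\<ge>N2. \<exists>L\<in>S n. (LINT w|M. (L w - g w)\<^sup>2) < e / 4"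
        using ap[OF f, of "e / 4"] ap[OF g, of "e / 4"] by auto
      have "\<exists>L\<in>S n. (LINT w|M. (L w - (f w + g w))\<^sup>2) < e" if nN: "n \<ge> max N1 N2" for n
      proof -
        obtain L1 L2 where L: "L1 \<in> S n" "(LINT w|M. (L1 w - f w)\<^sup>2) < e / 4" "L2 \<in> S n" "(LINT w|M. (L2 w - g w)\<^sup>2) < e / 4"
        proof -
          have "\<exists>L\<in>S n. (LINT w|M. (L w - f w)\<^sup>2) < e / 4" "\<exists>L\<in>S n. (LINT w|M. (L w - g w)\<^sup>2) < e / 4"
            using N1 N2 nN by auto
          then show ?thesis using that by blast
        qed
        have "(LINT w|M. ((L1 w + L2 w) - (f w + g w))\<^sup>2) = (LINT w|M. ((L1 w - f w) + (L2 w - g w))\<^sup>2)"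
          by (simp add: algebra_simps)
        also have "\<dots> \<le> 2 * (LINT w|M. (L1 w - f w)\<^sup>2) + 2 * (LINT w|M. (L2 w - g w)\<^sup>2)"
          by (rule integral_sq_add_le[OF L2_diff[OF SL[OF L(1)] VL[OF f]] L2_diff[OF SL[OF L(3)] VL[OF g]]])
        also have "\<dots> < e" using L(2,4) by simp
        finally show ?thesis using add[OF L(1,3)] by (intro bexI[of _ "\<lambda>w. L1 w + L2 w"])
      qed
      then show "\<exists>N. \<forall>n\<ge>N. \<exists>L\<in>S n. (LINT w|M. (L w - (f w + g w))\<^sup>2) < e" by blast
    qed (rule L2_add[OF VL[OF f] VL[OF g]])
    show "(\<lambda>x. c * f x) \<in> approximable M S" if f: "f \<in> approximable M S" for f c
      unfolding approximable_def
    proof (intro CollectI conjI allI impI)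
      fix e :: real assume "0 < e"
      \<comment> \<open>The summand \<open>1\<close> keeps the quotient
        \<open>e / (c\<^sup>2 + 1)\<close> meaningful for \<open>c = 0\<close>.\<close>
      have c1: "0 < c\<^sup>2 + 1" by (rule add_nonneg_pos) auto
      obtain N where N: "\<forall>n\<ge>N. \<exists>L\<in>S n. (LINT w|M. (L w - f w)\<^sup>2) < e / (c\<^sup>2 + 1)"
        using ap[OF f, of "e / (c\<^sup>2 + 1)"] \<open>0 < e\<close> c1 by auto
      have "\<exists>L\<in>S n. (LINT w|M. (L w - c * f w)\<^sup>2) < e" if nN: "n \<ge> N" for n
      proof -
        obtain L where L: "L \<in> S n" "(LINT w|M. (L w - f w)\<^sup>2) < e / (c\<^sup>2 + 1)" using N nN by blast
        let ?i = "(LINT w|M. (L w - f w)\<^sup>2)"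
        have i0: "0 \<le> ?i" by simp
        have "(LINT w|M. (c * L w - c * f w)\<^sup>2) = c\<^sup>2 * ?i"
          by (simp add: right_diff_distrib[symmetric] power_mult_distrib)
        also have "\<dots> \<le> (c\<^sup>2 + 1) * ?i" using i0 by (intro mult_right_mono) auto
        also have "\<dots> < e" using L(2) c1 by (simp only: pos_less_divide_eq mult.commute)
        finally show ?thesis using scale[OF L(1)] by (intro bexI[of _ "\<lambda>w. c * L w"])
      qed
      then show "\<exists>N. \<forall>n\<ge>N. \<exists>L\<in>S n. (LINT w|M. (L w - c * f w)\<^sup>2) < e" by blast
    qed (rule L2_scale[OF VL[OF f]])
    show "f \<in> approximable M S" if f: "f \<in> L2 M" and g: "\<forall>n. g n \<in> approximable M S"
      and l: "(\<lambda>n. (LINT x|M. (g n x - f x)\<^sup>2)) \<longlonglongrightarrow> 0" for f :: "'a \<Rightarrow> real" and g :: "nat \<Rightarrow> 'a \<Rightarrow> real"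
      unfolding approximable_def
    proof (intro CollectI conjI allI impI f)
      fix e :: real assume "0 < e"
      then obtain k where k: "(LINT x|M. (g k x - f x)\<^sup>2) < e / 4"
        using order_tendstoD(2)[OF l, of "e / 4"] by (auto simp: eventually_sequentially)
      obtain N where N: "\<forall>n\<ge>N. \<exists>L\<in>S n. (LINT w|M. (L w - g k w)\<^sup>2) < e / 4"
        using ap[of "g k" "e / 4"] g \<open>0 < e\<close> by auto
      have "\<exists>L\<in>S n. (LINT w|M. (L w - f w)\<^sup>2) < e" if nN: "n \<ge> N" for n
      proof -
        obtain L where L: "L \<in> S n" "(LINT w|M. (L w - g k w)\<^sup>2) < e / 4" using N nN by blast
        have "(LINT w|M. (L w - f w)\<^sup>2) \<le> 2 * (LINT w|M. (L w - g k w)\<^sup>2) + 2 * (LINT w|M. (f w - g k w)\<^sup>2)"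
          using g by (intro integral_sq_diff_le SL[OF L(1)] f VL) auto
        also have "\<dots> < e" using L(2) k by (simp add: power2_commute)
        finally show ?thesis using L(1) by blast
      qed
      then show "\<exists>N. \<forall>n\<ge>N. \<exists>L\<in>S n. (LINT w|M. (L w - f w)\<^sup>2) < e" by blast
    qed
  qed
  have both: "(CLINT w|M. iexp (U w)) = complex_of_real (exp (- (LINT w|M. (U w)\<^sup>2) / 2)) \<and> (LINT w|M. U w) = 0"
    if U: "U \<in> approximable M S" for U
  proof -
    obtain L where L: "\<And>k. \<exists>n. L k \<in> S n" and l: "(\<lambda>k. (LINT w|M. (L k w - U w)\<^sup>2)) \<longlonglongrightarrow> 0" using seq[OF U] by blast
    have L2: "L k \<in> L2 M" and g: "centered_gaussian M (L k)" for k using L[of k] SL gauss by blast+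
    note [measurable] = L2_measurable[OF L2] L2_measurable[OF VL[OF U]]
    have ix: "integrable M (\<lambda>w. iexp (f w))" if [measurable]: "f \<in> borel_measurable M" for f :: "'a \<Rightarrow> real"
      by (rule Bochner_Integration.integrable_bound[OF integrable_const[of "1::real"]]) auto
    have "(\<lambda>k. (LINT w|M. L k w * 1)) \<longlonglongrightarrow> (LINT w|M. U w * 1)"
      by (rule L2_tendsto_integral_mult_right[OF L2 VL[OF U] L2_const l])
    then have mean: "(LINT w|M. U w) = 0"
      using g by (simp add: centered_gaussian_def LIMSEQ_const_iff)
    have "(\<lambda>k. (CLINT w|M. iexp (L k w)) - (CLINT w|M. iexp (U w))) \<longlonglongrightarrow> 0"
    proof (rule Lim_null_comparison[OF always_eventually tendsto_sqrt_zero[OF l]], rule allI)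
      fix k
      have n1: "(CLINT w|M. iexp (L k w)) - (CLINT w|M. iexp (U w)) = (CLINT w|M. iexp (L k w) - iexp (U w))"
        by (rule Bochner_Integration.integral_diff[symmetric]; rule ix; measurable)
      have n2: "norm (CLINT w|M. iexp (L k w) - iexp (U w)) \<le> (LINT w|M. norm (iexp (L k w) - iexp (U w)))"
        by (rule integral_norm_bound)
      have n3: "(LINT w|M. norm (iexp (L k w) - iexp (U w))) \<le> (LINT w|M. \<bar>L k w - U w\<bar>)"
      proof (rule integral_mono)
        show "integrable M (\<lambda>w. norm (iexp (L k w) - iexp (U w)))"
          by (rule integrable_norm[OF Bochner_Integration.integrable_diff]; rule ix; measurable)
        show "integrable M (\<lambda>w. \<bar>L k w - U w\<bar>)" using L2_integrable[OF L2_diff[OF L2 VL[OF U]]] by simp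
        show "norm (iexp (L k w) - iexp (U w)) \<le> \<bar>L k w - U w\<bar>" for w
        proof -
          have "iexp (L k w) - iexp (U w) = (iexp (L k w - U w) - 1) * iexp (U w)"
            by (simp only: left_diff_distrib exp_add[symmetric] distrib_left[symmetric] of_real_add[symmetric]) simp
          then have "norm (iexp (L k w) - iexp (U w)) = norm (iexp (L k w - U w) - 1)"
            by (simp only: norm_mult norm_exp_i_times mult_1_right)
          also have "\<dots> \<le> \<bar>L k w - U w\<bar>" using iexp_approx1[of "L k w - U w" 0] by simp
          finally show ?thesis .
        qed
      qed
      have n4: "(LINT w|M. \<bar>L k w - U w\<bar>) \<le> sqrt (LINT w|M. (L k w - U w)\<^sup>2)"
        by (rule L2_integral_abs_le[OF L2_diff[OF L2 VL[OF U]]])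
      show "norm ((CLINT w|M. iexp (L k w)) - (CLINT w|M. iexp (U w))) \<le> sqrt (LINT w|M. (L k w - U w)\<^sup>2)"
        unfolding n1 by (rule order_trans[OF n2 order_trans[OF n3 n4]])
    qed
    then have "(\<lambda>k. CLINT w|M. iexp (L k w)) \<longlonglongrightarrow> (CLINT w|M. iexp (U w))" by (simp only: LIM_zero_iff)
    then have 1: "(\<lambda>k. complex_of_real (exp (- (LINT w|M. (L k w)\<^sup>2) / 2))) \<longlonglongrightarrow> (CLINT w|M. iexp (U w))"
      using g by (simp only: centered_gaussian_def)
    have "(\<lambda>k. complex_of_real (exp (- (LINT w|M. (L k w)\<^sup>2) / 2))) \<longlonglongrightarrow> complex_of_real (exp (- (LINT w|M. (U w)\<^sup>2) / 2))"
      by (intro tendsto_of_real tendsto_exp tendsto_divide tendsto_minus tendsto_const L2_tendsto_integral_sq[OF L2 VL[OF U] l]) simp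
    from LIMSEQ_unique[OF 1 this] mean show ?thesis by simp
  qed
  show "gaussian_space M (approximable M S)" unfolding gaussian_space_def using closed both by blast
  show "U \<in> approximable M S \<Longrightarrow> (LINT w|M. U w) = 0" using both by blast
qed

section \<open>Brownian increments and time integrals of processes\<close>

lemma brownian_motion_increment:
  assumes "prob_space M" and W: "brownian_motion M T W" and st: "0 \<le> s" "s < t" "t \<le> T"
  shows "centered_gaussian M (\<lambda>w. c * (W t w - W s w))" and "(LINT w|M. (W t w - W s w)\<^sup>2) = t - s"
proof -
  interpret prob_space M by fact
  have D: "distributed M lborel (\<lambda>w. W t w - W s w) (normal_density 0 (sqrt (t - s)))"
    using W st by (simp add: brownian_motion_def)
  show "centered_gaussian M (\<lambda>w. c * (W t w - W s w))"
    using normal_scale_centered_gaussian[OF D] st by simp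
  show "(LINT w|M. (W t w - W s w)\<^sup>2) = t - s"
    using normal_centered_gaussian(2)[OF D] st by simp
qed

lemma brownian_motion_orthogonal_increments:
  assumes M: "prob_space M" and W: "brownian_motion M T W" and T: "0 \<le> T"
  shows "orthogonal_increments M T W"
proof -
  interpret prob_space M by fact
  show ?thesis
  proof
    show "0 \<le> T" by fact
    have Wm: "W t \<in> borel_measurable M" if "t \<in> {0..T}" for t
      using W that unfolding brownian_motion_def by blast
    have W0: "AE w in M. W 0 w = 0" using W unfolding brownian_motion_def by blast
    show "W t \<in> L2 M" if t: "t \<in> {0..T}" for t
    proof (cases "t = 0")
      case True
      then show ?thesis
        using W0 Wm[OF t] by (intro L2_cong_AE[OF L2_zero]) (auto elim: eventually_mono)
    next
      case False
      have "centered_gaussian M (\<lambda>w. 1 * (W t w - W 0 w))"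
        by (rule brownian_motion_increment(1)[OF M W]) (use t False in auto)
      then have "(\<lambda>w. W t w - W 0 w) \<in> L2 M"
        unfolding centered_gaussian_def by (simp only: mult_1_left)
      moreover have "AE w in M. W t w - W 0 w = W t w" using W0 by eventually_elim simp
      ultimately show ?thesis by (rule L2_cong_AE[OF _ Wm[OF t]])
    qed
    show "(LINT w|M. (W t w - W s w)\<^sup>2) = t - s" if "0 \<le> s" "s \<le> t" "t \<le> T" for s t
    proof (cases "s = t")
      case False
      then show ?thesis using that by (intro brownian_motion_increment(2)[OF M W]) auto
    qed simp
  qed
qed

lemma brownian_motion_increment_mean:
  assumes "prob_space M" and W: "brownian_motion M T W" and st: "0 \<le> s" "s \<le> t" "t \<le> T"
  shows "(LINT w|M. W t w - W s w) = 0"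
proof (cases "s = t")
  case False
  have "centered_gaussian M (\<lambda>w. 1 * (W t w - W s w))"
    by (rule brownian_motion_increment(1)[OF assms(1,2)]) (use st False in auto)
  then have "(LINT w|M. 1 * (W t w - W s w)) = 0" unfolding centered_gaussian_def by blast
  then show ?thesis by (simp only: mult_1_left)
qed simp

text \<open>Almost every path is square integrable in time, so Cauchy-Schwarz bounds the path
  integral. The pairing with \<open>\<psi>\<close> is Fubini for the product of \<open>Z\<close> and
  \<open>g(s) \<psi>(w)\<close>, both square integrable on the product space.\<close>

lemma (in prob_space) process_integral:
  fixes Z :: "real \<Rightarrow> 'a \<Rightarrow> real"
  assumes Z: "(\<lambda>x. Z (fst x) (snd x)) \<in> L2 (lborel \<Otimes>\<^sub>M M)" and g: "g \<in> L2 lborel"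
  shows "AE w in M. integrable lborel (\<lambda>s. g s * Z s w)"
    and "(\<lambda>w. (LBINT s. g s * Z s w)) \<in> L2 M"
    and "(LINT w|M. (LBINT s. g s * Z s w)\<^sup>2) \<le> (LBINT s. (g s)\<^sup>2) * (\<integral>x. (Z (fst x) (snd x))\<^sup>2 \<partial>(lborel \<Otimes>\<^sub>M M))"
    and "\<psi> \<in> L2 M \<Longrightarrow> integrable lborel (\<lambda>s. g s * (LINT w|M. Z s w * \<psi> w))"
    and "\<psi> \<in> L2 M \<Longrightarrow> (LINT w|M. (LBINT s. g s * Z s w) * \<psi> w) = (LBINT s. g s * (LINT w|M. Z s w * \<psi> w))"
proof -
  interpret P: pair_sigma_finite lborel M ..
  note [measurable] = L2_measurable[OF g]
  have Zm [measurable]: "(\<lambda>x. Z (fst x) (snd x)) \<in> borel_measurable (lborel \<Otimes>\<^sub>M M)" by (rule L2_measurable[OF Z])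
  have Zm' [measurable]: "(\<lambda>x. Z (snd x) (fst x)) \<in> borel_measurable (M \<Otimes>\<^sub>M lborel)"
    using measurable_compose[OF measurable_pair_swap' Zm] by (simp add: case_prod_beta')
  let ?I = "\<lambda>w. (LBINT s. g s * Z s w)"
  have I_meas [measurable]: "?I \<in> borel_measurable M"
    by (rule lborel.borel_measurable_lebesgue_integral) (simp add: case_prod_beta')
  have Zsq: "integrable (lborel \<Otimes>\<^sub>M M) (\<lambda>(s, w). (Z s w)\<^sup>2)" using L2_integrable_sq[OF Z] by (simp add: case_prod_beta')
  have Zw: "AE w in M. (\<lambda>s. Z s w) \<in> L2 lborel"
    using P.AE_integrable_snd[OF Zsq] AE_space
  proof eventually_elim
    case (elim w)
    have "(\<lambda>s. Z s w) \<in> borel_measurable lborel"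
      using measurable_compose[OF measurable_Pair2'[OF elim(2)] Zm] by simp
    then show ?case using elim by (intro L2I) auto
  qed
  then show 1: "AE w in M. integrable lborel (\<lambda>s. g s * Z s w)"
    by eventually_elim (rule L2_mult_integrable[OF g])
  let ?n = "\<lambda>w. (LBINT s. (Z s w)\<^sup>2)"
  have bound: "AE w in M. (?I w)\<^sup>2 \<le> (LBINT s. (g s)\<^sup>2) * ?n w"
    using Zw by eventually_elim (rule L2_Cauchy_Schwarz[OF g])
  have nint: "integrable M ?n" using P.integrable_snd[OF Zsq] .
  have gnint: "integrable M (\<lambda>w. (LBINT s. (g s)\<^sup>2) * ?n w)" using nint by (rule integrable_mult_right)
  have Isq: "integrable M (\<lambda>w. (?I w)\<^sup>2)"
    by (rule Bochner_Integration.integrable_bound[OF gnint]) (use bound in \<open>auto elim!: eventually_mono intro: order_trans[OF _ abs_ge_self]\<close>)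
  then show I2: "?I \<in> L2 M" by (intro L2I) auto
  have "(LINT w|M. (?I w)\<^sup>2) \<le> (LINT w|M. (LBINT s. (g s)\<^sup>2) * ?n w)"
    by (rule integral_mono_AE[OF Isq gnint bound])
  also have "\<dots> = (LBINT s. (g s)\<^sup>2) * (\<integral>x. (Z (fst x) (snd x))\<^sup>2 \<partial>(lborel \<Otimes>\<^sub>M M))"
    using P.integral_snd[OF Zsq] by (simp add: case_prod_beta')
  finally show "(LINT w|M. (?I w)\<^sup>2) \<le> (LBINT s. (g s)\<^sup>2) * (\<integral>x. (Z (fst x) (snd x))\<^sup>2 \<partial>(lborel \<Otimes>\<^sub>M M))" .
  assume \<psi>: "\<psi> \<in> L2 M"
  note [measurable] = L2_measurable[OF \<psi>]
  have g\<psi>: "(\<lambda>x. g (fst x) * \<psi> (snd x)) \<in> L2 (lborel \<Otimes>\<^sub>M M)"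
  proof (rule L2I)
    show "(\<lambda>x. g (fst x) * \<psi> (snd x)) \<in> borel_measurable (lborel \<Otimes>\<^sub>M M)" by measurable
    have "integrable (lborel \<Otimes>\<^sub>M M) (\<lambda>(s, w). (g s)\<^sup>2 * (\<psi> w)\<^sup>2)"
    proof (rule P.Fubini_integrable)
      show "(\<lambda>(s, w). (g s)\<^sup>2 * (\<psi> w)\<^sup>2) \<in> borel_measurable (lborel \<Otimes>\<^sub>M M)" unfolding case_prod_beta' by measurable
      show "integrable lborel (\<lambda>s. (LINT w|M. norm (case (s, w) of (s, w) \<Rightarrow> (g s)\<^sup>2 * (\<psi> w)\<^sup>2)))"
        using L2_integrable_sq[OF g] by (simp add: abs_mult)
      show "AE s in lborel. integrable M (\<lambda>w. case (s, w) of (s, w) \<Rightarrow> (g s)\<^sup>2 * (\<psi> w)\<^sup>2)"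
        using L2_integrable_sq[OF \<psi>] by simp
    qed
    then show "integrable (lborel \<Otimes>\<^sub>M M) (\<lambda>x. (g (fst x) * \<psi> (snd x))\<^sup>2)"
      by (simp add: case_prod_beta' power_mult_distrib)
  qed
  have int: "integrable (lborel \<Otimes>\<^sub>M M) (\<lambda>(s, w). g s * (Z s w * \<psi> w))"
    using L2_mult_integrable[OF g\<psi> Z] by (simp add: case_prod_beta' ac_simps)
  show "integrable lborel (\<lambda>s. g s * (LINT w|M. Z s w * \<psi> w))"
    using P.integrable_fst[OF int] by simp
  have "(LINT w|M. ?I w * \<psi> w) = (LINT w|M. (LBINT s. g s * (Z s w * \<psi> w)))"
    by (intro Bochner_Integration.integral_cong refl) (simp add: mult.assoc flip: integral_mult_left_zero)
  also have "\<dots> = (LBINT s. (LINT w|M. g s * (Z s w * \<psi> w)))"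
    by (rule P.Fubini_integral[OF int])
  finally show "(LINT w|M. ?I w * \<psi> w) = (LBINT s. g s * (LINT w|M. Z s w * \<psi> w))" by simp
qed

text \<open>The part of the integral orthogonal to \<open>V\<close> is orthogonal to every
  \<open>Z s\<close>, hence by Fubini to the integral itself, and so vanishes. Approximation by
  Riemann sums, which would call for continuity in time, is avoided.\<close>

lemma (in prob_space) process_integral_in_subspace:
  fixes Z :: "real \<Rightarrow> 'a \<Rightarrow> real"
  assumes Z: "(\<lambda>x. Z (fst x) (snd x)) \<in> L2 (lborel \<Otimes>\<^sub>M M)" and g: "g \<in> L2 lborel"
    and V: "closed_subspace M V" and ZV: "\<And>s. Z s \<in> V"
  shows "(\<lambda>w. (LBINT s. g s * Z s w)) \<in> V"
proof -
  let ?I = "\<lambda>w. (LBINT s. g s * Z s w)"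
  have I2: "?I \<in> L2 M" by (rule process_integral(2)[OF Z g])
  obtain p where p: "p \<in> V" and orth: "\<And>v. v \<in> V \<Longrightarrow> (LINT w|M. (?I w - p w) * v w) = 0"
    by (rule L2_projection[OF V I2]) blast
  have p2: "p \<in> L2 M" using V p by (rule closed_subspace_L2)
  define \<psi> where "\<psi> w = ?I w - p w" for w
  have \<psi>: "\<psi> \<in> L2 M" unfolding \<psi>_def[abs_def] by (rule L2_diff[OF I2 p2])
  have "(LINT w|M. ?I w * \<psi> w) = (LBINT s. g s * (LINT w|M. Z s w * \<psi> w))"
    by (rule process_integral(5)[OF Z g \<psi>])
  also have "\<dots> = 0" using orth[OF ZV] by (simp add: \<psi>_def mult.commute)
  finally have "(LINT w|M. ?I w * \<psi> w) = 0" .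
  moreover have "(LINT w|M. p w * \<psi> w) = 0" using orth[OF p] by (simp add: \<psi>_def mult.commute)
  moreover have "(LINT w|M. (\<psi> w)\<^sup>2) = (LINT w|M. ?I w * \<psi> w) - (LINT w|M. p w * \<psi> w)"
  proof -
    have "(LINT w|M. (\<psi> w)\<^sup>2) = (LINT w|M. ?I w * \<psi> w - p w * \<psi> w)"
      by (intro Bochner_Integration.integral_cong refl) (simp add: \<psi>_def power2_eq_square left_diff_distrib)
    then show ?thesis using L2_mult_integrable[OF I2 \<psi>] L2_mult_integrable[OF p2 \<psi>] by simp
  qed
  ultimately have "AE w in M. \<psi> w = 0" by (intro integral_sq_zero_AE[OF \<psi>]) simp
  then show ?thesis
    by (intro closed_subspace_cong_AE[OF V p L2_measurable[OF I2]]) (auto simp: \<psi>_def elim: eventually_mono)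
qed

section \<open>The signal\<close>

text \<open>The initial value and the pair of paths take values of different types, so their
  independence is formulated with generated sigma-algebras; \<open>indep_var\<close> becomes
  available once both are mapped into one space \<open>N\<close>.\<close>

lemma (in prob_space) indep_set_imp_indep_var:
  assumes ind: "indep_set (sets (vimage_algebra (space M) X P)) (sets (vimage_algebra (space M) Y Q))"
    and X: "X \<in> measurable M P" and Y: "Y \<in> measurable M Q"
    and f: "f \<in> measurable P N" and g: "g \<in> measurable Q N"
  shows "indep_var N (\<lambda>w. f (X w)) N (\<lambda>w. g (Y w))"
proof -
  have sub: "sigma_sets (space M) {(\<lambda>w. h (Z w)) -` A \<inter> space M | A. A \<in> sets N} \<subseteq> sets (vimage_algebra (space M) Z R)"
    if Z: "Z \<in> measurable M R" and h: "h \<in> measurable R N" for h Z and R :: "'z measure"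
  proof -
    have "Z \<in> measurable (vimage_algebra (space M) Z R) R"
      using measurable_space[OF Z] by (intro measurable_vimage_algebra1) auto
    then have "(\<lambda>w. h (Z w)) \<in> measurable (vimage_algebra (space M) Z R) N" using h by (rule measurable_compose)
    then have "{(\<lambda>w. h (Z w)) -` A \<inter> space M | A. A \<in> sets N} \<subseteq> sets (vimage_algebra (space M) Z R)"
      using measurable_sets[of "\<lambda>w. h (Z w)" "vimage_algebra (space M) Z R" N] by auto
    then show ?thesis using sets.sigma_sets_subset[of _ "vimage_algebra (space M) Z R"] by simp
  qed
  show ?thesis
    unfolding indep_var_eq indep_sets2_eq
    using ind[unfolded indep_sets2_eq] sub[OF X f] sub[OF Y g] measurable_compose[OF X f] measurable_compose[OF Y g]
    by blast
qed

lemma (in prob_space) indep_var_integral_zero: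
  assumes "indep_var borel U borel W" "U \<in> L2 M" "W \<in> L2 M" "(LINT w|M. W w) = (0::real)"
  shows "(LINT w|M. U w * W w) = 0"
  using indep_var_lebesgue_integral[OF assms(1) L2_integrable[OF assms(2)] L2_integrable[OF assms(3)]] assms(4) by simp

lemma bounded_measurable_extension:
  fixes f :: "real \<Rightarrow> real"
  assumes "f \<in> borel_measurable (restrict_space borel {0..T})" "bounded (f ` {0..T})"
  shows "bounded_supp T (\<lambda>s. indicator {0..T} s * f s)"
proof -
  obtain c where "\<forall>x\<in>f ` {0..T}. norm x \<le> c" using assms(2) unfolding bounded_iff by blast
  then have c: "\<bar>f s\<bar> \<le> c" if "s \<in> {0..T}" for s using that by auto
  show ?thesis
  proof (rule bounded_suppI)
    have "(\<lambda>s. indicator {0..T} s *\<^sub>R f s) \<in> borel_measurable borel"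
      using assms(1) by (subst (asm) borel_measurable_restrict_space_iff) auto
    then show "(\<lambda>s. indicator {0..T} s * f s) \<in> borel_measurable borel" by simp
    show "\<bar>indicator {0..T} s * f s\<bar> \<le> \<bar>c\<bar>" for s
      using c[of s] by (auto split: split_indicator intro: order_trans)
  qed auto
qed

lemma integrable_powr_from_0:
  assumes "-1 < p" "0 \<le> T"
  shows "integrable lborel (\<lambda>x. indicator {0..T} x * x powr p :: real)"
proof -
  have "((\<lambda>x. x powr p) has_integral (T powr (p + 1) / (p + 1))) {0..T}"
    using assms by (rule has_integral_powr_from_0)
  then have "(\<lambda>x. x powr p) absolutely_integrable_on {0..T}"
    by (intro nonnegative_absolutely_integrable_1) (auto simp: integrable_on_def)
  then have "integrable lebesgue (\<lambda>x. indicator {0..T} x * x powr p :: real)"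
    by (simp add: set_integrable_def)
  then show ?thesis by (subst (asm) integrable_completion) auto
qed

lemma integrable_mult_bounded:
  fixes f g :: "'b \<Rightarrow> real"
  assumes "integrable N f" "g \<in> borel_measurable N" "\<And>x. \<bar>g x\<bar> \<le> c"
  shows "integrable N (\<lambda>x. g x * f x)"
proof (rule Bochner_Integration.integrable_bound[OF integrable_mult_right[OF assms(1), of c]])
  have "\<bar>g x * f x\<bar> \<le> \<bar>c * f x\<bar>" for x
    using assms(3)[of x] by (simp add: abs_mult mult_right_mono)
  then show "AE x in N. norm (g x * f x) \<le> norm (c * f x)" by simp
qed (use assms in measurable)

text \<open>Clamping the time argument to \<open>{0..T}\<close> is measurable into the restricted
  space where the process is known to be measurable; the indicator removes the values at clamped
  times.\<close>

lemma measurable_process_extension: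
  assumes T: "0 \<le> T" and Z: "measurable_process M T Z"
  shows "(\<lambda>x. indicator {0..T} (fst x) * Z (fst x) (snd x)) \<in> borel_measurable (borel \<Otimes>\<^sub>M M)"
proof -
  have Z': "(\<lambda>(t, w). Z t w) \<in> borel_measurable (restrict_space borel {0..T} \<Otimes>\<^sub>M M)"
    using Z by (simp add: measurable_process_def)
  have clamp: "(\<lambda>s. max 0 (min T s)) \<in> measurable borel (restrict_space borel {0..T})"
    by (rule measurable_restrict_space2) (use T in auto)
  have "(\<lambda>x. (max 0 (min T (fst x)), snd x)) \<in> measurable (borel \<Otimes>\<^sub>M M) (restrict_space borel {0..T} \<Otimes>\<^sub>M M)"
    by (rule measurable_Pair[OF measurable_compose[OF measurable_fst clamp] measurable_snd])
  from measurable_compose[OF this Z']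
  have [measurable]: "(\<lambda>x. Z (max 0 (min T (fst x))) (snd x)) \<in> borel_measurable (borel \<Otimes>\<^sub>M M)" by simp
  have "(\<lambda>x. indicator {0..T} (fst x) * Z (fst x) (snd x)) = (\<lambda>x. indicator {0..T} (fst x) * Z (max 0 (min T (fst x))) (snd x))"
    by (auto split: split_indicator)
  then show ?thesis by simp
qed

text \<open>Fubini for null sets: exceptional events depending on the time are traded for null sets
  of times depending on the path.\<close>

lemma (in prob_space) AE_process_commute:
  assumes P: "Measurable.pred (borel \<Otimes>\<^sub>M M) (\<lambda>x. P (fst x) (snd x))" and ae: "\<And>t::real. AE w in M. P t w"
  shows "AE w in M. AE t in lborel. P t w"
proof -
  interpret pair_sigma_finite lborel M ..
  have "{x \<in> space (lborel \<Otimes>\<^sub>M M). P (fst x) (snd x)} \<in> sets (lborel \<Otimes>\<^sub>M M)"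
    using predE[OF P] by (simp add: space_pair_measure cong: sets_pair_measure_cong)
  from AE_commute[OF this] ae show ?thesis by simp
qed

locale noisy_signal = prob_space M for M :: "'a measure" +
  fixes T \<alpha> :: real and F C :: "real \<Rightarrow> real" and B\<^sub>1 B\<^sub>2 X :: "real \<Rightarrow> 'a \<Rightarrow> real" and X\<^sub>0 :: "'a \<Rightarrow> real"
  assumes T_pos: "0 < T" and alpha: "1 / 2 < \<alpha>"
    and F: "F \<in> borel_measurable (restrict_space borel {0..T})" "bounded (F ` {0..T})"
    and C: "C \<in> borel_measurable (restrict_space borel {0..T})" "bounded (C ` {0..T})"
    and B1: "brownian_motion M T B\<^sub>1" and B2: "brownian_motion M T B\<^sub>2"
    and B_indep: "indep_var (path_space T) (sample_path T B\<^sub>1) (path_space T) (sample_path T B\<^sub>2)"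
    and X0_gauss: "gaussian_rv M X\<^sub>0" and X0_L2: "X\<^sub>0 \<in> L2 M"
    and X0_indep: "indep_set (sets (vimage_algebra (space M) X\<^sub>0 borel))
           (sets (vimage_algebra (space M) (\<lambda>w. (sample_path T B\<^sub>1 w, sample_path T B\<^sub>2 w))
              (path_space T \<Otimes>\<^sub>M path_space T)))"
    and X_proc: "measurable_process M T X"
    and X_sq: "(\<integral>\<^sup>+t\<in>{0..T}. (\<integral>\<^sup>+w. ennreal ((X t w)\<^sup>2) \<partial>M) \<partial>lborel) < \<infinity>"
    and X_eq: "\<And>t. t \<in> {0..T} \<Longrightarrow>
           \<exists>N. has_wiener_integral M B\<^sub>1 0 t (\<lambda>s. (t - s) powr (\<alpha> - 1) * C s) N \<and>
             (AE w in M. X t w =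
            X\<^sub>0 w + 1 / Gamma \<alpha> * (LBINT s:{0..t}. (t - s) powr (\<alpha> - 1) * F s * X s w)
            + 1 / Gamma \<alpha> * N w)"
begin

sublocale W1: orthogonal_increments M T B\<^sub>1
  by (rule brownian_motion_orthogonal_increments[OF prob_space_axioms B1]) (use T_pos in simp)

sublocale W2: orthogonal_increments M T B\<^sub>2
  by (rule brownian_motion_orthogonal_increments[OF prob_space_axioms B2]) (use T_pos in simp)

lemma X0_centered: "centered_gaussian M (\<lambda>w. c * (X\<^sub>0 w - expectation X\<^sub>0))"
proof -
  note [measurable] = L2_measurable[OF X0_L2]
  from X0_gauss obtain \<mu> where "(AE w in M. X\<^sub>0 w = \<mu>) \<or> (\<exists>\<sigma>>0. distributed M lborel X\<^sub>0 (normal_density \<mu> \<sigma>))"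
    by (auto simp: gaussian_rv_def)
  then show ?thesis
  proof
    assume ae: "AE w in M. X\<^sub>0 w = \<mu>"
    have "expectation X\<^sub>0 = expectation (\<lambda>_. \<mu>)" by (rule integral_cong_AE) (use ae in auto)
    then have "expectation X\<^sub>0 = \<mu>" by (simp add: prob_space)
    then show ?thesis by (intro centered_gaussian_zero) (use ae in auto)
  next
    assume "\<exists>\<sigma>>0. distributed M lborel X\<^sub>0 (normal_density \<mu> \<sigma>)"
    then obtain \<sigma> where \<sigma>: "0 < \<sigma>" and D: "distributed M lborel X\<^sub>0 (normal_density \<mu> \<sigma>)" by blast
    have "expectation X\<^sub>0 = \<mu>" by (rule normal_distributed_expectation[OF \<sigma> D])
    moreover have "distributed M lborel (\<lambda>w. X\<^sub>0 w - \<mu>) (normal_density 0 \<sigma>)"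
      using normal_density_affine[OF D \<sigma>, of 1 "- \<mu>"] by simp
    ultimately show ?thesis using normal_scale_centered_gaussian[OF _ \<sigma>] by simp
  qed
qed

text \<open>A functional of the whole path, so that it is measurable on the path space and
  independence of the two paths passes to it.\<close>

definition grid_fun :: "nat \<Rightarrow> (nat \<Rightarrow> real) \<Rightarrow> (real \<Rightarrow> real) \<Rightarrow> real" where
  "grid_fun n a p = (\<Sum>i<Suc n. a i * (p (ugrid 0 T n (Suc i)) - p (ugrid 0 T n i)))"

lemma grid_in: "i \<le> Suc n \<Longrightarrow> ugrid 0 T n i \<in> {0..T}"
  using ugrid_bounds[of 0 T i n] T_pos by simp

lemma grid_fun_measurable [measurable]: "grid_fun n a \<in> borel_measurable (path_space T)"
  unfolding grid_fun_def[abs_def]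
proof (rule borel_measurable_sum)
  fix i assume "i \<in> {..<Suc n}"
  then have "ugrid 0 T n (Suc i) \<in> {0..T}" "ugrid 0 T n i \<in> {0..T}" using grid_in[of i n] grid_in[of "Suc i" n] by auto
  then show "(\<lambda>p. a i * (p (ugrid 0 T n (Suc i)) - p (ugrid 0 T n i))) \<in> borel_measurable (path_space T)"
    by (intro borel_measurable_times borel_measurable_diff borel_measurable_const measurable_component_singleton)
qed

lemma grid_fun_path: "grid_fun n a (sample_path T W w) = grid_fun n a (\<lambda>t. W t w)"
  unfolding grid_fun_def sample_path_def
  by (intro sum.cong refl) (use grid_in in auto)

lemma paths_measurable [measurable]:
  "sample_path T B\<^sub>1 \<in> measurable M (path_space T)" "sample_path T B\<^sub>2 \<in> measurable M (path_space T)"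
  using B_indep indep_var_rv1 indep_var_rv2 by blast+

lemma X0_paths_indep:
  fixes f :: "real \<Rightarrow> real"
  assumes "f \<in> borel_measurable borel" "g \<in> borel_measurable (path_space T \<Otimes>\<^sub>M path_space T)"
  shows "indep_var borel (\<lambda>w. f (X\<^sub>0 w)) borel (\<lambda>w. g (sample_path T B\<^sub>1 w, sample_path T B\<^sub>2 w))"
  by (rule indep_set_imp_indep_var[OF X0_indep L2_measurable[OF X0_L2] _ assms]) measurable

text \<open>All increments come from one grid, which makes each element a sum of independent
  Gaussian variables. Uniform grids with \<open>n + 1\<close> cells are not nested in
  \<open>n\<close>; the limit is therefore formed with \<open>approximable\<close>.\<close>

definition lin :: "nat \<Rightarrow> ('a \<Rightarrow> real) set" where
  "lin n = {(\<lambda>w. c * (X\<^sub>0 w - expectation X\<^sub>0) + (grid_fun n a (\<lambda>t. B\<^sub>1 t w) + grid_fun n b (\<lambda>t. B\<^sub>2 t w))) | c a b. True}"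

lemma grid_fun_gaussian:
  assumes W: "brownian_motion M T W" shows "centered_gaussian M (\<lambda>w. grid_fun n a (\<lambda>t. W t w))"
  unfolding grid_fun_def
proof (rule centered_gaussian_sum)
  have strict: "ugrid 0 T n i < ugrid 0 T n (Suc i)" for i
    using ugrid_Suc[of 0 T n i] T_pos by (simp add: ugrid_def divide_strict_right_mono)
  have "indep_vars (\<lambda>_. borel) (\<lambda>i w. W (ugrid 0 T n (Suc i)) w - W (ugrid 0 T n i) w) {..<Suc n}"
  proof -
    have "\<forall>n p. 0 \<le> p 0 \<and> (\<forall>i<n. p i < p (Suc i)) \<and> p n \<le> T \<longrightarrow>
        indep_vars (\<lambda>_. borel) (\<lambda>i w. W (p (Suc i)) w - W (p i) w) {..<n}"
      using W unfolding brownian_motion_def by (elim conjE)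
    from this[rule_format, of "ugrid 0 T n" "Suc n"] show ?thesis using strict grid_in[of 0 n] grid_in[of "Suc n" n] by simp
  qed
  then show "indep_vars (\<lambda>_. borel) (\<lambda>i w. a i * (W (ugrid 0 T n (Suc i)) w - W (ugrid 0 T n i) w)) {..<Suc n}"
    by (rule indep_vars_compose2[where Y="\<lambda>i x. a i * x"]) simp
  fix i assume "i \<in> {..<Suc n}"
  then show "centered_gaussian M (\<lambda>w. a i * (W (ugrid 0 T n (Suc i)) w - W (ugrid 0 T n i) w))"
    using grid_in[of i n] grid_in[of "Suc i" n] strict[of i]
    by (intro brownian_motion_increment(1)[OF prob_space_axioms W]) auto
qed simp

lemma lin_gaussian: assumes "U \<in> lin n" shows "centered_gaussian M U"
proof -
  obtain c a b where U: "U = (\<lambda>w. c * (X\<^sub>0 w - expectation X\<^sub>0) + (grid_fun n a (\<lambda>t. B\<^sub>1 t w) + grid_fun n b (\<lambda>t. B\<^sub>2 t w)))"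
    using assms by (auto simp: lin_def)
  have "indep_var borel (grid_fun n a \<circ> sample_path T B\<^sub>1) borel (grid_fun n b \<circ> sample_path T B\<^sub>2)"
    by (rule indep_var_compose[OF B_indep grid_fun_measurable grid_fun_measurable])
  then have 12: "indep_var borel (\<lambda>w. grid_fun n a (\<lambda>t. B\<^sub>1 t w)) borel (\<lambda>w. grid_fun n b (\<lambda>t. B\<^sub>2 t w))"
    by (simp add: comp_def grid_fun_path)
  have "indep_var borel (\<lambda>w. c * (X\<^sub>0 w - expectation X\<^sub>0)) borel
     (\<lambda>w. (\<lambda>p. grid_fun n a (fst p) + grid_fun n b (snd p)) (sample_path T B\<^sub>1 w, sample_path T B\<^sub>2 w))"
    by (rule X0_paths_indep) measurable
  then have 0: "indep_var borel (\<lambda>w. c * (X\<^sub>0 w - expectation X\<^sub>0)) borel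
     (\<lambda>w. grid_fun n a (\<lambda>t. B\<^sub>1 t w) + grid_fun n b (\<lambda>t. B\<^sub>2 t w))"
    by (simp add: comp_def grid_fun_path)
  show ?thesis
    unfolding U by (intro centered_gaussian_add[OF 0 X0_centered] centered_gaussian_add[OF 12] grid_fun_gaussian B1 B2)
qed

lemma grid_fun_linear:
  "grid_fun n (\<lambda>i. a i + a' i) p = grid_fun n a p + grid_fun n a' p"
  "grid_fun n (\<lambda>i. c * a i) p = c * grid_fun n a p"
  "grid_fun n (\<lambda>i. 0) p = 0"
  unfolding grid_fun_def by (simp_all only: sum.distrib[symmetric] distrib_right sum_distrib_left mult.assoc mult_zero_left sum.neutral_const)

definition gspace :: "('a \<Rightarrow> real) set" where "gspace = approximable M lin"

lemma gspace: "gaussian_space M gspace" and gspace_mean: "U \<in> gspace \<Longrightarrow> expectation U = 0"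
proof -
  have 1: "(\<lambda>_. 0) \<in> lin n" for n
    unfolding lin_def by (intro CollectI exI[of _ 0] exI[of _ "\<lambda>_. 0"]) (simp add: grid_fun_linear(3))
  have 2: "(\<lambda>w. f w + g w) \<in> lin n" if f: "f \<in> lin n" and g: "g \<in> lin n" for n f g
  proof -
    obtain c a b c' a' b' where "f = (\<lambda>w. c * (X\<^sub>0 w - expectation X\<^sub>0) + (grid_fun n a (\<lambda>t. B\<^sub>1 t w) + grid_fun n b (\<lambda>t. B\<^sub>2 t w)))"
      and "g = (\<lambda>w. c' * (X\<^sub>0 w - expectation X\<^sub>0) + (grid_fun n a' (\<lambda>t. B\<^sub>1 t w) + grid_fun n b' (\<lambda>t. B\<^sub>2 t w)))"
      using f g by (auto simp: lin_def)
    then have "(\<lambda>w. f w + g w) = (\<lambda>w. (c + c') * (X\<^sub>0 w - expectation X\<^sub>0)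
        + (grid_fun n (\<lambda>i. a i + a' i) (\<lambda>t. B\<^sub>1 t w) + grid_fun n (\<lambda>i. b i + b' i) (\<lambda>t. B\<^sub>2 t w)))"
      by (auto simp: grid_fun_linear(1) algebra_simps)
    then show ?thesis unfolding lin_def by blast
  qed
  have 3: "(\<lambda>w. d * f w) \<in> lin n" if f: "f \<in> lin n" for n f d
  proof -
    obtain c a b where "f = (\<lambda>w. c * (X\<^sub>0 w - expectation X\<^sub>0) + (grid_fun n a (\<lambda>t. B\<^sub>1 t w) + grid_fun n b (\<lambda>t. B\<^sub>2 t w)))"
      using f by (auto simp: lin_def)
    then have "(\<lambda>w. d * f w) = (\<lambda>w. (d * c) * (X\<^sub>0 w - expectation X\<^sub>0)
        + (grid_fun n (\<lambda>i. d * a i) (\<lambda>t. B\<^sub>1 t w) + grid_fun n (\<lambda>i. d * b i) (\<lambda>t. B\<^sub>2 t w)))"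
      by (simp add: grid_fun_linear(2) distrib_left mult.assoc)
    then show ?thesis unfolding lin_def by blast
  qed
  show "gaussian_space M gspace" unfolding gspace_def by (rule approximable_gaussian_space(1)[OF 1 2 3 lin_gaussian])
  show "U \<in> gspace \<Longrightarrow> expectation U = 0" unfolding gspace_def by (rule approximable_gaussian_space(2)[OF 1 2 3 lin_gaussian])
qed

lemma gspace_closed: "closed_subspace M gspace" using gspace by (simp add: gaussian_space_def)

lemma X0_in_gspace: "(\<lambda>w. X\<^sub>0 w - expectation X\<^sub>0) \<in> gspace"
proof -
  have L: "(\<lambda>w. X\<^sub>0 w - expectation X\<^sub>0) \<in> lin n" for n
    unfolding lin_def by (intro CollectI exI[of _ 1] exI[of _ "\<lambda>_. 0"]) (simp add: grid_fun_linear(3))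
  have "(\<lambda>w. X\<^sub>0 w - expectation X\<^sub>0) \<in> L2 M" by (intro L2_diff X0_L2 L2_const)
  then show ?thesis unfolding gspace_def approximable_def using L by (auto intro!: bexI[OF _ L])
qed

lemma grid_fun_telescope:
  assumes "j \<le> Suc n"
  shows "grid_fun n (\<lambda>i. if i < j then 1 else 0) p = p (ugrid 0 T n j) - p 0"
proof -
  have "grid_fun n (\<lambda>i. if i < j then 1 else 0) p = (\<Sum>i<j. p (ugrid 0 T n (Suc i)) - p (ugrid 0 T n i))"
    unfolding grid_fun_def using assms by (intro sum.mono_neutral_cong_right) auto
  then show ?thesis by (simp add: sum_lessThan_telescope[of "\<lambda>i. p (ugrid 0 T n i)"])
qed

lemma brownian_in_gspace_aux:
  assumes W: "orthogonal_increments M T W"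
    and L: "\<And>n a. (\<lambda>w. grid_fun n a (\<lambda>t. W t w)) \<in> lin n" and s: "s \<in> {0..T}"
  shows "(\<lambda>w. W s w - W 0 w) \<in> gspace"
  unfolding gspace_def approximable_def
proof (intro CollectI conjI allI impI)
  interpret W: orthogonal_increments M T W by fact
  show "(\<lambda>w. W s w - W 0 w) \<in> L2 M" using s T_pos by (intro L2_diff W.W_L2) auto
  fix e :: real assume e: "0 < e"
  obtain N :: nat where N: "T / e < real N" using reals_Archimedean2 by blast
  have "\<exists>L\<in>lin n. (LINT w|M. (L w - (W s w - W 0 w))\<^sup>2) < e" if n: "N \<le> n" for n
  proof -
    define h where "h = T / real (Suc n)"
    have h: "0 < h" using T_pos by (simp add: h_def del: of_nat_Suc)
    have "T / e < real (Suc n)" using N n by simp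
    then have he: "h < e" using e by (simp add: h_def field_simps del: of_nat_Suc)
    \<comment> \<open>The index of the last grid point not after \<open>s\<close>. The remaining
      increment has variance less than the mesh \<open>h\<close>, and \<open>h < e\<close>.\<close>
    define j where "j = nat \<lfloor>s / h\<rfloor>"
    have jr: "real j \<le> s / h" "s / h < real j + 1" using s h by (auto simp: j_def)
    have jh: "real j * h \<le> s" "s < real j * h + h" using jr h by (simp_all add: pos_le_divide_eq pos_divide_less_eq distrib_right)
    have "real j * h \<le> real (Suc n) * h" using jh(1) s by (simp add: h_def del: of_nat_Suc)
    then have j: "j \<le> Suc n" using h by (simp del: of_nat_Suc)
    have g: "ugrid 0 T n j = real j * h" by (simp add: ugrid_def h_def)
    have gin: "ugrid 0 T n j \<in> {0..T}" using grid_in[OF j] .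
    let ?L = "\<lambda>w. grid_fun n (\<lambda>i. if i < j then 1 else 0) (\<lambda>t. W t w)"
    have "(LINT w|M. (?L w - (W s w - W 0 w))\<^sup>2) = (LINT w|M. (W (ugrid 0 T n j) w - W s w)\<^sup>2)"
      by (simp add: grid_fun_telescope[OF j])
    also have "\<dots> = \<bar>ugrid 0 T n j - s\<bar>" using gin s by (rule W.increment_var[rotated])
    also have "\<dots> < e" using jh he unfolding g by simp
    finally show ?thesis using L by (intro bexI[of _ ?L])
  qed
  then show "\<exists>N. \<forall>n\<ge>N. \<exists>L\<in>lin n. (LINT w|M. (L w - (W s w - W 0 w))\<^sup>2) < e" by blast
qed

lemma brownian_in_gspace:
  assumes "s \<in> {0..T}" "t \<in> {0..T}"
  shows "(\<lambda>w. B\<^sub>1 t w - B\<^sub>1 s w) \<in> gspace" "(\<lambda>w. B\<^sub>2 t w - B\<^sub>2 s w) \<in> gspace"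
proof -
  have L1: "(\<lambda>w. grid_fun n a (\<lambda>t. B\<^sub>1 t w)) \<in> lin n" for n a
    unfolding lin_def by (intro CollectI exI[of _ 0] exI[of _ a] exI[of _ "\<lambda>_. 0"]) (simp add: grid_fun_linear(3))
  have L2: "(\<lambda>w. grid_fun n a (\<lambda>t. B\<^sub>2 t w)) \<in> lin n" for n a
    unfolding lin_def by (rule CollectI, rule exI[of _ 0], rule exI[of _ "\<lambda>_. 0"], rule exI[of _ a]) (simp add: grid_fun_linear(3))
  show "(\<lambda>w. B\<^sub>1 t w - B\<^sub>1 s w) \<in> gspace"
    using closed_subspace_diff[OF gspace_closed brownian_in_gspace_aux[OF W1.orthogonal_increments_axioms L1 assms(2)]
        brownian_in_gspace_aux[OF W1.orthogonal_increments_axioms L1 assms(1)]] by simp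
  show "(\<lambda>w. B\<^sub>2 t w - B\<^sub>2 s w) \<in> gspace"
    using closed_subspace_diff[OF gspace_closed brownian_in_gspace_aux[OF W2.orthogonal_increments_axioms L2 assms(2)]
        brownian_in_gspace_aux[OF W2.orthogonal_increments_axioms L2 assms(1)]] by simp
qed

section \<open>Second moments of the signal\<close>

definition Xz :: "real \<Rightarrow> 'a \<Rightarrow> real" where "Xz s w = indicator {0..T} s * X s w"

lemma Xz_measurable [measurable]: "(\<lambda>x. Xz (fst x) (snd x)) \<in> borel_measurable (borel \<Otimes>\<^sub>M M)"
  unfolding Xz_def using T_pos by (intro measurable_process_extension X_proc) simp

lemma Xz_sec [measurable]: "Xz t \<in> borel_measurable M"
  using measurable_Pair2[OF Xz_measurable, of t] by simp

lemma Xz_L2: "(\<lambda>x. Xz (fst x) (snd x)) \<in> L2 (lborel \<Otimes>\<^sub>M M)"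
proof (rule L2I)
  interpret P: pair_sigma_finite lborel M ..
  have [measurable]: "(\<lambda>x. Xz (fst x) (snd x)) \<in> borel_measurable (lborel \<Otimes>\<^sub>M M)"
    using Xz_measurable by (simp cong: measurable_cong_sets sets_pair_measure_cong)
  then show "(\<lambda>x. Xz (fst x) (snd x)) \<in> borel_measurable (lborel \<Otimes>\<^sub>M M)" .
  show "integrable (lborel \<Otimes>\<^sub>M M) (\<lambda>x. (Xz (fst x) (snd x))\<^sup>2)"
  proof (rule integrableI_nonneg)
    have "(\<integral>\<^sup>+x. ennreal ((Xz (fst x) (snd x))\<^sup>2) \<partial>(lborel \<Otimes>\<^sub>M M)) = (\<integral>\<^sup>+s. \<integral>\<^sup>+w. ennreal ((Xz s w)\<^sup>2) \<partial>M \<partial>lborel)"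
      by (subst nn_integral_fst[symmetric]) auto
    also have "\<dots> = (\<integral>\<^sup>+t\<in>{0..T}. (\<integral>\<^sup>+w. ennreal ((X t w)\<^sup>2) \<partial>M) \<partial>lborel)"
      by (intro nn_integral_cong) (auto simp: Xz_def split: split_indicator)
    finally show "(\<integral>\<^sup>+x. ennreal ((Xz (fst x) (snd x))\<^sup>2) \<partial>(lborel \<Otimes>\<^sub>M M)) < \<infinity>" using X_sq by simp
  qed auto
qed

definition kern :: "(real \<Rightarrow> real) \<Rightarrow> real \<Rightarrow> real \<Rightarrow> real" where
  "kern f t s = indicator {0..t} s * ((t - s) powr (\<alpha> - 1) * f s)"

text \<open>The square of the singular factor is a power with exponent
  \<open>2 * (\<alpha> - 1) > -1\<close>, hence integrable, because \<open>1 / 2 < \<alpha>\<close>.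
  Reflecting \<open>s\<close> to \<open>t - s\<close> makes the bound independent of
  \<open>t\<close>.\<close>

lemma kern_bound:
  assumes "f \<in> borel_measurable (restrict_space borel {0..T})" "bounded (f ` {0..T})"
  obtains R where "0 \<le> R" "\<And>t. t \<in> {0..T} \<Longrightarrow> kern f t \<in> L2 lborel" "\<And>t. t \<in> {0..T} \<Longrightarrow> (LBINT s. (kern f t s)\<^sup>2) \<le> R"
proof -
  let ?f = "\<lambda>s. indicator {0..T} s * f s"
  have fb: "bounded_supp T ?f" by (rule bounded_measurable_extension[OF assms])
  obtain c where c: "0 \<le> c" "\<And>s. \<bar>?f s\<bar> \<le> c" by (rule bounded_suppE[OF fb]) blast
  define h where "h x = indicator {0..T} x * x powr (2 * (\<alpha> - 1))" for x :: real
  have hi: "integrable lborel h" unfolding h_def[abs_def] using alpha T_pos by (intro integrable_powr_from_0) auto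
  have ht: "integrable lborel (\<lambda>s. h (t - s))" for t
    using lborel_integrable_real_affine[OF hi, of "-1" t] by simp
  have hti: "(LBINT s. h (t - s)) = (LBINT s. h s)" for t
    using lborel_integral_real_affine[of "-1" h t] by simp
  have sq: "(kern f t s)\<^sup>2 \<le> c\<^sup>2 * h (t - s)" if t: "t \<in> {0..T}" for t s
  proof (cases "s \<in> {0..t}")
    case True
    then have st: "s \<in> {0..T}" "t - s \<in> {0..T}" using t by auto
    have "(f s)\<^sup>2 \<le> c\<^sup>2" using power_mono[OF c(2)[of s] abs_ge_zero, of 2] st by simp
    moreover have "((t - s) powr (\<alpha> - 1))\<^sup>2 = (t - s) powr (2 * (\<alpha> - 1))"
      using powr_powr[of "t - s" "\<alpha> - 1" 2] by (simp add: mult.commute)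
    ultimately show ?thesis
      using True st by (simp add: kern_def h_def power_mult_distrib mult.commute mult_right_mono)
  next
    case False
    then show ?thesis by (simp add: kern_def h_def)
  qed
  have L2: "kern f t \<in> L2 lborel" if t: "t \<in> {0..T}" for t
  proof (rule L2I)
    have [measurable]: "?f \<in> borel_measurable borel" using fb by auto
    have "kern f t = (\<lambda>s. indicator {0..t} s * ((t - s) powr (\<alpha> - 1) * ?f s))"
      using t by (auto simp: kern_def split: split_indicator)
    then show m: "kern f t \<in> borel_measurable lborel" by simp
    show "integrable lborel (\<lambda>s. (kern f t s)\<^sup>2)"
      by (rule Bochner_Integration.integrable_bound[OF integrable_mult_right[OF ht[of t], of "c\<^sup>2"]])
        (use m sq[OF t] in \<open>auto intro: order_trans[OF _ abs_ge_self]\<close>)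
  qed
  show ?thesis
  proof (rule that[of "c\<^sup>2 * (LBINT s. h s)"])
    show "0 \<le> c\<^sup>2 * (LBINT s. h s)" by (intro mult_nonneg_nonneg Bochner_Integration.integral_nonneg) (auto simp: h_def)
    show "kern f t \<in> L2 lborel" if "t \<in> {0..T}" for t by (rule L2[OF that])
    show "(LBINT s. (kern f t s)\<^sup>2) \<le> c\<^sup>2 * (LBINT s. h s)" if t: "t \<in> {0..T}" for t
    proof -
      have "(LBINT s. (kern f t s)\<^sup>2) \<le> (LBINT s. c\<^sup>2 * h (t - s))"
        by (intro integral_mono L2_integrable_sq[OF L2[OF t]] integrable_mult_right ht sq t)
      then show ?thesis by (simp add: hti)
    qed
  qed
qed

lemma X_decomp:
  assumes t: "t \<in> {0..T}"
  obtains N where "W1.wiener_rel (kern C t) N"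
    "AE w in M. X t w = X\<^sub>0 w + 1 / Gamma \<alpha> * (LBINT s. kern F t s * Xz s w) + 1 / Gamma \<alpha> * N w"
proof -
  obtain N where N: "has_wiener_integral M B\<^sub>1 0 t (\<lambda>s. (t - s) powr (\<alpha> - 1) * C s) N"
    and eq: "AE w in M. X t w = X\<^sub>0 w + 1 / Gamma \<alpha> * (LBINT s:{0..t}. (t - s) powr (\<alpha> - 1) * F s * X s w) + 1 / Gamma \<alpha> * N w"
    using X_eq[OF t] by blast
  have "W1.wiener_rel (kern C t) N"
    using W1.has_wiener_integral_imp_rel[OF N] t unfolding kern_def[abs_def] by simp
  moreover have "(LBINT s:{0..t}. (t - s) powr (\<alpha> - 1) * F s * X s w) = (LBINT s. kern F t s * Xz s w)" for w
    unfolding set_lebesgue_integral_def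
    by (intro Bochner_Integration.integral_cong) (use t in \<open>auto simp: kern_def Xz_def split: split_indicator\<close>)
  ultimately show ?thesis using that[of N] eq by simp
qed

text \<open>The hypothesis controls the second moment only integrated over time. Reinserting this
  into the signal equation, where the kernel has norm bounded uniformly in \<open>t\<close>, bounds
  it at every time.\<close>

lemma X_L2_bound: "\<exists>c\<ge>0. \<forall>t. Xz t \<in> L2 M \<and> (LINT w|M. (Xz t w)\<^sup>2) \<le> c"
proof -
  obtain RF where RF: "0 \<le> RF" "\<And>t. t \<in> {0..T} \<Longrightarrow> kern F t \<in> L2 lborel" "\<And>t. t \<in> {0..T} \<Longrightarrow> (LBINT s. (kern F t s)\<^sup>2) \<le> RF"
    by (rule kern_bound[OF F]) blast
  obtain RC where RC: "0 \<le> RC" "\<And>t. t \<in> {0..T} \<Longrightarrow> kern C t \<in> L2 lborel" "\<And>t. t \<in> {0..T} \<Longrightarrow> (LBINT s. (kern C t s)\<^sup>2) \<le> RC"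
    by (rule kern_bound[OF C]) blast
  define G where "G = 1 / Gamma \<alpha>"
  define q where "q = (\<integral>x. (Xz (fst x) (snd x))\<^sup>2 \<partial>(lborel \<Otimes>\<^sub>M M))"
  have q0: "0 \<le> q" by (simp add: q_def)
  \<comment> \<open>The inequality for the square of a sum, used twice, gives the factors
    \<open>2\<close>; \<open>RF * q\<close> bounds the drift integral by Cauchy-Schwarz and
    \<open>RC\<close> the stochastic integral by the isometry.\<close>
  define c where "c = 2 * (2 * expectation (\<lambda>w. (X\<^sub>0 w)\<^sup>2) + 2 * (G\<^sup>2 * (RF * q))) + 2 * (G\<^sup>2 * RC)"
  have c0: "0 \<le> c" unfolding c_def using RF RC q0 by (intro add_nonneg_nonneg mult_nonneg_nonneg) auto
  have "Xz t \<in> L2 M \<and> (LINT w|M. (Xz t w)\<^sup>2) \<le> c" for t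
  proof (cases "t \<in> {0..T}")
    case t: True
    obtain N where N: "W1.wiener_rel (kern C t) N"
      and eq: "AE w in M. X t w = X\<^sub>0 w + G * (LBINT s. kern F t s * Xz s w) + G * N w"
      unfolding G_def by (rule X_decomp[OF t]) blast
    let ?I = "\<lambda>w. (LBINT s. kern F t s * Xz s w)"
    note I = process_integral(2,3)[OF Xz_L2 RF(2)[OF t]]
    have N2: "N \<in> L2 M" using W1.wiener_rel_L2(2)[OF N] .
    have XI: "(\<lambda>w. X\<^sub>0 w + G * ?I w) \<in> L2 M" by (intro L2_add L2_scale X0_L2 I)
    have all: "(\<lambda>w. (X\<^sub>0 w + G * ?I w) + G * N w) \<in> L2 M" by (intro L2_add L2_scale XI N2)
    have ae: "AE w in M. (X\<^sub>0 w + G * ?I w) + G * N w = Xz t w"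
      using eq by eventually_elim (use t in \<open>simp add: Xz_def\<close>)
    have XL: "Xz t \<in> L2 M" by (rule L2_cong_AE[OF all Xz_sec ae])
    have "(LINT w|M. (Xz t w)\<^sup>2) = (LINT w|M. ((X\<^sub>0 w + G * ?I w) + G * N w)\<^sup>2)"
      using ae L2_measurable[OF all] by (intro integral_cong_AE) (auto elim: eventually_mono)
    also have "\<dots> \<le> 2 * (LINT w|M. (X\<^sub>0 w + G * ?I w)\<^sup>2) + 2 * (LINT w|M. (G * N w)\<^sup>2)"
      by (rule integral_sq_add_le[OF XI L2_scale[OF N2]])
    also have "\<dots> \<le> c" unfolding c_def
    proof (intro add_mono mult_left_mono)
      have "(LINT w|M. (X\<^sub>0 w + G * ?I w)\<^sup>2) \<le> 2 * (LINT w|M. (X\<^sub>0 w)\<^sup>2) + 2 * (LINT w|M. (G * ?I w)\<^sup>2)"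
        by (rule integral_sq_add_le[OF X0_L2 L2_scale[OF I(1)]])
      also have "(LINT w|M. (G * ?I w)\<^sup>2) = G\<^sup>2 * (LINT w|M. (?I w)\<^sup>2)" by (simp add: power_mult_distrib)
      also have "\<dots> \<le> G\<^sup>2 * (RF * q)"
        unfolding q_def using RF(3)[OF t] by (intro mult_left_mono order_trans[OF I(2)] mult_right_mono) auto
      finally show "(LINT w|M. (X\<^sub>0 w + G * ?I w)\<^sup>2) \<le> 2 * expectation (\<lambda>w. (X\<^sub>0 w)\<^sup>2) + 2 * (G\<^sup>2 * (RF * q))" by simp
      show "(LINT w|M. (G * N w)\<^sup>2) \<le> G\<^sup>2 * RC"
        using W1.wiener_rel_norm[OF N] RC(3)[OF t] by (simp add: power_mult_distrib mult_left_mono)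
    qed auto
    finally show ?thesis using XL by simp
  next
    case False
    then have "Xz t = (\<lambda>_. 0)" by (auto simp: Xz_def)
    then show ?thesis using c0 by (simp add: L2_zero)
  qed
  then show ?thesis using c0 by blast
qed

lemma Xz_sec_L2: "Xz t \<in> L2 M" using X_L2_bound by blast

text \<open>A functional that kills \<open>1\<close>, \<open>X\<^sub>0\<close> and the increments of \<open>B\<^sub>1\<close> turns the signal equation into a
  homogeneous Volterra equation.\<close>

lemma X_orthogonal:
  assumes \<psi>: "\<psi> \<in> L2 M" and X0: "(LINT \<omega>|M. X\<^sub>0 \<omega> * \<psi> \<omega>) = 0"
    and B: "\<And>s t. 0 \<le> s \<Longrightarrow> s \<le> t \<Longrightarrow> t \<le> T \<Longrightarrow> (LINT \<omega>|M. (B\<^sub>1 t \<omega> - B\<^sub>1 s \<omega>) * \<psi> \<omega>) = 0"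
  shows "(LINT \<omega>|M. Xz t \<omega> * \<psi> \<omega>) = 0"
proof (cases "t \<in> {0..T}")
  case t: True
  obtain RF where RF: "0 \<le> RF" "\<And>t. t \<in> {0..T} \<Longrightarrow> kern F t \<in> L2 lborel" "\<And>t. t \<in> {0..T} \<Longrightarrow> (LBINT s. (kern F t s)\<^sup>2) \<le> RF"
    by (rule kern_bound[OF F]) blast
  obtain cX where cX: "0 \<le> cX" "\<And>t. (LINT \<omega>|M. (Xz t \<omega>)\<^sup>2) \<le> cX" using X_L2_bound by blast
  define G where "G = 1 / Gamma \<alpha>"
  define e where "e s = (LINT \<omega>|M. Xz s \<omega> * \<psi> \<omega>)" for s
  define p where "p = (LINT \<omega>|M. (\<psi> \<omega>)\<^sup>2)"
  have p0: "0 \<le> p" by (simp add: p_def)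
  have e_sq: "(e s)\<^sup>2 \<le> cX * p" for s
  proof -
    have "(e s)\<^sup>2 \<le> (LINT \<omega>|M. (Xz s \<omega>)\<^sup>2) * p" unfolding e_def p_def by (rule L2_Cauchy_Schwarz[OF Xz_sec_L2 \<psi>])
    also have "\<dots> \<le> cX * p" using cX(2) p0 by (intro mult_right_mono)
    finally show ?thesis .
  qed
  have e_meas [measurable]: "e \<in> borel_measurable borel"
    unfolding e_def[abs_def]
  proof (rule borel_measurable_lebesgue_integral)
    note [measurable] = L2_measurable[OF \<psi>]
    show "(\<lambda>(s, \<omega>). Xz s \<omega> * \<psi> \<omega>) \<in> borel_measurable (borel \<Otimes>\<^sub>M M)"
      unfolding case_prod_beta' by measurable
  qed
  have e_supp: "e s = 0" if "s \<notin> {0..T}" for s using that by (simp add: e_def Xz_def)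
  have ebs: "bounded_supp T (\<lambda>u. indicator {0..s} u * e u)" for s
  proof (rule bounded_suppI)
    show "\<bar>indicator {0..s} u * e u\<bar> \<le> sqrt (cX * p)" for u
      using real_sqrt_le_mono[OF e_sq[of u]] cX(1) p0 by (auto split: split_indicator)
  qed (auto simp: e_supp)
  have e_eq: "e s = G * (LBINT u. kern F s u * (indicator {0..s} u * e u))" if s: "s \<in> {0..T}" for s
  proof -
    obtain N where N: "W1.wiener_rel (kern C s) N"
      and eq: "AE \<omega> in M. X s \<omega> = X\<^sub>0 \<omega> + G * (LBINT u. kern F s u * Xz u \<omega>) + G * N \<omega>"
      unfolding G_def by (rule X_decomp[OF s]) blast
    let ?I = "\<lambda>\<omega>. (LBINT u. kern F s u * Xz u \<omega>)"
    note I = process_integral(2)[OF Xz_L2 RF(2)[OF s]]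
    have N2: "N \<in> L2 M" using W1.wiener_rel_L2(2)[OF N] .
    note [measurable] = L2_measurable[OF I] L2_measurable[OF N2] L2_measurable[OF X0_L2] L2_measurable[OF \<psi>]
    have "e s = (LINT \<omega>|M. X\<^sub>0 \<omega> * \<psi> \<omega> + G * (?I \<omega> * \<psi> \<omega>) + G * (N \<omega> * \<psi> \<omega>))"
      unfolding e_def
    proof (rule integral_cong_AE)
      show "AE \<omega> in M. Xz s \<omega> * \<psi> \<omega> = X\<^sub>0 \<omega> * \<psi> \<omega> + G * (?I \<omega> * \<psi> \<omega>) + G * (N \<omega> * \<psi> \<omega>)"
      proof (use eq in eventually_elim)
        fix \<omega> assume "X s \<omega> = X\<^sub>0 \<omega> + G * ?I \<omega> + G * N \<omega>"
        then have "Xz s \<omega> = X\<^sub>0 \<omega> + G * ?I \<omega> + G * N \<omega>" using s by (simp add: Xz_def[of s])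
        then show "Xz s \<omega> * \<psi> \<omega> = X\<^sub>0 \<omega> * \<psi> \<omega> + G * (?I \<omega> * \<psi> \<omega>) + G * (N \<omega> * \<psi> \<omega>)"
          by (simp only: distrib_right mult.assoc)
      qed
    qed measurable
    also have "\<dots> = (LINT \<omega>|M. X\<^sub>0 \<omega> * \<psi> \<omega>) + G * (LINT \<omega>|M. ?I \<omega> * \<psi> \<omega>) + G * (LINT \<omega>|M. N \<omega> * \<psi> \<omega>)"
      using L2_mult_integrable[OF X0_L2 \<psi>] L2_mult_integrable[OF I \<psi>] L2_mult_integrable[OF N2 \<psi>] by simp
    also have "(LINT \<omega>|M. N \<omega> * \<psi> \<omega>) = 0" by (rule W1.wiener_rel_orthogonal[OF N \<psi> B])
    also have "(LINT \<omega>|M. ?I \<omega> * \<psi> \<omega>) = (LBINT u. kern F s u * e u)"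
      unfolding e_def by (rule process_integral(5)[OF Xz_L2 RF(2)[OF s] \<psi>])
    also have "\<dots> = (LBINT u. kern F s u * (indicator {0..s} u * e u))"
      by (intro Bochner_Integration.integral_cong refl) (auto simp: kern_def split: split_indicator)
    finally show ?thesis using X0 by simp
  qed
  have int: "set_integrable lborel {0..s} (\<lambda>u. (e u)\<^sup>2)" for s
    by (rule set_integrable_bounded[where B="cX * p"]) (use e_sq in auto)
  \<comment> \<open>The kernel is unbounded near \<open>s = t\<close>, so the equation for
    \<open>e\<close> is squared: Cauchy-Schwarz replaces the kernel by its norm bound
    \<open>RF\<close>, and Gronwall applies to the square of \<open>e\<close>.\<close>
  have "(e t)\<^sup>2 = 0"
  proof (rule triangle_gronwall[where w="\<lambda>_ s. (e s)\<^sup>2" and a=0 and b=T and t=t and c="G\<^sup>2 * RF" and B="cX * p"])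
    show "0 \<le> G\<^sup>2 * RF" using RF by simp
    fix t' s :: real assume s: "0 \<le> s" "s \<le> t'" "t' \<le> T"
    have "(e s)\<^sup>2 = G\<^sup>2 * (LBINT u. kern F s u * (indicator {0..s} u * e u))\<^sup>2"
      using e_eq[of s] s by (simp add: power_mult_distrib)
    also have "\<dots> \<le> G\<^sup>2 * ((LBINT u. (kern F s u)\<^sup>2) * (LBINT u. (indicator {0..s} u * e u)\<^sup>2))"
      using RF(2)[of s] s by (intro mult_left_mono L2_Cauchy_Schwarz bounded_supp_L2[OF ebs]) auto
    also have "\<dots> \<le> G\<^sup>2 * (RF * (LBINT u:{0..s}. (e u)\<^sup>2))"
    proof (intro mult_left_mono mult_mono RF)
      show "(LBINT u. (indicator {0..s} u * e u)\<^sup>2) \<le> (LBINT u:{0..s}. (e u)\<^sup>2)"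
        unfolding set_lebesgue_integral_def
        by (intro eq_refl Bochner_Integration.integral_cong) (auto split: split_indicator)
    qed (use s in auto)
    also have "\<dots> \<le> G\<^sup>2 * RF * (LBINT u:{0..s}. (e u)\<^sup>2 + (e u)\<^sup>2)"
      unfolding mult.assoc using RF(1) by (intro mult_left_mono set_integral_mono set_integral_add int) auto
    finally show "(e s)\<^sup>2 \<le> G\<^sup>2 * RF * (LBINT u:{0..s}. (e u)\<^sup>2 + (e u)\<^sup>2)" .
  qed (use t e_sq int in auto)
  then show ?thesis by (simp add: e_def)
qed (simp add: Xz_def)

text \<open>The increment of \<open>B\<^sub>2\<close> is taken as the test element of
  \<open>X_orthogonal\<close>: it has mean zero and is independent of \<open>X\<^sub>0\<close> and
  of the increments of \<open>B\<^sub>1\<close>.\<close>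

lemma B2_orthogonal:
  assumes "0 \<le> u" "u \<le> v" "v \<le> T"
  shows "(LINT w|M. (B\<^sub>2 v w - B\<^sub>2 u w) * Xz t w) = 0"
proof -
  let ?\<psi> = "\<lambda>w. B\<^sub>2 v w - B\<^sub>2 u w"
  have uv: "u \<in> {0..T}" "v \<in> {0..T}" using assms by auto
  have \<psi>: "?\<psi> \<in> L2 M" by (rule W2.increment_L2[OF assms])
  have mean: "(LINT w|M. ?\<psi> w) = 0" by (rule brownian_motion_increment_mean[OF prob_space_axioms B2 assms])
  have comp: "(\<lambda>p. p v - p u) \<in> borel_measurable (path_space T)" if "u \<in> {0..T}" "v \<in> {0..T}" for u v
    using that by (intro borel_measurable_diff measurable_component_singleton)
  have "(LINT w|M. Xz t w * ?\<psi> w) = 0"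
  proof (rule X_orthogonal[OF \<psi>])
    note [measurable] = comp[OF uv]
    have "indep_var borel (\<lambda>w. X\<^sub>0 w) borel (\<lambda>w. (\<lambda>p. snd p v - snd p u) (sample_path T B\<^sub>1 w, sample_path T B\<^sub>2 w))"
      by (rule X0_paths_indep) (simp, rule measurable_compose[OF measurable_snd comp[OF uv]])
    then have "indep_var borel X\<^sub>0 borel ?\<psi>" using uv by (simp add: comp_def sample_path_def)
    then show "(LINT w|M. X\<^sub>0 w * ?\<psi> w) = 0" by (rule indep_var_integral_zero[OF _ X0_L2 \<psi> mean])
    fix s r assume sr: "0 \<le> s" "s \<le> r" "r \<le> T"
    then have sr': "s \<in> {0..T}" "r \<in> {0..T}" by auto
    have "indep_var borel ((\<lambda>p. p r - p s) \<circ> sample_path T B\<^sub>1) borel ((\<lambda>p. p v - p u) \<circ> sample_path T B\<^sub>2)"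
      by (rule indep_var_compose[OF B_indep comp[OF sr'] comp[OF uv]])
    then have "indep_var borel (\<lambda>w. B\<^sub>1 r w - B\<^sub>1 s w) borel ?\<psi>" using uv sr' by (simp add: comp_def sample_path_def)
    then show "(LINT w|M. (B\<^sub>1 r w - B\<^sub>1 s w) * ?\<psi> w) = 0"
      by (rule indep_var_integral_zero[OF _ W1.increment_L2[OF sr] \<psi> mean])
  qed
  then show ?thesis by (simp only: mult.commute)
qed

section \<open>The centred signal and its covariance\<close>

definition Xc :: "real \<Rightarrow> 'a \<Rightarrow> real" where "Xc t w = Xz t w - expectation (Xz t)"

lemma mean_bounded_supp: "bounded_supp T (\<lambda>t. expectation (Xz t))"
proof -
  obtain c where c: "0 \<le> c" "\<And>t. (LINT w|M. (Xz t w)\<^sup>2) \<le> c" using X_L2_bound by blast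
  show ?thesis
  proof (rule bounded_suppI)
    show "(\<lambda>t. expectation (Xz t)) \<in> borel_measurable borel"
      by (rule borel_measurable_lebesgue_integral) (simp add: case_prod_beta')
    show "\<bar>expectation (Xz t)\<bar> \<le> sqrt c" for t
    proof -
      have "\<bar>expectation (Xz t)\<bar> \<le> expectation (\<lambda>w. \<bar>Xz t w\<bar>)" by (rule integral_abs_bound)
      also have "\<dots> \<le> sqrt (LINT w|M. (Xz t w)\<^sup>2)" by (rule L2_integral_abs_le[OF Xz_sec_L2])
      also have "\<dots> \<le> sqrt c" using c(2) by (rule real_sqrt_le_mono)
      finally show ?thesis .
    qed
  qed (auto simp: Xz_def[abs_def])
qed

lemma Xc_sec_L2: "Xc t \<in> L2 M" unfolding Xc_def[abs_def] by (intro L2_diff Xz_sec_L2 L2_const)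

lemma Xc_mean: "expectation (Xc t) = 0"
  unfolding Xc_def[abs_def] using L2_integrable[OF Xz_sec_L2] by (simp add: prob_space)

text \<open>The component \<open>\<psi>\<close> of \<open>Xc t\<close> orthogonal to
  \<open>gspace\<close> is used as a test element. It has mean zero, so it is orthogonal to
  \<open>X\<^sub>0\<close> itself and not only to its centred version; by
  \<open>X_orthogonal\<close> it is orthogonal to the signal and hence zero. Thus signal and both
  Brownian motions are jointly Gaussian.\<close>

lemma Xc_in_gspace: "Xc t \<in> gspace"
proof -
  obtain p where p: "p \<in> gspace" and orth: "\<And>v. v \<in> gspace \<Longrightarrow> (LINT w|M. (Xc t w - p w) * v w) = 0"
    by (rule L2_projection[OF gspace_closed Xc_sec_L2]) blast
  have p2: "p \<in> L2 M" using gspace_closed p by (rule closed_subspace_L2)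
  define \<psi> where "\<psi> w = Xc t w - p w" for w
  have \<psi>: "\<psi> \<in> L2 M" unfolding \<psi>_def[abs_def] by (rule L2_diff[OF Xc_sec_L2 p2])
  have orth': "(LINT w|M. v w * \<psi> w) = 0" if "v \<in> gspace" for v using orth[OF that] by (simp add: \<psi>_def mult.commute)
  have mean: "expectation \<psi> = 0"
    unfolding \<psi>_def[abs_def] using L2_integrable[OF Xc_sec_L2] L2_integrable[OF p2] by (simp add: Xc_mean gspace_mean[OF p])
  have "(LINT w|M. Xz t w * \<psi> w) = 0"
  proof (rule X_orthogonal[OF \<psi>])
    have "(LINT w|M. X\<^sub>0 w * \<psi> w) = (LINT w|M. (X\<^sub>0 w - expectation X\<^sub>0) * \<psi> w + expectation X\<^sub>0 * \<psi> w)"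
      by (intro Bochner_Integration.integral_cong) (auto simp: algebra_simps)
    also have "\<dots> = (LINT w|M. (X\<^sub>0 w - expectation X\<^sub>0) * \<psi> w) + expectation X\<^sub>0 * expectation \<psi>"
      using L2_mult_integrable[OF L2_diff[OF X0_L2 L2_const] \<psi>] L2_integrable[OF \<psi>] by simp
    finally show "(LINT w|M. X\<^sub>0 w * \<psi> w) = 0" using orth'[OF X0_in_gspace] mean by simp
    show "(LINT w|M. (B\<^sub>1 r w - B\<^sub>1 s w) * \<psi> w) = 0" if "0 \<le> s" "s \<le> r" "r \<le> T" for s r
      using that by (intro orth' brownian_in_gspace) auto
  qed
  then have "(LINT w|M. Xc t w * \<psi> w) = 0"
    unfolding Xc_def left_diff_distrib using L2_mult_integrable[OF Xz_sec_L2 \<psi>] L2_integrable[OF \<psi>] mean by simp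
  moreover have "(LINT w|M. p w * \<psi> w) = 0" by (rule orth'[OF p])
  moreover have "(LINT w|M. (\<psi> w)\<^sup>2) = (LINT w|M. Xc t w * \<psi> w) - (LINT w|M. p w * \<psi> w)"
  proof -
    have "(LINT w|M. (\<psi> w)\<^sup>2) = (LINT w|M. Xc t w * \<psi> w - p w * \<psi> w)"
      by (intro Bochner_Integration.integral_cong refl) (simp add: \<psi>_def power2_eq_square left_diff_distrib)
    then show ?thesis using L2_mult_integrable[OF Xc_sec_L2 \<psi>] L2_mult_integrable[OF p2 \<psi>] by simp
  qed
  ultimately have "AE w in M. \<psi> w = 0" by (intro integral_sq_zero_AE[OF \<psi>]) simp
  then show ?thesis
    by (intro closed_subspace_cong_AE[OF gspace_closed p L2_measurable[OF Xc_sec_L2]]) (auto simp: \<psi>_def elim: eventually_mono)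
qed

lemma Xc_measurable [measurable]: "(\<lambda>x. Xc (fst x) (snd x)) \<in> borel_measurable (borel \<Otimes>\<^sub>M M)"
  unfolding Xc_def using bounded_supp_measurable[OF mean_bounded_supp] by measurable

lemma Xc_B2_orthogonal:
  assumes "0 \<le> u" "u \<le> v" "v \<le> T"
  shows "(LINT w|M. (B\<^sub>2 v w - B\<^sub>2 u w) * Xc t w) = 0"
proof -
  have "(LINT w|M. (B\<^sub>2 v w - B\<^sub>2 u w) * Xc t w) = (LINT w|M. (B\<^sub>2 v w - B\<^sub>2 u w) * Xz t w) - (LINT w|M. (B\<^sub>2 v w - B\<^sub>2 u w)) * expectation (Xz t)"
    unfolding Xc_def right_diff_distrib
    using L2_mult_integrable[OF W2.increment_L2[OF assms] Xz_sec_L2[of t]] L2_integrable[OF W2.increment_L2[OF assms]]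
    by (subst Bochner_Integration.integral_diff) auto
  then show ?thesis
    using B2_orthogonal[OF assms] brownian_motion_increment_mean[OF prob_space_axioms B2 assms] by simp
qed

lemma Xc_compose [measurable (raw)]:
  "f \<in> measurable N borel \<Longrightarrow> g \<in> measurable N M \<Longrightarrow> (\<lambda>x. Xc (f x) (g x)) \<in> borel_measurable N"
  using measurable_compose[OF measurable_Pair Xc_measurable, of f N g] by simp

lemma Xc_sq_bound: "\<exists>c\<ge>0. \<forall>t. (LINT w|M. (Xc t w)\<^sup>2) \<le> c"
proof -
  obtain c where c: "0 \<le> c" "\<And>t. (LINT w|M. (Xz t w)\<^sup>2) \<le> c" using X_L2_bound by blast
  have "(LINT w|M. (Xc t w)\<^sup>2) \<le> c" for t
  proof -
    have "(LINT w|M. (Xc t w)\<^sup>2) = (LINT w|M. (Xz t w)\<^sup>2) - (expectation (Xz t))\<^sup>2"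
      unfolding Xc_def by (rule variance_eq[OF L2_integrable[OF Xz_sec_L2] L2_integrable_sq[OF Xz_sec_L2]])
    also have "\<dots> \<le> c" using c(2)[of t] by (simp add: diff_le_eq add_increasing2)
    finally show ?thesis .
  qed
  then show ?thesis using c(1) by blast
qed

lemma Xc_supp: "s \<notin> {0..T} \<Longrightarrow> Xc s w = 0"
  by (simp add: Xc_def Xz_def[abs_def])

lemma process_L2:
  assumes Z: "(\<lambda>x. Z (fst x) (snd x)) \<in> borel_measurable (borel \<Otimes>\<^sub>M M)"
    and L: "\<And>s. Z s \<in> L2 M" and c: "\<And>s. (LINT w|M. (Z s w)\<^sup>2) \<le> c" and supp: "\<And>s w. s \<notin> {0..T} \<Longrightarrow> Z s w = 0"
  shows "(\<lambda>x. Z (fst x) (snd x)) \<in> L2 (lborel \<Otimes>\<^sub>M M)"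
proof (rule L2I)
  interpret P: pair_sigma_finite lborel M ..
  have Zl [measurable]: "(\<lambda>x. Z (fst x) (snd x)) \<in> borel_measurable (lborel \<Otimes>\<^sub>M M)"
    using Z by (simp cong: measurable_cong_sets sets_pair_measure_cong)
  then show "(\<lambda>x. Z (fst x) (snd x)) \<in> borel_measurable (lborel \<Otimes>\<^sub>M M)" .
  show "integrable (lborel \<Otimes>\<^sub>M M) (\<lambda>x. (Z (fst x) (snd x))\<^sup>2)"
  proof (rule integrableI_nonneg)
    have "(\<integral>\<^sup>+x. ennreal ((Z (fst x) (snd x))\<^sup>2) \<partial>(lborel \<Otimes>\<^sub>M M)) = (\<integral>\<^sup>+s. \<integral>\<^sup>+w. ennreal ((Z s w)\<^sup>2) \<partial>M \<partial>lborel)"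
      by (subst nn_integral_fst[symmetric]) auto
    also have "\<dots> \<le> (\<integral>\<^sup>+s. ennreal c * indicator {0..T} s \<partial>lborel)"
    proof (rule nn_integral_mono)
      fix s
      have "(\<integral>\<^sup>+w. ennreal ((Z s w)\<^sup>2) \<partial>M) = ennreal (LINT w|M. (Z s w)\<^sup>2)"
        by (rule nn_integral_eq_integral[OF L2_integrable_sq[OF L]]) simp
      then show "(\<integral>\<^sup>+w. ennreal ((Z s w)\<^sup>2) \<partial>M) \<le> ennreal c * indicator {0..T} s"
        using c[of s] supp[of s] by (cases "s \<in> {0..T}") (simp_all add: ennreal_leI)
    qed
    also have "\<dots> = ennreal c * emeasure lborel {0..T}" by (rule nn_integral_cmult_indicator) simp
    also have "\<dots> < \<infinity>" using T_pos by (simp add: ennreal_mult_less_top)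
    finally show "(\<integral>\<^sup>+x. ennreal ((Z (fst x) (snd x))\<^sup>2) \<partial>(lborel \<Otimes>\<^sub>M M)) < \<infinity>" .
  qed auto
qed

lemma Xc_L2: "(\<lambda>x. Xc (fst x) (snd x)) \<in> L2 (lborel \<Otimes>\<^sub>M M)"
proof -
  obtain c where c: "\<And>t. (LINT w|M. (Xc t w)\<^sup>2) \<le> c" using Xc_sq_bound by blast
  show ?thesis by (rule process_L2[OF Xc_measurable Xc_sec_L2 c Xc_supp])
qed

definition K0 :: "real \<Rightarrow> real \<Rightarrow> real" where "K0 t s = (LINT w|M. Xc t w * Xc s w)"

lemma K0_measurable: "(\<lambda>x. K0 (fst x) (snd x)) \<in> borel_measurable (borel \<Otimes>\<^sub>M borel)"
  unfolding K0_def[abs_def] by measurable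

lemma K0_sym: "K0 t s = K0 s t" unfolding K0_def by (simp only: mult.commute)

lemma K0_bound: "\<exists>c. \<forall>t s. \<bar>K0 t s\<bar> \<le> c"
proof -
  obtain c where c: "0 \<le> c" "\<And>t. (LINT w|M. (Xc t w)\<^sup>2) \<le> c" using Xc_sq_bound by blast
  have "\<bar>K0 t s\<bar> \<le> c" for t s
  proof (rule abs_le_square_iff[THEN iffD2, of _ c, simplified abs_of_nonneg[OF c(1)]])
    have "(K0 t s)\<^sup>2 \<le> (LINT w|M. (Xc t w)\<^sup>2) * (LINT w|M. (Xc s w)\<^sup>2)"
      unfolding K0_def by (rule L2_Cauchy_Schwarz[OF Xc_sec_L2 Xc_sec_L2])
    also have "\<dots> \<le> c * c" by (rule mult_mono[OF c(2) c(2) c(1)]) simp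
    finally show "(K0 t s)\<^sup>2 \<le> c\<^sup>2" by (simp add: power2_eq_square)
  qed
  then show ?thesis by blast
qed

text \<open>The quadratic form is the second moment of the time integral of
  \<open>f * Xc\<close>.\<close>

lemma K0_psd:
  assumes f: "bounded_supp T f" shows "0 \<le> (LBINT s. f s * (LBINT r. K0 s r * f r))"
proof -
  define V where "V w = (LBINT s. f s * Xc s w)" for w
  note I = process_integral(2,5)[OF Xc_L2 bounded_supp_L2[OF f], folded V_def]
  have "(LBINT r. K0 s r * f r) = (LINT w|M. V w * Xc s w)" for s
    unfolding I(2)[OF Xc_sec_L2] by (intro Bochner_Integration.integral_cong refl) (simp add: K0_def mult.commute)
  then have "(LBINT s. f s * (LBINT r. K0 s r * f r)) = (LBINT s. f s * (LINT w|M. Xc s w * V w))"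
    by (simp only: mult.commute)
  also have "\<dots> = (LINT w|M. V w * V w)" using I(2)[OF I(1)] by simp
  finally show ?thesis by simp
qed

end

section \<open>The observation and the best estimate\<close>

locale observed_signal = noisy_signal M T \<alpha> F C B\<^sub>1 B\<^sub>2 X X\<^sub>0
  for M :: "'a measure" and T \<alpha> F C B\<^sub>1 B\<^sub>2 X X\<^sub>0 +
  fixes G D :: "real \<Rightarrow> real" and d\<^sub>0 Y\<^sub>0 :: real and Y :: "real \<Rightarrow> 'a \<Rightarrow> real"
  assumes G: "G \<in> borel_measurable (restrict_space borel {0..T})" "bounded (G ` {0..T})"
    and D: "D \<in> borel_measurable (restrict_space borel {0..T})" "bounded (D ` {0..T})"
    and d0: "0 < d\<^sub>0" and D_ge: "\<And>t. t \<in> {0..T} \<Longrightarrow> d\<^sub>0 \<le> \<bar>D t\<bar>"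
    and Y_measurable: "\<And>t. t \<in> {0..T} \<Longrightarrow> Y t \<in> borel_measurable M"
    and Y_eq: "\<And>t. t \<in> {0..T} \<Longrightarrow>
           \<exists>J. has_obs_integral M G D X B\<^sub>2 t (\<lambda>_. 1) J \<and> (AE w in M. Y t w = Y\<^sub>0 + J w)"
begin

definition Gt :: "real \<Rightarrow> real" where "Gt s = indicator {0..T} s * G s"
definition Dt :: "real \<Rightarrow> real" where "Dt s = indicator {0..T} s * D s"
definition Di :: "real \<Rightarrow> real" where "Di s = indicator {0..T} s * (1 / D s)"
definition a :: "real \<Rightarrow> real" where "a s = Gt s * Di s"

lemma D_nonzero: "s \<in> {0..T} \<Longrightarrow> D s \<noteq> 0" using D_ge[of s] d0 by auto

lemma Gt_bs: "bounded_supp T Gt" and Dt_bs: "bounded_supp T Dt" and Di_bs: "bounded_supp T Di"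
proof -
  show "bounded_supp T Gt" unfolding Gt_def[abs_def] by (rule bounded_measurable_extension[OF G])
  show "bounded_supp T Dt" unfolding Dt_def[abs_def] by (rule bounded_measurable_extension[OF D])
  show "bounded_supp T Di" unfolding Di_def[abs_def]
  proof (rule bounded_measurable_extension)
    show "(\<lambda>s. 1 / D s) \<in> borel_measurable (restrict_space borel {0..T})"
      by (intro borel_measurable_divide borel_measurable_const D)
    show "bounded ((\<lambda>s. 1 / D s) ` {0..T})"
      unfolding bounded_iff
    proof (intro exI[of _ "1 / d\<^sub>0"] ballI)
      fix x assume "x \<in> (\<lambda>s. 1 / D s) ` {0..T}"
      then obtain s where "s \<in> {0..T}" "x = 1 / D s" by blast
      then show "norm x \<le> 1 / d\<^sub>0" using D_ge[of s] d0 by (simp add: frac_le)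
    qed
  qed
qed

lemma a_bs: "bounded_supp T a" unfolding a_def[abs_def] by (rule bounded_supp_mult2[OF Gt_bs Di_bs])

lemma Di_Dt: "Di s * Dt s = indicator {0..T} s" and a_Dt: "a s * Dt s = Gt s"
  using D_nonzero[of s] by (auto simp: a_def Gt_def Dt_def Di_def split: split_indicator)

text \<open>The bounds are fixed by choice so that the parameters of \<open>riccati_kernel\<close>
  are constants of this locale.\<close>

definition ca :: real where "ca = (SOME c. \<forall>s. \<bar>a s\<bar> \<le> c)"
definition cK :: real where "cK = (SOME c. \<forall>t s. \<bar>K0 t s\<bar> \<le> c)"

sublocale R: riccati_kernel T ca cK a K0
proof
  have "\<exists>c. \<forall>s. \<bar>a s\<bar> \<le> c" by (rule bounded_suppE[OF a_bs]) blast
  from someI_ex[OF this] show "\<bar>a s\<bar> \<le> ca" for s unfolding ca_def by blast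
  from someI_ex[OF K0_bound] show "\<bar>K0 t s\<bar> \<le> cK" for t s unfolding cK_def by blast
  show "a \<in> borel_measurable borel" using a_bs by (rule bounded_supp_measurable)
  show "a s = 0" if "s \<notin> {0..T}" for s using bounded_supp_zero[OF a_bs that] .
  show "K0 t s = K0 s t" for t s by (rule K0_sym)
qed (use T_pos K0_measurable K0_psd in auto)

text \<open>\<open>obs_rel f V\<close>: \<open>V\<close> is the integral of \<open>f / D\<close> against the centred observation.\<close>

definition obs_rel :: "(real \<Rightarrow> real) \<Rightarrow> ('a \<Rightarrow> real) \<Rightarrow> bool" where
  "obs_rel f V \<longleftrightarrow> bounded_supp T f \<and> V \<in> borel_measurable M \<and>
     (\<exists>N. W2.wiener_rel f N \<and> (AE w in M. V w = (LBINT s. a s * f s * Xc s w) + N w))"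

lemma obs_relE:
  assumes "obs_rel f V"
  obtains N where "bounded_supp T f" "V \<in> borel_measurable M" "W2.wiener_rel f N"
    "AE w in M. V w = (LBINT s. a s * f s * Xc s w) + N w"
  using assms unfolding obs_rel_def by blast

lemma af_bs: "bounded_supp T f \<Longrightarrow> bounded_supp T (\<lambda>s. a s * f s)"
  by (rule bounded_supp_mult2[OF a_bs])

lemma drift_L2: "bounded_supp T f \<Longrightarrow> (\<lambda>w. (LBINT s. a s * f s * Xc s w)) \<in> L2 M"
  by (rule process_integral(2)[OF Xc_L2 bounded_supp_L2[OF af_bs]])

lemma obs_rel_L2: assumes "obs_rel f V" shows "V \<in> L2 M"
proof -
  obtain N where N: "bounded_supp T f" "V \<in> borel_measurable M" "W2.wiener_rel f N"
    "AE w in M. V w = (LBINT s. a s * f s * Xc s w) + N w" by (rule obs_relE[OF assms]) blast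
  show ?thesis
    by (rule L2_cong_AE[OF L2_add[OF drift_L2[OF N(1)] W2.wiener_rel_L2(2)[OF N(3)]] N(2)])
      (use N(4) in \<open>auto elim: eventually_mono\<close>)
qed

lemma obs_rel_gspace: assumes "obs_rel f V" shows "V \<in> gspace"
proof -
  obtain N where N: "bounded_supp T f" "V \<in> borel_measurable M" "W2.wiener_rel f N"
    "AE w in M. V w = (LBINT s. a s * f s * Xc s w) + N w" by (rule obs_relE[OF assms]) blast
  have "(\<lambda>w. (LBINT s. a s * f s * Xc s w)) \<in> gspace"
    by (rule process_integral_in_subspace[OF Xc_L2 bounded_supp_L2[OF af_bs[OF N(1)]] gspace_closed Xc_in_gspace])
  moreover have "N \<in> gspace"
    by (rule W2.wiener_rel_in_subspace[OF N(3) gspace_closed]) (use brownian_in_gspace in auto)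
  ultimately have "(\<lambda>w. (LBINT s. a s * f s * Xc s w) + N w) \<in> gspace"
    by (rule closed_subspace_add[OF gspace_closed])
  then show ?thesis by (rule closed_subspace_cong_AE[OF gspace_closed _ N(2)]) (use N(4) in \<open>auto elim: eventually_mono\<close>)
qed

lemma obs_rel_mult:
  assumes V: "obs_rel f V" and \<psi>: "\<psi> \<in> L2 M" and N: "W2.wiener_rel f N"
  shows "(LINT w|M. V w * \<psi> w) = (LBINT s. a s * f s * (LINT w|M. Xc s w * \<psi> w)) + (LINT w|M. N w * \<psi> w)"
proof -
  obtain N' where N': "bounded_supp T f" "V \<in> borel_measurable M" "W2.wiener_rel f N'"
    "AE w in M. V w = (LBINT s. a s * f s * Xc s w) + N' w" by (rule obs_relE[OF V]) blast
  have NN: "AE w in M. N' w = N w" by (rule W2.wiener_rel_unique[OF N'(3) N]) simp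
  let ?I = "\<lambda>w. (LBINT s. a s * f s * Xc s w)"
  note I = drift_L2[OF N'(1)] and NL = W2.wiener_rel_L2(2)[OF N]
  note [measurable] = L2_measurable[OF I] L2_measurable[OF NL] L2_measurable[OF \<psi>] N'(2)
  have "(LINT w|M. V w * \<psi> w) = (LINT w|M. ?I w * \<psi> w + N w * \<psi> w)"
  proof (rule integral_cong_AE)
    show "AE w in M. V w * \<psi> w = ?I w * \<psi> w + N w * \<psi> w"
      using N'(4) NN by eventually_elim (simp only: distrib_right)
  qed measurable
  also have "\<dots> = (LINT w|M. ?I w * \<psi> w) + (LINT w|M. N w * \<psi> w)"
    by (rule Bochner_Integration.integral_add[OF L2_mult_integrable[OF I \<psi>] L2_mult_integrable[OF NL \<psi>]])
  also have "(LINT w|M. ?I w * \<psi> w) = (LBINT s. a s * f s * (LINT w|M. Xc s w * \<psi> w))"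
    by (rule process_integral(5)[OF Xc_L2 bounded_supp_L2[OF af_bs[OF N'(1)]] \<psi>])
  finally show ?thesis .
qed

lemma wiener_Xc_orthogonal: "W2.wiener_rel f N \<Longrightarrow> (LINT w|M. N w * Xc t w) = 0"
  by (rule W2.wiener_rel_orthogonal[OF _ Xc_sec_L2 Xc_B2_orthogonal])

lemma obs_rel_Xc:
  assumes V: "obs_rel f V"
  shows "(LINT w|M. V w * Xc t w) = (LBINT s. a s * f s * K0 s t)"
proof -
  obtain N where N: "W2.wiener_rel f N" by (rule obs_relE[OF V]) blast
  show ?thesis using obs_rel_mult[OF V Xc_sec_L2 N] wiener_Xc_orthogonal[OF N] by (simp add: K0_def)
qed

text \<open>The covariance operator of the centred observation, conjugated by \<open>D\<close>.\<close>

definition covop :: "(real \<Rightarrow> real) \<Rightarrow> real \<Rightarrow> real" where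
  "covop g s = g s + a s * (LBINT r. K0 s r * (a r * g r))"

text \<open>Products of signal and noise have expectation zero. The noise parts contribute the
  identity in \<open>covop\<close> by the isometry, the signal parts the kernel
  \<open>a s * K0 s r * a r\<close>.\<close>

lemma obs_rel_cov:
  assumes V: "obs_rel f V" and W: "obs_rel g W"
  shows "(LINT w|M. V w * W w) = (LBINT s. f s * covop g s)"
proof -
  obtain N where f: "bounded_supp T f" and N: "W2.wiener_rel f N" by (rule obs_relE[OF V]) blast
  obtain N' where g: "bounded_supp T g" and N': "W2.wiener_rel g N'" by (rule obs_relE[OF W]) blast
  note WL = obs_rel_L2[OF W] and NL = W2.wiener_rel_L2(2)[OF N]
  have inner: "(LINT w|M. Xc s w * W w) = (LBINT r. K0 s r * (a r * g r))" for s
    using obs_rel_Xc[OF W, of s] by (simp only: mult.commute K0_sym)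
  have "(LINT w|M. N w * W w) = (LINT w|M. W w * N w)" by (simp only: mult.commute)
  also have "\<dots> = (LBINT s. a s * g s * (LINT w|M. Xc s w * N w)) + (LINT w|M. N' w * N w)"
    by (rule obs_rel_mult[OF W NL N'])
  also have "(\<lambda>s. (LINT w|M. Xc s w * N w)) = (\<lambda>s. 0)"
    using wiener_Xc_orthogonal[OF N] by (simp add: mult.commute)
  also have "(LINT w|M. N' w * N w) = (LBINT s. f s * g s)"
    using W2.wiener_isometry[OF N' N] by (simp add: mult.commute)
  finally have NW: "(LINT w|M. N w * W w) = (LBINT s. f s * g s)" by simp
  have i1: "integrable lborel (\<lambda>s. a s * f s * (LINT w|M. Xc s w * W w))"
    by (rule process_integral(4)[OF Xc_L2 bounded_supp_L2[OF af_bs[OF f]] WL])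
  have i2: "integrable lborel (\<lambda>s. f s * g s)" by (rule bounded_supp_integrable[OF bounded_supp_mult2[OF f g]])
  have "(LINT w|M. V w * W w) = (LBINT s. a s * f s * (LINT w|M. Xc s w * W w) + f s * g s)"
    using obs_rel_mult[OF V WL N] NW Bochner_Integration.integral_add[OF i1 i2] by simp
  also have "\<dots> = (LBINT s. f s * covop g s)"
    unfolding inner covop_def by (intro Bochner_Integration.integral_cong refl) (simp add: algebra_simps)
  finally show ?thesis .
qed

text \<open>Continuity of the integral in its integrand, with a constant independent of
  \<open>f\<close>; it carries measurability of elementary integrals over to their limits.\<close>

lemma obs_rel_norm: "\<exists>c\<ge>0. \<forall>f V. obs_rel f V \<longrightarrow> (LINT w|M. (V w)\<^sup>2) \<le> c * (LBINT s. (f s)\<^sup>2)"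
proof -
  define q where "q = (\<integral>x. (Xc (fst x) (snd x))\<^sup>2 \<partial>(lborel \<Otimes>\<^sub>M M))"
  have q0: "0 \<le> q" by (simp add: q_def)
  have "(LINT w|M. (V w)\<^sup>2) \<le> (2 * (ca\<^sup>2 * q) + 2) * (LBINT s. (f s)\<^sup>2)" if V: "obs_rel f V" for f V
  proof -
    obtain N where N: "bounded_supp T f" "V \<in> borel_measurable M" "W2.wiener_rel f N"
      "AE w in M. V w = (LBINT s. a s * f s * Xc s w) + N w" by (rule obs_relE[OF V]) blast
    let ?I = "\<lambda>w. (LBINT s. a s * f s * Xc s w)"
    note I = drift_L2[OF N(1)] and NL = W2.wiener_rel_L2(2)[OF N(3)]
    note [measurable] = L2_measurable[OF I] L2_measurable[OF NL] N(2)
    have "(LINT w|M. (V w)\<^sup>2) = (LINT w|M. (?I w + N w)\<^sup>2)"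
    proof (rule integral_cong_AE)
      show "AE w in M. (V w)\<^sup>2 = (?I w + N w)\<^sup>2" using N(4) by eventually_elim (simp only:)
    qed measurable
    also have "\<dots> \<le> 2 * (LINT w|M. (?I w)\<^sup>2) + 2 * (LINT w|M. (N w)\<^sup>2)" by (rule integral_sq_add_le[OF I NL])
    also have "(LINT w|M. (N w)\<^sup>2) = (LBINT s. (f s)\<^sup>2)" by (rule W2.wiener_rel_norm[OF N(3)])
    also have "(LINT w|M. (?I w)\<^sup>2) \<le> (LBINT s. (a s * f s)\<^sup>2) * q"
      unfolding q_def by (rule process_integral(3)[OF Xc_L2 bounded_supp_L2[OF af_bs[OF N(1)]]])
    also have "(LBINT s. (a s * f s)\<^sup>2) \<le> (LBINT s. ca\<^sup>2 * (f s)\<^sup>2)"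
    proof (intro integral_mono integrable_mult_right L2_integrable_sq bounded_supp_L2[OF af_bs[OF N(1)]] bounded_supp_L2[OF N(1)])
      show "(a s * f s)\<^sup>2 \<le> ca\<^sup>2 * (f s)\<^sup>2" for s
        using power_mono[OF R.a_bound[of s] abs_ge_zero, of 2] by (simp add: power_mult_distrib mult_right_mono)
    qed
    finally show ?thesis using q0 by (simp add: algebra_simps mult_left_mono mult_right_mono)
  qed
  moreover have "0 \<le> 2 * (ca\<^sup>2 * q) + 2" using q0 by simp
  ultimately show ?thesis by blast
qed

lemma obs_rel_add:
  assumes V: "obs_rel f V" and W: "obs_rel g W"
  shows "obs_rel (\<lambda>s. f s + g s) (\<lambda>w. V w + W w)"
proof -
  obtain N where N: "bounded_supp T f" "V \<in> borel_measurable M" "W2.wiener_rel f N"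
    "AE w in M. V w = (LBINT s. a s * f s * Xc s w) + N w" by (rule obs_relE[OF V]) blast
  obtain N' where N': "bounded_supp T g" "W \<in> borel_measurable M" "W2.wiener_rel g N'"
    "AE w in M. W w = (LBINT s. a s * g s * Xc s w) + N' w" by (rule obs_relE[OF W]) blast
  have "AE w in M. V w + W w = (LBINT s. a s * (f s + g s) * Xc s w) + (N w + N' w)"
    using process_integral(1)[OF Xc_L2 bounded_supp_L2[OF af_bs[OF N(1)]]]
      process_integral(1)[OF Xc_L2 bounded_supp_L2[OF af_bs[OF N'(1)]]] N(4) N'(4)
    by eventually_elim (simp add: distrib_left distrib_right)
  then show ?thesis
    unfolding obs_rel_def using bounded_supp_add[OF N(1) N'(1)] W2.wiener_rel_add[OF N(3) N'(3)] N(2) N'(2) by auto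
qed

lemma obs_rel_scale:
  assumes V: "obs_rel f V" shows "obs_rel (\<lambda>s. c * f s) (\<lambda>w. c * V w)"
proof -
  obtain N where N: "bounded_supp T f" "V \<in> borel_measurable M" "W2.wiener_rel f N"
    "AE w in M. V w = (LBINT s. a s * f s * Xc s w) + N w" by (rule obs_relE[OF V]) blast
  have "(LBINT s. a s * (c * f s) * Xc s w) = c * (LBINT s. a s * f s * Xc s w)" for w
    by (simp only: mult.assoc mult.left_commute[of _ c] integral_mult_right_zero)
  then have "AE w in M. c * V w = (LBINT s. a s * (c * f s) * Xc s w) + c * N w"
    using N(4) by (simp only: distrib_left[symmetric]) (auto elim: eventually_mono)
  then show ?thesis
    unfolding obs_rel_def using bounded_supp_scale[OF N(1), of c] W2.wiener_rel_scale[OF N(3), of c] N(2) by auto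
qed

lemma obs_rel_diff:
  "obs_rel f V \<Longrightarrow> obs_rel g W \<Longrightarrow> obs_rel (\<lambda>s. f s - g s) (\<lambda>w. V w - W w)"
  using obs_rel_add[of f V "\<lambda>s. -1 * g s" "\<lambda>w. -1 * W w"] obs_rel_scale[of g W "-1"] by simp

lemma obs_rel_zero: "obs_rel (\<lambda>s. 0) (\<lambda>w. 0)"
  unfolding obs_rel_def using W2.wiener_rel_steps[of "[]"] bounded_supp_const_zero
  by (auto simp: step_simps step_fun_def[abs_def] step_integral_def[abs_def])

lemma obs_rel_sum:
  assumes "finite I" "\<And>i. i \<in> I \<Longrightarrow> obs_rel (f i) (V i)"
  shows "obs_rel (\<lambda>s. \<Sum>i\<in>I. f i s) (\<lambda>w. \<Sum>i\<in>I. V i w)"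
  using assms by (induction I rule: finite_induct) (auto simp: obs_rel_zero obs_rel_add)

lemma phi_compose [measurable (raw)]:
  "f \<in> measurable N borel \<Longrightarrow> g \<in> measurable N borel \<Longrightarrow> (\<lambda>x. R.phi (f x) (g x)) \<in> borel_measurable N"
  using measurable_compose[OF measurable_Pair R.phi_measurable, of f N g] by simp

text \<open>One version of all noise integrals, measurable jointly in time and sample point.
  Versions chosen separately for each \<open>s\<close> could not be integrated in
  \<open>s\<close>.\<close>

definition noise :: "real \<Rightarrow> 'a \<Rightarrow> real" where
  "noise = (SOME Z. (\<lambda>(s, w). Z s w) \<in> borel_measurable (borel \<Otimes>\<^sub>M M) \<and> (\<forall>s. W2.wiener_rel (R.phi s) (Z s)))"

lemma noise_pair_measurable: "(\<lambda>(s, w). noise s w) \<in> borel_measurable (borel \<Otimes>\<^sub>M M)"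
  and noise_rel: "W2.wiener_rel (R.phi s) (noise s)"
proof -
  obtain b where b: "\<And>t s. \<bar>R.phi t s\<bar> \<le> b" using R.phi_bounded by blast
  obtain Z where Z: "(\<lambda>(s, w). Z s w) \<in> borel_measurable (borel \<Otimes>\<^sub>M M)"
    "\<And>s. W2.wiener_rel (\<lambda>u. indicator {0..T} u * R.phi s u) (Z s)"
    by (rule W2.measurable_wiener_version[OF T_pos R.phi_measurable b]) blast
  have "(\<lambda>u. indicator {0..T} u * R.phi s u) = R.phi s" for s
    using bounded_supp_zero[OF R.phi_bs] by (auto split: split_indicator)
  then have "\<exists>Z. (\<lambda>(s, w). Z s w) \<in> borel_measurable (borel \<Otimes>\<^sub>M M) \<and> (\<forall>s. W2.wiener_rel (R.phi s) (Z s))"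
    using Z by auto
  from someI_ex[OF this, folded noise_def]
  show "(\<lambda>(s, w). noise s w) \<in> borel_measurable (borel \<Otimes>\<^sub>M M)" "W2.wiener_rel (R.phi s) (noise s)" by blast+
qed

section \<open>The optimal linear estimate and its error\<close>

definition est0 :: "real \<Rightarrow> 'a \<Rightarrow> real" where
  "est0 t w = (LBINT s. a s * R.phi t s * Xc s w) + noise t w"

lemma est0_measurable: "(\<lambda>x. est0 (fst x) (snd x)) \<in> borel_measurable (borel \<Otimes>\<^sub>M M)"
proof -
  note [measurable] = noise_pair_measurable[unfolded case_prod_beta'] bounded_supp_measurable[OF a_bs]
  show ?thesis unfolding est0_def by measurable
qed

lemma est0_compose [measurable (raw)]:
  "f \<in> measurable N borel \<Longrightarrow> g \<in> measurable N M \<Longrightarrow> (\<lambda>x. est0 (f x) (g x)) \<in> borel_measurable N"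
  using measurable_compose[OF measurable_Pair est0_measurable, of f N g] by simp

lemma est0_rel: "obs_rel (R.phi t) (est0 t)"
proof -
  have "est0 t \<in> borel_measurable M" using est0_compose[of "\<lambda>_. t" M "\<lambda>x. x"] by simp
  then show ?thesis unfolding obs_rel_def est0_def using R.phi_bs noise_rel by blast
qed

lemma est0_L2: "est0 t \<in> L2 M" by (rule obs_rel_L2[OF est0_rel])

definition err :: "real \<Rightarrow> 'a \<Rightarrow> real" where "err t w = Xc t w - est0 t w"

lemma err_L2: "err t \<in> L2 M"
  unfolding err_def[abs_def] by (rule L2_diff[OF Xc_sec_L2 est0_L2])

lemma err_gspace: "err t \<in> gspace"
  unfolding err_def[abs_def] by (rule closed_subspace_diff[OF gspace_closed Xc_in_gspace obs_rel_gspace[OF est0_rel]])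

text \<open>This is the Wiener-Hopf equation read probabilistically: on \<open>{0..t}\<close> it
  states that \<open>covop (phi t)\<close> equals \<open>a\<close> times the covariance with the
  signal at \<open>t\<close>, so both terms of the difference agree for \<open>f\<close> supported
  there.\<close>

lemma err_orthogonal:
  assumes V: "obs_rel f V" and f: "\<And>s. s \<notin> {0..t} \<Longrightarrow> f s = 0"
  shows "(LINT w|M. err t w * V w) = 0"
proof -
  have "(LINT w|M. err t w * V w) = (LINT w|M. V w * Xc t w - V w * est0 t w)"
    by (intro Bochner_Integration.integral_cong refl) (simp add: err_def algebra_simps)
  also have "\<dots> = (LINT w|M. V w * Xc t w) - (LINT w|M. V w * est0 t w)"
    by (intro Bochner_Integration.integral_diff L2_mult_integrable obs_rel_L2[OF V] Xc_sec_L2 est0_L2)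
  also have "(LINT w|M. V w * est0 t w) = (LBINT s. f s * covop (R.phi t) s)"
    by (rule obs_rel_cov[OF V est0_rel])
  also have "\<dots> = (LBINT s. a s * f s * K0 s t)"
  proof (intro Bochner_Integration.integral_cong refl)
    fix s show "f s * covop (R.phi t) s = a s * f s * K0 s t"
      using R.phi_eq[of s t] f[of s] K0_sym[of s t] by (cases "s \<in> {0..t}") (simp_all add: covop_def)
  qed
  finally show ?thesis using obs_rel_Xc[OF V] by simp
qed

abbreviation mz :: "real \<Rightarrow> real" where "mz t \<equiv> expectation (Xz t)"

lemma Xz_split:
  assumes h: "bounded_supp T h"
  shows "AE w in M. integrable lborel (\<lambda>s. h s * Xz s w) \<and>
    (LBINT s. h s * Xz s w) = (LBINT s. h s * Xc s w) + (LBINT s. h s * mz s)"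
  using process_integral(1)[OF Xc_L2 bounded_supp_L2[OF h]]
proof eventually_elim
  fix w assume i: "integrable lborel (\<lambda>s. h s * Xc s w)"
  have m: "integrable lborel (\<lambda>s. h s * mz s)"
    by (rule bounded_supp_integrable[OF bounded_supp_mult2[OF h mean_bounded_supp]])
  have e: "(\<lambda>s. h s * Xz s w) = (\<lambda>s. h s * Xc s w + h s * mz s)" by (simp add: Xc_def algebra_simps)
  show "integrable lborel (\<lambda>s. h s * Xz s w) \<and>
    (LBINT s. h s * Xz s w) = (LBINT s. h s * Xc s w) + (LBINT s. h s * mz s)"
    unfolding e using Bochner_Integration.integrable_add[OF i m] Bochner_Integration.integral_add[OF i m] by blast
qed

text \<open>An integrand \<open>l\<close> against the observation corresponds to
  \<open>f = l * D\<close> against the normalised one, and \<open>a * f = l * G\<close> on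
  \<open>{0..t}\<close>. The mean of the signal contributes a deterministic term, which is
  subtracted.\<close>

lemma obs_integral_rel:
  assumes t: "t \<in> {0..T}" and f: "bounded_supp T f" and fl: "\<And>s. f s = indicator {0..t} s * (l s * Dt s)"
    and J: "has_obs_integral M G D X B\<^sub>2 t l J"
    and V: "V \<in> borel_measurable M" "AE w in M. V w = J w - (LBINT s. a s * f s * mz s)"
  shows "obs_rel f V"
proof -
  obtain N where N: "has_wiener_integral M B\<^sub>2 0 t (\<lambda>s. l s * D s) N"
    and eq: "AE w in M. J w = (LBINT s:{0..t}. l s * G s * X s w) + N w"
    using J unfolding has_obs_integral_def by blast
  have "(\<lambda>s. indicator {0..t} s * (l s * D s)) = f"
    using t by (auto simp: fl Dt_def split: split_indicator)
  then have rel: "W2.wiener_rel f N" using W2.has_wiener_integral_imp_rel[OF N] t by simp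
  have set: "(LBINT s:{0..t}. l s * G s * X s w) = (LBINT s. a s * f s * Xz s w)" for w
    unfolding set_lebesgue_integral_def
  proof (intro Bochner_Integration.integral_cong refl)
    fix s show "indicator {0..t} s *\<^sub>R (l s * G s * X s w) = a s * f s * Xz s w"
      using t D_nonzero[of s] by (auto simp: fl a_def Gt_def Di_def Dt_def Xz_def split: split_indicator)
  qed
  have "AE w in M. V w = (LBINT s. a s * f s * Xc s w) + N w"
    using V(2) eq Xz_split[OF af_bs[OF f]] by eventually_elim (simp add: set)
  then show ?thesis unfolding obs_rel_def using f V(1) rel by blast
qed

lemma rel_obs_integral:
  assumes t: "t \<in> {0..T}" and fl: "\<And>s. f s = indicator {0..t} s * (l s * Dt s)" and V: "obs_rel f V"
  shows "has_obs_integral M G D X B\<^sub>2 t l (\<lambda>\<omega>. V \<omega> + (LBINT s. a s * f s * mz s))"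
proof -
  obtain N where N: "bounded_supp T f" "V \<in> borel_measurable M" "W2.wiener_rel f N"
    "AE \<omega> in M. V \<omega> = (LBINT s. a s * f s * Xc s \<omega>) + N \<omega>" by (rule obs_relE[OF V]) blast
  obtain b where b: "\<And>s. \<bar>f s\<bar> \<le> b" by (rule bounded_suppE[OF N(1)]) blast
  have ind: "(\<lambda>s. indicator {0..t} s * f s) = f" by (auto simp: fl split: split_indicator)
  have pt: "indicator {0..t} s *\<^sub>R (l s * G s * X s \<omega>) = a s * f s * Xz s \<omega>" for s \<omega>
    using t D_nonzero[of s] by (auto simp: fl a_def Gt_def Di_def Dt_def Xz_def split: split_indicator)
  have "has_wiener_integral M B\<^sub>2 0 t f N"
    by (rule W2.rel_imp_has_wiener_integral[where B=b]) (use t b N(3) bounded_supp_measurable[OF N(1)] ind in auto)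
  moreover have "f s = l s * D s" if "s \<in> {0..t}" for s using that t by (simp add: fl Dt_def)
  ultimately have w: "has_wiener_integral M B\<^sub>2 0 t (\<lambda>s. l s * D s) N"
    using has_wiener_integral_cong[of 0 t f "\<lambda>s. l s * D s"] by blast
  have "AE \<omega> in M. set_integrable lborel {0..t} (\<lambda>s. l s * G s * X s \<omega>)"
    using Xz_split[OF af_bs[OF N(1)]] unfolding set_integrable_def pt by (auto elim: eventually_mono)
  moreover have "AE \<omega> in M. V \<omega> + (LBINT s. a s * f s * mz s) = (LBINT s:{0..t}. l s * G s * X s \<omega>) + N \<omega>"
    using N(4) Xz_split[OF af_bs[OF N(1)]] unfolding set_lebesgue_integral_def pt by eventually_elim simp
  ultimately show ?thesis using w unfolding has_obs_integral_def by blast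
qed

section \<open>Adaptedness and identification of the best estimate\<close>

definition Yc :: "real \<Rightarrow> 'a \<Rightarrow> real" where
  "Yc s w = Y s w - (Y\<^sub>0 + (LBINT r. a r * (indicator {0..s} r * Dt r) * mz r))"

lemma indicator_bs: "bounded_supp T f \<Longrightarrow> A \<in> sets borel \<Longrightarrow> bounded_supp T (\<lambda>s. indicator A s * f s)"
  by (rule bounded_supp_mult(1)[where b=1]) (auto split: split_indicator)

lemma Yc_rel:
  assumes s: "s \<in> {0..T}" shows "obs_rel (\<lambda>r. indicator {0..s} r * Dt r) (Yc s)"
proof -
  obtain J where J: "has_obs_integral M G D X B\<^sub>2 s (\<lambda>_. 1) J" and eq: "AE w in M. Y s w = Y\<^sub>0 + J w"
    using Y_eq[OF s] by blast
  show ?thesis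
  proof (rule obs_integral_rel[OF s _ _ J])
    show "Yc s \<in> borel_measurable M" unfolding Yc_def[abs_def] using Y_measurable[OF s] by simp
    show "AE w in M. Yc s w = J w - (LBINT r. a r * (indicator {0..s} r * Dt r) * mz r)"
      using eq by eventually_elim (simp add: Yc_def)
  qed (auto intro: indicator_bs[OF Dt_bs])
qed

abbreviation Yt :: "real \<Rightarrow> 'a measure" where "Yt t \<equiv> obs_filtration M Y t"

lemma Yt: assumes "t \<in> {0..T}"
  shows "subalgebra M (Yt t)" "null_sets M \<subseteq> sets (Yt t)" "\<And>s. s \<in> {0..t} \<Longrightarrow> Y s \<in> borel_measurable (Yt t)"
proof -
  have m: "Y s \<in> borel_measurable M" if "s \<in> {0..t}" for s using that assms Y_measurable by simp
  show "subalgebra M (Yt t)" by (rule obs_filtration_subalgebra[OF m])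
  show "null_sets M \<subseteq> sets (Yt t)" by (rule obs_filtration_sets(1)[OF m])
  show "Y s \<in> borel_measurable (Yt t)" if "s \<in> {0..t}" for s by (rule obs_filtration_sets(2)[OF m that])
qed

lemma Yc_adapted:
  assumes "s \<in> {0..t}" "t \<in> {0..T}" shows "Yc s \<in> L2_rv M (Yt t)"
proof -
  have "Yc s \<in> borel_measurable (Yt t)"
    unfolding Yc_def[abs_def] using Yt(3)[OF assms(2,1)] by simp
  moreover have "Yc s \<in> L2 M" using assms by (intro obs_rel_L2[OF Yc_rel]) auto
  ultimately show ?thesis by (simp add: L2_rv_def)
qed

text \<open>Replacing \<open>l = f / D\<close> by grid averages turns the integral into a linear
  combination of increments of \<open>Yc\<close>, which is adapted. Convergence of the averages is
  transferred by \<open>obs_rel_norm\<close>, and adapted variables form a closed subspace.\<close>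

lemma obs_rel_adapted:
  assumes t: "t \<in> {0..T}" and V: "obs_rel f V" and f: "\<And>s. s \<notin> {0..t} \<Longrightarrow> f s = 0"
  shows "V \<in> L2_rv M (Yt t)"
proof -
  note cs = L2_rv_closed_subspace[OF Yt(1,2)[OF t]]
  note VL = obs_rel_L2[OF V]
  have fb: "bounded_supp T f" by (rule obs_relE[OF V]) blast
  obtain c where c: "0 \<le> c" "\<And>f V. obs_rel f V \<Longrightarrow> (LINT w|M. (V w)\<^sup>2) \<le> c * (LBINT s. (f s)\<^sup>2)" using obs_rel_norm by blast
  show ?thesis
  proof (cases "t = 0")
    \<comment> \<open>At \<open>t = 0\<close> the integrand lives on a single point, so the integral
      is almost surely zero.\<close>
    case True
    have "(LBINT s. (f s)\<^sup>2) = (\<integral>s. 0 \<partial>(lborel :: real measure))"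
    proof (rule integral_cong_AE)
      show "AE s in lborel. (f s)\<^sup>2 = 0"
        using AE_lborel_singleton[of 0] by eventually_elim (use f True in simp)
    qed (use bounded_supp_measurable[OF fb] in measurable)
    then have "(LINT w|M. (V w)\<^sup>2) = 0" using c(2)[OF V] by (intro antisym) auto
    from integral_sq_zero_AE[OF VL this] show ?thesis
      by (intro closed_subspace_cong_AE[OF cs closed_subspace_zero[OF cs] L2_measurable[OF VL]]) (auto elim: eventually_mono)
  next
    case False
    then have t0: "0 < t" using t by simp
    define l where "l s = f s * Di s" for s
    have lb: "bounded_supp T l" unfolding l_def[abs_def] by (rule bounded_supp_mult2[OF fb Di_bs])
    obtain bl where bl: "\<And>s. \<bar>l s\<bar> \<le> bl" by (rule bounded_suppE[OF lb]) blast
    obtain bD where bD: "0 \<le> bD" "\<And>s. \<bar>Dt s\<bar> \<le> bD" by (rule bounded_suppE[OF Dt_bs]) blast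
    note lm = bounded_supp_measurable[OF lb]
    define p where "p n i = ugrid 0 t n i" for n i
    have p: "p n i \<in> {0..t}" if "i \<le> Suc n" for n i using ugrid_bounds[of 0 t i n] that t0 by (simp add: p_def)
    have pm: "p n i \<le> p n (Suc i)" for n i unfolding p_def using t0 by (intro ugrid_mono) auto
    define J where "J n w = (\<Sum>i<Suc n. avg_coeff 0 t n l i * (Yc (p n (Suc i)) w - Yc (p n i) w))" for n w
    have inT: "p n i \<in> {0..T}" if "i \<le> Suc n" for n i using p[OF that] t by auto
    have Jrel: "obs_rel (\<lambda>s. avg_step 0 t n l s * Dt s) (J n)" for n
    proof -
      have cell: "indicator {0..p n (Suc i)} s - indicator {0..p n i} s = (indicator {p n i<..p n (Suc i)} s :: real)" if "i \<le> n" for i s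
        using p[of i n] pm[of n i] that by (auto split: split_indicator)
      have "obs_rel (\<lambda>s. \<Sum>i<Suc n. avg_coeff 0 t n l i * (indicator {0..p n (Suc i)} s * Dt s - indicator {0..p n i} s * Dt s)) (J n)"
        unfolding J_def[abs_def]
        by (intro obs_rel_sum obs_rel_scale obs_rel_diff Yc_rel inT) auto
      also have "(\<lambda>s. \<Sum>i<Suc n. avg_coeff 0 t n l i * (indicator {0..p n (Suc i)} s * Dt s - indicator {0..p n i} s * Dt s))
          = (\<lambda>s. avg_step 0 t n l s * Dt s)"
        unfolding avg_step_def sum_distrib_right
        by (intro ext sum.cong refl) (simp add: left_diff_distrib[symmetric] cell p_def[symmetric])
      finally show ?thesis .
    qed
    have JV: "J n \<in> L2_rv M (Yt t)" for n
      unfolding J_def[abs_def]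
      by (intro closed_subspace_sum[OF cs] closed_subspace_scale[OF cs] closed_subspace_diff[OF cs] Yc_adapted p t) auto
    have step: "(LINT w|M. (J n w - V w)\<^sup>2) \<le> c * (bD\<^sup>2 * (LBINT x. (indicator {0..t} x * l x - avg_step 0 t n l x)\<^sup>2))" for n
    proof -
      have il: "(\<lambda>x. indicator {0..t} x * l x) \<in> L2 lborel" by (rule L2_indicator[OF lm bl]) auto
      have dl: "(\<lambda>x. indicator {0..t} x * l x - avg_step 0 t n l x) \<in> L2 lborel" by (rule L2_diff[OF il avg_step_L2])
      have r: "obs_rel (\<lambda>s. avg_step 0 t n l s * Dt s - f s) (\<lambda>w. J n w - V w)" by (rule obs_rel_diff[OF Jrel V])
      have "bounded_supp T (\<lambda>s. avg_step 0 t n l s * Dt s - f s)" by (rule obs_relE[OF r]) blast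
      then have ri: "integrable lborel (\<lambda>s. (avg_step 0 t n l s * Dt s - f s)\<^sup>2)" by (intro L2_integrable_sq bounded_supp_L2)
      have "(LINT w|M. (J n w - V w)\<^sup>2) \<le> c * (LBINT s. (avg_step 0 t n l s * Dt s - f s)\<^sup>2)" by (rule c(2)[OF r])
      also have "\<dots> \<le> c * (LBINT s. bD\<^sup>2 * (indicator {0..t} s * l s - avg_step 0 t n l s)\<^sup>2)"
      proof (intro mult_left_mono integral_mono ri integrable_mult_right L2_integrable_sq[OF dl] c(1))
        fix s
        have "f s = Dt s * (indicator {0..t} s * l s)"
          using f[of s] Di_Dt[of s] t by (cases "s \<in> {0..t}") (auto simp: l_def mult.commute mult.left_commute)
        then have "(avg_step 0 t n l s * Dt s - f s)\<^sup>2 = (Dt s)\<^sup>2 * (indicator {0..t} s * l s - avg_step 0 t n l s)\<^sup>2"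
          by (simp only: power_mult_distrib[symmetric] right_diff_distrib mult.commute[of "Dt s"]) (simp add: power2_commute)
        also have "\<dots> \<le> bD\<^sup>2 * (indicator {0..t} s * l s - avg_step 0 t n l s)\<^sup>2"
          using power_mono[OF bD(2)[of s] abs_ge_zero, of 2] by (intro mult_right_mono) auto
        finally show "(avg_step 0 t n l s * Dt s - f s)\<^sup>2 \<le> bD\<^sup>2 * (indicator {0..t} s * l s - avg_step 0 t n l s)\<^sup>2" .
      qed
      finally show ?thesis by simp
    qed
    have "(\<lambda>n. (LBINT x. (indicator {0..t} x * l x - avg_step 0 t n l x)\<^sup>2)) \<longlonglongrightarrow> 0"
      by (rule avg_step_converges[OF t0 lm bl])
    then have lim: "(\<lambda>n. c * (bD\<^sup>2 * (LBINT x. (indicator {0..t} x * l x - avg_step 0 t n l x)\<^sup>2))) \<longlonglongrightarrow> 0"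
      by (intro tendsto_mult_right_zero)
    have "(\<lambda>n. (LINT w|M. (J n w - V w)\<^sup>2)) \<longlonglongrightarrow> 0"
      by (rule tendsto_sandwich[OF _ _ tendsto_const lim]) (simp_all add: step)
    then show ?thesis by (rule closed_subspace_limit[OF cs VL JV])
  qed
qed

definition est :: "real \<Rightarrow> 'a \<Rightarrow> real" where "est t w = mz t + est0 t w"

lemma X_eq_Xz: "t \<in> {0..T} \<Longrightarrow> X t = Xz t" by (rule ext) (simp add: Xz_def)

lemma err_eq: "err t w = Xz t w - est t w" by (simp add: err_def est_def Xc_def)

lemma est_adapted: assumes t: "t \<in> {0..T}" shows "est t \<in> L2_rv M (Yt t)"
proof -
  have "est0 t \<in> L2_rv M (Yt t)" by (rule obs_rel_adapted[OF t est0_rel R.phi_supp])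
  then have "est0 t \<in> borel_measurable (Yt t)" by (simp add: L2_rv_def)
  then have "est t \<in> borel_measurable (Yt t)"
    unfolding est_def[abs_def] by (intro borel_measurable_add borel_measurable_const)
  moreover have "est t \<in> L2 M" unfolding est_def[abs_def] by (intro L2_add L2_const est0_L2)
  ultimately show ?thesis by (simp add: L2_rv_def)
qed

lemma est_L2: "est t \<in> L2 M" unfolding est_def[abs_def] by (intro L2_add L2_const est0_L2)

lemma est_set_integral:
  assumes t: "t \<in> {0..T}" and A: "A \<in> sets (Yt t)"
  shows "(LINT w:A|M. X t w) = (LINT w:A|M. est t w)"
proof -
  have AM: "A \<in> sets M" using A Yt(1)[OF t] by (auto simp: subalgebra_def)
  have sT: "s \<in> {0..T}" if "s \<in> {0..t}" for s using that t by auto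
  have "(LINT w:A|M. err t w) = 0"
  proof (rule gaussian_independent_of_filtration[OF gspace err_gspace _ _ _ _ A, where v=Yc])
    fix s assume s: "s \<in> {0..t}"
    show "Yc s \<in> gspace" by (rule obs_rel_gspace[OF Yc_rel[OF sT[OF s]]])
    show "(LINT w|M. err t w * Yc s w) = 0"
      by (rule err_orthogonal[OF Yc_rel[OF sT[OF s]]]) (use s in auto)
    show "Y s \<in> borel_measurable M" by (rule Y_measurable[OF sT[OF s]])
    show "AE w in M. Y s w = (Y\<^sub>0 + (LBINT r. a r * (indicator {0..s} r * Dt r) * mz r)) + Yc s w"
      by (simp add: Yc_def)
  qed
  moreover have "(LINT w:A|M. err t w) = (LINT w:A|M. Xz t w) - (LINT w:A|M. est t w)"
    unfolding err_eq
    using integrable_mult_indicator[OF AM L2_integrable[OF Xz_sec_L2]] integrable_mult_indicator[OF AM L2_integrable[OF est_L2]]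
    by (intro set_integral_diff(2)) (simp_all only: set_integrable_def)
  ultimately show ?thesis using X_eq_Xz[OF t] by simp
qed

lemma best_estimate_iff:
  assumes t: "t \<in> {0..T}"
  shows "best_estimate M (Yt t) (X t) Z \<longleftrightarrow> Z \<in> L2_rv M (Yt t) \<and> (AE w in M. Z w = est t w)"
    and "AE w in M. real_cond_exp M (Yt t) (X t) w = est t w"
proof -
  have XL: "X t \<in> L2 M" using X_eq_Xz[OF t] Xz_sec_L2 by simp
  note b = best_estimate_charact[OF Yt(1,2)[OF t] XL est_adapted[OF t] est_set_integral[OF t]]
  show "best_estimate M (Yt t) (X t) Z \<longleftrightarrow> Z \<in> L2_rv M (Yt t) \<and> (AE w in M. Z w = est t w)"
    "AE w in M. real_cond_exp M (Yt t) (X t) w = est t w"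
    using b(1) b(2) by blast+
qed

text \<open>This identifies the analytically constructed kernel with the covariance between signal
  and estimation error.\<close>

lemma err_Xc: "(LINT w|M. Xc t w * err s w) = R.H t s"
proof -
  have "(LINT w|M. Xc t w * err s w) = (LINT w|M. Xc t w * Xc s w - est0 s w * Xc t w)"
    by (intro Bochner_Integration.integral_cong refl) (simp add: err_def algebra_simps)
  also have "\<dots> = K0 t s - (LINT w|M. est0 s w * Xc t w)"
    unfolding K0_def by (intro Bochner_Integration.integral_diff L2_mult_integrable Xc_sec_L2 est0_L2)
  also have "(LINT w|M. est0 s w * Xc t w) = (LBINT r. a r * R.phi s r * K0 r t)" by (rule obs_rel_Xc[OF est0_rel])
  also have "\<dots> = (LBINT r. R.phi s r * (a r * K0 t r))"
    by (intro Bochner_Integration.integral_cong refl) (simp add: K0_sym[of _ t])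
  finally show ?thesis by (simp add: R.H_def)
qed

lemma err_Xz: "(LINT w|M. Xz t w * err s w) = R.H t s"
proof -
  have "(LINT w|M. Xz t w * err s w) = (LINT w|M. Xc t w * err s w + mz t * err s w)"
    by (intro Bochner_Integration.integral_cong refl) (simp add: Xc_def algebra_simps)
  also have "\<dots> = (LINT w|M. Xc t w * err s w) + mz t * expectation (err s)"
    using L2_mult_integrable[OF Xc_sec_L2 err_L2] L2_integrable[OF err_L2] by simp
  finally show ?thesis using err_Xc gspace_mean[OF err_gspace] by simp
qed

lemma err_sq: "(LINT w|M. (err t w)\<^sup>2) = R.H t t"
proof -
  have "(LINT w|M. (err t w)\<^sup>2) = (LINT w|M. Xc t w * err t w - err t w * est0 t w)"
    by (intro Bochner_Integration.integral_cong refl) (simp add: err_def power2_eq_square algebra_simps)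
  also have "\<dots> = (LINT w|M. Xc t w * err t w) - (LINT w|M. err t w * est0 t w)"
    by (intro Bochner_Integration.integral_diff L2_mult_integrable Xc_sec_L2 est0_L2 err_L2)
  finally show ?thesis using err_Xc err_orthogonal[OF est0_rel R.phi_supp] by simp
qed

section \<open>The kernel equation on the triangle and its uniqueness\<close>

lemma a_sq: "s \<in> {0..T} \<Longrightarrow> (G s)\<^sup>2 / (D s)\<^sup>2 = (a s)\<^sup>2"
  and a_Di: "s \<in> {0..T} \<Longrightarrow> G s / (D s)\<^sup>2 = a s * Di s"
  by (simp_all add: a_def Gt_def Di_def power2_eq_square)

lemma process_mean_eq: "t \<in> {0..T} \<Longrightarrow> process_mean M X t = mz t"
  by (simp add: process_mean_def X_eq_Xz)

lemma process_cov_eq: "t \<in> {0..T} \<Longrightarrow> s \<in> {0..T} \<Longrightarrow> process_cov M X t s = K0 t s"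
  by (simp add: process_cov_def process_mean_eq X_eq_Xz K0_def Xc_def)

lemma H_kernel_eq_LBINT:
  assumes "0 \<le> s" "s \<le> t" "t \<le> T"
  shows "R.H t s = process_cov M X t s - (LBINT r:{0..s}. (G r)\<^sup>2 / (D r)\<^sup>2 * R.H t r * R.H s r)"
proof -
  have "(LBINT r. indicator {..s} r * ((a r)\<^sup>2 * R.H t r * R.H s r)) = (LBINT r:{0..s}. (G r)\<^sup>2 / (D r)\<^sup>2 * R.H t r * R.H s r)"
    unfolding set_lebesgue_integral_def
  proof (intro Bochner_Integration.integral_cong refl)
    fix r show "indicator {..s} r * ((a r)\<^sup>2 * R.H t r * R.H s r) = indicator {0..s} r *\<^sub>R ((G r)\<^sup>2 / (D r)\<^sup>2 * R.H t r * R.H s r)"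
      using assms a_sq[of r] R.a_supp[of r] by (cases "r \<in> {0..s}") (auto split: split_indicator)
  qed
  then show ?thesis using R.H_kernel_eq[OF assms] process_cov_eq[of t s] assms by simp
qed

lemma triangle_measurable: "time_triangle T \<in> sets borel"
proof -
  have "{x \<in> space (borel \<Otimes>\<^sub>M borel). (0::real) \<le> snd x \<and> snd x \<le> fst x \<and> fst x \<le> T} \<in> sets (borel \<Otimes>\<^sub>M borel)" by measurable
  also have "{x \<in> space (borel \<Otimes>\<^sub>M borel). (0::real) \<le> snd x \<and> snd x \<le> fst x \<and> fst x \<le> T} = time_triangle T"
    by (auto simp: time_triangle_def space_pair_measure)
  finally show ?thesis by (simp only: borel_prod)
qed

lemma kernel_eq_solution_H:
  assumes h: "\<And>t s. (t, s) \<in> time_triangle T \<Longrightarrow> h t s = R.H t s"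
  shows "kernel_eq_solution T G D (process_cov M X) h"
  unfolding kernel_eq_solution_def
proof (intro conjI)
  have "(\<lambda>(t, s). R.H t s) \<in> borel_measurable (restrict_space borel (time_triangle T))"
    using R.H_measurable by (intro measurable_restrict_space1) (simp add: borel_prod case_prod_beta')
  then show "(\<lambda>(t, s). h t s) \<in> borel_measurable (restrict_space borel (time_triangle T))"
    by (rule measurable_cong[THEN iffD1, rotated]) (auto simp: h space_restrict_space)
  obtain b where "\<And>t s. \<bar>R.H t s\<bar> \<le> b" using R.H_bounded by blast
  then show "bounded ((\<lambda>(t, s). h t s) ` time_triangle T)"
    unfolding bounded_iff by (intro exI[of _ b]) (auto simp: h)
  show "\<forall>(t, s)\<in>time_triangle T. h t s = process_cov M X t s - (LBINT r:{0..s}. (G r)\<^sup>2 / (D r)\<^sup>2 * h t r * h s r)"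
  proof clarify
    fix t s assume ts: "(t, s) \<in> time_triangle T"
    then have st: "0 \<le> s" "s \<le> t" "t \<le> T" by (auto simp: time_triangle_def)
    have "(LBINT r:{0..s}. (G r)\<^sup>2 / (D r)\<^sup>2 * R.H t r * R.H s r) = (LBINT r:{0..s}. (G r)\<^sup>2 / (D r)\<^sup>2 * h t r * h s r)"
      by (rule set_lebesgue_integral_cong) (use st h in \<open>auto simp: time_triangle_def\<close>)
    then show "h t s = process_cov M X t s - (LBINT r:{0..s}. (G r)\<^sup>2 / (D r)\<^sup>2 * h t r * h s r)"
      using H_kernel_eq_LBINT[OF st] h[OF ts] by simp
  qed
qed

text \<open>The difference of the quadratic terms splits into \<open>(H - k) * H\<close> at
  \<open>(t, r)\<close> and \<open>(s, r)\<close> plus \<open>k * (H - k)\<close>. With both kernels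
  bounded by \<open>b\<close> this is linear in the differences at \<open>(t, r)\<close> and
  \<open>(s, r)\<close>, exactly the form of \<open>triangle_gronwall\<close>.\<close>

lemma kernel_eq_solution_unique:
  assumes sol: "kernel_eq_solution T G D (process_cov M X) h" and st: "0 \<le> s" "s \<le> t" "t \<le> T"
  shows "h t s = R.H t s"
proof -
  \<comment> \<open>Nothing is known of \<open>h\<close> off the triangle; the extension by zero is
    bounded and measurable on the plane.\<close>
  define k where "k t s = indicator (time_triangle T) (t, s) * h t s" for t s
  have k: "k t s = h t s" if "0 \<le> s" "s \<le> t" "t \<le> T" for t s using that by (simp add: k_def time_triangle_def)
  have "(\<lambda>x. indicator (time_triangle T) x *\<^sub>R (case x of (t, s) \<Rightarrow> h t s)) \<in> borel_measurable borel"
    using sol triangle_measurable unfolding kernel_eq_solution_def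
    by (subst (asm) borel_measurable_restrict_space_iff) auto
  moreover have "(\<lambda>x. indicator (time_triangle T) x *\<^sub>R (case x of (t, s) \<Rightarrow> h t s)) = (\<lambda>x. k (fst x) (snd x))"
    by (auto simp: k_def)
  ultimately have km: "(\<lambda>x. k (fst x) (snd x)) \<in> borel_measurable (borel \<Otimes>\<^sub>M borel)" by (simp add: borel_prod)
  have ks [measurable]: "k t \<in> borel_measurable borel" for t
    using measurable_Pair2[OF km, of t] by simp
  obtain b1 where b1: "\<forall>x\<in>time_triangle T. norm (case x of (t, s) \<Rightarrow> h t s) \<le> b1"
    using sol unfolding kernel_eq_solution_def bounded_iff by blast
  obtain b2 where b2: "0 \<le> b2" "\<And>t s. \<bar>R.H t s\<bar> \<le> b2" using R.H_bounded by blast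
  define b where "b = max \<bar>b1\<bar> b2"
  have b0: "0 \<le> b" by (simp add: b_def)
  have kb: "\<bar>k t s\<bar> \<le> b" for t s
    using b1[rule_format, of "(t, s)"] by (auto simp: k_def b_def split: split_indicator)
  have Hb: "\<bar>R.H t s\<bar> \<le> b" for t s using b2(2)[of t s] by (simp add: b_def)
  have keq: "k t s = process_cov M X t s - (LBINT r:{0..s}. (a r)\<^sup>2 * (k t r * k s r))"
    if ts: "0 \<le> s" "s \<le> t" "t \<le> T" for t s
  proof -
    have "h t s = process_cov M X t s - (LBINT r:{0..s}. (G r)\<^sup>2 / (D r)\<^sup>2 * h t r * h s r)"
      using sol ts unfolding kernel_eq_solution_def time_triangle_def by auto
    also have "(LBINT r:{0..s}. (G r)\<^sup>2 / (D r)\<^sup>2 * h t r * h s r) = (LBINT r:{0..s}. (a r)\<^sup>2 * (k t r * k s r))"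
      by (rule set_lebesgue_integral_cong) (use ts a_sq k in auto)
    finally show ?thesis using k[OF ts] by simp
  qed
  have Heq: "R.H t s = process_cov M X t s - (LBINT r:{0..s}. (a r)\<^sup>2 * (R.H t r * R.H s r))"
    if ts: "0 \<le> s" "s \<le> t" "t \<le> T" for t s
  proof -
    have "(LBINT r:{0..s}. (G r)\<^sup>2 / (D r)\<^sup>2 * R.H t r * R.H s r) = (LBINT r:{0..s}. (a r)\<^sup>2 * (R.H t r * R.H s r))"
      by (rule set_lebesgue_integral_cong) (use ts a_sq in auto)
    then show ?thesis using H_kernel_eq_LBINT[OF ts] by simp
  qed
  note am [measurable] = R.a_meas
  have a2: "(a r)\<^sup>2 \<le> ca\<^sup>2" for r using power_mono[OF R.a_bound[of r] abs_ge_zero, of 2] by simp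
  have prod: "\<bar>x * y\<bar> \<le> b * b" if "\<bar>x\<bar> \<le> b" "\<bar>y\<bar> \<le> b" for x y :: real
    using that b0 by (simp add: abs_mult mult_mono)
  have gen: "\<bar>x * y + z * w\<bar> \<le> \<bar>x\<bar> * b + b * \<bar>w\<bar>" if "\<bar>y\<bar> \<le> b" "\<bar>z\<bar> \<le> b" for x y z w :: real
  proof -
    have "\<bar>x * y + z * w\<bar> \<le> \<bar>x\<bar> * \<bar>y\<bar> + \<bar>z\<bar> * \<bar>w\<bar>" using abs_triangle_ineq[of "x * y" "z * w"] by (simp add: abs_mult)
    also have "\<dots> \<le> \<bar>x\<bar> * b + b * \<bar>w\<bar>" using that by (intro add_mono mult_left_mono mult_right_mono) auto
    finally show ?thesis .
  qed
  have i1: "set_integrable lborel {0..s} (\<lambda>r. (a r)\<^sup>2 * (f t r * f s r))"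
    if "\<And>t. f t \<in> borel_measurable borel" "\<And>t s. \<bar>f t s\<bar> \<le> b" for f :: "real \<Rightarrow> real \<Rightarrow> real" and t s
  proof (rule set_integrable_bounded[where B="ca\<^sup>2 * (b * b)"])
    show "\<bar>(a r)\<^sup>2 * (f t r * f s r)\<bar> \<le> ca\<^sup>2 * (b * b)" for r
      using a2[of r] prod[OF that(2,2)] b0 by (simp add: abs_mult mult_mono)
  qed (use that in measurable)
  have wi: "set_integrable lborel {0..s} (\<lambda>r. \<bar>k t r - R.H t r\<bar>)" for t s
  proof (rule set_integrable_bounded[where B="b + b"])
    show "\<bar>\<bar>k t r - R.H t r\<bar>\<bar> \<le> b + b" for r
      unfolding abs_abs by (rule order_trans[OF abs_triangle_ineq4 add_mono[OF kb Hb]])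
  qed measurable
  have "\<bar>k t s - R.H t s\<bar> = 0"
  proof (rule triangle_gronwall[where w="\<lambda>t s. \<bar>k t s - R.H t s\<bar>" and a=0 and b=T and B="b + b" and c="ca\<^sup>2 * b"])
    show "0 \<le> ca\<^sup>2 * b" using b0 by simp
    show "\<bar>k t s - R.H t s\<bar> \<le> b + b" for t s by (rule order_trans[OF abs_triangle_ineq4 add_mono[OF kb Hb]])
    fix t s :: real assume ts: "0 \<le> s" "s \<le> t" "t \<le> T"
    have "k t s - R.H t s = (LBINT r:{0..s}. (a r)\<^sup>2 * (R.H t r * R.H s r)) - (LBINT r:{0..s}. (a r)\<^sup>2 * (k t r * k s r))"
      using keq[OF ts] Heq[OF ts] by simp
    also have "\<dots> = (LBINT r:{0..s}. (a r)\<^sup>2 * (R.H t r * R.H s r) - (a r)\<^sup>2 * (k t r * k s r))"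
      by (rule set_integral_diff(2)[symmetric, OF i1 i1]) (use Hb kb in auto)
    finally have "\<bar>k t s - R.H t s\<bar> \<le> (LBINT r:{0..s}. \<bar>(a r)\<^sup>2 * (R.H t r * R.H s r) - (a r)\<^sup>2 * (k t r * k s r)\<bar>)"
      using set_integral_abs_le by simp
    also have "\<dots> \<le> (LBINT r:{0..s}. ca\<^sup>2 * b * (\<bar>k t r - R.H t r\<bar> + \<bar>k s r - R.H s r\<bar>))"
    proof (rule set_integral_mono)
      show "set_integrable lborel {0..s} (\<lambda>r. \<bar>(a r)\<^sup>2 * (R.H t r * R.H s r) - (a r)\<^sup>2 * (k t r * k s r)\<bar>)"
        by (intro set_integrable_abs set_integral_diff(1) i1) (use Hb kb in auto)
      show "set_integrable lborel {0..s} (\<lambda>r. ca\<^sup>2 * b * (\<bar>k t r - R.H t r\<bar> + \<bar>k s r - R.H s r\<bar>))"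
        by (intro set_integrable_mult_right set_integral_add(1) wi)
      fix r
      have "(a r)\<^sup>2 * (R.H t r * R.H s r) - (a r)\<^sup>2 * (k t r * k s r)
          = (a r)\<^sup>2 * ((R.H t r - k t r) * R.H s r + k t r * (R.H s r - k s r))" by (simp add: algebra_simps)
      then have "\<bar>(a r)\<^sup>2 * (R.H t r * R.H s r) - (a r)\<^sup>2 * (k t r * k s r)\<bar> = (a r)\<^sup>2 * \<bar>(R.H t r - k t r) * R.H s r + k t r * (R.H s r - k s r)\<bar>" by (simp add: abs_mult)
      also have "\<dots> \<le> ca\<^sup>2 * (\<bar>k t r - R.H t r\<bar> * b + b * \<bar>k s r - R.H s r\<bar>)"
      proof (rule mult_mono[OF a2])
        show "\<bar>(R.H t r - k t r) * R.H s r + k t r * (R.H s r - k s r)\<bar> \<le> \<bar>k t r - R.H t r\<bar> * b + b * \<bar>k s r - R.H s r\<bar>"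
          using gen[OF Hb[of s r] kb[of t r], of "R.H t r - k t r" "R.H s r - k s r"]
          unfolding abs_minus_commute[of "R.H t r" "k t r"] abs_minus_commute[of "R.H s r" "k s r"] .
      qed (rule zero_le_power2, rule abs_ge_zero)
      also have "\<dots> = ca\<^sup>2 * b * (\<bar>k t r - R.H t r\<bar> + \<bar>k s r - R.H s r\<bar>)" by (simp only: distrib_left mult_ac)
      finally show "\<bar>(a r)\<^sup>2 * (R.H t r * R.H s r) - (a r)\<^sup>2 * (k t r * k s r)\<bar> \<le> ca\<^sup>2 * b * (\<bar>k t r - R.H t r\<bar> + \<bar>k s r - R.H s r\<bar>)" .
    qed
    finally show "\<bar>k t s - R.H t s\<bar> \<le> ca\<^sup>2 * b * (LBINT r:{0..s}. \<bar>k t r - R.H t r\<bar> + \<bar>k s r - R.H s r\<bar>)"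
      by (simp only: set_integral_mult_right)
  qed (use wi st in auto)
  then show ?thesis using k[OF st] by simp
qed

section \<open>Resolvent formulas for the observation weight and the mean\<close>

lemma wgt_measurable: "(\<lambda>x. R.wgt (fst x) (snd x)) \<in> borel_measurable (borel \<Otimes>\<^sub>M borel)"
proof -
  note [measurable] = R.a_meas R.H_measurable
  have "(\<lambda>x. R.wgt (fst x) (snd x)) = (\<lambda>x. if snd x \<le> fst x then (a (snd x))\<^sup>2 * R.H (fst x) (snd x) else 0)"
    by (auto simp: R.wgt_def)
  then show ?thesis by simp
qed

definition cw :: real where "cw = (SOME c. \<forall>t s. \<bar>R.wgt t s\<bar> \<le> c)"

sublocale V: volterra_kernel T cw R.wgt
proof
  obtain b where b: "0 \<le> b" "\<And>t s. \<bar>R.H t s\<bar> \<le> b" using R.H_bounded by blast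
  have "\<bar>R.wgt t s\<bar> \<le> ca\<^sup>2 * b" for t s
    using power_mono[OF R.a_bound[of s] abs_ge_zero, of 2] b
    by (auto simp: R.wgt_def abs_mult intro!: mult_mono split: split_indicator)
  then have "\<exists>c. \<forall>t s. \<bar>R.wgt t s\<bar> \<le> c" by blast
  from someI_ex[OF this] show "\<bar>R.wgt t s\<bar> \<le> cw" for t s unfolding cw_def by blast
qed (rule wgt_measurable)

abbreviation gain :: "real \<Rightarrow> real \<Rightarrow> real" where "gain t u \<equiv> indicator {..t} u * (a u * R.H t u)"

lemma wgt_gain: "R.wgt t u = a u * gain t u" by (simp add: R.wgt_def power2_eq_square)

lemma wgt_supp: "s \<notin> {0..t} \<Longrightarrow> R.wgt t s = 0"
  using R.a_supp[of s] T_pos by (auto simp: R.wgt_def split: split_indicator)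

lemma gain_supp: "s \<notin> {0..t} \<Longrightarrow> gain t s = 0"
  using R.a_supp[of s] T_pos by (auto split: split_indicator)

lemma wgt_phi:
  assumes "t \<in> {0..T}" shows "(LBINT s. R.wgt t s * R.phi s u) = gain t u - R.phi t u"
proof (cases "u \<in> {0..t}")
  case True
  then show ?thesis using R.phi_volterra[of u t] assms by simp
next
  case False
  then have "R.wgt t s * R.phi s u = 0" for s
    using wgt_supp[of s t] R.phi_supp[of u s] by (cases "s \<in> {0..t}") auto
  then have "(LBINT s. R.wgt t s * R.phi s u) = 0" by (simp only: Bochner_Integration.integral_zero)
  then show ?thesis using gain_supp[OF False] R.phi_supp[OF False] by (simp only: diff_zero)
qed

text \<open>The Volterra equation for \<open>phi\<close>, integrated against an arbitrary weight
  \<open>w\<close> in its second argument.\<close>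

lemma wgt_phi_swap:
  assumes t: "t \<in> {0..T}" and w: "bounded_supp T w"
  shows "(LBINT s. R.wgt t s * (LBINT u. w u * R.phi s u)) = (LBINT u. w u * gain t u) - (LBINT u. w u * R.phi t u)"
proof -
  obtain b where b: "\<And>t s. \<bar>R.phi t s\<bar> \<le> b" using R.phi_bounded by blast
  have "(LBINT s. R.wgt t s * (LBINT u. w u * R.phi s u)) = (LBINT u. w u * (LBINT s. R.wgt t s * R.phi s u))"
    by (rule Fubini_bounded_supp_mult[OF R.phi_measurable b w R.wgt_bs, symmetric])
  also have "\<dots> = (LBINT u. w u * gain t u - w u * R.phi t u)"
    by (simp only: wgt_phi[OF t] right_diff_distrib)
  also have "\<dots> = (LBINT u. w u * gain t u) - (LBINT u. w u * R.phi t u)"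
    by (intro Bochner_Integration.integral_diff bounded_supp_integrable[OF bounded_supp_mult2[OF w R.aH_bs]]
        bounded_supp_integrable[OF bounded_supp_mult2[OF w R.phi_bs]])
  finally show ?thesis .
qed

text \<open>The support of \<open>wgt t\<close> supplies the limits \<open>0\<close> and
  \<open>t\<close>; a positive lower limit \<open>u\<close> has to come from
  \<open>x\<close>.\<close>

lemma wgt_set_integral:
  assumes u: "\<And>s. s < u \<Longrightarrow> x s = 0 \<or> u \<le> 0"
  shows "(LBINT s:{u..t}. R.wgt t s * x s) = (LBINT s. R.wgt t s * x s)"
  unfolding set_lebesgue_integral_def
proof (intro Bochner_Integration.integral_cong refl)
  fix s show "indicator {u..t} s *\<^sub>R (R.wgt t s * x s) = R.wgt t s * x s"
    using wgt_supp[of s t] u[of s] by (auto split: split_indicator)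
qed

text \<open>For fixed \<open>u\<close> the function \<open>phi t u * Di u\<close> of
  \<open>t\<close> solves the Volterra equation with right-hand side \<open>B(t, u)\<close>. The
  resolvent formula then reads: the weight of \<open>dY(u)\<close> in the linear estimate is
  \<open>L\<^sub>H\<close>.\<close>

lemma gain_resolvent:
  assumes "0 \<le> u" "u \<le> t" "t \<le> T"
  shows "R.phi t u * Di u = a u * Di u * R.H t u + (LBINT s:{u..t}. resolvent R.wgt t s * (a u * Di u * R.H s u))"
proof -
  obtain b where b: "\<And>t s. \<bar>R.phi t s\<bar> \<le> b" using R.phi_bounded by blast
  obtain c where c: "\<And>t s. \<bar>R.H t s\<bar> \<le> c" using R.H_bounded by blast
  show ?thesis
  proof (rule V.volterra_resolvent[OF assms(1), where By="b * \<bar>Di u\<bar>" and B="\<bar>a u * Di u\<bar> * c"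
        and y="\<lambda>t. R.phi t u * Di u" and b="\<lambda>t. a u * Di u * R.H t u"])
    fix t assume t: "t \<in> {u..T}"
    show "R.phi t u * Di u = a u * Di u * R.H t u - (LBINT s:{u..t}. R.wgt t s * (R.phi s u * Di u))"
    proof -
      have "(LBINT s:{u..t}. R.wgt t s * (R.phi s u * Di u)) = (LBINT s. R.wgt t s * R.phi s u * Di u)"
        using wgt_set_integral[of u "\<lambda>s. R.phi s u * Di u" t] R.phi_supp[of u] by (simp add: mult.assoc)
      also have "\<dots> = (gain t u - R.phi t u) * Di u"
        using wgt_phi[of t u] t assms by simp
      finally show ?thesis using t by (simp add: algebra_simps)
    qed
  qed (use assms b c R.phi_sec R.H_sec in \<open>auto simp: abs_mult intro: mult_right_mono mult_left_mono\<close>)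
qed

text \<open>The left-hand side is the constant left when the estimate is written with the
  observation itself instead of the centred one. Weighting the Volterra equation for
  \<open>phi\<close> with \<open>a * mz\<close> shows that it solves the equation with right-hand
  side \<open>mz\<close>.\<close>

lemma mean_resolvent:
  assumes t: "t \<in> {0..T}"
  shows "mz t - (LBINT s. a s * mz s * R.phi t s) = mz t + (LBINT s:{0..t}. resolvent R.wgt t s * mz s)"
proof -
  obtain b where b: "0 \<le> b" "\<And>t s. \<bar>R.phi t s\<bar> \<le> b" using R.phi_bounded by blast
  obtain bm where bm: "0 \<le> bm" "\<And>t. \<bar>mz t\<bar> \<le> bm" by (rule bounded_suppE[OF mean_bounded_supp]) blast
  have w: "bounded_supp T (\<lambda>s. a s * mz s)" by (rule bounded_supp_mult2[OF a_bs mean_bounded_supp])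
  have xb: "\<bar>a s * mz s * R.phi t s\<bar> \<le> ca * bm * b" for t s
    unfolding abs_mult using R.a_bound R.ca0 bm b by (intro mult_mono mult_nonneg_nonneg) auto
  note [measurable] = bounded_supp_measurable[OF mean_bounded_supp] R.a_meas
  show ?thesis
  proof (rule V.volterra_resolvent[where u=0 and By="bm + ca * bm * b * T" and B=bm
        and y="\<lambda>t. mz t - (LBINT s. a s * mz s * R.phi t s)"])
    show "(\<lambda>t. mz t - (LBINT s. a s * mz s * R.phi t s)) \<in> borel_measurable borel" by measurable
    show "\<bar>mz t - (LBINT s. a s * mz s * R.phi t s)\<bar> \<le> bm + ca * bm * b * T" for t
      using T_pos by (intro order_trans[OF abs_triangle_ineq4] add_mono bm integral_abs_le_bounded_supp xb bounded_supp_mult2[OF w R.phi_bs]) simp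
    fix t assume t: "t \<in> {0..T}"
    have i1: "integrable lborel (\<lambda>s. R.wgt t s * mz s)"
      by (rule bounded_supp_integrable[OF bounded_supp_mult2[OF R.wgt_bs mean_bounded_supp]])
    have "bounded_supp T (\<lambda>s. R.wgt t s * (LBINT u. a u * mz u * R.phi s u))"
    proof (rule bounded_supp_mult(2)[OF R.wgt_bs])
      show "\<bar>(LBINT u. a u * mz u * R.phi s u)\<bar> \<le> ca * bm * b * T" for s
        using T_pos by (intro integral_abs_le_bounded_supp xb bounded_supp_mult2[OF w R.phi_bs]) simp
    qed measurable
    then have i2: "integrable lborel (\<lambda>s. R.wgt t s * (LBINT u. a u * mz u * R.phi s u))"
      by (rule bounded_supp_integrable)
    have "(LBINT s:{0..t}. R.wgt t s * (mz s - (LBINT u. a u * mz u * R.phi s u)))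
        = (LBINT s. R.wgt t s * mz s - R.wgt t s * (LBINT u. a u * mz u * R.phi s u))"
      by (subst wgt_set_integral) (simp_all add: right_diff_distrib)
    also have "\<dots> = (LBINT s. R.wgt t s * mz s) - (LBINT s. R.wgt t s * (LBINT u. a u * mz u * R.phi s u))"
      by (rule Bochner_Integration.integral_diff[OF i1 i2])
    also have "(LBINT s. R.wgt t s * (LBINT u. a u * mz u * R.phi s u))
        = (LBINT u. a u * mz u * gain t u) - (LBINT u. a u * mz u * R.phi t u)"
      by (rule wgt_phi_swap[OF t w])
    also have "(LBINT u. a u * mz u * gain t u) = (LBINT s. R.wgt t s * mz s)"
      unfolding wgt_gain by (intro Bochner_Integration.integral_cong refl) (simp only: mult_ac)
    finally show "mz t - (LBINT s. a s * mz s * R.phi t s)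
        = mz t - (LBINT s:{0..t}. R.wgt t s * (mz s - (LBINT s'. a s' * mz s' * R.phi s s')))" by simp
  qed (use t bm in auto)
qed

lemma obs_rel_exists:
  assumes f: "bounded_supp T f" obtains V where "obs_rel f V"
proof -
  obtain b where b: "\<And>s. \<bar>f s\<bar> \<le> b" by (rule bounded_suppE[OF f]) blast
  have "(\<lambda>x. f (snd x)) \<in> borel_measurable (borel \<Otimes>\<^sub>M borel)" using bounded_supp_measurable[OF f] by measurable
  then obtain Z :: "real \<Rightarrow> 'a \<Rightarrow> real" where Z: "\<And>s. W2.wiener_rel (\<lambda>u. indicator {0..T} u * f u) (Z s)"
    by (rule W2.measurable_wiener_version[OF T_pos, where l="\<lambda>_. f" and B=b]) (use b in auto)
  have "(\<lambda>u. indicator {0..T} u * f u) = f" using bounded_supp_zero[OF f] by (auto split: split_indicator)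
  then have N: "W2.wiener_rel f (Z 0)" using Z by simp
  note [measurable] = L2_measurable[OF drift_L2[OF f]] L2_measurable[OF W2.wiener_rel_L2(2)[OF N]]
  have "obs_rel f (\<lambda>w. (LBINT s. a s * f s * Xc s w) + Z 0 w)"
    unfolding obs_rel_def using f N by (intro conjI exI[of _ "Z 0"]) auto
  then show ?thesis by (rule that)
qed

lemma covop_bs: assumes g: "bounded_supp T g" shows "bounded_supp T (covop g)"
proof -
  note [measurable] = bounded_supp_measurable[OF g] R.a_meas K0_measurable
  obtain b where b: "\<And>s. \<bar>a s * g s\<bar> \<le> b" by (rule bounded_suppE[OF af_bs[OF g]]) blast
  have "bounded_supp T (\<lambda>s. a s * (LBINT r. K0 s r * (a r * g r)))"
  proof (rule bounded_supp_mult(2)[OF a_bs])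
    have "(\<lambda>x. K0 (fst x) (snd x) * (a (snd x) * g (snd x))) \<in> borel_measurable (borel \<Otimes>\<^sub>M lborel)"
      by (simp cong: measurable_cong_sets sets_pair_measure_cong)
    then show "(\<lambda>s. (LBINT r. K0 s r * (a r * g r))) \<in> borel_measurable borel"
      by (intro lborel.borel_measurable_lebesgue_integral) (simp add: case_prod_beta')
    have "\<bar>K0 s r * (a r * g r)\<bar> \<le> cK * b" for s r
      unfolding abs_mult[of "K0 s r"] using R.K_bound[of s r] b[of r] R.cK0 by (intro mult_mono) auto
    moreover have "bounded_supp T (\<lambda>r. K0 s r * (a r * g r))" for s
      using R.bounded_supp_K[OF af_bs[OF g], of s] by (simp only: mult.commute)
    ultimately show "\<bar>(LBINT r. K0 s r * (a r * g r))\<bar> \<le> cK * b * T" for s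
      using T_pos by (intro integral_abs_le_bounded_supp) auto
  qed
  then show ?thesis unfolding covop_def[abs_def] by (rule bounded_supp_add[OF g])
qed

section \<open>The innovation representation\<close>

definition errz :: "real \<Rightarrow> 'a \<Rightarrow> real" where "errz s w = indicator {0..T} s * err s w"

definition est0z :: "real \<Rightarrow> 'a \<Rightarrow> real" where "est0z s w = indicator {0..T} s * est0 s w"

lemma est0z_eq: "est0z s w = Xc s w - errz s w"
  using Xc_supp[of s w] by (auto simp: est0z_def errz_def err_def split: split_indicator)

text \<open>The estimate is the signal minus the error, and the second moment of the error is
  \<open>R.H s s\<close>, which is bounded.\<close>

lemma est0z_L2: "(\<lambda>x. est0z (fst x) (snd x)) \<in> L2 (lborel \<Otimes>\<^sub>M M)"
proof -
  obtain b where b: "0 \<le> b" "\<And>t s. \<bar>R.H t s\<bar> \<le> b" using R.H_bounded by blast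
  have "(\<lambda>x. errz (fst x) (snd x)) \<in> L2 (lborel \<Otimes>\<^sub>M M)"
  proof (rule process_L2)
    show "(\<lambda>x. errz (fst x) (snd x)) \<in> borel_measurable (borel \<Otimes>\<^sub>M M)"
      unfolding errz_def err_def by measurable
    show "errz s \<in> L2 M" for s unfolding errz_def[abs_def] by (rule L2_scale[OF err_L2])
    show "(LINT w|M. (errz s w)\<^sup>2) \<le> b" for s
      using err_sq[of s] b(1) b(2)[of s s] by (cases "s \<in> {0..T}") (simp_all add: errz_def)
    show "errz s w = 0" if "s \<notin> {0..T}" for s w using that by (simp add: errz_def)
  qed
  from L2_diff[OF Xc_L2 this] show ?thesis by (simp add: est0z_eq)
qed

text \<open>Innovation representation: both sides have the same inner product with every integral against
  the observation, and each of them is a limit of such integrals.\<close>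

lemma est0_innovation:
  assumes t: "t \<in> {0..T}" and U: "obs_rel (gain t) U"
  shows "AE w in M. est0 t w = U w - (LBINT s. R.wgt t s * est0z s w)"
proof -
  define P where "P w = (LBINT s. R.wgt t s * est0z s w)" for w
  note PI = process_integral(2,5)[OF est0z_L2 bounded_supp_L2[OF R.wgt_bs[of t]], folded P_def]
  define \<Delta> where "\<Delta> w = (est0 t w - U w) + P w" for w
  note UL = obs_rel_L2[OF U]
  have \<Delta>L: "\<Delta> \<in> L2 M" unfolding \<Delta>_def[abs_def] by (intro L2_add L2_diff est0_L2 UL PI(1))
  have P\<psi>: "(LINT w|M. P w * \<psi> w) = (LBINT s. R.wgt t s * (LINT w|M. est0 s w * \<psi> w))" if "\<psi> \<in> L2 M" for \<psi>
    unfolding PI(2)[OF that]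
  proof (intro Bochner_Integration.integral_cong refl)
    fix s show "R.wgt t s * (LINT w|M. est0z s w * \<psi> w) = R.wgt t s * (LINT w|M. est0 s w * \<psi> w)"
      using bounded_supp_zero[OF R.wgt_bs[of t], of s] by (cases "s \<in> {0..T}") (simp_all add: est0z_def)
  qed
  have orth: "(LINT w|M. \<Delta> w * V w) = 0" if V: "obs_rel g V" for g V
  proof -
    note VL = obs_rel_L2[OF V]
    have g: "bounded_supp T g" by (rule obs_relE[OF V]) blast
    \<comment> \<open>The covariance of \<open>est0 s\<close> with \<open>V\<close> is the integral
      of \<open>covop g * phi s\<close>, so the Volterra equation for \<open>phi\<close> with weight
      \<open>covop g\<close> evaluates the time integral.\<close>
    have "(LINT w|M. P w * V w) = (LBINT s. R.wgt t s * (LBINT u. covop g u * R.phi s u))"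
      unfolding P\<psi>[OF VL] obs_rel_cov[OF est0_rel V] by (simp only: mult.commute)
    also have "\<dots> = (LBINT u. covop g u * gain t u) - (LBINT u. covop g u * R.phi t u)"
      by (rule wgt_phi_swap[OF t covop_bs[OF g]])
    also have "\<dots> = (LINT w|M. U w * V w) - (LINT w|M. est0 t w * V w)"
      unfolding obs_rel_cov[OF U V] obs_rel_cov[OF est0_rel V] by (simp only: mult.commute)
    finally have PV: "(LINT w|M. P w * V w) = (LINT w|M. U w * V w) - (LINT w|M. est0 t w * V w)" .
    have "(LINT w|M. \<Delta> w * V w) = (LINT w|M. (est0 t w * V w - U w * V w) + P w * V w)"
      by (intro Bochner_Integration.integral_cong refl) (simp add: \<Delta>_def algebra_simps)
    also have "\<dots> = ((LINT w|M. est0 t w * V w) - (LINT w|M. U w * V w)) + (LINT w|M. P w * V w)"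
      using L2_mult_integrable[OF est0_L2 VL] L2_mult_integrable[OF UL VL] L2_mult_integrable[OF PI(1) VL] by simp
    finally show ?thesis using PV by simp
  qed
  \<comment> \<open>\<open>P\<close> is not itself of the form \<open>obs_rel\<close>, but a time
    integral of such variables, to each of which \<open>\<Delta>\<close> is orthogonal; with the
    other two summands this makes \<open>\<Delta>\<close> orthogonal to itself.\<close>
  have "(LINT w|M. P w * \<Delta> w) = (LBINT s. R.wgt t s * (LINT w|M. \<Delta> w * est0 s w))"
    unfolding P\<psi>[OF \<Delta>L] by (simp only: mult.commute)
  then have P0: "(LINT w|M. P w * \<Delta> w) = 0" by (simp add: orth[OF est0_rel])
  have "(LINT w|M. (\<Delta> w)\<^sup>2) = (LINT w|M. (\<Delta> w * est0 t w - \<Delta> w * U w) + P w * \<Delta> w)"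
    by (intro Bochner_Integration.integral_cong refl) (simp add: power2_eq_square \<Delta>_def algebra_simps)
  also have "\<dots> = ((LINT w|M. \<Delta> w * est0 t w) - (LINT w|M. \<Delta> w * U w)) + (LINT w|M. P w * \<Delta> w)"
    using L2_mult_integrable[OF \<Delta>L est0_L2] L2_mult_integrable[OF \<Delta>L UL] L2_mult_integrable[OF PI(1) \<Delta>L] by simp
  also have "\<dots> = 0" using orth[OF est0_rel] orth[OF U] P0 by simp
  finally have "AE w in M. \<Delta> w = 0" by (rule integral_sq_zero_AE[OF \<Delta>L])
  then show ?thesis by eventually_elim (simp add: \<Delta>_def P_def)
qed

section \<open>The filter equation\<close>

definition estz :: "real \<Rightarrow> 'a \<Rightarrow> real" where "estz s w = indicator {0..T} s * est s w"

lemma estz_split: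
  assumes h: "bounded_supp T h"
  shows "AE w in M. integrable lborel (\<lambda>s. h s * estz s w) \<and>
    (LBINT s. h s * estz s w) = (LBINT s. h s * est0z s w) + (LBINT s. h s * mz s)"
  using process_integral(1)[OF est0z_L2 bounded_supp_L2[OF h]]
proof eventually_elim
  fix w assume i: "integrable lborel (\<lambda>s. h s * est0z s w)"
  have m: "integrable lborel (\<lambda>s. h s * mz s)"
    by (rule bounded_supp_integrable[OF bounded_supp_mult2[OF h mean_bounded_supp]])
  have e: "(\<lambda>s. h s * estz s w) = (\<lambda>s. h s * est0z s w + h s * mz s)"
    using bounded_supp_zero[OF mean_bounded_supp]
    by (auto simp: estz_def est_def est0z_def algebra_simps split: split_indicator)
  show "integrable lborel (\<lambda>s. h s * estz s w) \<and>
    (LBINT s. h s * estz s w) = (LBINT s. h s * est0z s w) + (LBINT s. h s * mz s)"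
    unfolding e using Bochner_Integration.integrable_add[OF i m] Bochner_Integration.integral_add[OF i m] by blast
qed

lemma est_measurable [measurable (raw)]:
  assumes "f \<in> measurable N borel" "g \<in> measurable N M" shows "(\<lambda>x. est (f x) (g x)) \<in> borel_measurable N"
  unfolding est_def
  using est0_compose[OF assms] measurable_compose[OF assms(1) bounded_supp_measurable[OF mean_bounded_supp]] by measurable

text \<open>The kernel of the statement is formed from a given best estimate and is compared with
  \<open>R.H\<close> only for times in the interval; hence the lemmas allow any \<open>h\<close>
  that agrees with \<open>R.H\<close> on the triangle.\<close>

context
  fixes h :: "real \<Rightarrow> real \<Rightarrow> real"
  assumes h: "\<And>t s. 0 \<le> s \<Longrightarrow> s \<le> t \<Longrightarrow> t \<le> T \<Longrightarrow> h t s = R.H t s"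
begin

abbreviation gh :: "real \<Rightarrow> real \<Rightarrow> real" where "gh t s \<equiv> G s / (D s)\<^sup>2 * h t s"

lemma gain_gh: "t \<in> {0..T} \<Longrightarrow> gain t s = indicator {0..t} s * (gh t s * Dt s)"
  using gain_supp[of s t] D_nonzero[of s] h[of s t]
  by (cases "s \<in> {0..t}") (auto simp: a_def Gt_def Di_def Dt_def power2_eq_square)

lemma correction_eq:
  assumes t: "t \<in> {0..T}"
  shows "(LBINT s:{0..t}. gh t s * (G s * Z s w)) = (LBINT s. R.wgt t s * (indicator {0..T} s * Z s w))"
  unfolding set_lebesgue_integral_def
proof (intro Bochner_Integration.integral_cong refl)
  fix s show "indicator {0..t} s *\<^sub>R (gh t s * (G s * Z s w)) = R.wgt t s * (indicator {0..T} s * Z s w)"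
    using wgt_supp[of s t] D_nonzero[of s] h[of s t] t
    by (cases "s \<in> {0..t}") (auto simp: R.wgt_def a_def Gt_def Di_def power2_eq_square)
qed

lemma wgt_integral_mean: "(LBINT s. a s * gain t s * mz s) = (LBINT s. R.wgt t s * mz s)"
  by (simp only: wgt_gain)

lemma filter_eq_solutionI:
  assumes Z: "measurable_process M T Z" and eq: "\<And>t. t \<in> {0..T} \<Longrightarrow> AE w in M. Z t w = est t w"
  shows "filter_eq_solution M T G D X B\<^sub>2 Yt (process_mean M X) h Z"
  unfolding filter_eq_solution_def
proof (intro conjI ballI)
  define Zb where "Zb s w = indicator {0..T} s * Z s w" for s w
  have Zb [measurable]: "(\<lambda>x. Zb (fst x) (snd x)) \<in> borel_measurable (borel \<Otimes>\<^sub>M M)"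
    unfolding Zb_def using T_pos by (intro measurable_process_extension Z) simp
  have ZM: "Z t \<in> borel_measurable M" if "t \<in> {0..T}" for t
    using measurable_Pair2[OF Zb, of t] that by (simp add: Zb_def)
  \<comment> \<open>Equality at each time outside a null set becomes, for almost every path,
    equality at almost every time, which suffices inside the integrals.\<close>
  have ae: "AE w in M. AE s in lborel. Zb s w = estz s w"
  proof (rule AE_process_commute)
    show "Measurable.pred (borel \<Otimes>\<^sub>M M) (\<lambda>x. Zb (fst x) (snd x) = estz (fst x) (snd x))"
      unfolding estz_def by measurable
    show "AE w in M. Zb t w = estz t w" for t
    proof (cases "t \<in> {0..T}")
      case True
      from eq[OF this] show ?thesis by eventually_elim (simp add: Zb_def estz_def)
    qed (simp add: Zb_def estz_def)
  qed
  have sec: "(\<lambda>s. Zb s w) \<in> borel_measurable borel" "(\<lambda>s. estz s w) \<in> borel_measurable borel" if "w \<in> space M" for w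
    using measurable_Pair1[OF Zb that] that unfolding estz_def by (simp_all add: est_measurable)
  show "measurable_process M T Z" by (rule Z)
  show "AE w in M. set_integrable lborel {0..T} (\<lambda>s. G s * Z s w)"
    using ae estz_split[OF Gt_bs] AE_space
  proof eventually_elim
    fix w assume ae: "AE s in lborel. Zb s w = estz s w" and w: "w \<in> space M"
      and i: "integrable lborel (\<lambda>s. Gt s * estz s w) \<and>
        (LBINT s. Gt s * estz s w) = (LBINT s. Gt s * est0z s w) + (LBINT s. Gt s * mz s)"
    note [measurable] = sec[OF w] bounded_supp_measurable[OF Gt_bs]
    have "integrable lborel (\<lambda>s. Gt s * Zb s w)"
      by (rule integrable_cong_AE[THEN iffD1, OF _ _ _ conjunct1[OF i]]) (use ae in \<open>auto elim: eventually_mono\<close>)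
    moreover have "indicator {0..T} s *\<^sub>R (G s * Z s w) = Gt s * Zb s w" for s
      by (simp add: Gt_def Zb_def split: split_indicator)
    ultimately show "set_integrable lborel {0..T} (\<lambda>s. G s * Z s w)" by (simp only: set_integrable_def)
  qed
  fix t assume t: "t \<in> {0..T}"
  have "est t \<in> borel_measurable (Yt t)" using est_adapted[OF t] by (simp add: L2_rv_def)
  then show "Z t \<in> borel_measurable (Yt t)" by (rule measurable_complete_subalgebra[OF Yt(1,2)[OF t] _ ZM[OF t] eq[OF t]])
  obtain U where U: "obs_rel (gain t) U" by (rule obs_rel_exists[OF R.aH_bs]) blast
  show "\<exists>J. has_obs_integral M G D X B\<^sub>2 t (\<lambda>s. gh t s) J \<and>
      (AE w in M. Z t w = process_mean M X t + (J w - (LBINT s:{0..t}. gh t s * (G s * Z s w))))"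
  proof (intro exI conjI)
    show "has_obs_integral M G D X B\<^sub>2 t (\<lambda>s. gh t s) (\<lambda>w. U w + (LBINT s. a s * gain t s * mz s))"
      by (rule rel_obs_integral[OF t gain_gh[OF t] U])
    show "AE w in M. Z t w = process_mean M X t + (U w + (LBINT s. a s * gain t s * mz s)
        - (LBINT s:{0..t}. gh t s * (G s * Z s w)))"
      using ae est0_innovation[OF t U] estz_split[OF R.wgt_bs[of t]] eq[OF t] AE_space
    proof eventually_elim
      fix w assume ae: "AE s in lborel. Zb s w = estz s w" and w: "w \<in> space M"
        and e0: "est0 t w = U w - (LBINT s. R.wgt t s * est0z s w)"
        and sp: "integrable lborel (\<lambda>s. R.wgt t s * estz s w) \<and>
          (LBINT s. R.wgt t s * estz s w) = (LBINT s. R.wgt t s * est0z s w) + (LBINT s. R.wgt t s * mz s)"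
        and Zt: "Z t w = est t w"
      note [measurable] = sec[OF w] bounded_supp_measurable[OF R.wgt_bs]
      have "(LBINT s. R.wgt t s * Zb s w) = (LBINT s. R.wgt t s * estz s w)"
        by (rule integral_cong_AE) (use ae in \<open>auto elim: eventually_mono\<close>)
      then show "Z t w = process_mean M X t + (U w + (LBINT s. a s * gain t s * mz s) - (LBINT s:{0..t}. gh t s * (G s * Z s w)))"
        unfolding correction_eq[OF t] wgt_integral_mean Zb_def[symmetric] using e0 sp Zt process_mean_eq[OF t] by (simp add: est_def)
    qed
  qed
qed

text \<open>The difference \<open>d\<close> from the estimate solves a homogeneous Volterra
  equation. As only \<open>G * Z\<close> is known to have integrable paths, the kernel is written as
  a bounded factor \<open>q\<close> times \<open>Gt\<close> and Gronwall is applied to the absolute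
  value of \<open>Gt * d\<close>.\<close>

lemma filter_eq_solutionD:
  assumes sol: "filter_eq_solution M T G D X B\<^sub>2 Yt (process_mean M X) h Z"
  shows "measurable_process M T Z" and "t \<in> {0..T} \<Longrightarrow> AE w in M. Z t w = est t w"
proof -
  show Z: "measurable_process M T Z" using sol by (simp add: filter_eq_solution_def)
  define Zb where "Zb s w = indicator {0..T} s * Z s w" for s w
  have Zb [measurable]: "(\<lambda>x. Zb (fst x) (snd x)) \<in> borel_measurable (borel \<Otimes>\<^sub>M M)"
    unfolding Zb_def using T_pos by (intro measurable_process_extension Z) simp
  have Zb_sec: "Zb t \<in> borel_measurable M" for t using measurable_Pair2[OF Zb, of t] by simp
  have Zb_int: "AE w in M. integrable lborel (\<lambda>s. Gt s * Zb s w)"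
  proof -
    have "indicator {0..T} s *\<^sub>R (G s * Z s w) = Gt s * Zb s w" for s w
      by (simp add: Gt_def Zb_def split: split_indicator)
    then show ?thesis using sol by (simp only: filter_eq_solution_def set_integrable_def)
  qed
  obtain bH where bH: "0 \<le> bH" "\<And>t s. \<bar>R.H t s\<bar> \<le> bH" using R.H_bounded by blast
  obtain bi where bi: "0 \<le> bi" "\<And>s. \<bar>Di s\<bar> \<le> bi" by (rule bounded_suppE[OF Di_bs]) blast
  obtain bG where bG: "0 \<le> bG" "\<And>s. \<bar>Gt s\<bar> \<le> bG" by (rule bounded_suppE[OF Gt_bs]) blast
  define q where "q t s = indicator {..t} s * (a s * Di s * R.H t s)" for t s
  define c where "c = ca * bi * bH"
  have c0: "0 \<le> c" using R.ca0 bi(1) bH(1) by (simp add: c_def)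
  have qb: "\<bar>q t s\<bar> \<le> c" for t s
    using mult_mono[OF mult_mono[OF R.a_bound[of s] bi(2)[of s]] bH(2)[of t s]] R.ca0 bi(1) c0
    by (auto simp: q_def c_def abs_mult split: split_indicator)
  have qm: "q t \<in> borel_measurable borel" for t
    using R.a_meas bounded_supp_measurable[OF Di_bs] unfolding q_def[abs_def] by measurable
  have wq: "R.wgt t s = q t s * Gt s" for t s by (simp add: R.wgt_def q_def a_def power2_eq_square)
  have wint: "integrable lborel (\<lambda>s. R.wgt t s * x s)" if "integrable lborel (\<lambda>s. Gt s * x s)" for t x
    using integrable_mult_bounded[OF that, of "q t" c] qm qb by (simp add: wq mult.assoc)
  define d where "d s w = Zb s w - estz s w" for s w
  have dm [measurable]: "(\<lambda>x. d (fst x) (snd x)) \<in> borel_measurable (borel \<Otimes>\<^sub>M M)"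
    unfolding d_def estz_def by measurable
  have Gd: "AE w in M. integrable lborel (\<lambda>s. Gt s * d s w)"
    using Zb_int estz_split[OF Gt_bs]
    by eventually_elim (simp add: d_def right_diff_distrib)
  have wm: "(\<lambda>x. (LBINT s. R.wgt (fst x) s * d s (snd x))) \<in> borel_measurable (borel \<Otimes>\<^sub>M M)"
    unfolding case_prod_beta'
  proof (intro lborel.borel_measurable_lebesgue_integral)
    have "(\<lambda>y. R.wgt (fst (fst y)) (snd y)) \<in> borel_measurable ((borel \<Otimes>\<^sub>M M) \<Otimes>\<^sub>M lborel)"
      using measurable_compose[OF measurable_Pair wgt_measurable, of "\<lambda>y. fst (fst y)" "(borel \<Otimes>\<^sub>M M) \<Otimes>\<^sub>M lborel" snd] by simp
    moreover have "(\<lambda>y. d (snd y) (snd (fst y))) \<in> borel_measurable ((borel \<Otimes>\<^sub>M M) \<Otimes>\<^sub>M lborel)"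
      using measurable_compose[OF measurable_Pair dm, of snd "(borel \<Otimes>\<^sub>M M) \<Otimes>\<^sub>M lborel" "\<lambda>y. snd (fst y)"] by simp
    ultimately show "(\<lambda>(x, s). R.wgt (fst x) s * d s (snd x)) \<in> borel_measurable ((borel \<Otimes>\<^sub>M M) \<Otimes>\<^sub>M lborel)"
      unfolding case_prod_beta' by (rule borel_measurable_times)
  qed
  have hom: "AE w in M. d t w = - (LBINT s. R.wgt t s * d s w)" if t: "t \<in> {0..T}" for t
  proof -
    obtain J where J: "has_obs_integral M G D X B\<^sub>2 t (\<lambda>s. gh t s) J"
      and Jeq: "AE w in M. Z t w = process_mean M X t + (J w - (LBINT s:{0..t}. gh t s * (G s * Z s w)))"
      using sol t unfolding filter_eq_solution_def by blast
    \<comment> \<open>The combination that the filter equation for \<open>Z\<close> identifies with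
      the centred observation integral of \<open>gain t\<close>. Applying
      \<open>est0_innovation\<close> to this same \<open>U\<close> eliminates the stochastic
      integral.\<close>
    define U where "U w = Zb t w - mz t + (LBINT s. R.wgt t s * Zb s w) - (LBINT s. R.wgt t s * mz s)" for w
    have "obs_rel (gain t) U"
    proof (rule obs_integral_rel[OF t R.aH_bs gain_gh[OF t] J])
      have "(\<lambda>x. R.wgt t (snd x) * Zb (snd x) (fst x)) \<in> borel_measurable (M \<Otimes>\<^sub>M lborel)"
        using measurable_compose[OF measurable_snd bounded_supp_measurable[OF R.wgt_bs[of t]], of M]
          measurable_compose[OF measurable_Pair Zb, of snd "M \<Otimes>\<^sub>M lborel" fst] by simp
      then have "(\<lambda>w. (LBINT s. R.wgt t s * Zb s w)) \<in> borel_measurable M"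
        by (intro lborel.borel_measurable_lebesgue_integral) (simp add: case_prod_beta')
      then show "U \<in> borel_measurable M" unfolding U_def[abs_def] using Zb_sec[of t] by simp
      show "AE w in M. U w = J w - (LBINT s. a s * gain t s * mz s)"
        using Jeq unfolding correction_eq[OF t] wgt_integral_mean Zb_def[symmetric]
        by eventually_elim (use t in \<open>simp add: U_def process_mean_eq, simp add: Zb_def\<close>)
    qed
    from est0_innovation[OF t this] estz_split[OF R.wgt_bs[of t]] Zb_int
    show ?thesis
    proof eventually_elim
      fix w assume e0: "est0 t w = U w - (LBINT s. R.wgt t s * est0z s w)"
        and sp: "integrable lborel (\<lambda>s. R.wgt t s * estz s w) \<and>
          (LBINT s. R.wgt t s * estz s w) = (LBINT s. R.wgt t s * est0z s w) + (LBINT s. R.wgt t s * mz s)"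
        and i: "integrable lborel (\<lambda>s. Gt s * Zb s w)"
      have "(LBINT s. R.wgt t s * d s w) = (LBINT s. R.wgt t s * Zb s w) - (LBINT s. R.wgt t s * estz s w)"
        unfolding d_def right_diff_distrib by (rule Bochner_Integration.integral_diff[OF wint[OF i] conjunct1[OF sp]])
      moreover have "estz t w = mz t + est0 t w" using t by (simp add: estz_def est_def)
      ultimately show "d t w = - (LBINT s. R.wgt t s * d s w)"
        using e0 sp by (simp add: d_def U_def)
    qed
  qed
  have "AE w in M. AE t in lborel. t \<in> {0..T} \<longrightarrow> d t w = - (LBINT s. R.wgt t s * d s w)"
  proof (rule AE_process_commute)
    show "Measurable.pred (borel \<Otimes>\<^sub>M M) (\<lambda>x. fst x \<in> {0..T} \<longrightarrow> d (fst x) (snd x) = - (LBINT s. R.wgt (fst x) s * d s (snd x)))"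
      using wm by measurable
    show "AE w in M. t \<in> {0..T} \<longrightarrow> d t w = - (LBINT s. R.wgt t s * d s w)" for t
      by (cases "t \<in> {0..T}") (use hom[of t] in auto)
  qed
  then have zero: "AE w in M. \<forall>t. (LBINT s. R.wgt t s * d s w) = 0"
    using Gd
  proof eventually_elim
    fix w assume ae: "AE t in lborel. t \<in> {0..T} \<longrightarrow> d t w = - (LBINT s. R.wgt t s * d s w)"
      and i: "integrable lborel (\<lambda>s. Gt s * d s w)"
    define u where "u s = \<bar>Gt s * d s w\<bar>" for s
    have ui: "integrable lborel u" unfolding u_def[abs_def] using i by simp
    have us: "set_integrable lborel A u" if "A \<in> sets borel" for A
      unfolding set_integrable_def using ui that by (intro integrable_mult_indicator) auto
    have "AE t in lborel. t \<in> {0..T} \<longrightarrow> u t \<le> bG * c * (LBINT s:{0..t}. u s)"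
      using ae
    proof eventually_elim
      fix t assume *: "t \<in> {0..T} \<longrightarrow> d t w = - (LBINT s. R.wgt t s * d s w)"
      show "t \<in> {0..T} \<longrightarrow> u t \<le> bG * c * (LBINT s:{0..t}. u s)"
      proof
        assume t: "t \<in> {0..T}"
        have "\<bar>d t w\<bar> \<le> (LBINT s. \<bar>R.wgt t s * d s w\<bar>)" using * t integral_abs_bound[of lborel "\<lambda>s. R.wgt t s * d s w"] by simp
        also have "\<dots> \<le> (LBINT s. c * (indicator {0..t} s *\<^sub>R u s))"
        proof (rule integral_mono)
          show "integrable lborel (\<lambda>s. \<bar>R.wgt t s * d s w\<bar>)" using wint[OF i] by simp
          show "integrable lborel (\<lambda>s. c * (indicator {0..t} s *\<^sub>R u s))"
            using us[of "{0..t}"] unfolding set_integrable_def by (intro integrable_mult_right) simp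
          show "\<bar>R.wgt t s * d s w\<bar> \<le> c * (indicator {0..t} s *\<^sub>R u s)" for s
            using wgt_supp[of s t] mult_right_mono[OF qb[of t s], of "u s"]
            by (cases "s \<in> {0..t}") (auto simp: wq u_def abs_mult mult.assoc)
        qed
        also have "\<dots> = c * (LBINT s:{0..t}. u s)" unfolding set_lebesgue_integral_def by (rule integral_mult_right_zero)
        finally have dle: "\<bar>d t w\<bar> \<le> c * (LBINT s:{0..t}. u s)" .
        have "u t = \<bar>Gt t\<bar> * \<bar>d t w\<bar>" by (simp add: u_def abs_mult)
        also have "\<dots> \<le> bG * (c * (LBINT s:{0..t}. u s))" by (rule mult_mono[OF bG(2) dle bG(1)]) simp
        finally show "u t \<le> bG * c * (LBINT s:{0..t}. u s)" by (simp only: mult.assoc)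
      qed
    qed
    from gronwall_AE(2)[OF _ _ us _ this] have "AE t in lborel. t \<in> {0..T} \<longrightarrow> u t = 0"
      using bG(1) c0 T_pos by (simp add: u_def)
    then have "AE s in lborel. Gt s * d s w = 0"
    proof eventually_elim
      fix s assume "s \<in> {0..T} \<longrightarrow> u s = 0"
      then show "Gt s * d s w = 0" using bounded_supp_zero[OF Gt_bs, of s] by (cases "s \<in> {0..T}") (auto simp: u_def)
    qed
    then have "AE s in lborel. R.wgt t s * d s w = 0" for t
      by eventually_elim (simp add: wq mult.assoc)
    then show "\<forall>t. (LBINT s. R.wgt t s * d s w) = 0"
      by (intro allI integral_eq_zero_AE)
  qed
  \<comment> \<open>On one event of full measure the integrals vanish for all \<open>t\<close> at
    once; the equation \<open>hom\<close> at the given \<open>t\<close> then yields equality at this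
    \<open>t\<close>, although Gronwall worked only for almost every time.\<close>
  show "AE w in M. Z t w = est t w" if t: "t \<in> {0..T}"
    using zero hom[OF t] by eventually_elim (use t in \<open>simp add: d_def Zb_def estz_def\<close>)
qed

end

section \<open>Transfer to an arbitrary version of the best estimate\<close>

theorem best_estimate_exists:
  "\<forall>t\<in>{0..T}. \<exists>Z. best_estimate M (Yt t) (X t) Z \<and>
     (\<forall>Z'. best_estimate M (Yt t) (X t) Z' \<longrightarrow> (AE w in M. Z' w = Z w))"
proof
  fix t assume t: "t \<in> {0..T}"
  show "\<exists>Z. best_estimate M (Yt t) (X t) Z \<and> (\<forall>Z'. best_estimate M (Yt t) (X t) Z' \<longrightarrow> (AE w in M. Z' w = Z w))"
    by (rule exI[of _ "est t"]) (use est_adapted[OF t] in \<open>simp add: best_estimate_iff(1)[OF t]\<close>)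
qed

theorem best_estimate_properties:
  assumes best: "\<forall>t\<in>{0..T}. best_estimate M (Yt t) (X t) (Xh t)"
    and H: "H = (\<lambda>t s. (LINT w|M. X t w * (X s w - Xh s w)))"
    and S: "S = (\<lambda>t. (LINT w|M. (X t w - Xh t w)\<^sup>2))"
    and A: "A = (\<lambda>t s. (G s)\<^sup>2 / (D s)\<^sup>2 * H t s)"
    and B: "B = (\<lambda>t s. G s / (D s)\<^sup>2 * H t s)"
    and Q: "Q = resolvent A"
    and mH: "m\<^sub>H = (\<lambda>t. process_mean M X t + (LBINT s:{0..t}. Q t s * process_mean M X s))"
    and LH: "L\<^sub>H = (\<lambda>t u. B t u + (LBINT s:{u..t}. Q t s * B s u))"
  shows "(kernel_eq_solution T G D (process_cov M X) H \<and>
         (\<forall>h. kernel_eq_solution T G D (process_cov M X) h \<longrightarrow> (\<forall>(t, s)\<in>time_triangle T. h t s = H t s))) \<and>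
        (\<forall>(t, s)\<in>time_triangle T.
           (\<forall>n. set_integrable lborel {s..t} (\<lambda>r. A t r * resolvent_iter A n r s)) \<and>
           summable (\<lambda>n. resolvent_iter A n t s) \<and>
           set_integrable lborel {s..t} (\<lambda>r. Q t r * B r s)) \<and>
        (\<forall>t\<in>{0..T}.
           set_integrable lborel {0..t} (\<lambda>s. Q t s * process_mean M X s) \<and>
           (AE w in M. Xh t w = real_cond_exp M (Yt t) (X t) w) \<and>
           (\<exists>J. has_obs_integral M G D X B\<^sub>2 t (L\<^sub>H t) J \<and>
              (AE w in M. Xh t w = m\<^sub>H t + J w))) \<and>
        ((\<exists>Z. filter_eq_solution M T G D X B\<^sub>2 Yt (process_mean M X) H Z) \<and>
         (\<forall>Z. filter_eq_solution M T G D X B\<^sub>2 Yt (process_mean M X) H Z \<longleftrightarrow>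
            measurable_process M T Z \<and> (\<forall>t\<in>{0..T}. AE w in M. Z t w = Xh t w))) \<and>
        (\<forall>t\<in>{0..T}. S t = H t t \<and>
           H t t = process_cov M X t t - (LBINT r:{0..t}. (G r)\<^sup>2 / (D r)\<^sup>2 * (H t r)\<^sup>2)) \<and>
        ((AE w in M. Xh 0 w = process_mean M X 0) \<and> (\<forall>t\<in>{0..T}. H t 0 = process_cov M X t 0) \<and>
          S 0 = process_cov M X 0 0)"
proof -
  have Xh: "AE w in M. Xh t w = est t w" and Xh_meas: "Xh t \<in> borel_measurable M" if t: "t \<in> {0..T}" for t
  proof -
    have "Xh t \<in> L2_rv M (Yt t) \<and> (AE w in M. Xh t w = est t w)"
      using best t best_estimate_iff(1)[OF t] by blast
    then show "AE w in M. Xh t w = est t w" "Xh t \<in> borel_measurable M"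
      using measurable_from_subalg[OF Yt(1)[OF t]] by (auto simp: L2_rv_def)
  qed
  have tri: "(t, s) \<in> time_triangle T \<longleftrightarrow> 0 \<le> s \<and> s \<le> t \<and> t \<le> T" for t s by (simp add: time_triangle_def)
  have H_eq: "H t s = R.H t s" if "t \<in> {0..T}" "s \<in> {0..T}" for t s
  proof -
    have "(LINT w|M. X t w * (X s w - Xh s w)) = (LINT w|M. Xz t w * err s w)"
    proof (rule integral_cong_AE)
      show "AE w in M. X t w * (X s w - Xh s w) = Xz t w * err s w"
        using Xh[OF that(2)] by eventually_elim (simp only: X_eq_Xz[OF that(1)] X_eq_Xz[OF that(2)] err_eq)
    qed (use that Xh_meas X_eq_Xz Xz_sec L2_measurable[OF err_L2] in auto)
    then show ?thesis by (simp add: H err_Xz)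
  qed
  have S_eq: "S t = R.H t t" if "t \<in> {0..T}" for t
  proof -
    have "(LINT w|M. (X t w - Xh t w)\<^sup>2) = (LINT w|M. (err t w)\<^sup>2)"
    proof (rule integral_cong_AE)
      show "AE w in M. (X t w - Xh t w)\<^sup>2 = (err t w)\<^sup>2"
        using Xh[OF that] by eventually_elim (simp only: X_eq_Xz[OF that] err_eq)
    qed (use that Xh_meas X_eq_Xz Xz_sec L2_measurable[OF err_L2] in auto)
    then show ?thesis by (simp add: S err_sq)
  qed
  have H_tri: "H t s = R.H t s" if "0 \<le> s" "s \<le> t" "t \<le> T" for t s using that by (intro H_eq) auto
  have A_eq: "A t s = R.wgt t s" if "0 \<le> s" "s \<le> t" "t \<le> T" for t s
    using that a_sq[of s] H_tri[OF that] by (simp add: A R.wgt_def del: times_divide_eq_left)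
  have iter_eq: "resolvent_iter A n t s = resolvent_iter R.wgt n t s" if "0 \<le> s" "s \<le> t" "t \<le> T" for n t s
    by (rule resolvent_iter_cong[of 0 T, OF A_eq that])
  have Q_eq: "Q t s = resolvent R.wgt t s" if "0 \<le> s" "s \<le> t" "t \<le> T" for t s
    unfolding Q by (rule resolvent_cong[of 0 T, OF A_eq that])
  have B_eq: "B t s = a s * Di s * R.H t s" if "0 \<le> s" "s \<le> t" "t \<le> T" for t s
    using that a_Di[of s] H_tri[OF that] by (simp add: B del: times_divide_eq_left)
  \<comment> \<open>The resolvent formula identifies the kernel of the statement with the
    Wiener-Hopf solution divided by \<open>D\<close>.\<close>
  have LH_eq: "L\<^sub>H t u = R.phi t u * Di u" if "0 \<le> u" "u \<le> t" "t \<le> T" for t u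
  proof -
    have "(LBINT s:{u..t}. Q t s * B s u) = (LBINT s:{u..t}. resolvent R.wgt t s * (a u * Di u * R.H s u))"
      by (rule set_lebesgue_integral_cong) (use that Q_eq B_eq in auto)
    then show ?thesis using gain_resolvent[OF that] B_eq[OF that] by (simp add: LH)
  qed
  have mean_eq: "(LBINT s:{0..t}. Q t s * process_mean M X s) = (LBINT s:{0..t}. resolvent R.wgt t s * mz s)" if "t \<in> {0..T}" for t
    by (rule set_lebesgue_integral_cong) (use that Q_eq process_mean_eq in auto)
  have mH_eq: "m\<^sub>H t = mz t - (LBINT s. a s * mz s * R.phi t s)" if t: "t \<in> {0..T}" for t
    unfolding mH using mean_eq[OF t] mean_resolvent[OF t] process_mean_eq[OF t] by simp
  obtain bm where bm: "\<And>t. \<bar>mz t\<bar> \<le> bm" by (rule bounded_suppE[OF mean_bounded_supp]) blast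
  obtain bH where bH: "\<And>t s. \<bar>R.H t s\<bar> \<le> bH" using R.H_bounded by blast
  have a: "kernel_eq_solution T G D (process_cov M X) H \<and>
      (\<forall>h. kernel_eq_solution T G D (process_cov M X) h \<longrightarrow> (\<forall>(t, s)\<in>time_triangle T. h t s = H t s))"
  proof (intro conjI allI impI)
    show "kernel_eq_solution T G D (process_cov M X) H"
      by (rule kernel_eq_solution_H) (simp add: tri H_tri)
    show "\<forall>(t, s)\<in>time_triangle T. h t s = H t s" if "kernel_eq_solution T G D (process_cov M X) h" for h
      using kernel_eq_solution_unique[OF that] H_tri by (auto simp: tri)
  qed
  have b1: "\<forall>(t, s)\<in>time_triangle T.
      (\<forall>n. set_integrable lborel {s..t} (\<lambda>r. A t r * resolvent_iter A n r s)) \<and>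
      summable (\<lambda>n. resolvent_iter A n t s) \<and> set_integrable lborel {s..t} (\<lambda>r. Q t r * B r s)"
  proof (clarify, intro conjI allI)
    fix t s assume "(t, s) \<in> time_triangle T"
    then have st: "0 \<le> s" "s \<le> t" "t \<le> T" by (auto simp: tri)
    show "set_integrable lborel {s..t} (\<lambda>r. A t r * resolvent_iter A n r s)" for n
      by (rule set_integrable_cong[THEN iffD1, OF refl refl _ V.iter_integrable[of s t n]])
        (use st A_eq iter_eq in auto)
    show "summable (\<lambda>n. resolvent_iter A n t s)"
      using V.iter_summable[OF st(2)] by (simp only: iter_eq[OF st])
    have "set_integrable lborel {s..t} (\<lambda>r. resolvent R.wgt t r * (a s * Di s * R.H r s))"
    proof (rule V.resolvent_formula_bound(1)[OF st(1) _ _ st(2,3)])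
      show "\<bar>a s * Di s * R.H r s\<bar> \<le> \<bar>a s * Di s\<bar> * bH" for r
        using bH[of r s] by (simp add: abs_mult mult_left_mono)
      show "(\<lambda>r. a s * Di s * R.H r s) \<in> borel_measurable borel"
        by (intro borel_measurable_times borel_measurable_const R.H_sec)
    qed
    then show "set_integrable lborel {s..t} (\<lambda>r. Q t r * B r s)"
      by (rule set_integrable_cong[THEN iffD1, OF refl refl, rotated]) (use st Q_eq B_eq in auto)
  qed
  have b2: "\<forall>t\<in>{0..T}. set_integrable lborel {0..t} (\<lambda>s. Q t s * process_mean M X s) \<and>
      (AE w in M. Xh t w = real_cond_exp M (Yt t) (X t) w) \<and>
      (\<exists>J. has_obs_integral M G D X B\<^sub>2 t (L\<^sub>H t) J \<and> (AE w in M. Xh t w = m\<^sub>H t + J w))"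
  proof (intro ballI conjI)
    fix t assume t: "t \<in> {0..T}"
    have "set_integrable lborel {0..t} (\<lambda>s. resolvent R.wgt t s * mz s)"
      by (rule V.resolvent_formula_bound(1)[OF order_refl bounded_supp_measurable[OF mean_bounded_supp] bm]) (use t in auto)
    then show "set_integrable lborel {0..t} (\<lambda>s. Q t s * process_mean M X s)"
      by (rule set_integrable_cong[THEN iffD1, OF refl refl, rotated]) (use t Q_eq process_mean_eq in auto)
    show "AE w in M. Xh t w = real_cond_exp M (Yt t) (X t) w"
      using Xh[OF t] best_estimate_iff(2)[OF t] by eventually_elim simp
    have "R.phi t s = indicator {0..t} s * (L\<^sub>H t s * Dt s)" for s
      using LH_eq[of s t] R.phi_supp[of s t] Di_Dt[of s] t by (cases "s \<in> {0..t}") auto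
    from rel_obs_integral[OF t this est0_rel]
    have "has_obs_integral M G D X B\<^sub>2 t (L\<^sub>H t) (\<lambda>w. est0 t w + (LBINT s. a s * R.phi t s * mz s))" .
    moreover have "(LBINT s. a s * R.phi t s * mz s) = (LBINT s. a s * mz s * R.phi t s)"
      by (intro Bochner_Integration.integral_cong refl) (simp only: mult_ac)
    \<comment> \<open>The deterministic term added by passing from the centred to the original
      observation is the one subtracted in \<open>mH_eq\<close>.\<close>
    then have "AE w in M. Xh t w = m\<^sub>H t + (est0 t w + (LBINT s. a s * R.phi t s * mz s))"
      using Xh[OF t] mH_eq[OF t] by (auto simp: est_def elim: eventually_mono)
    ultimately show "\<exists>J. has_obs_integral M G D X B\<^sub>2 t (L\<^sub>H t) J \<and> (AE w in M. Xh t w = m\<^sub>H t + J w)" by blast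
  qed
  have c_iff: "filter_eq_solution M T G D X B\<^sub>2 Yt (process_mean M X) H Z \<longleftrightarrow>
      measurable_process M T Z \<and> (\<forall>t\<in>{0..T}. AE w in M. Z t w = Xh t w)" for Z
  proof (intro iffI conjI ballI)
    assume sol: "filter_eq_solution M T G D X B\<^sub>2 Yt (process_mean M X) H Z"
    show "measurable_process M T Z" by (rule filter_eq_solutionD(1)[OF _ sol]) (rule H_tri)
    show "AE w in M. Z t w = Xh t w" if t: "t \<in> {0..T}" for t
    proof -
      have "AE w in M. Z t w = est t w" by (rule filter_eq_solutionD(2)[OF _ sol t]) (rule H_tri)
      then show ?thesis using Xh[OF t] by eventually_elim simp
    qed
  next
    assume Z: "measurable_process M T Z \<and> (\<forall>t\<in>{0..T}. AE w in M. Z t w = Xh t w)"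
    show "filter_eq_solution M T G D X B\<^sub>2 Yt (process_mean M X) H Z"
    proof (rule filter_eq_solutionI)
      show "H t s = R.H t s" if "0 \<le> s" "s \<le> t" "t \<le> T" for t s by (rule H_tri[OF that])
      show "AE w in M. Z t w = est t w" if t: "t \<in> {0..T}" for t
        using Z[THEN conjunct2, rule_format, OF t] Xh[OF t] by eventually_elim simp
    qed (use Z in auto)
  qed
  have c: "(\<exists>Z. filter_eq_solution M T G D X B\<^sub>2 Yt (process_mean M X) H Z) \<and>
      (\<forall>Z. filter_eq_solution M T G D X B\<^sub>2 Yt (process_mean M X) H Z \<longleftrightarrow>
        measurable_process M T Z \<and> (\<forall>t\<in>{0..T}. AE w in M. Z t w = Xh t w))"
  proof
    have id: "(\<lambda>s. s) \<in> borel_measurable (restrict_space borel {0..T})"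
      by (rule measurable_restrict_space1) simp
    have "(\<lambda>x. est (fst x) (snd x)) \<in> borel_measurable (restrict_space borel {0..T} \<Otimes>\<^sub>M M)"
      by (rule est_measurable[OF measurable_compose[OF measurable_fst id] measurable_snd])
    then have "measurable_process M T est" by (simp add: measurable_process_def case_prod_beta')
    then show "\<exists>Z. filter_eq_solution M T G D X B\<^sub>2 Yt (process_mean M X) H Z"
      by (intro exI[of _ est] filter_eq_solutionI) (auto intro: H_tri)
  qed (use c_iff in blast)
  have d: "\<forall>t\<in>{0..T}. S t = H t t \<and> H t t = process_cov M X t t - (LBINT r:{0..t}. (G r)\<^sup>2 / (D r)\<^sup>2 * (H t r)\<^sup>2)"
  proof (intro ballI conjI)
    fix t assume t: "t \<in> {0..T}"
    show "S t = H t t" using S_eq[OF t] H_eq[OF t t] by simp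
    have "(LBINT r:{0..t}. (G r)\<^sup>2 / (D r)\<^sup>2 * R.H t r * R.H t r) = (LBINT r:{0..t}. (G r)\<^sup>2 / (D r)\<^sup>2 * (H t r)\<^sup>2)"
      by (rule set_lebesgue_integral_cong) (use t H_tri in \<open>auto simp: power2_eq_square\<close>)
    then show "H t t = process_cov M X t t - (LBINT r:{0..t}. (G r)\<^sup>2 / (D r)\<^sup>2 * (H t r)\<^sup>2)"
      using H_kernel_eq_LBINT[of t t] H_eq[OF t t] t by simp
  qed
  have zero: "0 \<in> {0..T}" using T_pos by simp
  have H0: "H t 0 = process_cov M X t 0" if t: "t \<in> {0..T}" for t
  proof -
    have "(LBINT r:{0..0}. (G r)\<^sup>2 / (D r)\<^sup>2 * R.H t r * R.H 0 r) = 0"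
      unfolding set_lebesgue_integral_def
    proof (rule integral_eq_zero_AE)
      show "AE r in lborel. indicator {0..0::real} r *\<^sub>R ((G r)\<^sup>2 / (D r)\<^sup>2 * R.H t r * R.H 0 r) = 0"
        using AE_lborel_singleton[of 0] by eventually_elim (simp add: indicator_def)
    qed
    then show ?thesis using H_kernel_eq_LBINT[of 0 t] H_eq[OF t zero] t by simp
  qed
  have e: "(AE w in M. Xh 0 w = process_mean M X 0) \<and> (\<forall>t\<in>{0..T}. H t 0 = process_cov M X t 0) \<and> S 0 = process_cov M X 0 0"
  proof (intro conjI ballI H0)
    show "S 0 = process_cov M X 0 0" using S_eq[OF zero] H_eq[OF zero zero] H0[OF zero] by simp
    have "(LINT w|M. (est0 0 w)\<^sup>2) = (LBINT s. R.phi 0 s * covop (R.phi 0) s)"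
      using obs_rel_cov[OF est0_rel est0_rel, of 0 0] by (simp add: power2_eq_square)
    also have "\<dots> = (\<integral>s. 0 \<partial>(lborel :: real measure))"
    proof (rule integral_cong_AE)
      show "AE s in lborel. R.phi 0 s * covop (R.phi 0) s = 0"
        using AE_lborel_singleton[of 0] by eventually_elim (simp add: R.phi_supp)
      show "(\<lambda>s. R.phi 0 s * covop (R.phi 0) s) \<in> borel_measurable lborel"
        using bounded_supp_measurable[OF covop_bs[OF R.phi_bs[of 0]]] R.phi_sec(1)[of 0] by simp
    qed simp
    finally have "AE w in M. est0 0 w = 0" by (intro integral_sq_zero_AE[OF est0_L2]) simp
    then show "AE w in M. Xh 0 w = process_mean M X 0"
      using Xh[OF zero] by eventually_elim (simp add: est_def process_mean_eq[OF zero])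
  qed auto
  show ?thesis by (intro conjI[OF a] conjI[OF b1] conjI[OF b2] conjI[OF c] conjI[OF d] e)
qed

end

theorem theorem5p2:
  fixes M :: "'a measure" and T \<alpha> d\<^sub>0 Y\<^sub>0 :: real
    and F C G D :: "real \<Rightarrow> real"
    and B\<^sub>1 B\<^sub>2 X Y :: "real \<Rightarrow> 'a \<Rightarrow> real" and X\<^sub>0 :: "'a \<Rightarrow> real"
  assumes "prob_space M"
    and "0 < T" and "1 / 2 < \<alpha>" and "\<alpha> \<le> 1"
    and "\<And>f. f \<in> {F, C, G, D} \<Longrightarrow>
           f \<in> borel_measurable (restrict_space borel {0..T}) \<and> bounded (f ` {0..T})"
    and "0 < d\<^sub>0" and "\<And>t. t \<in> {0..T} \<Longrightarrow> d\<^sub>0 \<le> \<bar>D t\<bar>"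
    and "brownian_motion M T B\<^sub>1" and "brownian_motion M T B\<^sub>2"
    and "prob_space.indep_var M (path_space T) (sample_path T B\<^sub>1) (path_space T) (sample_path T B\<^sub>2)"
    and "gaussian_rv M X\<^sub>0" and "X\<^sub>0 \<in> L2_rv M M"
    and "prob_space.indep_set M (sets (vimage_algebra (space M) X\<^sub>0 borel))
           (sets (vimage_algebra (space M) (\<lambda>\<omega>. (sample_path T B\<^sub>1 \<omega>, sample_path T B\<^sub>2 \<omega>))
              (path_space T \<Otimes>\<^sub>M path_space T)))"
    \<comment> \<open>the signal\<close>
    and "measurable_process M T X"
    and "(\<integral>\<^sup>+t\<in>{0..T}. (\<integral>\<^sup>+\<omega>. ennreal ((X t \<omega>)\<^sup>2) \<partial>M) \<partial>lborel) < \<infinity>"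
    and "gaussian_process M {0..T} X"
    and "\<And>t. t \<in> {0..T} \<Longrightarrow>
           \<exists>N. has_wiener_integral M B\<^sub>1 0 t (\<lambda>s. (t - s) powr (\<alpha> - 1) * C s) N \<and>
             (AE \<omega> in M. X t \<omega> =
            X\<^sub>0 \<omega> + 1 / Gamma \<alpha> * (LBINT s:{0..t}. (t - s) powr (\<alpha> - 1) * F s * X s \<omega>)
            + 1 / Gamma \<alpha> * N \<omega>)"
    \<comment> \<open>the observation\<close>
    and "\<And>t. t \<in> {0..T} \<Longrightarrow> Y t \<in> borel_measurable M"
    and "\<And>t. t \<in> {0..T} \<Longrightarrow>
           \<exists>J. has_obs_integral M G D X B\<^sub>2 t (\<lambda>_. 1) J \<and> (AE \<omega> in M. Y t \<omega> = Y\<^sub>0 + J \<omega>)"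
  shows
    "let \<Y> = obs_filtration M Y; m = process_mean M X; K = process_cov M X in
     \<comment> \<open>existence and uniqueness of the best estimate\<close>
     (\<forall>t\<in>{0..T}. \<exists>Z. best_estimate M (\<Y> t) (X t) Z \<and>
        (\<forall>Z'. best_estimate M (\<Y> t) (X t) Z' \<longrightarrow> (AE \<omega> in M. Z' \<omega> = Z \<omega>))) \<and>
     (\<forall>Xh. (\<forall>t\<in>{0..T}. best_estimate M (\<Y> t) (X t) (Xh t)) \<longrightarrow>
       (let H = (\<lambda>t s. \<integral>\<omega>. X t \<omega> * (X s \<omega> - Xh s \<omega>) \<partial>M);
            S = (\<lambda>t. \<integral>\<omega>. (X t \<omega> - Xh t \<omega>)\<^sup>2 \<partial>M);
            A = (\<lambda>t s. (G s)\<^sup>2 / (D s)\<^sup>2 * H t s);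
            B = (\<lambda>t s. G s / (D s)\<^sup>2 * H t s);
            Q = resolvent A;
            m\<^sub>H = (\<lambda>t. m t + (LBINT s:{0..t}. Q t s * m s));
            L\<^sub>H = (\<lambda>t u. B t u + (LBINT s:{u..t}. Q t s * B s u))
        in
        \<comment> \<open>(a)\<close>
        (kernel_eq_solution T G D K H \<and>
         (\<forall>h. kernel_eq_solution T G D K h \<longrightarrow> (\<forall>(t, s)\<in>time_triangle T. h t s = H t s))) \<and>
        \<comment> \<open>(b), preceded by the convergence of the series and the integrals defining the kernels\<close>
        (\<forall>(t, s)\<in>time_triangle T.
           (\<forall>n. set_integrable lborel {s..t} (\<lambda>r. A t r * resolvent_iter A n r s)) \<and>
           summable (\<lambda>n. resolvent_iter A n t s) \<and>
           set_integrable lborel {s..t} (\<lambda>r. Q t r * B r s)) \<and>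
        (\<forall>t\<in>{0..T}.
           set_integrable lborel {0..t} (\<lambda>s. Q t s * m s) \<and>
           (AE \<omega> in M. Xh t \<omega> = real_cond_exp M (\<Y> t) (X t) \<omega>) \<and>
           (\<exists>J. has_obs_integral M G D X B\<^sub>2 t (L\<^sub>H t) J \<and>
              (AE \<omega> in M. Xh t \<omega> = m\<^sub>H t + J \<omega>))) \<and>
        \<comment> \<open>(c)\<close>
        ((\<exists>Z. filter_eq_solution M T G D X B\<^sub>2 \<Y> m H Z) \<and>
         (\<forall>Z. filter_eq_solution M T G D X B\<^sub>2 \<Y> m H Z \<longleftrightarrow>
            measurable_process M T Z \<and> (\<forall>t\<in>{0..T}. AE \<omega> in M. Z t \<omega> = Xh t \<omega>))) \<and>
        \<comment> \<open>(d)\<close>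
        (\<forall>t\<in>{0..T}. S t = H t t \<and>
           H t t = K t t - (LBINT r:{0..t}. (G r)\<^sup>2 / (D r)\<^sup>2 * (H t r)\<^sup>2)) \<and>
        \<comment> \<open>(e)\<close>
        ((AE \<omega> in M. Xh 0 \<omega> = m 0) \<and> (\<forall>t\<in>{0..T}. H t 0 = K t 0) \<and> S 0 = K 0 0)))"
proof -
  interpret prob_space M by fact
  interpret observed_signal M T \<alpha> F C B\<^sub>1 B\<^sub>2 X X\<^sub>0 G D d\<^sub>0 Y\<^sub>0 Y
    by unfold_locales (use assms in auto)
  show ?thesis
    unfolding Let_def
    by (rule conjI[OF best_estimate_exists], rule allI, rule impI,
        rule best_estimate_properties[OF _ refl refl refl refl refl refl refl])
qed

end
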